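(* Let $c > 1$ and let $\rho_{\mathrm{q}}, \rho_{\mathrm{s}} \geq 0$ satisfy $$(2c^2 - 1) \rho_{\mathrm{q}} + 2 c^2 (c^2 - 1) \sqrt{\rho_{\mathrm{s}} (1 - \rho_{\mathrm{s}})} \geq c^4.$$ Then there exists a graph-based $(c,r)$-ANN data structure for (random) data sets of size $n = 2^{o(d)}$ on the unit sphere $\mathcal{S}^{d-1}$, with $r = \sqrt{2}/c$, using space $n^{1 + \rho_{\mathrm{s}} + o(1)}$ and query time $n^{\rho_{\mathrm{q}} + o(1)}$.
   Context: $\mathcal{S}^{d-1}=\{u\in\mathbb{R}^d:\|u\|=1\}$ with the Euclidean norm. The $(c,r)$-approximate near neighbor ($(c,r)$-ANN) problem: preprocess a data set $\mathcal{D}\subset\mathbb{R}^d$ of $n$ points so that, given a query $q$ whose nearest neighbor in $\mathcal{D}$ lies at distance at most $r$, one returns a point $p\in\mathcal{D}$ at distance at most $c\cdot r$ from $q$. Random instances: all points of $\mathcal{D}$ are independent and uniformly distributed on $\mathcal{S}^{d-1}$, except for a single planted nearest neighbor $p^*$ lying close to the query (for $n=2^{o(d)}$ the non-planted points lie at distance $\sqrt{2}+o(1)$ from the query, and the planted one at distance $r=\sqrt{2}/c$, i.e. inner product $1-1/c^2$ with the query). "Graph-based" means the data structure is the $\alpha$-near neighbor graph for some $\alpha\in(0,1)$ (vertex set $\mathcal{D}$, edge between $p,p'$ iff $\langle p,p'\rangle\ge\alpha$), queried by a greedy walk: start at a uniformly random $p\in\mathcal{D}$, repeatedly move to a neighbor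 $p'$ of $p$ with $\langle p',q\rangle\ge\langle p,q\rangle+1/d$, and restart at a fresh uniformly random vertex whenever no such neighbor exists, until the planted neighbor is reached. Asymptotics are as $d,n\to\infty$; the data structure succeeds with high probability over the random instance. *)

theory Defs
  imports "HOL-Probability.Probability"
begin

text \<open>Points of R^d are represented as functions nat => real; only coordinates i < d matter.\<close>

definition ip :: "nat \<Rightarrow> (nat \<Rightarrow> real) \<Rightarrow> (nat \<Rightarrow> real) \<Rightarrow> real" where
  "ip d x y = (\<Sum>i<d. x i * y i)"

definition nrm :: "nat \<Rightarrow> (nat \<Rightarrow> real) \<Rightarrow> real" where
  "nrm d x = sqrt (ip d x x)"

definition normalize :: "nat \<Rightarrow> (nat \<Rightarrow> real) \<Rightarrow> (nat \<Rightarrow> real)" where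
  "normalize d x = (\<lambda>i. if i < d then x i / nrm d x else 0)"

text \<open>Source of randomness: an (n+1) x d matrix of i.i.d. standard Gaussians.
  Row j of a normalised Gaussian vector is uniform on the unit sphere S^(d-1).\<close>

definition gauss_matrix :: "nat \<Rightarrow> nat \<Rightarrow> (nat \<times> nat \<Rightarrow> real) measure" where
  "gauss_matrix d n = (\<Pi>\<^sub>M ji \<in> {..n} \<times> {..<d}. density lborel std_normal_density)"

definition grow :: "(nat \<times> nat \<Rightarrow> real) \<Rightarrow> nat \<Rightarrow> (nat \<Rightarrow> real)" where
  "grow G j = (\<lambda>i. G (j, i))"

definition query :: "nat \<Rightarrow> (nat \<times> nat \<Rightarrow> real) \<Rightarrow> (nat \<Rightarrow> real)" where
  "query d G = normalize d (grow G 0)"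

text \<open>The planted neighbour: uniform among unit vectors with inner product
  1 - 1/c^2 with the query (built from row 1, orthogonalised against the query).\<close>
definition planted :: "real \<Rightarrow> nat \<Rightarrow> (nat \<times> nat \<Rightarrow> real) \<Rightarrow> (nat \<Rightarrow> real)" where
  "planted c d G =
     (let q = query d G;
          z0 = grow G 1;
          z = normalize d (\<lambda>i. z0 i - ip d z0 q * q i);
          \<beta> = 1 - 1 / c\<^sup>2
      in (\<lambda>i. \<beta> * q i + sqrt (1 - \<beta>\<^sup>2) * z i))"

text \<open>The data set, indexed by {..<n}: index 0 is the planted neighbour,
  indices k = 1..n-1 are independent uniform points on the sphere (rows 2..n).\<close>
definition dataset :: "real \<Rightarrow> nat \<Rightarrow> (nat \<times> nat \<Rightarrow> real) \<Rightarrow> nat \<Rightarrow> (nat \<Rightarrow> real)" where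
  "dataset c d G k = (if k = 0 then planted c d G else normalize d (grow G (k + 1)))"

definition nn_edge :: "nat \<Rightarrow> nat \<Rightarrow> real \<Rightarrow> (nat \<Rightarrow> nat \<Rightarrow> real) \<Rightarrow> nat \<Rightarrow> nat \<Rightarrow> bool" where
  "nn_edge d n \<alpha> D k l \<longleftrightarrow> k < n \<and> l < n \<and> k \<noteq> l \<and> ip d (D k) (D l) \<ge> \<alpha>"

definition degree :: "nat \<Rightarrow> nat \<Rightarrow> real \<Rightarrow> (nat \<Rightarrow> nat \<Rightarrow> real) \<Rightarrow> nat \<Rightarrow> nat" where
  "degree d n \<alpha> D k = card {l. nn_edge d n \<alpha> D k l}"

definition graph_space :: "nat \<Rightarrow> nat \<Rightarrow> real \<Rightarrow> (nat \<Rightarrow> nat \<Rightarrow> real) \<Rightarrow> nat" where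
  "graph_space d n \<alpha> D = n + (\<Sum>k<n. degree d n \<alpha> D k)"

definition improving :: "nat \<Rightarrow> nat \<Rightarrow> real \<Rightarrow> (nat \<Rightarrow> nat \<Rightarrow> real) \<Rightarrow> (nat \<Rightarrow> real) \<Rightarrow> nat \<Rightarrow> nat set" where
  "improving d n \<alpha> D q k =
     {l. nn_edge d n \<alpha> D k l \<and> ip d (D l) q \<ge> ip d (D k) q + 1 / real d}"

definition greedy_step :: "nat \<Rightarrow> nat \<Rightarrow> real \<Rightarrow> (nat \<Rightarrow> nat \<Rightarrow> real) \<Rightarrow> (nat \<Rightarrow> real) \<Rightarrow> nat \<Rightarrow> nat" where
  "greedy_step d n \<alpha> D q k =
     (if k = 0 \<or> improving d n \<alpha> D q k = {} then k else Min (improving d n \<alpha> D q k))"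

definition visited :: "nat \<Rightarrow> nat \<Rightarrow> real \<Rightarrow> (nat \<Rightarrow> nat \<Rightarrow> real) \<Rightarrow> (nat \<Rightarrow> real) \<Rightarrow> nat \<Rightarrow> nat set" where
  "visited d n \<alpha> D q s = range (\<lambda>t. (greedy_step d n \<alpha> D q ^^ t) s)"

definition descent_succeeds :: "nat \<Rightarrow> nat \<Rightarrow> real \<Rightarrow> (nat \<Rightarrow> nat \<Rightarrow> real) \<Rightarrow> (nat \<Rightarrow> real) \<Rightarrow> nat \<Rightarrow> bool" where
  "descent_succeeds d n \<alpha> D q s \<longleftrightarrow> 0 \<in> visited d n \<alpha> D q s"

text \<open>Cost of one descent: at every visited non-planted vertex its whole
  neighbourhood is scanned (degree many inner products), plus one comparison
  per visited vertex.\<close>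
definition descent_cost :: "nat \<Rightarrow> nat \<Rightarrow> real \<Rightarrow> (nat \<Rightarrow> nat \<Rightarrow> real) \<Rightarrow> (nat \<Rightarrow> real) \<Rightarrow> nat \<Rightarrow> nat" where
  "descent_cost d n \<alpha> D q s =
     (\<Sum>v\<in>visited d n \<alpha> D q s. (if v = 0 then 1 else degree d n \<alpha> D v + 1))"

text \<open>Expected query time of the walk with uniformly random (re)starts, given
  the instance: by Wald's identity it equals (mean cost of one descent) divided
  by (probability that a descent succeeds). It is finite iff some start succeeds.\<close>
definition expected_query_time :: "nat \<Rightarrow> nat \<Rightarrow> real \<Rightarrow> (nat \<Rightarrow> nat \<Rightarrow> real) \<Rightarrow> (nat \<Rightarrow> real) \<Rightarrow> ereal" where
  "expected_query_time d n \<alpha> D q =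
     (let S = card {s. s < n \<and> descent_succeeds d n \<alpha> D q s}
      in if S = 0 then \<infinity>
         else ereal ((\<Sum>s<n. real (descent_cost d n \<alpha> D q s)) / real S))"

end

theory Submission
  imports Defs
begin

text \<open>
  Write \<open>lam = ln n\<close> and \<open>\<beta> = 1 - 1/c\<^sup>2\<close>, let \<open>\<rho> = min \<rho>s (1/2)\<close>, and take the threshold
  \<open>\<alpha> = sqrt (2 \<kappa> lam / d)\<close> with \<open>\<kappa>\<close> slightly below \<open>1 - \<rho>\<close>, so that degrees are about \<open>n powr \<rho>\<close>.
  From every vertex whose inner product with the query (its level) is below
  \<open>g0 = sqrt (2 \<rho> lam / d)\<close> there is an improving neighbour, and small improvements are so rare
  that every walk stops after \<open>n powr O(\<epsilon>)\<close> steps, hence at a vertex of level at least \<open>g0\<close>.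
  Given the walks, the direction \<open>z\<close> of the planted point orthogonal to the query is uniform, so
  that such a vertex is adjacent to the planted point with probability about \<open>n powr - e\<close>, where
  \<open>e = (sqrt \<kappa> - \<beta> sqrt \<rho>)\<^sup>2 / (1 - \<beta>\<^sup>2)\<close>; the hypothesis says \<open>\<rho>q \<ge> \<rho> + e\<close> up to \<open>O(\<epsilon>)\<close>.
  The number of successful starts concentrates: by rotation invariance its mean given \<open>z\<close> is
  constant, and by the Efron-Stein inequality its variance is controlled by the probability that
  two walks meet. For \<open>\<rho>q \<ge> 1\<close> the neighbours of the planted point are enough successful starts.
  A single \<open>\<alpha>\<close> that serves every \<open>\<epsilon>\<close> is obtained by diagonalisation.
\<close>

subsection \<open>Greedy trajectories\<close>

text \<open>The walks depend on all data points at once, so a visited vertex is no longer a fresh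
  Gaussian point. Deletion restores independence: until a walk enters a point \<open>j\<close> it
  agrees with the walk without \<open>j\<close>, and \<open>j\<close> itself is then fresh. The
  least-index rule of \<open>greedy_step\<close> is compatible with deletion. One start succeeds
  with probability only about \<open>n powr - e\<close>, and all starts share the planted direction,
  so a second moment is needed. Variance over squared mean is about
  \<open>n powr (e + \<rho> - 1)\<close>; this decays when \<open>\<rho>q < 1\<close>, because
  \<open>e + \<rho> \<le> \<rho>q\<close>, and is the reason why \<open>\<rho>q \<ge> 1\<close> is a
  separate case. The exponent \<open>e\<close> is plane geometry: a vertex at level
  \<open>g0\<close> needs a component \<open>\<tau>\<close> along \<open>z\<close> with
  \<open>\<alpha> = \<beta> * g0 + sqrt (1 - \<beta>\<^sup>2) * \<tau>\<close>, and
  \<open>e * lam\<close> is the Gaussian exponent of that component. The minimum in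
  \<open>\<rho>\<close> appears because \<open>\<rho> * (1 - \<rho>)\<close> is largest at
  1/2.\<close>

definition step :: "nat set \<Rightarrow> (nat \<times> nat) set \<Rightarrow> nat \<Rightarrow> nat" where
  "step I E k = (if \<exists>l\<in>I. (k, l) \<in> E then LEAST l. l \<in> I \<and> (k, l) \<in> E else k)"

definition traj :: "nat set \<Rightarrow> (nat \<times> nat) set \<Rightarrow> nat \<Rightarrow> nat \<Rightarrow> nat" where
  "traj I E s t = (step I E ^^ t) s"

text \<open>Vertex set and edge set are separate arguments so that a vertex can be deleted from the
  walk (\<open>I - {j}\<close>) while \<open>E\<close> stays the edge set of the whole
  configuration. The horizon \<open>T\<close> bounds the number of visited vertices.\<close>

definition orbit :: "nat set \<Rightarrow> (nat \<times> nat) set \<Rightarrow> nat \<Rightarrow> nat \<Rightarrow> nat set" where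
  "orbit I E T s = traj I E s ` {..T}"

lemma traj_0 [simp]: "traj I E s 0 = s"
  by (simp add: traj_def)

lemma traj_Suc: "traj I E s (Suc t) = step I E (traj I E s t)"
  by (simp add: traj_def)

lemma step_cases: "step I E k = k \<or> (step I E k \<in> I \<and> (k, step I E k) \<in> E)"
proof (cases "\<exists>l\<in>I. (k, l) \<in> E")
  case True
  then have "\<exists>l. l \<in> I \<and> (k, l) \<in> E" by blast
  from LeastI_ex[OF this] True show ?thesis by (simp add: step_def)
qed (simp add: step_def)

lemma step_edge: "l \<in> I \<Longrightarrow> (k, l) \<in> E \<Longrightarrow> step I E k \<in> I \<and> (k, step I E k) \<in> E"
  unfolding step_def using LeastI_ex[of "\<lambda>l. l \<in> I \<and> (k, l) \<in> E"] by auto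

lemma step_le: "l \<in> I \<Longrightarrow> (k, l) \<in> E \<Longrightarrow> step I E k \<le> l"
  unfolding step_def by (auto intro: Least_le)

lemma step_eqI:
  assumes "l \<in> I" "(k, l) \<in> E" "\<And>m. m \<in> I \<Longrightarrow> (k, m) \<in> E \<Longrightarrow> l \<le> m"
  shows "step I E k = l"
  using assms step_edge[of l I k E] step_le[of l I k E] by (meson order_antisym)

lemma step_cong:
  assumes "\<And>l. l \<in> I \<Longrightarrow> (k, l) \<in> E \<longleftrightarrow> (k, l) \<in> E'"
  shows "step I E k = step I E' k"
proof -
  have "(\<lambda>l. l \<in> I \<and> (k, l) \<in> E) = (\<lambda>l. l \<in> I \<and> (k, l) \<in> E')" using assms by auto
  moreover have "(\<exists>l\<in>I. (k, l) \<in> E) = (\<exists>l\<in>I. (k, l) \<in> E')" using assms by auto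
  ultimately show ?thesis by (simp add: step_def)
qed

lemma traj_mem: "s \<in> I \<Longrightarrow> traj I E s t \<in> I"
proof (induction t)
  case (Suc t)
  then show ?case using step_cases[of I E "traj I E s t"] by (auto simp: traj_Suc)
qed simp

lemma traj_cong:
  assumes "s \<in> I" "E \<inter> (I \<times> I) = E' \<inter> (I \<times> I)"
  shows "traj I E s t = traj I E' s t"
proof (induction t)
  case (Suc t)
  have "traj I E' s t \<in> I" using assms traj_mem by auto
  then have "step I E (traj I E' s t) = step I E' (traj I E' s t)"
    by (intro step_cong) (use assms(2) in blast)
  then show ?case by (simp add: traj_Suc Suc)
qed simp

lemma orbit_cong:
  assumes "s \<in> I" "E \<inter> (I \<times> I) = E' \<inter> (I \<times> I)"
  shows "orbit I E T s = orbit I E' T s"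
  unfolding orbit_def by (intro image_cong refl traj_cong assms)

lemma self_in_orbit [simp]: "s \<in> orbit I E T s"
  unfolding orbit_def by (rule image_eqI[of _ _ 0]) auto

lemma orbit_subset: "s \<in> I \<Longrightarrow> orbit I E T s \<subseteq> I"
  unfolding orbit_def using traj_mem by auto

lemma finite_orbit [simp]: "finite (orbit I E T s)"
  unfolding orbit_def by simp

lemma card_orbit: "card (orbit I E T s) \<le> T + 1"
  unfolding orbit_def using card_image_le[of "{..T}" "traj I E s"] by simp

text \<open>Deleting a candidate that is not the least one leaves the least one in place. This is
  what makes the least-index rule compatible with deletion.\<close>

lemma step_remove:
  assumes "step I E k \<noteq> j" shows "step (I - {j}) E k = step I E k"
proof (cases "\<exists>l\<in>I. (k, l) \<in> E")
  case True
  then obtain l where l: "l \<in> I" "(k, l) \<in> E" by blast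
  have "step I E k \<in> I" "(k, step I E k) \<in> E" using step_edge[OF l] by auto
  then show ?thesis using assms by (intro step_eqI) (auto intro: step_le)
next
  case False
  then show ?thesis by (auto simp: step_def)
qed

lemma traj_remove:
  assumes "\<And>t'. t' \<le> t \<Longrightarrow> traj I E s t' \<noteq> j"
  shows "traj (I - {j}) E s t = traj I E s t"
  using assms
proof (induction t)
  case (Suc t)
  then have "traj (I - {j}) E s t = traj I E s t" by auto
  moreover have "step I E (traj I E s t) \<noteq> j" using Suc.prems[of "Suc t"] by (simp add: traj_Suc)
  ultimately show ?case by (simp add: traj_Suc step_remove)
qed simp

lemma orbit_remove:
  assumes "j \<notin> orbit I E T s"
  shows "orbit (I - {j}) E T s = orbit I E T s" "t \<le> T \<Longrightarrow> traj (I - {j}) E s t = traj I E s t"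
proof -
  have *: "traj (I - {j}) E s t = traj I E s t" if "t \<le> T" for t
  proof (rule traj_remove)
    show "traj I E s t' \<noteq> j" if "t' \<le> t" for t'
      using assms \<open>t \<le> T\<close> that unfolding orbit_def by auto
  qed
  then show "orbit (I - {j}) E T s = orbit I E T s" unfolding orbit_def by (intro image_cong) (simp_all add: *)
  show "t \<le> T \<Longrightarrow> traj (I - {j}) E s t = traj I E s t" by (rule *)
qed

lemma orbit_pred:
  assumes "v \<in> orbit I E T s" "v \<noteq> s"
  obtains t where "t < T" "(traj I E s t, v) \<in> E" "v = traj I E s (Suc t)"
    "\<And>t'. t' \<le> t \<Longrightarrow> traj I E s t' \<noteq> v"
proof -
  define t where "t = (LEAST t. traj I E s t = v)"
  obtain t0 where t0: "t0 \<le> T" "traj I E s t0 = v" using assms unfolding orbit_def by blast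
  have t: "traj I E s t = v" unfolding t_def by (rule LeastI[of "\<lambda>t. traj I E s t = v", OF t0(2)])
  have tT: "t \<le> T" using t0 Least_le[of "\<lambda>t. traj I E s t = v" t0] by (simp add: t_def)
  have min: "traj I E s t' \<noteq> v" if "t' < t" for t'
    using not_less_Least[of t' "\<lambda>t. traj I E s t = v"] that by (simp add: t_def)
  have "t \<noteq> 0" using t assms(2) by (cases t) auto
  then obtain u where u: "t = Suc u" by (cases t) auto
  have "step I E (traj I E s u) = v" using t u by (simp add: traj_Suc)
  moreover have "traj I E s u \<noteq> v" using min[of u] u by simp
  ultimately have "(traj I E s u, v) \<in> E" using step_cases[of I E "traj I E s u"] by metis
  then show ?thesis
  proof (rule that[of u, rotated])
    show "u < T" using u tT by simp
    show "v = traj I E s (Suc u)" using t u by simp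
    show "traj I E s t' \<noteq> v" if "t' \<le> u" for t' by (rule min) (use that u in simp)
  qed
qed

text \<open>The walk reaches \<open>j\<close> for the first time from a vertex that it also visits
  when \<open>j\<close> is deleted; everything about that vertex is independent of the point \<open>j\<close>.\<close>

lemma orbit_pred_remove:
  assumes "j \<in> orbit I E T s" "j \<noteq> s"
  obtains w where "w \<in> orbit (I - {j}) E T s" "(w, j) \<in> E"
proof -
  obtain t where t: "t < T" "(traj I E s t, j) \<in> E"
    "\<And>t'. t' \<le> t \<Longrightarrow> traj I E s t' \<noteq> j" by (rule orbit_pred[OF assms]) blast
  have "traj (I - {j}) E s t = traj I E s t" by (rule traj_remove) (use t in auto)
  then have "traj I E s t \<in> orbit (I - {j}) E T s"
    using t(1) unfolding orbit_def by (intro image_eqI[of _ _ t]) auto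
  then show ?thesis using that t(2) by blast
qed

locale increasing =
  fixes E :: "(nat \<times> nat) set" and h :: "nat \<Rightarrow> real"
  assumes inc: "(k, l) \<in> E \<Longrightarrow> h k < h l"
begin

lemma traj_mono: "t \<le> t' \<Longrightarrow> h (traj I E s t) \<le> h (traj I E s t')"
proof (induction t')
  case (Suc t')
  have "h (traj I E s t') \<le> h (traj I E s (Suc t'))"
    using step_cases[of I E "traj I E s t'"] inc by (force simp: traj_Suc)
  then show ?case using Suc by (cases "t = Suc t'") (auto intro: order_trans)
qed simp

text \<open>Let \<open>v\<close> be the first vertex on the walk from \<open>s\<close> that also
  lies on the walk from \<open>s'\<close>, and \<open>j\<close> the predecessor of \<open>v\<close>
  on the latter. Then \<open>j\<close> is not on the walk from \<open>s\<close>: an earlier position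
  contradicts the choice of \<open>v\<close>, a later one has height at least that of
  \<open>v\<close>. Hence \<open>v\<close> is reached without \<open>j\<close>, and if
  \<open>j\<close> is not \<open>s'\<close>, then \<open>j\<close> is entered from a vertex
  \<open>w\<close> that is also reached without \<open>j\<close>. So a meeting forces the fresh
  point \<open>j\<close> to be joined to two vertices that do not depend on it.\<close>

lemma orbits_meet:
  assumes s: "s \<in> I" "s' \<in> I" and meet: "orbit I E T s \<inter> orbit I E T s' \<noteq> {}" and s': "s' \<notin> orbit I E T s"
  shows "(\<exists>v \<in> orbit (I - {s'}) E T s. (s', v) \<in> E) \<or>
    (\<exists>j \<in> I - {s, s'}. \<exists>w \<in> orbit (I - {j}) E T s'. \<exists>v \<in> orbit (I - {j}) E T s. w \<noteq> v \<and> (w, j) \<in> E \<and> (j, v) \<in> E)"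
proof -
  define P where "P t \<longleftrightarrow> t \<le> T \<and> traj I E s t \<in> orbit I E T s'" for t
  obtain t0 where "P t0" using meet unfolding P_def orbit_def[of _ _ _ s] by blast
  define t where "t = (LEAST t. P t)"
  have Pt: "P t" unfolding t_def by (rule LeastI[of P, OF \<open>P t0\<close>])
  have min: "\<not> P t'" if "t' < t" for t' using not_less_Least[of t' P] that by (simp add: t_def)
  define v where "v = traj I E s t"
  have v: "v \<in> orbit I E T s'" "v \<in> orbit I E T s" "t \<le> T"
    using Pt unfolding P_def v_def orbit_def[of _ _ _ s] by blast+
  have "v \<noteq> s'" using s' v by auto
  obtain u where u: "u < T" "(traj I E s' u, v) \<in> E"
    using orbit_pred[OF v(1) \<open>v \<noteq> s'\<close>] by metis
  define j where "j = traj I E s' u"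
  have jv: "(j, v) \<in> E" using u by (simp add: j_def)
  have j': "j \<in> orbit I E T s'" using u unfolding j_def orbit_def by (intro image_eqI[of _ _ u]) auto
  have jI: "j \<in> I" using j' orbit_subset[OF s(2), of E T] by blast
  have jn: "j \<notin> orbit I E T s"
  proof
    assume "j \<in> orbit I E T s"
    then obtain r where r: "r \<le> T" "traj I E s r = j" unfolding orbit_def by blast
    have "\<not> r < t" using min[of r] r j' by (auto simp: P_def)
    then have "h v \<le> h j" using traj_mono[of t r I s] r by (simp add: v_def)
    then show False using inc[OF jv] by simp
  qed
  have vo: "v \<in> orbit (I - {j}) E T s" using orbit_remove(1)[OF jn] v by simp
  show ?thesis
  proof (cases "j = s'")
    case True
    then show ?thesis using vo jv by auto
  next
    case False
    from orbit_pred_remove[OF j' False] obtain w where w: "w \<in> orbit (I - {j}) E T s'" "(w, j) \<in> E" .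
    have "w \<noteq> v" using inc[OF w(2)] inc[OF jv] by auto
    moreover have "j \<in> I - {s, s'}" using jI False jn by auto
    ultimately show ?thesis using vo w jv by blast
  qed
qed

end

text \<open>The list runs backwards in time: its head is the newest vertex, so a walk is extended by
  \<open>Cons\<close>.\<close>

fun walk :: "(nat \<times> nat) set \<Rightarrow> nat list \<Rightarrow> bool" where
  "walk E (j # k # ks) \<longleftrightarrow> (k, j) \<in> E \<and> walk E (k # ks)"
| "walk E [k] \<longleftrightarrow> True"
| "walk E [] \<longleftrightarrow> True"

lemma walk_Cons: "ks \<noteq> [] \<Longrightarrow> walk E (j # ks) \<longleftrightarrow> (hd ks, j) \<in> E \<and> walk E ks"
  by (cases ks) auto

text \<open>If no \<open>r\<close> consecutive steps all gain less than \<open>W\<close>, then the walk gains \<open>W\<close>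
  every \<open>r\<close> steps and has to stop.\<close>

lemma (in increasing) traj_stops:
  assumes s: "s \<in> I" and H: "\<And>k. k \<in> I \<Longrightarrow> \<bar>h k\<bar> \<le> H" and W: "2 * H < real m * W"
    and nowalk: "\<And>js. set js \<subseteq> I \<Longrightarrow> length js = Suc r \<Longrightarrow> \<not> walk {(k, l) \<in> E. h l < h k + W} js"
  shows "\<exists>t \<le> r * m. \<not> (\<exists>l\<in>I. (traj I E s t, l) \<in> E)"
proof (rule ccontr)
  assume "\<not> ?thesis"
  then have go: "\<exists>l\<in>I. (traj I E s t, l) \<in> E" if "t \<le> r * m" for t using that by blast
  have "h s + real m' * W \<le> h (traj I E s (r * m'))" if "m' \<le> m" for m'
    using that
  proof (induction m')
    case (Suc m')
    have rm: "r * m' + r \<le> r * m" using mult_le_mono2[OF Suc.prems, of r] by simp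
    define E' where "E' = {(k, l) \<in> E. h l < h k + W}"
    let ?k = "\<lambda>i. traj I E s (r * m' + i)"
    have e: "(?k i, ?k (Suc i)) \<in> E" if "i < r" for i
    proof -
      have "r * m' + i \<le> r * m" using that rm by linarith
      then obtain l where "l \<in> I" "(?k i, l) \<in> E" using go by blast
      from step_edge[OF this] show ?thesis by (simp add: traj_Suc)
    qed
    have "\<exists>i<r. h (?k i) + W \<le> h (?k (Suc i))"
    proof (rule ccontr)
      assume "\<not> ?thesis"
      then have e': "(?k i, ?k (Suc i)) \<in> E'" if "i < r" for i using e[OF that] that by (auto simp: E'_def not_le)
      have "walk E' (rev (map ?k [0..<Suc t]))" if "t \<le> r" for t
        using that
      proof (induction t)
        case (Suc t)
        then have "walk E' (rev (map ?k [0..<Suc t]))" "(?k t, ?k (Suc t)) \<in> E'" using e'[of t] by auto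
        then show ?case by simp
      qed simp
      moreover have "set (rev (map ?k [0..<Suc r])) \<subseteq> I" using traj_mem[OF s] by auto
      ultimately show False using nowalk[of "rev (map ?k [0..<Suc r])"] by (auto simp: E'_def)
    qed
    then obtain i where i: "i < r" "h (?k i) + W \<le> h (?k (Suc i))" by blast
    have "h s + real (Suc m') * W = (h s + real m' * W) + W" by (simp add: distrib_right)
    also have "h s + real m' * W \<le> h (?k 0)" using Suc by simp
    also have "h (?k 0) \<le> h (?k i)" by (rule traj_mono) simp
    also note i(2)
    also have "h (?k (Suc i)) \<le> h (?k r)" by (rule traj_mono) (use i in simp)
    also have "r * m' + r = r * Suc m'" by simp
    finally show ?case by simp
  qed simp
  from this[OF order_refl] have gain: "h s + real m * W \<le> h (traj I E s (r * m))" .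
  have bounds: "\<bar>h s\<bar> \<le> H" "\<bar>h (traj I E s (r * m))\<bar> \<le> H" using H s traj_mem[OF s] by blast+
  from gain bounds W show False by argo
qed

lemma traj_stopped:
  assumes "\<not> (\<exists>l\<in>I. (traj I E s t, l) \<in> E)" "t \<le> t'"
  shows "traj I E s t' = traj I E s t"
  using assms(2)
proof (induction t')
  case (Suc t')
  show ?case
  proof (cases "t \<le> t'")
    case True
    then show ?thesis using Suc assms(1) by (auto simp: traj_Suc step_def)
  next
    case False
    then show ?thesis using Suc by (simp add: le_Suc_eq)
  qed
qed simp

text \<open>Outside \<open>A\<close> the walk along \<open>E\<close> is frozen and inside
  \<open>A\<close> both walks choose the same successor. It serves to find the endpoint of the walk
  frozen at a given level on the walk that goes on.\<close>

lemma traj_prefix: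
  assumes "E \<subseteq> E'" "\<And>k l. k \<in> A \<Longrightarrow> (k, l) \<in> E' \<Longrightarrow> (k, l) \<in> E" "\<And>k l. (k, l) \<in> E \<Longrightarrow> k \<in> A"
  shows "\<exists>t'\<le>t. traj I E s t = traj I E' s t'"
proof (induction t)
  case (Suc t)
  then obtain t' where t': "t' \<le> t" "traj I E s t = traj I E' s t'" by blast
  let ?k = "traj I E s t"
  show ?case
  proof (cases "?k \<in> A")
    case True
    then have "step I E ?k = step I E' ?k" by (intro step_cong) (use assms in blast)
    then show ?thesis using t' by (intro exI[of _ "Suc t'"]) (simp add: traj_Suc)
  next
    case False
    then have "step I E ?k = ?k" using assms(3) by (auto simp: step_def)
    then show ?thesis using t' by (intro exI[of _ t']) (simp add: traj_Suc)
  qed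
qed simp

section \<open>Resampling one coordinate and the Efron-Stein inequality\<close>

lemma (in finite_measure) integrable_bounded:
  fixes f :: "'a \<Rightarrow> real"
  assumes "f \<in> borel_measurable M" "\<And>x. x \<in> space M \<Longrightarrow> \<bar>f x\<bar> \<le> B"
  shows "integrable M f"
  by (rule integrable_const_bound[of _ B]) (use assms in auto)

lemma (in prob_space) variance_le_square_diff:
  fixes f :: "'a \<Rightarrow> real"
  assumes "integrable M f" "integrable M (\<lambda>x. (f x)\<^sup>2)"
  shows "expectation (\<lambda>x. (f x)\<^sup>2) - (expectation f)\<^sup>2 \<le> expectation (\<lambda>x. (f x - c)\<^sup>2)"
proof -
  have "expectation (\<lambda>x. (f x - c)\<^sup>2) = expectation (\<lambda>x. (f x)\<^sup>2 - 2 * c * f x + c\<^sup>2)"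
    by (intro Bochner_Integration.integral_cong) (auto simp: power2_eq_square algebra_simps)
  also have "\<dots> = expectation (\<lambda>x. (f x)\<^sup>2) - 2 * c * expectation f + c\<^sup>2"
    using assms by (simp add: prob_space)
  finally have "expectation (\<lambda>x. (f x - c)\<^sup>2) - (expectation (\<lambda>x. (f x)\<^sup>2) - (expectation f)\<^sup>2)
      = (expectation f - c)\<^sup>2"
    by (simp add: power2_eq_square algebra_simps)
  then show ?thesis using zero_le_power2[of "expectation f - c"] by linarith
qed

lemma (in prob_space) square_expectation_le:
  fixes f :: "'a \<Rightarrow> real"
  assumes "integrable M f" "integrable M (\<lambda>x. (f x)\<^sup>2)"
  shows "(expectation f)\<^sup>2 \<le> expectation (\<lambda>x. (f x)\<^sup>2)"
proof -
  have "0 \<le> expectation (\<lambda>x. (f x - expectation f)\<^sup>2)" by simp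
  also have "\<dots> = expectation (\<lambda>x. (f x)\<^sup>2) - (expectation f)\<^sup>2"
    by (rule variance_eq[OF assms])
  finally show ?thesis by simp
qed

context prob_space
begin

abbreviation iid :: "nat set \<Rightarrow> (nat \<Rightarrow> 'a) measure" where
  "iid I \<equiv> PiM I (\<lambda>_. M)"

lemma product_prob: "product_prob_space (\<lambda>_::nat. M)"
  by unfold_locales

lemma prob_space_iid: "prob_space (iid I)"
  by (intro prob_space_PiM prob_space_axioms)

lemma iid_upd: "x \<in> space (iid I) \<Longrightarrow> y \<in> space M \<Longrightarrow> j \<in> I \<Longrightarrow> x(j := y) \<in> space (iid I)"
  by (auto simp: space_PiM PiE_def extensional_def)

lemma iid_upd_measurable: "j \<in> I \<Longrightarrow> (\<lambda>(x, y). x(j := y)) \<in> iid I \<Otimes>\<^sub>M M \<rightarrow>\<^sub>M iid I"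
  using measurable_add_dim[of j I "\<lambda>_. M"] by (simp add: insert_absorb)

lemma iid_upd_measurable1: "j \<in> I \<Longrightarrow> x \<in> space (iid I) \<Longrightarrow> (\<lambda>y. x(j := y)) \<in> M \<rightarrow>\<^sub>M iid I"
  using measurable_compose[OF measurable_Pair1' iid_upd_measurable] by simp

text \<open>On the right the old value at \<open>j\<close> is overwritten, so integrating it out
  contributes a factor one. Resampling stands in for conditioning on all coordinates but
  \<open>j\<close>.\<close>

lemma resample_nn:
  assumes I: "finite I" "j \<in> I" and f: "f \<in> borel_measurable (iid I)"
  shows "(\<integral>\<^sup>+x. f x \<partial>iid I) = (\<integral>\<^sup>+x. \<integral>\<^sup>+y. f (x(j := y)) \<partial>M \<partial>iid I)"
proof -
  interpret PP: product_prob_space "\<lambda>_::nat. M" by (rule product_prob)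
  have Ieq: "I = insert j (I - {j})" using I by auto
  have f': "f \<in> borel_measurable (iid (insert j (I - {j})))" using f Ieq by simp
  have g: "(\<lambda>x. \<integral>\<^sup>+y. f (x(j := y)) \<partial>M) \<in> borel_measurable (iid I)"
    by (rule borel_measurable_nn_integral)
      (use measurable_compose[OF iid_upd_measurable[OF I(2)] f] in \<open>simp add: case_prod_unfold\<close>)
  then have g': "(\<lambda>x. \<integral>\<^sup>+y. f (x(j := y)) \<partial>M) \<in> borel_measurable (iid (insert j (I - {j})))"
    using Ieq by simp
  have "(\<integral>\<^sup>+x. \<integral>\<^sup>+y. f (x(j := y)) \<partial>M \<partial>iid I)
      = (\<integral>\<^sup>+x. \<integral>\<^sup>+z. \<integral>\<^sup>+y. f ((x(j := z))(j := y)) \<partial>M \<partial>M \<partial>iid (I - {j}))"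
    by (subst Ieq, subst PP.product_nn_integral_insert[OF _ _ g']) (use I in auto)
  also have "\<dots> = (\<integral>\<^sup>+x. \<integral>\<^sup>+y. f (x(j := y)) \<partial>M \<partial>iid (I - {j}))"
    by (simp add: emeasure_space_1)
  also have "\<dots> = (\<integral>\<^sup>+x. f x \<partial>iid I)"
    by (subst (2) Ieq, subst PP.product_nn_integral_insert[OF _ _ f']) (use I in auto)
  finally show ?thesis by simp
qed

lemma resample_measurable:
  fixes f :: "(nat \<Rightarrow> 'a) \<Rightarrow> real"
  assumes "j \<in> I" "f \<in> borel_measurable (iid I)"
  shows "(\<lambda>x. \<integral>y. f (x(j := y)) \<partial>M) \<in> borel_measurable (iid I)"
  by (rule borel_measurable_lebesgue_integral)
    (use measurable_compose[OF iid_upd_measurable[OF assms(1)] assms(2)] in \<open>simp add: case_prod_unfold\<close>)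

lemma resample:
  fixes f :: "(nat \<Rightarrow> 'a) \<Rightarrow> real"
  assumes I: "finite I" "j \<in> I" and f: "f \<in> borel_measurable (iid I)"
    and B: "\<And>x. x \<in> space (iid I) \<Longrightarrow> \<bar>f x\<bar> \<le> B"
  shows "(\<integral>x. f x \<partial>iid I) = (\<integral>x. (\<integral>y. f (x(j := y)) \<partial>M) \<partial>iid I)"
proof -
  interpret P: prob_space "iid I" by (rule prob_space_iid)
  interpret PP: product_prob_space "\<lambda>_::nat. M" by (rule product_prob)
  have Ieq: "I = insert j (I - {j})" using I by auto
  have i1: "integrable (iid I) f" by (rule P.integrable_bounded[OF f B])
  have B': "\<bar>\<integral>y. f (x(j := y)) \<partial>M\<bar> \<le> B" if x: "x \<in> space (iid I)" for x
  proof -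
    have m: "(\<lambda>y. f (x(j := y))) \<in> borel_measurable M"
      by (rule measurable_compose[OF iid_upd_measurable1[OF I(2) x] f])
    have b: "\<bar>f (x(j := y))\<bar> \<le> B" if "y \<in> space M" for y by (rule B[OF iid_upd[OF x that I(2)]])
    have i: "integrable M (\<lambda>y. f (x(j := y)))" by (rule integrable_bounded[OF m b])
    have "\<bar>\<integral>y. f (x(j := y)) \<partial>M\<bar> \<le> (\<integral>y. \<bar>f (x(j := y))\<bar> \<partial>M)" by (rule integral_abs_bound)
    also have "\<dots> \<le> (\<integral>y. B \<partial>M)" by (rule integral_mono) (use i b in auto)
    finally show ?thesis by (simp add: prob_space)
  qed
  have i2: "integrable (iid I) (\<lambda>x. \<integral>y. f (x(j := y)) \<partial>M)"
    by (rule P.integrable_bounded[OF resample_measurable[OF I(2) f] B'])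
  have i1': "integrable (iid (insert j (I - {j}))) f" using i1 Ieq by simp
  have i2': "integrable (iid (insert j (I - {j}))) (\<lambda>x. \<integral>y. f (x(j := y)) \<partial>M)" using i2 Ieq by simp
  have "(\<integral>x. (\<integral>y. f (x(j := y)) \<partial>M) \<partial>iid I)
      = (\<integral>x. (\<integral>z. (\<integral>y. f ((x(j := z))(j := y)) \<partial>M) \<partial>M) \<partial>iid (I - {j}))"
    by (subst Ieq, subst PP.product_integral_insert[OF _ _ i2']) (use I in auto)
  also have "\<dots> = (\<integral>x. (\<integral>y. f (x(j := y)) \<partial>M) \<partial>iid (I - {j}))"
    by (simp add: prob_space)
  also have "\<dots> = (\<integral>x. f x \<partial>iid I)"
    by (subst (2) Ieq, subst PP.product_integral_insert[OF _ _ i1']) (use I in auto)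
  finally show ?thesis by simp
qed

lemma resample_prob:
  assumes I: "finite I" "j \<in> I" and A: "A \<in> sets (iid I)"
  shows "measure (iid I) A = (\<integral>x. \<P>(y in M. x(j := y) \<in> A) \<partial>iid I)"
proof -
  have "measure (iid I) A = (\<integral>x. indicator A x \<partial>iid I)" using A by simp
  also have "\<dots> = (\<integral>x. (\<integral>y. indicator A (x(j := y)) \<partial>M) \<partial>iid I)"
    by (rule resample[OF I, of _ 1]) (use A in \<open>auto simp: indicator_def\<close>)
  also have "\<dots> = (\<integral>x. \<P>(y in M. x(j := y) \<in> A) \<partial>iid I)"
  proof (rule Bochner_Integration.integral_cong[OF refl])
    fix x assume x: "x \<in> space (iid I)"
    have m: "{y \<in> space M. x(j := y) \<in> A} \<in> sets M"
      using measurable_sets[OF iid_upd_measurable1[OF I(2) x] A] by (simp add: vimage_def Int_def conj_commute)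
    have "(\<integral>y. indicator A (x(j := y)) \<partial>M) = (\<integral>y. indicator {y \<in> space M. x(j := y) \<in> A} y \<partial>M :: real)"
      by (intro Bochner_Integration.integral_cong) (auto simp: indicator_def)
    then show "(\<integral>y. indicator A (x(j := y)) \<partial>M) = \<P>(y in M. x(j := y) \<in> A)" using m by simp
  qed
  finally show ?thesis .
qed

text \<open>The working form of conditioning on all points but \<open>j\<close>: bound the chance of
  a fresh \<open>j\<close>-th point by a function of the configuration, then integrate that
  function.\<close>

lemma resample_prob_le:
  assumes I: "finite I" "j \<in> I" and A: "A \<in> sets (iid I)" and g: "g \<in> borel_measurable (iid I)"
    "\<And>x. x \<in> space (iid I) \<Longrightarrow> \<bar>g x\<bar> \<le> B"
    and le: "\<And>x. x \<in> space (iid I) \<Longrightarrow> \<P>(y in M. x(j := y) \<in> A) \<le> g x"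
  shows "measure (iid I) A \<le> (\<integral>x. g x \<partial>iid I)"
proof -
  interpret P: prob_space "iid I" by (rule prob_space_iid)
  have "(\<lambda>x. \<P>(y in M. x(j := y) \<in> A)) \<in> borel_measurable (iid I)"
  proof -
    have "{p \<in> space (iid I \<Otimes>\<^sub>M M). (fst p)(j := snd p) \<in> A} \<in> sets (iid I \<Otimes>\<^sub>M M)"
      using measurable_sets[OF iid_upd_measurable[OF I(2)] A]
      by (simp add: vimage_def Int_def conj_commute case_prod_unfold)
    from measurable_emeasure_Pair[OF this] have
      "(\<lambda>x. emeasure M (Pair x -` {p \<in> space (iid I \<Otimes>\<^sub>M M). (fst p)(j := snd p) \<in> A})) \<in> borel_measurable (iid I)" .
    then have "(\<lambda>x. measure M (Pair x -` {p \<in> space (iid I \<Otimes>\<^sub>M M). (fst p)(j := snd p) \<in> A})) \<in> borel_measurable (iid I)"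
      unfolding measure_def by measurable
    then show ?thesis
      by (rule measurable_cong[THEN iffD1, rotated])
        (auto simp: space_pair_measure intro!: arg_cong[where f=prob])
  qed
  then show ?thesis unfolding resample_prob[OF I A]
    by (intro integral_mono le P.integrable_bounded[of _ 1] P.integrable_bounded[OF g]) auto
qed

text \<open>Averaging over coordinate \<open>j\<close> splits the variance into the mean conditional
  variance given the other coordinates and the variance of the average \<open>F\<close>. The former
  is at most the mean of \<open>(f - g j)\<^sup>2\<close>, since the variance is the least mean
  squared distance to a constant and \<open>g j\<close> is constant in coordinate \<open>j\<close>.
  The latter falls under the induction hypothesis with averaged \<open>g i\<close>, and Jensen
  compares the averaged squares with the original ones. Thus the \<open>g i\<close> may be any
  functions that ignore coordinate \<open>i\<close>; later \<open>g i\<close> is the count with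
  point \<open>i\<close> deleted.\<close>

theorem efron_stein:
  fixes f :: "(nat \<Rightarrow> 'a) \<Rightarrow> real"
  assumes "finite I" and f: "f \<in> borel_measurable (iid I)" "\<And>x. x \<in> space (iid I) \<Longrightarrow> \<bar>f x\<bar> \<le> B"
    and g: "\<And>i. i \<in> I \<Longrightarrow> g i \<in> borel_measurable (iid I)"
      "\<And>i x. i \<in> I \<Longrightarrow> x \<in> space (iid I) \<Longrightarrow> \<bar>g i x\<bar> \<le> B"
      "\<And>i x y. i \<in> I \<Longrightarrow> x \<in> space (iid I) \<Longrightarrow> y \<in> space M \<Longrightarrow> g i (x(i := y)) = g i x"
  shows "(\<integral>x. (f x)\<^sup>2 \<partial>iid I) - (\<integral>x. f x \<partial>iid I)\<^sup>2 \<le> (\<Sum>i\<in>I. \<integral>x. (f x - g i x)\<^sup>2 \<partial>iid I)"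
  using assms
proof (induction I arbitrary: f g rule: finite_induct)
  case empty
  interpret P: prob_space "iid {}" by (rule prob_space_iid)
  have "(\<integral>x. (f x)^k \<partial>iid {}) = f (\<lambda>_. undefined) ^ k" for k
  proof -
    have "(\<integral>x. (f x)^k \<partial>iid {}) = (\<integral>x. f (\<lambda>_. undefined) ^ k \<partial>iid {})"
      by (rule Bochner_Integration.integral_cong) (auto simp: space_PiM)
    then show ?thesis by (simp add: P.prob_space)
  qed
  from this[of 1] this[of 2] show ?case by simp
next
  case (insert j I)
  interpret P: prob_space "iid I" by (rule prob_space_iid)
  interpret PP: product_prob_space "\<lambda>_::nat. M" by (rule product_prob)
  interpret J: prob_space "iid (insert j I)" by (rule prob_space_iid)
  note fm = insert.prems(1) and fB = insert.prems(2)
  have upd: "x(j := y) \<in> space (iid (insert j I))" if "x \<in> space (iid I)" "y \<in> space M" for x y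
    using that by (auto simp: space_PiM PiE_def extensional_def)
  have am: "(\<lambda>(x, y). x(j := y)) \<in> iid I \<Otimes>\<^sub>M M \<rightarrow>\<^sub>M iid (insert j I)" by (rule measurable_add_dim)
  have am1: "(\<lambda>y. x(j := y)) \<in> M \<rightarrow>\<^sub>M iid (insert j I)" if "x \<in> space (iid I)" for x
    using measurable_compose[OF measurable_Pair1'[OF that] am] by simp
  text \<open>bounded measurable functions on the large product: Fubini and all side conditions\<close>
  have sec: "integrable M (\<lambda>y. u (x(j := y)))" "\<bar>\<integral>y. u (x(j := y)) \<partial>M\<bar> \<le> C"
    if u: "u \<in> borel_measurable (iid (insert j I))" "\<And>x. x \<in> space (iid (insert j I)) \<Longrightarrow> \<bar>u x\<bar> \<le> C"
      and x: "x \<in> space (iid I)" for u :: "_ \<Rightarrow> real" and x C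
  proof -
    show i: "integrable M (\<lambda>y. u (x(j := y)))"
      by (rule integrable_bounded[of _ C]) (use measurable_compose[OF am1[OF x] u(1)] u(2) upd[OF x] in auto)
    have "\<bar>\<integral>y. u (x(j := y)) \<partial>M\<bar> \<le> (\<integral>y. \<bar>u (x(j := y))\<bar> \<partial>M)" by (rule integral_abs_bound)
    also have "\<dots> \<le> (\<integral>y. C \<partial>M)" by (rule integral_mono) (use i u(2) upd[OF x] in auto)
    finally show "\<bar>\<integral>y. u (x(j := y)) \<partial>M\<bar> \<le> C" by (simp add: prob_space)
  qed
  have secm: "(\<lambda>x. \<integral>y. u (x(j := y)) \<partial>M) \<in> borel_measurable (iid I)"
    if u: "u \<in> borel_measurable (iid (insert j I))" for u :: "_ \<Rightarrow> real"
    by (rule borel_measurable_lebesgue_integral)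
      (use measurable_compose[OF am u] in \<open>simp add: case_prod_unfold\<close>)
  have fub: "(\<integral>x. u x \<partial>iid (insert j I)) = (\<integral>x. (\<integral>y. u (x(j := y)) \<partial>M) \<partial>iid I)"
    if u: "u \<in> borel_measurable (iid (insert j I))" "\<And>x. x \<in> space (iid (insert j I)) \<Longrightarrow> \<bar>u x\<bar> \<le> C"
    for u :: "_ \<Rightarrow> real" and C
    by (rule PP.product_integral_insert) (use insert J.integrable_bounded[OF u] in auto)
  have B0: "0 \<le> B"
  proof -
    obtain x where "x \<in> space (iid (insert j I))" using J.not_empty by blast
    then show ?thesis using fB[of x] by linarith
  qed
  have sqB: "\<bar>u\<^sup>2\<bar> \<le> C\<^sup>2" if "\<bar>u\<bar> \<le> C" for u C :: real
    using power_mono[OF that abs_ge_zero, of 2] by simp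
  define F where "F x = (\<integral>y. f (x(j := y)) \<partial>M)" for x
  define G where "G i x = (\<integral>y. g i (x(j := y)) \<partial>M)" for i x
  have dm: "(\<lambda>x. (f x - g i x)\<^sup>2) \<in> borel_measurable (iid (insert j I))"
    and dB: "\<And>x. x \<in> space (iid (insert j I)) \<Longrightarrow> \<bar>(f x - g i x)\<^sup>2\<bar> \<le> (2 * B)\<^sup>2"
    if "i \<in> insert j I" for i
  proof -
    show "(\<lambda>x. (f x - g i x)\<^sup>2) \<in> borel_measurable (iid (insert j I))"
      using fm insert.prems(3)[OF that] by measurable
    show "\<bar>(f x - g i x)\<^sup>2\<bar> \<le> (2 * B)\<^sup>2" if x: "x \<in> space (iid (insert j I))" for x
      by (rule sqB) (use fB[OF x] insert.prems(4)[OF \<open>i \<in> insert j I\<close> x] in linarith)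
  qed
  have f2m: "(\<lambda>x. (f x)\<^sup>2) \<in> borel_measurable (iid (insert j I))" using fm by measurable
  have f2B: "\<bar>(f x)\<^sup>2\<bar> \<le> B\<^sup>2" if "x \<in> space (iid (insert j I))" for x by (rule sqB[OF fB[OF that]])
  have Fm: "F \<in> borel_measurable (iid I)" unfolding F_def by (rule secm[OF fm])
  have FB: "\<bar>F x\<bar> \<le> B" if "x \<in> space (iid I)" for x
    unfolding F_def by (rule sec(2)[OF fm fB that])
  have IH: "(\<integral>x. (F x)\<^sup>2 \<partial>iid I) - (\<integral>x. F x \<partial>iid I)\<^sup>2 \<le> (\<Sum>i\<in>I. \<integral>x. (F x - G i x)\<^sup>2 \<partial>iid I)"
  proof (rule insert.IH[OF Fm FB])
    fix i assume i: "i \<in> I"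
    show "G i \<in> borel_measurable (iid I)" unfolding G_def by (rule secm) (use insert.prems(3) i in auto)
    show "\<bar>G i x\<bar> \<le> B" if "x \<in> space (iid I)" for x
      unfolding G_def by (rule sec(2)[OF _ _ that]) (use insert.prems(3,4) i in auto)
    show "G i (x(i := y)) = G i x" if x: "x \<in> space (iid I)" and y: "y \<in> space M" for x y
      unfolding G_def
    proof (rule Bochner_Integration.integral_cong[OF refl])
      fix z assume z: "z \<in> space M"
      have "i \<noteq> j" using i insert by auto
      then have "(x(i := y))(j := z) = (x(j := z))(i := y)" by (auto simp: fun_eq_iff)
      then show "g i ((x(i := y))(j := z)) = g i (x(j := z))"
        using insert.prems(5)[OF insertI2[OF i] upd[OF x z] y] by (simp only:)
    qed
  qed
  also have "\<dots> \<le> (\<Sum>i\<in>I. \<integral>x. (f x - g i x)\<^sup>2 \<partial>iid (insert j I))"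
  proof (rule sum_mono)
    fix i assume i: "i \<in> I"
    have i': "i \<in> insert j I" using i by simp
    have gm: "g i \<in> borel_measurable (iid (insert j I))" using insert.prems(3) i by auto
    have gB: "\<bar>g i x\<bar> \<le> B" if "x \<in> space (iid (insert j I))" for x using insert.prems(4) i that by auto
    have pm: "(\<lambda>x. f x - g i x) \<in> borel_measurable (iid (insert j I))" using fm gm by measurable
    have pB: "\<bar>f x - g i x\<bar> \<le> 2 * B" if "x \<in> space (iid (insert j I))" for x
      using fB[OF that] gB[OF that] by linarith
    have "(\<integral>x. (F x - G i x)\<^sup>2 \<partial>iid I) = (\<integral>x. (\<integral>y. f (x(j := y)) - g i (x(j := y)) \<partial>M)\<^sup>2 \<partial>iid I)"
      by (intro Bochner_Integration.integral_cong refl)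
        (simp add: F_def G_def sec(1)[OF fm fB] sec(1)[OF gm gB])
    also have "\<dots> \<le> (\<integral>x. (\<integral>y. (f (x(j := y)) - g i (x(j := y)))\<^sup>2 \<partial>M) \<partial>iid I)"
    proof (rule integral_mono)
      show "(\<integral>y. f (x(j := y)) - g i (x(j := y)) \<partial>M)\<^sup>2 \<le> (\<integral>y. (f (x(j := y)) - g i (x(j := y)))\<^sup>2 \<partial>M)"
        if "x \<in> space (iid I)" for x
        by (rule square_expectation_le[OF sec(1)[OF pm pB that] sec(1)[OF dm dB that]]) (use i' in auto)
      show "integrable (iid I) (\<lambda>x. (\<integral>y. f (x(j := y)) - g i (x(j := y)) \<partial>M)\<^sup>2)"
        by (rule P.integrable_bounded[OF borel_measurable_power[OF secm[OF pm]] sqB[OF sec(2)[OF pm pB]]])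
      show "integrable (iid I) (\<lambda>x. \<integral>y. (f (x(j := y)) - g i (x(j := y)))\<^sup>2 \<partial>M)"
        by (rule P.integrable_bounded[OF secm[OF dm[OF i']] sec(2)[OF dm dB]]) (use i' in auto)
    qed
    also have "\<dots> = (\<integral>x. (f x - g i x)\<^sup>2 \<partial>iid (insert j I))"
      by (rule fub[symmetric, OF dm[OF i'] dB[OF i']])
    finally show "(\<integral>x. (F x - G i x)\<^sup>2 \<partial>iid I) \<le> (\<integral>x. (f x - g i x)\<^sup>2 \<partial>iid (insert j I))" .
  qed
  finally have 1: "(\<integral>x. (F x)\<^sup>2 \<partial>iid I) - (\<integral>x. F x \<partial>iid I)\<^sup>2
      \<le> (\<Sum>i\<in>I. \<integral>x. (f x - g i x)\<^sup>2 \<partial>iid (insert j I))" .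
  have F2i: "integrable (iid I) (\<lambda>x. (F x)\<^sup>2)"
    by (rule P.integrable_bounded[OF borel_measurable_power[OF Fm] sqB[OF FB]])
  have "(\<integral>x. (f x)\<^sup>2 \<partial>iid (insert j I)) - (\<integral>x. (F x)\<^sup>2 \<partial>iid I)
      = (\<integral>x. (\<integral>y. (f (x(j := y)))\<^sup>2 \<partial>M) - (F x)\<^sup>2 \<partial>iid I)"
    using F2i P.integrable_bounded[OF secm[OF f2m] sec(2)[OF f2m f2B]] by (simp add: fub[OF f2m f2B])
  also have "\<dots> \<le> (\<integral>x. (\<integral>y. (f (x(j := y)) - g j (x(j := y)))\<^sup>2 \<partial>M) \<partial>iid I)"
  proof (rule integral_mono)
    show "integrable (iid I) (\<lambda>x. (\<integral>y. (f (x(j := y)))\<^sup>2 \<partial>M) - (F x)\<^sup>2)"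
      using F2i P.integrable_bounded[OF secm[OF f2m] sec(2)[OF f2m f2B]] by simp
    show "integrable (iid I) (\<lambda>x. \<integral>y. (f (x(j := y)) - g j (x(j := y)))\<^sup>2 \<partial>M)"
      by (rule P.integrable_bounded[OF secm[OF dm] sec(2)[OF dm dB]]) auto
    fix x assume x: "x \<in> space (iid I)"
    obtain y0 where y0: "y0 \<in> space M" using not_empty by auto
    define c where "c = g j (x(j := y0))"
    have c: "g j (x(j := y)) = c" if "y \<in> space M" for y
      using insert.prems(5)[OF insertI1 upd[OF x y0] that] by (simp only: c_def fun_upd_upd)
    have "(\<integral>y. (f (x(j := y)))\<^sup>2 \<partial>M) - (F x)\<^sup>2 \<le> (\<integral>y. (f (x(j := y)) - c)\<^sup>2 \<partial>M)"
      unfolding F_def by (rule variance_le_square_diff[OF sec(1)[OF fm fB x] sec(1)[OF f2m f2B x]])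
    also have "\<dots> = (\<integral>y. (f (x(j := y)) - g j (x(j := y)))\<^sup>2 \<partial>M)"
      by (intro Bochner_Integration.integral_cong) (auto simp: c)
    finally show "(\<integral>y. (f (x(j := y)))\<^sup>2 \<partial>M) - (F x)\<^sup>2 \<le> (\<integral>y. (f (x(j := y)) - g j (x(j := y)))\<^sup>2 \<partial>M)" .
  qed
  also have "\<dots> = (\<integral>x. (f x - g j x)\<^sup>2 \<partial>iid (insert j I))"
    by (rule fub[symmetric, OF dm dB]) auto
  finally have 2: "(\<integral>x. (f x)\<^sup>2 \<partial>iid (insert j I)) - (\<integral>x. (F x)\<^sup>2 \<partial>iid I)
      \<le> (\<integral>x. (f x - g j x)\<^sup>2 \<partial>iid (insert j I))" .
  have "(\<integral>x. f x \<partial>iid (insert j I)) = (\<integral>x. F x \<partial>iid I)"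
    unfolding F_def by (rule fub[OF fm fB])
  then show ?case using 1 2 insert.hyps by simp
qed

end

subsection \<open>Random walk models\<close>

text \<open>The first argument of \<open>Rel\<close> is the index of the target. It leaves room for
  a cutoff by index besides the condition on the two positions.\<close>

locale walk_model = prob_space M for M :: "'a measure" +
  fixes I :: "nat set" and Rel :: "nat \<Rightarrow> 'a \<Rightarrow> 'a \<Rightarrow> bool" and h :: "'a \<Rightarrow> real"
  assumes finite_I [simp]: "finite I"
    and Rel_measurable: "Measurable.pred (M \<Otimes>\<^sub>M M) (\<lambda>(u, y). Rel l u y)"
    and Rel_inc: "Rel l u y \<Longrightarrow> h u < h y"
begin

definition edges :: "(nat \<Rightarrow> 'a) \<Rightarrow> (nat \<times> nat) set" where
  "edges x = {(k, l). k \<in> I \<and> l \<in> I \<and> Rel l (x k) (x l)}"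

abbreviation orb where "orb T s x \<equiv> orbit I (edges x) T s"

lemma edges_increasing: "increasing (edges x) (\<lambda>k. h (x k))"
  by standard (auto simp: edges_def dest: Rel_inc)

lemma Rel_pred [measurable]:
  "k \<in> I \<Longrightarrow> l \<in> I \<Longrightarrow> Measurable.pred (iid I) (\<lambda>x. Rel l' (x k) (x l))"
proof -
  assume "k \<in> I" "l \<in> I"
  then have "(\<lambda>x. (x k, x l)) \<in> iid I \<rightarrow>\<^sub>M M \<Otimes>\<^sub>M M"
    by (intro measurable_Pair measurable_component_singleton)
  from measurable_compose[OF this Rel_measurable[of l']] show ?thesis by simp
qed

lemma Rel_sets1: "u \<in> space M \<Longrightarrow> {y \<in> space M. Rel l u y} \<in> sets M"
  using measurable_compose[OF measurable_Pair1' Rel_measurable, of u l] by simp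

lemma Rel_sets2: "v \<in> space M \<Longrightarrow> {y \<in> space M. Rel l y v} \<in> sets M"
  using measurable_compose[OF measurable_Pair2' Rel_measurable, of v l] by simp

lemma Rel_prob_measurable [measurable]: "(\<lambda>u. \<P>(y in M. Rel l u y)) \<in> borel_measurable M"
proof -
  have "{p \<in> space (M \<Otimes>\<^sub>M M). Rel l (fst p) (snd p)} \<in> sets (M \<Otimes>\<^sub>M M)"
    using Rel_measurable[of l] by (simp add: case_prod_unfold pred_def)
  from measurable_emeasure_Pair[OF this] have
    "(\<lambda>u. emeasure M (Pair u -` {p \<in> space (M \<Otimes>\<^sub>M M). Rel l (fst p) (snd p)})) \<in> borel_measurable M" .
  then have "(\<lambda>u. prob (Pair u -` {p \<in> space (M \<Otimes>\<^sub>M M). Rel l (fst p) (snd p)})) \<in> borel_measurable M"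
    unfolding measure_def by measurable
  then show ?thesis
    by (rule measurable_cong[THEN iffD1, rotated])
      (auto simp: space_pair_measure intro!: arg_cong[where f=prob])
qed

text \<open>\<open>edges\<close> takes finitely many values, and each value is fixed by finitely
  many measurable conditions on pairs of points. This settles measurability of everything that
  depends on the graph only.\<close>

lemma edges_pred [measurable]: "Measurable.pred (iid I) (\<lambda>x. Q (edges x))"
proof -
  have "Q (edges x) \<longleftrightarrow> (\<exists>S \<in> {S \<in> Pow (I \<times> I). Q S}. \<forall>k\<in>I. \<forall>l\<in>I. ((k, l) \<in> S) = Rel l (x k) (x l))" for x
  proof
    assume "Q (edges x)"
    then show "\<exists>S \<in> {S \<in> Pow (I \<times> I). Q S}. \<forall>k\<in>I. \<forall>l\<in>I. ((k, l) \<in> S) = Rel l (x k) (x l)"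
      by (intro bexI[of _ "edges x"]) (auto simp: edges_def)
  next
    assume "\<exists>S \<in> {S \<in> Pow (I \<times> I). Q S}. \<forall>k\<in>I. \<forall>l\<in>I. ((k, l) \<in> S) = Rel l (x k) (x l)"
    then obtain S where S: "S \<subseteq> I \<times> I" "Q S" "\<forall>k\<in>I. \<forall>l\<in>I. ((k, l) \<in> S) = Rel l (x k) (x l)" by auto
    then have "edges x = S" unfolding edges_def by auto
    then show "Q (edges x)" using S by simp
  qed
  moreover have "Measurable.pred (iid I) (\<lambda>x. \<exists>S \<in> {S \<in> Pow (I \<times> I). Q S}. \<forall>k\<in>I. \<forall>l\<in>I. ((k, l) \<in> S) = Rel l (x k) (x l))"
  proof (intro pred_intros_finite)
    fix S k l assume "k \<in> I" "l \<in> I"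
    from Rel_pred[OF this, of l] show "Measurable.pred (iid I) (\<lambda>x. ((k, l) \<in> S) = Rel l (x k) (x l))"
      by (cases "(k, l) \<in> S") auto
  qed auto
  ultimately show ?thesis by simp
qed

lemma space_iidD: "x \<in> space (iid I) \<Longrightarrow> k \<in> I \<Longrightarrow> x k \<in> space M"
  by (auto simp: space_PiM)

lemma edges_upd: "edges (x(j := y)) \<inter> (I - {j}) \<times> (I - {j}) = edges x \<inter> (I - {j}) \<times> (I - {j})"
  by (auto simp: edges_def)

lemma orbit_upd: "s \<in> I \<Longrightarrow> s \<noteq> j \<Longrightarrow> orbit (I - {j}) (edges (x(j := y))) T s = orbit (I - {j}) (edges x) T s"
  by (rule orbit_cong) (use edges_upd in auto)

lemma traj_upd: "s \<in> I \<Longrightarrow> s \<noteq> j \<Longrightarrow> traj (I - {j}) (edges (x(j := y))) s t = traj (I - {j}) (edges x) s t"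
  by (rule traj_cong) (use edges_upd in auto)

text \<open>Vertices of a walk are distinct because \<open>h\<close> increases along it, so the
  newest point is independent of the rest of the walk. Revealing the points one by one, each
  extension multiplies the expected number of walks by at most \<open>\<theta>\<close>; the first
  vertex costs the factor \<open>card I\<close>.\<close>

lemma prob_walk_le:
  assumes \<theta>: "\<And>u. u \<in> space M \<Longrightarrow> (\<Sum>j\<in>I. \<P>(y in M. Rel j u y)) \<le> \<theta>"
  shows "\<P>(x in iid I. \<exists>js. set js \<subseteq> I \<and> length js = Suc r \<and> walk (edges x) js)
    \<le> real (card I) * \<theta> ^ r"
proof -
  interpret P: prob_space "iid I" by (rule prob_space_iid)
  define Ls where "Ls r = {js. set js \<subseteq> I \<and> length js = Suc r \<and> distinct js}" for r
  have fin: "finite (Ls r)" for r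
    unfolding Ls_def by (rule finite_subset[OF _ finite_lists_length_eq[OF finite_I, of "Suc r"]]) auto
  define W where "W js = {x \<in> space (iid I). walk (edges x) js}" for js
  have Wm [measurable]: "W js \<in> sets (iid I)" for js unfolding W_def using edges_pred by (auto simp: pred_def)
  have inc: "walk (edges x) (j # js) \<Longrightarrow> k \<in> set js \<Longrightarrow> h (x k) < h (x j)" for x j js k
  proof (induction js arbitrary: j)
    case (Cons a js)
    have "h (x a) < h (x j)" using Cons.prems(1) by (auto simp: edges_def dest: Rel_inc)
    moreover have "k \<in> set js \<Longrightarrow> h (x k) < h (x a)" using Cons by auto
    ultimately show ?case using Cons.prems(2) by auto
  qed simp
  have dist: "walk (edges x) js \<Longrightarrow> distinct js" for x js
  proof (induction js)
    case (Cons a js)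
    then have "walk (edges x) js" by (cases js) auto
    then show ?case using Cons inc[of x a js a] by auto
  qed simp
  have bound: "(\<Sum>js\<in>Ls r. P.prob (W js)) \<le> real (card I) * \<theta> ^ r" for r
  proof (induction r)
    case 0
    have "Ls 0 = (\<lambda>k. [k]) ` I" by (auto simp: Ls_def length_Suc_conv)
    then have "(\<Sum>js\<in>Ls 0. P.prob (W js)) = (\<Sum>k\<in>I. P.prob (W [k]))"
      by (simp add: sum.reindex inj_on_def)
    also have "\<dots> \<le> (\<Sum>k\<in>I. 1)" by (intro sum_mono) simp
    finally show ?case by simp
  next
    case (Suc r)
    let ?S = "Sigma (Ls r) (\<lambda>js. I - set js)"
    have eq: "Ls (Suc r) = (\<lambda>(js, j). j # js) ` ?S"
    proof
      show "Ls (Suc r) \<subseteq> (\<lambda>(js, j). j # js) ` ?S"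
      proof
        fix ks assume "ks \<in> Ls (Suc r)"
        then show "ks \<in> (\<lambda>(js, j). j # js) ` ?S"
          by (cases ks) (auto simp: Ls_def image_iff)
      qed
    qed (auto simp: Ls_def)
    have "(\<Sum>ks\<in>Ls (Suc r). P.prob (W ks)) = (\<Sum>(js, j)\<in>?S. P.prob (W (j # js)))"
      unfolding eq by (subst sum.reindex) (auto simp: inj_on_def case_prod_unfold)
    also have "\<dots> = (\<Sum>js\<in>Ls r. \<Sum>j\<in>I - set js. P.prob (W (j # js)))"
      by (rule sum.Sigma[symmetric]) (auto simp: fin)
    also have "\<dots> \<le> (\<Sum>js\<in>Ls r. \<theta> * P.prob (W js))"
    proof (rule sum_mono)
      fix js assume js: "js \<in> Ls r"
      then have ne: "js \<noteq> []" and sub: "set js \<subseteq> I" by (auto simp: Ls_def)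
      have hd: "hd js \<in> I" using hd_in_set[OF ne] sub by blast
      define p where "p j u = \<P>(y in M. Rel j u y)" for j u
      have gm: "(\<lambda>x. indicator (W js) x * p j (x (hd js))) \<in> borel_measurable (iid I)" for j
        unfolding p_def using hd by measurable
      have gi: "integrable (iid I) (\<lambda>x. indicator (W js) x * p j (x (hd js)))" for j
        by (rule P.integrable_bounded[where B=1, OF gm]) (auto simp: p_def indicator_def)
      have step: "P.prob (W (j # js)) \<le> (\<integral>x. indicator (W js) x * p j (x (hd js)) \<partial>iid I)"
        if j: "j \<in> I - set js" for j
      proof (rule resample_prob_le[OF finite_I, of j])
        show "\<P>(y in M. x(j := y) \<in> W (j # js)) \<le> indicator (W js) x * p j (x (hd js))"
          if x: "x \<in> space (iid I)" for x
        proof -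
          have hdj: "hd js \<noteq> j" using j ne by (metis DiffD2 hd_in_set)
          have eqw: "walk (edges (x(j := y))) js = walk (edges x) js" for y
            using j
          proof (induction js)
            case (Cons a js)
            then show ?case by (cases js) (auto simp: edges_def)
          qed simp
          show ?thesis
          proof (cases "x \<in> W js")
            case True
            have "{y \<in> space M. x(j := y) \<in> W (j # js)} \<subseteq> {y \<in> space M. Rel j (x (hd js)) y}"
              using hdj by (auto simp: W_def walk_Cons[OF ne] edges_def)
            then show ?thesis using True
              by (auto simp: p_def intro!: finite_measure_mono Rel_sets1 space_iidD[OF x] hd)
          next
            case False
            then have "{y \<in> space M. x(j := y) \<in> W (j # js)} = {}"
              using x by (auto simp: W_def walk_Cons[OF ne] eqw)
            then show ?thesis using False by (simp only: measure_empty) simp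
          qed
        qed
      qed (use j gm in \<open>auto simp: p_def indicator_def\<close>)
      have "(\<Sum>j\<in>I - set js. P.prob (W (j # js)))
          \<le> (\<Sum>j\<in>I - set js. \<integral>x. indicator (W js) x * p j (x (hd js)) \<partial>iid I)"
        by (rule sum_mono) (rule step)
      also have "\<dots> = (\<integral>x. (\<Sum>j\<in>I - set js. indicator (W js) x * p j (x (hd js))) \<partial>iid I)"
        by (rule Bochner_Integration.integral_sum[symmetric]) (rule gi)
      also have "\<dots> \<le> (\<integral>x. \<theta> * indicator (W js) x \<partial>iid I)"
      proof (rule integral_mono)
        fix x assume x: "x \<in> space (iid I)"
        have "(\<Sum>j\<in>I - set js. indicator (W js) x * p j (x (hd js)))
            = indicator (W js) x * (\<Sum>j\<in>I - set js. p j (x (hd js)))" by (simp add: sum_distrib_left)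
        also have "\<dots> \<le> indicator (W js) x * \<theta>"
        proof (rule mult_left_mono)
          have "(\<Sum>j\<in>I - set js. p j (x (hd js))) \<le> (\<Sum>j\<in>I. p j (x (hd js)))"
            by (rule sum_mono2) (auto simp: p_def)
          also have "\<dots> \<le> \<theta>" unfolding p_def by (rule \<theta>[OF space_iidD[OF x hd]])
          finally show "(\<Sum>j\<in>I - set js. p j (x (hd js))) \<le> \<theta>" .
        qed simp
        finally show "(\<Sum>j\<in>I - set js. indicator (W js) x * p j (x (hd js))) \<le> \<theta> * indicator (W js) x"
          by (simp add: mult.commute)
      next
        show "integrable (iid I) (\<lambda>x. \<Sum>j\<in>I - set js. indicator (W js) x * p j (x (hd js)))"
          by (intro Bochner_Integration.integrable_sum gi)
        show "integrable (iid I) (\<lambda>x. \<theta> * indicator (W js) x)"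
          by (intro integrable_mult_right integrable_real_indicator Wm) (simp add: P.emeasure_eq_measure)
      qed
      also have "\<dots> = \<theta> * P.prob (W js)" by simp
      finally show "(\<Sum>j\<in>I - set js. P.prob (W (j # js))) \<le> \<theta> * P.prob (W js)" .
    qed
    also have "\<dots> = \<theta> * (\<Sum>js\<in>Ls r. P.prob (W js))" by (rule sum_distrib_left[symmetric])
    also have "\<dots> \<le> \<theta> * (real (card I) * \<theta> ^ r)"
    proof (rule mult_left_mono[OF Suc])
      obtain u where "u \<in> space M" using not_empty by auto
      then show "0 \<le> \<theta>" by (rule order_trans[OF _ \<theta>, rotated]) (auto intro!: sum_nonneg)
    qed
    finally show ?case by (simp add: mult.left_commute)
  qed
  have "{x \<in> space (iid I). \<exists>js. set js \<subseteq> I \<and> length js = Suc r \<and> walk (edges x) js} = (\<Union>js\<in>Ls r. W js)"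
    using dist by (auto simp: Ls_def W_def)
  then have "\<P>(x in iid I. \<exists>js. set js \<subseteq> I \<and> length js = Suc r \<and> walk (edges x) js)
      \<le> (\<Sum>js\<in>Ls r. P.prob (W js))"
    using P.finite_measure_subadditive_finite[OF fin, of W r] Wm by (metis image_subsetI)
  then show ?thesis using bound[of r] by linarith
qed

end

section \<open>Probabilities that a walk hits a given point and that two walks meet\<close>

context walk_model
begin

lemma orbit_pred_measurable [measurable]:
  "Measurable.pred (iid I) (\<lambda>x. w \<in> orbit I' (edges x) T s)"
  by (rule edges_pred)

lemma prob_UN_le:
  assumes "finite V" "\<And>v. v \<in> V \<Longrightarrow> B v \<in> sets M" "A \<subseteq> (\<Union>v\<in>V. B v)"
  shows "prob A \<le> (\<Sum>v\<in>V. prob (B v))"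
proof -
  have "prob A \<le> prob (\<Union>v\<in>V. B v)"
    by (rule finite_measure_mono[OF assms(3)]) (use assms in auto)
  also have "\<dots> \<le> (\<Sum>v\<in>V. prob (B v))"
    by (rule finite_measure_subadditive_finite) (use assms in auto)
  finally show ?thesis .
qed

lemma sum_orbit_const_le: "0 \<le> c \<Longrightarrow> (\<Sum>w\<in>orbit I' E T s. c) \<le> (real T + 1) * c"
  using card_orbit[of I' E T s] by (simp add: mult_right_mono)

text \<open>By \<open>orbit_pred_remove\<close> the point \<open>j\<close> is entered from one of
  the at most \<open>T + 1\<close> vertices that are visited when \<open>j\<close> is deleted. These
  do not depend on \<open>y\<close>, so a union bound over them is enough.\<close>

lemma prob_hit_le:
  assumes p: "\<And>l u. u \<in> space M \<Longrightarrow> \<P>(y in M. Rel l u y) \<le> p"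
    and s: "s \<in> I" "j \<in> I" "s \<noteq> j" and x: "x \<in> space (iid I)"
  shows "\<P>(y in M. j \<in> orbit I (edges (x(j := y))) T s) \<le> (real T + 1) * p"
proof -
  have sI: "s \<in> I - {j}" using s by auto
  let ?V = "orbit (I - {j}) (edges x) T s"
  have V: "?V \<subseteq> I - {j}" by (rule orbit_subset[OF sI])
  have "\<P>(y in M. j \<in> orbit I (edges (x(j := y))) T s) \<le> (\<Sum>w\<in>?V. \<P>(y in M. Rel j (x w) y))"
  proof (rule prob_UN_le)
    show "{y \<in> space M. j \<in> orbit I (edges (x(j := y))) T s} \<subseteq> (\<Union>w\<in>?V. {y \<in> space M. Rel j (x w) y})"
    proof safe
      fix y assume y: "y \<in> space M" "j \<in> orbit I (edges (x(j := y))) T s"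
      obtain w where w: "w \<in> orbit (I - {j}) (edges (x(j := y))) T s" "(w, j) \<in> edges (x(j := y))"
        using orbit_pred_remove[OF y(2)] s by metis
      have "w \<in> ?V" using w(1) orbit_upd[of s j x y T] s by simp
      moreover from this have "w \<noteq> j" using V by auto
      then have "Rel j (x w) y" using w(2) by (simp add: edges_def)
      ultimately show "y \<in> (\<Union>w\<in>?V. {y \<in> space M. Rel j (x w) y})" using y by auto
    qed
  qed (use V in \<open>auto intro!: Rel_sets1 space_iidD[OF x]\<close>)
  also have "\<dots> \<le> (\<Sum>w\<in>?V. p)"
    by (rule sum_mono) (use V in \<open>auto intro!: p space_iidD[OF x]\<close>)
  also have "\<dots> \<le> (real T + 1) * p"
  proof (rule sum_orbit_const_le)
    obtain u where "u \<in> space M" using not_empty by auto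
    from order_trans[OF measure_nonneg p[OF this]] show "0 \<le> p" .
  qed
  finally show ?thesis .
qed

text \<open>A sum over all of \<open>I\<close> with an indicator, rather than over the random set of
  visited vertices, because in this form it is a finite sum of measurable terms.\<close>

definition orbit_sum :: "nat set \<Rightarrow> nat \<Rightarrow> nat \<Rightarrow> ('a \<Rightarrow> real) \<Rightarrow> (nat \<Rightarrow> 'a) \<Rightarrow> real" where
  "orbit_sum I' T s \<phi> x = (\<Sum>w\<in>I. of_bool (w \<in> orbit I' (edges x) T s) * \<phi> (x w))"

lemma orbit_sum_eq:
  assumes "orbit I' (edges x) T s \<subseteq> I"
  shows "orbit_sum I' T s \<phi> x = (\<Sum>w\<in>orbit I' (edges x) T s. \<phi> (x w))"
proof -
  have "orbit_sum I' T s \<phi> x = (\<Sum>w\<in>I. if w \<in> orbit I' (edges x) T s then \<phi> (x w) else 0)"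
    unfolding orbit_sum_def by (intro sum.cong) auto
  also have "\<dots> = (\<Sum>w\<in>I \<inter> orbit I' (edges x) T s. \<phi> (x w))" by (simp add: sum.inter_restrict)
  finally show ?thesis using assms by (simp add: Int_absorb1)
qed

lemma orbit_sum_measurable [measurable]:
  assumes [measurable]: "\<phi> \<in> borel_measurable M"
  shows "orbit_sum I' T s \<phi> \<in> borel_measurable (iid I)"
  unfolding orbit_sum_def of_bool_def by measurable

lemma orbit_sum_bounds:
  assumes "\<And>u. u \<in> space M \<Longrightarrow> 0 \<le> \<phi> u \<and> \<phi> u \<le> B" "x \<in> space (iid I)"
  shows "0 \<le> orbit_sum I' T s \<phi> x" "orbit_sum I' T s \<phi> x \<le> real (card I) * B"
proof -
  have *: "0 \<le> \<phi> (x w) \<and> \<phi> (x w) \<le> B" if "w \<in> I" for w using assms(1)[OF space_iidD[OF assms(2) that]] .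
  show "0 \<le> orbit_sum I' T s \<phi> x" unfolding orbit_sum_def by (intro sum_nonneg) (use * in auto)
  have "orbit_sum I' T s \<phi> x \<le> (\<Sum>w\<in>I. B)"
    unfolding orbit_sum_def
  proof (rule sum_mono)
    fix w assume "w \<in> I"
    from *[OF this] show "of_bool (w \<in> orbit I' (edges x) T s) * \<phi> (x w) \<le> B"
      by (cases "w \<in> orbit I' (edges x) T s") auto
  qed
  then show "orbit_sum I' T s \<phi> x \<le> real (card I) * B" by simp
qed

text \<open>A walk hits a given point with probability at most one half, so deleting that point
  costs only a factor two.\<close>

lemma decouple:
  assumes p: "\<And>l u. u \<in> space M \<Longrightarrow> \<P>(y in M. Rel l u y) \<le> p" and Tp: "(real T + 1) * p \<le> 1 / 2"
    and s: "s \<in> I" "j \<in> I" "s \<noteq> j"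
    and m [measurable]: "\<phi> \<in> borel_measurable M" and b: "\<And>u. u \<in> space M \<Longrightarrow> 0 \<le> \<phi> u \<and> \<phi> u \<le> B"
  shows "(\<integral>x. orbit_sum (I - {j}) T s \<phi> x \<partial>iid I) \<le> 2 * (\<integral>x. orbit_sum I T s \<phi> x \<partial>iid I)"
proof -
  interpret P: prob_space "iid I" by (rule prob_space_iid)
  let ?g = "orbit_sum (I - {j}) T s \<phi>" and ?h = "orbit_sum I T s \<phi>"
  have gb: "\<bar>?g x\<bar> \<le> real (card I) * B" "\<bar>?h x\<bar> \<le> real (card I) * B" if "x \<in> space (iid I)" for x
    using orbit_sum_bounds[where \<phi>=\<phi> and B=B, OF b that] by auto
  have gi: "integrable (iid I) ?g" by (rule P.integrable_bounded[OF _ gb(1)]) (auto intro: m)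
  have "(\<integral>x. ?g x / 2 \<partial>iid I) \<le> (\<integral>x. (\<integral>y. ?h (x(j := y)) \<partial>M) \<partial>iid I)"
  proof (rule integral_mono)
    show "integrable (iid I) (\<lambda>x. ?g x / 2)" using gi by simp
    have hm: "(\<lambda>y. ?h (x(j := y))) \<in> borel_measurable M" if "x \<in> space (iid I)" for x
      by (rule measurable_compose[OF iid_upd_measurable1[OF s(2) that]]) measurable
    have hb: "\<bar>?h (x(j := y))\<bar> \<le> real (card I) * B" if "x \<in> space (iid I)" "y \<in> space M" for x y
      using gb(2)[OF iid_upd[OF that s(2)]] .
    have hi: "integrable M (\<lambda>y. ?h (x(j := y)))" if "x \<in> space (iid I)" for x
      by (rule integrable_bounded[OF hm[OF that] hb[OF that]])
    show "integrable (iid I) (\<lambda>x. \<integral>y. ?h (x(j := y)) \<partial>M)"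
    proof (rule P.integrable_bounded[where B="real (card I) * B"])
      show "(\<lambda>x. \<integral>y. ?h (x(j := y)) \<partial>M) \<in> borel_measurable (iid I)"
        by (rule resample_measurable[OF s(2)]) measurable
      fix x assume x: "x \<in> space (iid I)"
      have "\<bar>\<integral>y. ?h (x(j := y)) \<partial>M\<bar> \<le> (\<integral>y. \<bar>?h (x(j := y))\<bar> \<partial>M)" by (rule integral_abs_bound)
      also have "\<dots> \<le> (\<integral>y. real (card I) * B \<partial>M)" by (rule integral_mono) (use hi[OF x] hb[OF x] in auto)
      finally show "\<bar>\<integral>y. ?h (x(j := y)) \<partial>M\<bar> \<le> real (card I) * B" by (simp add: prob_space)
    qed
    fix x assume x: "x \<in> space (iid I)"
    let ?H = "{y \<in> space M. j \<in> orbit I (edges (x(j := y))) T s}"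
    have Hm: "?H \<in> sets M"
      using measurable_compose[OF iid_upd_measurable1[OF s(2) x] orbit_pred_measurable] by (simp add: pred_def)
    have H: "prob ?H \<le> 1 / 2" using prob_hit_le[OF p s x, of T] Tp by simp
    \<comment> \<open>Off the event \<open>?H\<close> the two orbit sums agree, and that complement
      has probability at least 1/2 by \<open>Tp\<close>.\<close>
    have "?g x / 2 \<le> ?g x * (1 - prob ?H)"
      using orbit_sum_bounds(1)[where \<phi>=\<phi> and B=B, OF b x, of "I - {j}" T s] H
        mult_left_mono[of "1 / 2" "1 - prob ?H" "?g x"] by auto
    also have "\<dots> = (\<integral>y. ?g x * indicator (space M - ?H) y \<partial>M)"
      using prob_compl[OF Hm] Hm by simp
    also have "\<dots> \<le> (\<integral>y. ?h (x(j := y)) \<partial>M)"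
    proof (rule integral_mono)
      fix y assume y: "y \<in> space M"
      show "?g x * indicator (space M - ?H) y \<le> ?h (x(j := y))"
      proof (cases "y \<in> ?H")
        case True
        then show ?thesis using orbit_sum_bounds(1)[where \<phi>=\<phi> and B=B, OF b iid_upd[OF x y s(2)]] by simp
      next
        case False
        then have nh: "j \<notin> orbit I (edges (x(j := y))) T s" using y by auto
        have eq: "orbit I (edges (x(j := y))) T s = orbit (I - {j}) (edges x) T s"
          using orbit_remove(1)[OF nh] orbit_upd[OF s(1) s(3), of x y T] by simp
        have sub: "orbit (I - {j}) (edges x) T s \<subseteq> I - {j}" by (rule orbit_subset) (use s in auto)
        have "?h (x(j := y)) = (\<Sum>w\<in>orbit (I - {j}) (edges x) T s. \<phi> ((x(j := y)) w))"
          by (subst orbit_sum_eq) (use eq sub in auto)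
        also have "\<dots> = (\<Sum>w\<in>orbit (I - {j}) (edges x) T s. \<phi> (x w))"
          by (rule sum.cong) (use sub in auto)
        also have "\<dots> = ?g x" by (rule orbit_sum_eq[symmetric]) (use sub in auto)
        finally show ?thesis using orbit_sum_bounds(1)[where \<phi>=\<phi> and B=B, OF b x, of "I - {j}" T s]
          by (simp add: indicator_def)
      qed
    qed (use hi[OF x] Hm in \<open>auto simp: integrable_indicator_iff emeasure_eq_measure intro!: integrable_mult_right\<close>)
    finally show "?g x / 2 \<le> (\<integral>y. ?h (x(j := y)) \<partial>M)" .
  qed
  also have "\<dots> = (\<integral>x. ?h x \<partial>iid I)"
    by (rule resample[symmetric, OF finite_I s(2) _ gb(2)]) measurable
  finally show ?thesis by simp
qed

text \<open>By \<open>orbits_meet\<close> a meeting falls under \<open>A0\<close> (the second start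
  is itself visited), \<open>A1\<close> (the second start is joined directly to the first walk),
  \<open>Bad\<close> (some pair is not nearly orthogonal) or \<open>A j\<close> (the fresh point
  \<open>j\<close> links \<open>w\<close> on the second walk to \<open>v\<close> on the first). For
  \<open>A j\<close> there are at most \<open>(T + 1)\<^sup>2\<close> pairs \<open>(w, v)\<close>,
  each contributing \<open>p * W j (x w)\<close>. The weights carry the dependence on the index of
  \<open>j\<close>: the sum over all \<open>j\<close> then costs \<open>K\<close> and not
  \<open>card I\<close>.\<close>

lemma prob_meet_le:
  fixes W :: "nat \<Rightarrow> 'a \<Rightarrow> real"
  assumes p: "\<And>l u. u \<in> space M \<Longrightarrow> \<P>(y in M. Rel l u y) \<le> p"
      "\<And>l u. u \<in> space M \<Longrightarrow> \<P>(y in M. Rel l y u) \<le> p"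
    and Tp: "(real T + 1) * p \<le> 1 / 2"
    and O: "Measurable.pred (M \<Otimes>\<^sub>M M) (\<lambda>(u, y). Orth u y)"
    and \<delta>: "\<P>(x in iid I. \<exists>k\<in>I. \<exists>l\<in>I. k \<noteq> l \<and> \<not> Orth (x k) (x l)) \<le> \<delta>"
    and W: "\<And>j. W j \<in> borel_measurable M" "\<And>j u. u \<in> space M \<Longrightarrow> 0 \<le> W j u \<and> W j u \<le> B"
      "\<And>u. u \<in> space M \<Longrightarrow> (\<Sum>j\<in>I. W j u) \<le> K"
    and pW: "\<And>u v j l. u \<in> space M \<Longrightarrow> v \<in> space M \<Longrightarrow> Orth u v \<Longrightarrow>
        \<P>(y in M. Rel j u y \<and> Rel l y v) \<le> p * W j u"
    and s: "s \<in> I" "s' \<in> I" "s \<noteq> s'"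
  shows "\<P>(x in iid I. orb T s x \<inter> orb T s' x \<noteq> {})
    \<le> \<P>(x in iid I. s' \<in> orb T s x) + (real T + 1) * p
      + 2 * (real T + 1)\<^sup>2 * p * K + \<delta>"
proof -
  interpret P: prob_space "iid I" by (rule prob_space_iid)
  obtain u0 where u0: "u0 \<in> space M" using not_empty by auto
  have p0: "0 \<le> p" using order_trans[OF measure_nonneg p(1)[OF u0]] .
  have Om [measurable]: "k \<in> I \<Longrightarrow> l \<in> I \<Longrightarrow> Measurable.pred (iid I) (\<lambda>x. Orth (x k) (x l))" for k l
  proof -
    assume "k \<in> I" "l \<in> I"
    then have "(\<lambda>x. (x k, x l)) \<in> iid I \<rightarrow>\<^sub>M M \<Otimes>\<^sub>M M"
      by (intro measurable_Pair measurable_component_singleton)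
    from measurable_compose[OF this O] show ?thesis by simp
  qed
  define A0 where "A0 = {x \<in> space (iid I). s' \<in> orb T s x}"
  define A1 where "A1 = {x \<in> space (iid I). \<exists>v \<in> orbit (I - {s'}) (edges x) T s. (s', v) \<in> edges x}"
  define Bad where "Bad = {x \<in> space (iid I). \<exists>k\<in>I. \<exists>l\<in>I. k \<noteq> l \<and> \<not> Orth (x k) (x l)}"
  define A where "A j = {x \<in> space (iid I). \<exists>w\<in>I. \<exists>v\<in>I. w \<noteq> v \<and> Orth (x w) (x v) \<and>
     w \<in> orbit (I - {j}) (edges x) T s' \<and> v \<in> orbit (I - {j}) (edges x) T s \<and> (w, j) \<in> edges x \<and> (j, v) \<in> edges x}" for j
  let ?J = "I - {s, s'}"
  have A0m: "A0 \<in> sets (iid I)" unfolding A0_def by measurable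
  have A1m: "A1 \<in> sets (iid I)" unfolding A1_def using edges_pred by (auto simp: pred_def)
  have Badm: "Bad \<in> sets (iid I)" unfolding Bad_def
  proof -
    have "Measurable.pred (iid I) (\<lambda>x. \<exists>k\<in>I. \<exists>l\<in>I. k \<noteq> l \<and> \<not> Orth (x k) (x l))"
      by (intro pred_intros_finite pred_intros_logic finite_I Om) auto
    then show "{x \<in> space (iid I). \<exists>k\<in>I. \<exists>l\<in>I. k \<noteq> l \<and> \<not> Orth (x k) (x l)} \<in> sets (iid I)"
      by (simp add: pred_def)
  qed
  have Am: "A j \<in> sets (iid I)" for j unfolding A_def
  proof -
    have "Measurable.pred (iid I) (\<lambda>x. \<exists>w\<in>I. \<exists>v\<in>I. w \<noteq> v \<and> Orth (x w) (x v) \<and>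
     w \<in> orbit (I - {j}) (edges x) T s' \<and> v \<in> orbit (I - {j}) (edges x) T s \<and> (w, j) \<in> edges x \<and> (j, v) \<in> edges x)"
      by (intro pred_intros_finite pred_intros_logic finite_I Om edges_pred) auto
    then show "{x \<in> space (iid I). \<exists>w\<in>I. \<exists>v\<in>I. w \<noteq> v \<and> Orth (x w) (x v) \<and>
     w \<in> orbit (I - {j}) (edges x) T s' \<and> v \<in> orbit (I - {j}) (edges x) T s \<and> (w, j) \<in> edges x \<and> (j, v) \<in> edges x} \<in> sets (iid I)"
      by (simp add: pred_def)
  qed
  have cover: "{x \<in> space (iid I). orb T s x \<inter> orb T s' x \<noteq> {}}
      \<subseteq> A0 \<union> A1 \<union> Bad \<union> (\<Union>j\<in>?J. A j)"
  proof
    fix x assume "x \<in> {x \<in> space (iid I). orb T s x \<inter> orb T s' x \<noteq> {}}"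
    then have x: "x \<in> space (iid I)" and meet: "orb T s x \<inter> orb T s' x \<noteq> {}" by auto
    show "x \<in> A0 \<union> A1 \<union> Bad \<union> (\<Union>j\<in>?J. A j)"
    proof (rule ccontr)
      assume "\<not> ?thesis"
      then have n: "s' \<notin> orb T s x" "x \<notin> A1" "x \<notin> Bad" "\<And>j. j \<in> ?J \<Longrightarrow> x \<notin> A j"
        using x by (auto simp: A0_def)
      have orth: "Orth (x k) (x l)" if "k \<in> I" "l \<in> I" "k \<noteq> l" for k l
        using n(3) x that by (auto simp: Bad_def)
      from increasing.orbits_meet[OF edges_increasing s(1,2) meet n(1)] n(2) x
      obtain j w v where j: "j \<in> ?J" "w \<in> orbit (I - {j}) (edges x) T s'" "v \<in> orbit (I - {j}) (edges x) T s"
        "w \<noteq> v" "(w, j) \<in> edges x" "(j, v) \<in> edges x"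
        unfolding A1_def by blast
      have "w \<in> I" "v \<in> I" using j by (auto simp: edges_def)
      then have "x \<in> A j" using j x orth[of w v] unfolding A_def by blast
      then show False using n(4)[OF j(1)] by simp
    qed
  qed
  have A1p: "P.prob A1 \<le> (real T + 1) * p"
  proof -
    have "P.prob A1 \<le> (\<integral>x. (real T + 1) * p \<partial>iid I)"
    proof (rule resample_prob_le[OF finite_I s(2) A1m])
      fix x assume x: "x \<in> space (iid I)"
      let ?V = "orbit (I - {s'}) (edges x) T s"
      have V: "?V \<subseteq> I - {s'}" by (rule orbit_subset) (use s in auto)
      have "\<P>(y in M. x(s' := y) \<in> A1) \<le> (\<Sum>v\<in>?V. \<P>(y in M. Rel v y (x v)))"
      proof (rule prob_UN_le)
        show "{y \<in> space M. x(s' := y) \<in> A1} \<subseteq> (\<Union>v\<in>?V. {y \<in> space M. Rel v y (x v)})"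
          using orbit_upd[OF s(1) s(3), of x _ T] V by (force simp: A1_def edges_def)
      qed (use V in \<open>auto intro!: Rel_sets2 space_iidD[OF x]\<close>)
      also have "\<dots> \<le> (\<Sum>v\<in>?V. p)"
        by (rule sum_mono) (use V in \<open>auto intro!: p(2) space_iidD[OF x]\<close>)
      also have "\<dots> \<le> (real T + 1) * p" by (rule sum_orbit_const_le[OF p0])
      finally show "\<P>(y in M. x(s' := y) \<in> A1) \<le> (real T + 1) * p" .
    qed auto
    then show ?thesis by (simp add: P.prob_space)
  qed
  define \<phi> where "\<phi> j u = (real T + 1) * (p * W j u)" for j u
  have \<phi>m: "\<phi> j \<in> borel_measurable M" for j unfolding \<phi>_def using W(1)[of j] by measurable
  have \<phi>b: "0 \<le> \<phi> j u \<and> \<phi> j u \<le> (real T + 1) * (p * B)" if "u \<in> space M" for j u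
    using W(2)[OF that, of j] p0 by (auto simp: \<phi>_def intro!: mult_left_mono mult_nonneg_nonneg)
  have Ap: "P.prob (A j) \<le> 2 * (\<integral>x. orbit_sum I T s' (\<phi> j) x \<partial>iid I)" if j: "j \<in> ?J" for j
  proof -
    have "P.prob (A j) \<le> (\<integral>x. orbit_sum (I - {j}) T s' (\<phi> j) x \<partial>iid I)"
    proof (rule resample_prob_le[OF finite_I _ Am])
      show "\<bar>orbit_sum (I - {j}) T s' (\<phi> j) x\<bar> \<le> real (card I) * ((real T + 1) * (p * B))" if "x \<in> space (iid I)" for x
        using orbit_sum_bounds[where \<phi>="\<phi> j", OF \<phi>b that, of "I - {j}" T s'] by auto
      fix x assume x: "x \<in> space (iid I)"
      let ?V' = "orbit (I - {j}) (edges x) T s'" and ?V = "orbit (I - {j}) (edges x) T s"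
      have V: "?V \<subseteq> I - {j}" "?V' \<subseteq> I - {j}" using j s by (auto intro!: orbit_subset del: subsetI)
      let ?S = "{(w, v) \<in> ?V' \<times> ?V. Orth (x w) (x v)}"
      have fS: "finite ?S" by (rule finite_subset[of _ "?V' \<times> ?V"]) auto
      have "\<P>(y in M. x(j := y) \<in> A j)
          \<le> (\<Sum>wv\<in>?S. \<P>(y in M. Rel j (x (fst wv)) y \<and> Rel (snd wv) y (x (snd wv))))"
      proof (rule prob_UN_le[OF fS])
        show "{y \<in> space M. x(j := y) \<in> A j}
            \<subseteq> (\<Union>wv\<in>?S. {y \<in> space M. Rel j (x (fst wv)) y \<and> Rel (snd wv) y (x (snd wv))})"
        proof safe
          fix y assume y: "y \<in> space M" "x(j := y) \<in> A j"
          then obtain w v where wv: "Orth ((x(j := y)) w) ((x(j := y)) v)"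
            "w \<in> orbit (I - {j}) (edges (x(j := y))) T s'" "v \<in> orbit (I - {j}) (edges (x(j := y))) T s"
            "(w, j) \<in> edges (x(j := y))" "(j, v) \<in> edges (x(j := y))" unfolding A_def by blast
          have *: "w \<in> ?V'" "v \<in> ?V" using wv(2,3) orbit_upd[of s j x y T] orbit_upd[of s' j x y T] j s by auto
          then have "w \<noteq> j" "v \<noteq> j" using V by auto
          then have "Orth (x w) (x v)" "Rel j (x w) y" "Rel v y (x v)" using wv by (auto simp: edges_def)
          then show "y \<in> (\<Union>wv\<in>?S. {y \<in> space M. Rel j (x (fst wv)) y \<and> Rel (snd wv) y (x (snd wv))})"
            using y * by (intro UN_I[of "(w, v)"]) auto
        qed
        fix wv assume "wv \<in> ?S"
        then have "x (fst wv) \<in> space M" "x (snd wv) \<in> space M" using V by (auto intro!: space_iidD[OF x])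
        then have "{y \<in> space M. Rel j (x (fst wv)) y} \<inter> {y \<in> space M. Rel (snd wv) y (x (snd wv))} \<in> sets M"
          by (intro sets.Int Rel_sets1 Rel_sets2)
        then show "{y \<in> space M. Rel j (x (fst wv)) y \<and> Rel (snd wv) y (x (snd wv))} \<in> sets M"
          by (simp add: Int_def conj_ac cong: conj_cong)
      qed
      also have "\<dots> \<le> (\<Sum>wv\<in>?S. p * W j (x (fst wv)))"
        by (rule sum_mono) (use V in \<open>auto intro!: pW space_iidD[OF x]\<close>)
      also have "\<dots> \<le> (\<Sum>wv\<in>?V' \<times> ?V. p * W j (x (fst wv)))"
        by (rule sum_mono2)
          (use V p0 W(2) in \<open>auto intro!: mult_nonneg_nonneg W(2)[THEN conjunct1] space_iidD[OF x]\<close>)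
      also have "\<dots> = (\<Sum>w\<in>?V'. \<Sum>v\<in>?V. p * W j (x w))" by (simp only: sum.cartesian_product case_prod_unfold)
      also have "\<dots> \<le> (\<Sum>w\<in>?V'. \<phi> j (x w))"
        unfolding \<phi>_def
        by (intro sum_mono sum_orbit_const_le mult_nonneg_nonneg p0 W(2)[THEN conjunct1] space_iidD[OF x])
          (use V in auto)
      also have "\<dots> = orbit_sum (I - {j}) T s' (\<phi> j) x" by (rule orbit_sum_eq[symmetric]) (use V in auto)
      finally show "\<P>(y in M. x(j := y) \<in> A j) \<le> orbit_sum (I - {j}) T s' (\<phi> j) x" .
    qed (use j \<phi>m in auto)
    \<comment> \<open>Undoing the deletion of \<open>j\<close> makes all the sums run over the same
      walk. Only then can the weights \<open>W j\<close> be summed over \<open>j\<close> at each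
      visited vertex.\<close>
    also have "\<dots> \<le> 2 * (\<integral>x. orbit_sum I T s' (\<phi> j) x \<partial>iid I)"
      by (rule decouple[OF p(1) Tp _ _ _ \<phi>m \<phi>b]) (use j s in auto)
    finally show ?thesis .
  qed
  have sumA: "(\<Sum>j\<in>?J. P.prob (A j)) \<le> 2 * (real T + 1)\<^sup>2 * p * K"
  proof -
    have oi: "integrable (iid I) (orbit_sum I T s' (\<phi> j))" for j
    proof (rule P.integrable_bounded)
      show "orbit_sum I T s' (\<phi> j) \<in> borel_measurable (iid I)" using \<phi>m by measurable
      show "\<bar>orbit_sum I T s' (\<phi> j) x\<bar> \<le> real (card I) * ((real T + 1) * (p * B))" if "x \<in> space (iid I)" for x
        using orbit_sum_bounds[where \<phi>="\<phi> j", OF \<phi>b that, of I T s'] by auto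
    qed
    have "(\<Sum>j\<in>?J. P.prob (A j)) \<le> (\<Sum>j\<in>?J. 2 * (\<integral>x. orbit_sum I T s' (\<phi> j) x \<partial>iid I))"
      by (rule sum_mono) (rule Ap)
    also have "\<dots> = 2 * (\<integral>x. (\<Sum>j\<in>?J. orbit_sum I T s' (\<phi> j) x) \<partial>iid I)"
      using oi by (simp add: sum_distrib_left)
    also have "(\<integral>x. (\<Sum>j\<in>?J. orbit_sum I T s' (\<phi> j) x) \<partial>iid I) \<le> (\<integral>x. (real T + 1)\<^sup>2 * p * K \<partial>iid I)"
    proof (rule integral_mono)
      fix x assume x: "x \<in> space (iid I)"
      let ?V = "orb T s' x"
      have V: "?V \<subseteq> I" by (rule orbit_subset[OF s(2)])
      have K0: "0 \<le> K" by (rule order_trans[OF _ W(3)[OF u0]]) (use W(2)[OF u0] in \<open>auto intro!: sum_nonneg\<close>)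
      have "(\<Sum>j\<in>?J. orbit_sum I T s' (\<phi> j) x) = (\<Sum>j\<in>?J. \<Sum>w\<in>?V. \<phi> j (x w))"
        by (intro sum.cong refl orbit_sum_eq V)
      also have "\<dots> = (\<Sum>w\<in>?V. (real T + 1) * (p * (\<Sum>j\<in>?J. W j (x w))))"
        by (subst sum.swap) (simp add: \<phi>_def sum_distrib_left)
      also have "\<dots> \<le> (\<Sum>w\<in>?V. (real T + 1) * (p * K))"
      proof (intro sum_mono mult_left_mono p0)
        fix w assume "w \<in> ?V"
        then have xw: "x w \<in> space M" using V space_iidD[OF x] by auto
        have "(\<Sum>j\<in>?J. W j (x w)) \<le> (\<Sum>j\<in>I. W j (x w))" by (rule sum_mono2) (use W(2)[OF xw] in auto)
        then show "(\<Sum>j\<in>?J. W j (x w)) \<le> K" using W(3)[OF xw] by simp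
      qed auto
      also have "\<dots> \<le> (real T + 1) * ((real T + 1) * (p * K))"
        by (rule sum_orbit_const_le) (use p0 K0 in auto)
      finally show "(\<Sum>j\<in>?J. orbit_sum I T s' (\<phi> j) x) \<le> (real T + 1)\<^sup>2 * p * K"
        by (simp add: power2_eq_square mult.assoc)
    qed (use oi in auto)
    finally show ?thesis by (simp add: P.prob_space mult.assoc)
  qed
  have "\<P>(x in iid I. orb T s x \<inter> orb T s' x \<noteq> {})
      \<le> P.prob (A0 \<union> A1 \<union> Bad \<union> (\<Union>j\<in>?J. A j))"
    by (rule P.finite_measure_mono[OF cover]) (use A0m A1m Badm Am in auto)
  also have "\<dots> \<le> P.prob (A0 \<union> A1 \<union> Bad) + P.prob (\<Union>j\<in>?J. A j)"
    by (rule measure_Un_le) (use A0m A1m Badm Am in auto)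
  also have "P.prob (A0 \<union> A1 \<union> Bad) \<le> P.prob (A0 \<union> A1) + P.prob Bad"
    by (rule measure_Un_le) (use A0m A1m Badm Am in auto)
  also have "P.prob (A0 \<union> A1) \<le> P.prob A0 + P.prob A1"
    by (rule measure_Un_le) (use A0m A1m Badm Am in auto)
  also have "P.prob (\<Union>j\<in>?J. A j) \<le> (\<Sum>j\<in>?J. P.prob (A j))"
    by (rule P.finite_measure_subadditive_finite) (use Am in auto)
  finally show ?thesis using A1p sumA \<delta> unfolding A0_def Bad_def by linarith
qed

end

lemma (in pair_prob_space) prob_pair_eq:
  assumes "A \<in> sets (M1 \<Otimes>\<^sub>M M2)"
  shows "measure (M1 \<Otimes>\<^sub>M M2) A = (\<integral>x. \<P>(y in M2. (x, y) \<in> A) \<partial>M1)"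
proof -
  have "measure (M1 \<Otimes>\<^sub>M M2) A = (\<integral>p. indicator A p \<partial>(M1 \<Otimes>\<^sub>M M2))" using assms by simp
  also have "\<dots> = (\<integral>x. (\<integral>y. indicator A (x, y) \<partial>M2) \<partial>M1)"
    by (rule integral_fst'[symmetric])
      (use assms in \<open>simp add: integrable_indicator_iff P.emeasure_eq_measure\<close>)
  also have "\<dots> = (\<integral>x. \<P>(y in M2. (x, y) \<in> A) \<partial>M1)"
  proof (rule Bochner_Integration.integral_cong[OF refl])
    fix x assume x: "x \<in> space M1"
    have "{y \<in> space M2. (x, y) \<in> A} = Pair x -` A"
      using sets.sets_into_space[OF assms] by (auto simp: space_pair_measure)
    then have m: "{y \<in> space M2. (x, y) \<in> A} \<in> sets M2" using sets_Pair1[OF assms] by simp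
    have "(\<integral>y. indicator A (x, y) \<partial>M2) = (\<integral>y. indicator {y \<in> space M2. (x, y) \<in> A} y \<partial>M2 :: real)"
      by (intro Bochner_Integration.integral_cong) (auto simp: indicator_def)
    then show "(\<integral>y. indicator A (x, y) \<partial>M2) = \<P>(y in M2. (x, y) \<in> A)" using m by simp
  qed
  finally show ?thesis .
qed

section \<open>Concentration of the number of successful starts\<close>

context walk_model
begin

text \<open>Tells whether the endpoint after \<open>T\<close> steps is marked. Writing it as a sum
  over possible endpoints gives joint measurability in the mark and the configuration.\<close>

definition hits :: "('a \<Rightarrow> bool) \<Rightarrow> nat \<Rightarrow> nat set \<Rightarrow> nat \<Rightarrow> (nat \<Rightarrow> 'a) \<Rightarrow> real" where
  "hits m T I' s x = (\<Sum>v\<in>I'. of_bool (traj I' (edges x) s T = v) * of_bool (m (x v)))"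

definition count :: "('a \<Rightarrow> bool) \<Rightarrow> nat \<Rightarrow> (nat \<Rightarrow> 'a) \<Rightarrow> real" where
  "count m T x = (\<Sum>s\<in>I. hits m T I s x)"

lemma hits_eq: "s \<in> I' \<Longrightarrow> I' \<subseteq> I \<Longrightarrow> hits m T I' s x = of_bool (m (x (traj I' (edges x) s T)))"
proof -
  assume a: "s \<in> I'" "I' \<subseteq> I"
  have "finite I'" using a finite_subset finite_I by blast
  then have "hits m T I' s x = (\<Sum>v\<in>I'. if v = traj I' (edges x) s T then of_bool (m (x v)) else 0)"
    unfolding hits_def by (intro sum.cong) auto
  also have "\<dots> = of_bool (m (x (traj I' (edges x) s T)))"
    using \<open>finite I'\<close> traj_mem[OF a(1)] by simp
  finally show ?thesis .
qed

lemma hits_measurable: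
  assumes m: "Measurable.pred (N \<Otimes>\<^sub>M M) (\<lambda>(b, u). m b u)" and I': "I' \<subseteq> I"
  shows "(\<lambda>(b, x). hits (m b) T I' s x) \<in> borel_measurable (N \<Otimes>\<^sub>M iid I)"
proof -
  have m': "Measurable.pred (N \<Otimes>\<^sub>M iid I) (\<lambda>p. m (fst p) (snd p v))" if "v \<in> I'" for v
  proof -
    have "v \<in> I" using that I' by auto
    then have "(\<lambda>p. snd p v) \<in> N \<Otimes>\<^sub>M iid I \<rightarrow>\<^sub>M M"
      by (intro measurable_compose[OF measurable_snd measurable_component_singleton])
    then have "(\<lambda>p. (fst p, snd p v)) \<in> N \<Otimes>\<^sub>M iid I \<rightarrow>\<^sub>M N \<Otimes>\<^sub>M M" by measurable
    from measurable_compose[OF this m] show ?thesis by simp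
  qed
  have t: "Measurable.pred (N \<Otimes>\<^sub>M iid I) (\<lambda>p. traj I' (edges (snd p)) s T = v)" for v
    by (rule measurable_compose[OF measurable_snd edges_pred])
  show ?thesis unfolding hits_def case_prod_unfold of_bool_def
    by (intro borel_measurable_sum borel_measurable_times measurable_If m' t borel_measurable_const pred_def[THEN iffD1])
qed

text \<open>Deleting point \<open>i\<close> changes the outcome only for starts whose walk visits
  \<open>i\<close>, so the square expands into pairs of starts whose walks share \<open>i\<close>.
  In each product one factor keeps its marks, to gain the marking probability when the mark is
  averaged, and the other is bounded by the indicator that its walk visits \<open>i\<close>.\<close>

lemma count_deviation:
  assumes i: "i \<in> I"
  shows "(count m T x - (\<Sum>s\<in>I - {i}. hits m T (I - {i}) s x))\<^sup>2
    \<le> (\<Sum>s\<in>I. \<Sum>s'\<in>I. of_bool (i \<in> orb T s x \<inter> orb T s' x)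
        * (hits m T I s x + of_bool (s \<noteq> i) * hits m T (I - {i}) s x))"
proof -
  define X where "X s = hits m T I s x" for s
  define X' where "X' s = of_bool (s \<noteq> i) * hits m T (I - {i}) s x" for s
  define D where "D s = X s - X' s" for s
  define q where "q s = (of_bool (i \<in> orb T s x) :: real)" for s
  have X01: "X s \<in> {0, 1}" "X' s \<in> {0, 1}" if "s \<in> I" for s
    using that hits_eq[of s I m T x] hits_eq[of s "I - {i}" m T x] by (auto simp: X_def X'_def)
  have D0: "D s = 0" if "s \<in> I" "i \<notin> orb T s x" for s
  proof -
    have "s \<noteq> i" using that by auto
    then show ?thesis
      using that orbit_remove(2)[OF that(2), of T] hits_eq[of s I m T x] hits_eq[of s "I - {i}" m T x]
      by (simp add: D_def X_def X'_def)
  qed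
  have D1: "\<bar>D s\<bar> \<le> q s * (X s + X' s)" "\<bar>D s\<bar> \<le> q s" if "s \<in> I" for s
    using X01[OF that] D0[OF that] by (auto simp: q_def D_def)
  have "(\<Sum>s\<in>I. X' s) = (\<Sum>s\<in>I - {i}. hits m T (I - {i}) s x)"
    using i by (subst sum.remove[of I i]) (auto simp: X'_def intro!: sum.cong)
  then have "count m T x - (\<Sum>s\<in>I - {i}. hits m T (I - {i}) s x) = (\<Sum>s\<in>I. D s)"
    by (simp add: count_def D_def X_def sum_subtractf)
  also have "(\<Sum>s\<in>I. D s)\<^sup>2 = (\<Sum>s\<in>I. \<Sum>s'\<in>I. D s * D s')"
    by (simp add: power2_eq_square sum_product)
  also have "\<dots> \<le> (\<Sum>s\<in>I. \<Sum>s'\<in>I. (q s * (X s + X' s)) * q s')"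
  proof (intro sum_mono)
    fix s s' assume s: "s \<in> I" "s' \<in> I"
    have "D s * D s' \<le> \<bar>D s\<bar> * \<bar>D s'\<bar>" by (metis abs_ge_self abs_mult)
    also have "\<dots> \<le> (q s * (X s + X' s)) * q s'"
      using D1(1)[OF s(1)] D1(2)[OF s(2)] by (intro mult_mono) auto
    finally show "D s * D s' \<le> (q s * (X s + X' s)) * q s'" .
  qed
  also have "\<dots> = (\<Sum>s\<in>I. \<Sum>s'\<in>I. of_bool (i \<in> orb T s x \<inter> orb T s' x) * (X s + X' s))"
    by (intro sum.cong) (auto simp: q_def)
  finally show ?thesis by (simp add: X_def X'_def)
qed

text \<open>Chebyshev is applied for fixed \<open>b\<close>, which calls for the conditional mean
  and not merely its average: hence the assumption \<open>const\<close>. By Fubini the mean is at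
  least half of \<open>card I * \<pi>l\<close>, so the threshold in the conclusion is at most half
  the mean. The variance comes from \<open>efron_stein\<close> with \<open>count_deviation\<close>;
  averaging it over \<open>b\<close> replaces each mark by \<open>\<pi>u\<close>, and two walks that
  meet share at most \<open>T + 1\<close> vertices.\<close>

theorem prob_count_less:
  fixes N :: "'b measure"
  assumes N: "prob_space N" and m: "Measurable.pred (N \<Otimes>\<^sub>M M) (\<lambda>(b, u). m b u)"
    and \<pi>u: "\<And>u. u \<in> space M \<Longrightarrow> \<P>(b in N. m b u) \<le> \<pi>u"
    and const: "AE b in N. (\<integral>x. count (m b) T x \<partial>iid I) = F"
    and \<pi>l: "0 < \<pi>l" "\<And>s. s \<in> I \<Longrightarrow> 1 / 2 \<le> measure (iid I)
        {x \<in> space (iid I). \<pi>l \<le> \<P>(b in N. m b (x (traj I (edges x) s T)))}"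
    and meet: "(\<Sum>s\<in>I. \<Sum>s'\<in>I. measure (iid I)
        {x \<in> space (iid I). orb T s x \<inter> orb T s' x \<noteq> {}}) \<le> C"
    and I: "I \<noteq> {}"
  shows "\<P>(p in N \<Otimes>\<^sub>M iid I. count (m (fst p)) T (snd p) < real (card I) * \<pi>l / 4)
    \<le> 32 * \<pi>u * (real T + 1) * C / (real (card I) * \<pi>l)\<^sup>2"
proof -
  interpret N: prob_space N by (rule N)
  interpret P: prob_space "iid I" by (rule prob_space_iid)
  interpret NP: pair_prob_space N "iid I" by unfold_locales
  define n where "n = real (card I)"
  have n0: "0 < n" using I by (simp add: n_def card_gt_0_iff)
  have hm: "(\<lambda>p. hits (m (fst p)) T I' s (snd p)) \<in> borel_measurable (N \<Otimes>\<^sub>M iid I)" if "I' \<subseteq> I" for I' s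
    using hits_measurable[OF m that, of T s] by (simp add: case_prod_unfold)
  have mb: "Measurable.pred N (\<lambda>b. m b u)" if "u \<in> space M" for u
    using measurable_compose[OF measurable_Pair2' m, of u] that by simp
  have hm1: "(\<lambda>x. hits (m b) T I' s x) \<in> borel_measurable (iid I)" if "I' \<subseteq> I" "b \<in> space N" for I' s b
    using measurable_compose[OF measurable_Pair1' hm[OF that(1)], of b s] that by simp
  have h01: "0 \<le> hits (m b) T I' s x \<and> hits (m b) T I' s x \<le> 1" if "I' \<subseteq> I" "s \<in> I'" for b I' s x
    using hits_eq[OF that(2) that(1)] by simp
  have hb: "(\<integral>b. hits (m b) T I' s x \<partial>N) = \<P>(b in N. m b (x (traj I' (edges x) s T)))"
    if "I' \<subseteq> I" "s \<in> I'" "x \<in> space (iid I)" for I' s x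
  proof -
    have "x (traj I' (edges x) s T) \<in> space M" using traj_mem[OF that(2)] that by (auto intro: space_iidD)
    from mb[OF this] have "{b \<in> space N. m b (x (traj I' (edges x) s T))} \<in> sets N" by (simp add: pred_def)
    then have "\<P>(b in N. m b (x (traj I' (edges x) s T)))
        = (\<integral>b. indicator {b \<in> space N. m b (x (traj I' (edges x) s T))} b \<partial>N)" by simp
    also have "\<dots> = (\<integral>b. hits (m b) T I' s x \<partial>N)"
      by (intro Bochner_Integration.integral_cong) (auto simp: hits_eq[OF that(2,1)] indicator_def)
    finally show ?thesis by simp
  qed
  text \<open>the mean\<close>
  have hi: "integrable (N \<Otimes>\<^sub>M iid I) (\<lambda>(b, x). hits (m b) T I' s x)" if "I' \<subseteq> I" "s \<in> I'" for I' s
    by (rule NP.P.integrable_bounded[of _ 1]) (use hits_measurable[OF m that(1)] h01[OF that] in auto)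
  have "n * \<pi>l / 2 = (\<Sum>s\<in>I. \<pi>l / 2)" by (simp add: n_def)
  also have "\<dots> \<le> (\<Sum>s\<in>I. \<integral>x. (\<integral>b. hits (m b) T I s x \<partial>N) \<partial>iid I)"
  proof (rule sum_mono)
    fix s assume s: "s \<in> I"
    let ?g = "\<lambda>x. \<integral>b. hits (m b) T I s x \<partial>N"
    have gm: "?g \<in> borel_measurable (iid I)"
      by (rule N.borel_measurable_lebesgue_integral)
        (use measurable_compose[OF measurable_pair_swap' hm[OF subset_refl, of s]] in \<open>simp add: case_prod_unfold\<close>)
    have gb: "0 \<le> ?g x \<and> ?g x \<le> 1" if "x \<in> space (iid I)" for x using hb[OF subset_refl s that] by simp
    let ?A = "{x \<in> space (iid I). \<pi>l \<le> ?g x}"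
    have Am: "?A \<in> sets (iid I)" using gm by measurable
    have "{x \<in> space (iid I). \<pi>l \<le> \<P>(b in N. m b (x (traj I (edges x) s T)))} = ?A"
      using hb[OF subset_refl s] by auto
    then have "\<pi>l / 2 \<le> \<pi>l * P.prob ?A" using \<pi>l(2)[OF s] \<pi>l(1) by simp
    also have "\<dots> = (\<integral>x. \<pi>l * indicator ?A x \<partial>iid I)" using Am by simp
    also have "\<dots> \<le> (\<integral>x. ?g x \<partial>iid I)"
    proof (rule integral_mono)
      show "integrable (iid I) (\<lambda>x. \<pi>l * indicator ?A x)"
        by (intro integrable_mult_right integrable_real_indicator Am) (simp add: P.emeasure_eq_measure)
      show "integrable (iid I) ?g" by (rule P.integrable_bounded[OF gm, of 1]) (use gb in auto)
    qed (use gb in \<open>auto simp: indicator_def\<close>)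
    finally show "\<pi>l / 2 \<le> (\<integral>x. ?g x \<partial>iid I)" .
  qed
  also have "\<dots> = (\<Sum>s\<in>I. \<integral>b. (\<integral>x. hits (m b) T I s x \<partial>iid I) \<partial>N)"
    by (intro sum.cong refl NP.Fubini_integral hi subset_refl)
  also have "\<dots> = (\<integral>b. (\<Sum>s\<in>I. \<integral>x. hits (m b) T I s x \<partial>iid I) \<partial>N)"
    by (rule Bochner_Integration.integral_sum[symmetric]) (rule NP.integrable_fst[OF hi], auto)
  also have "\<dots> = (\<integral>b. (\<integral>x. count (m b) T x \<partial>iid I) \<partial>N)"
  proof (rule Bochner_Integration.integral_cong[OF refl])
    fix b assume b: "b \<in> space N"
    show "(\<Sum>s\<in>I. \<integral>x. hits (m b) T I s x \<partial>iid I) = (\<integral>x. count (m b) T x \<partial>iid I)"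
      unfolding count_def
      by (rule Bochner_Integration.integral_sum[symmetric], rule P.integrable_bounded[of _ 1])
        (use hm1[OF subset_refl b] h01[OF subset_refl] in auto)
  qed
  also have "\<dots> = (\<integral>b. F \<partial>N)"
  proof (rule integral_cong_AE)
    show "(\<lambda>b. \<integral>x. count (m b) T x \<partial>iid I) \<in> borel_measurable N"
      by (rule P.borel_measurable_lebesgue_integral)
        (use hm in \<open>auto simp: count_def case_prod_unfold\<close>)
  qed (use const in auto)
  also have "\<dots> = F" by (simp add: N.prob_space)
  finally have Fl: "n * \<pi>l / 2 \<le> F" .
  have F0: "0 < F" using Fl n0 \<pi>l(1) by (meson half_gt_zero less_le_trans mult_pos_pos)
  define D where "D i s s' b x = of_bool (i \<in> orb T s x \<inter> orb T s' x)
      * (hits (m b) T I s x + of_bool (s \<noteq> i) * hits (m b) T (I - {i}) s x)" for i s s' b x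
  define Tot where "Tot b x = (\<Sum>i\<in>I. \<Sum>s\<in>I. \<Sum>s'\<in>I. D i s s' b x)" for b x
  have Dm: "(\<lambda>p. D i s s' (fst p) (snd p)) \<in> borel_measurable (N \<Otimes>\<^sub>M iid I)" for i s s'
  proof -
    have t: "Measurable.pred (N \<Otimes>\<^sub>M iid I) (\<lambda>p. i \<in> orbit I (edges (snd p)) T s \<inter> orbit I (edges (snd p)) T s')"
      by (rule measurable_compose[OF measurable_snd edges_pred])
    show ?thesis unfolding D_def of_bool_def[of "i \<in> _"]
      by (intro borel_measurable_times borel_measurable_add measurable_If t[unfolded pred_def] borel_measurable_const hm) auto
  qed
  have D01: "0 \<le> D i s s' b x \<and> D i s s' b x \<le> 2" if "i \<in> I" "s \<in> I" "s' \<in> I" for i s s' b x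
    using h01[OF subset_refl that(2), of b x] h01[of "I - {i}" s b x] that by (cases "s = i") (auto simp: D_def)
  have Totm: "(\<lambda>(b, x). Tot b x) \<in> borel_measurable (N \<Otimes>\<^sub>M iid I)"
    unfolding Tot_def case_prod_unfold by (intro borel_measurable_sum Dm)
  have Tot0: "0 \<le> Tot b x" for b x unfolding Tot_def by (intro sum_nonneg) (use D01 in auto)
  have TotB: "\<bar>Tot b x\<bar> \<le> 2 * n ^ 3" for b x
  proof -
    have "Tot b x \<le> (\<Sum>i\<in>I. \<Sum>s\<in>I. \<Sum>s'\<in>I. 2)" unfolding Tot_def by (intro sum_mono) (use D01 in auto)
    also have "\<dots> = 2 * n ^ 3" by (simp add: n_def power3_eq_cube)
    finally show ?thesis using Tot0[of b x] by simp
  qed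
  have Toti: "integrable (N \<Otimes>\<^sub>M iid I) (\<lambda>(b, x). Tot b x)"
    by (rule NP.P.integrable_bounded[OF Totm, of "2 * n ^ 3"]) (use TotB in auto)
  have cm: "(\<lambda>x. count (m b) T x) \<in> borel_measurable (iid I)" if "b \<in> space N" for b
    unfolding count_def by (intro borel_measurable_sum hm1 subset_refl that)
  have cB: "\<bar>count (m b) T x\<bar> \<le> n" for b x
  proof -
    have "count (m b) T x \<le> (\<Sum>s\<in>I. 1)" unfolding count_def by (intro sum_mono) (use h01 in auto)
    moreover have "0 \<le> count (m b) T x" unfolding count_def by (intro sum_nonneg) (use h01 in auto)
    ultimately show ?thesis by (simp add: n_def)
  qed
  have var: "(\<integral>x. (count (m b) T x)\<^sup>2 \<partial>iid I) - (\<integral>x. count (m b) T x \<partial>iid I)\<^sup>2 \<le> (\<integral>x. Tot b x \<partial>iid I)"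
    if b: "b \<in> space N" for b
  proof -
    define g where "g i x = (\<Sum>s\<in>I - {i}. hits (m b) T (I - {i}) s x)" for i x
    have gm: "g i \<in> borel_measurable (iid I)" for i unfolding g_def by (intro borel_measurable_sum hm1 b) auto
    have gB: "\<bar>g i x\<bar> \<le> n" for i x
    proof -
      have "g i x \<le> (\<Sum>s\<in>I - {i}. 1)" unfolding g_def by (intro sum_mono) (use h01 in auto)
      also have "\<dots> \<le> (\<Sum>s\<in>I. 1)" by (rule sum_mono2) auto
      finally have "g i x \<le> n" by (simp add: n_def)
      moreover have "0 \<le> g i x" unfolding g_def by (intro sum_nonneg) (use h01 in auto)
      ultimately show ?thesis by simp
    qed
    have gu: "g i (x(i := y)) = g i x" for i x y
      unfolding g_def
    proof (rule sum.cong[OF refl])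
      fix s assume s: "s \<in> I - {i}"
      have "traj (I - {i}) (edges (x(i := y))) s T = traj (I - {i}) (edges x) s T" by (rule traj_upd) (use s in auto)
      moreover have "traj (I - {i}) (edges x) s T \<noteq> i" using traj_mem[OF s, of "edges x" T] by auto
      ultimately show "hits (m b) T (I - {i}) s (x(i := y)) = hits (m b) T (I - {i}) s x"
        using s by (simp add: hits_eq)
    qed
    have Dm1: "(\<lambda>x. D i s s' b x) \<in> borel_measurable (iid I)" for i s s'
      using measurable_compose[OF measurable_Pair1'[OF b] Dm] by simp
    have Di: "integrable (iid I) (\<lambda>x. D i s s' b x)" if "i \<in> I" "s \<in> I" "s' \<in> I" for i s s'
      by (rule P.integrable_bounded[where B=2, OF Dm1]) (use D01[OF that] in auto)
    have "(\<integral>x. (count (m b) T x)\<^sup>2 \<partial>iid I) - (\<integral>x. count (m b) T x \<partial>iid I)\<^sup>2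
        \<le> (\<Sum>i\<in>I. \<integral>x. (count (m b) T x - g i x)\<^sup>2 \<partial>iid I)"
      by (rule efron_stein[OF finite_I cm[OF b] cB gm gB gu])
    also have "\<dots> \<le> (\<Sum>i\<in>I. \<integral>x. (\<Sum>s\<in>I. \<Sum>s'\<in>I. D i s s' b x) \<partial>iid I)"
    proof (intro sum_mono integral_mono)
      fix i assume i: "i \<in> I"
      show "integrable (iid I) (\<lambda>x. (count (m b) T x - g i x)\<^sup>2)"
      proof (rule P.integrable_bounded[of _ "(2 * n)\<^sup>2"])
        show "(\<lambda>x. (count (m b) T x - g i x)\<^sup>2) \<in> borel_measurable (iid I)"
          using cm[OF b] gm[of i] by measurable
        show "\<bar>(count (m b) T x - g i x)\<^sup>2\<bar> \<le> (2 * n)\<^sup>2" for x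
        proof -
          have "\<bar>count (m b) T x - g i x\<bar> \<le> 2 * n" using cB[of b x] gB[of i x] by linarith
          from power_mono[OF this, of 2] show ?thesis by simp
        qed
      qed
      show "integrable (iid I) (\<lambda>x. \<Sum>s\<in>I. \<Sum>s'\<in>I. D i s s' b x)"
        by (intro Bochner_Integration.integrable_sum Di i)
      show "(count (m b) T x - g i x)\<^sup>2 \<le> (\<Sum>s\<in>I. \<Sum>s'\<in>I. D i s s' b x)" for x
        unfolding g_def D_def by (rule count_deviation[OF i])
    qed
    also have "\<dots> = (\<integral>x. Tot b x \<partial>iid I)"
      unfolding Tot_def
      by (rule Bochner_Integration.integral_sum[symmetric]) (intro Bochner_Integration.integrable_sum Di)
    finally show ?thesis .
  qed
  define S where "S = {p \<in> space (N \<Otimes>\<^sub>M iid I). count (m (fst p)) T (snd p) < n * \<pi>l / 4}"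
  have Sm: "S \<in> sets (N \<Otimes>\<^sub>M iid I)"
  proof -
    have "(\<lambda>p. count (m (fst p)) T (snd p)) \<in> borel_measurable (N \<Otimes>\<^sub>M iid I)"
      unfolding count_def by (intro borel_measurable_sum hm subset_refl)
    then show ?thesis unfolding S_def by measurable
  qed
  have cheb: "\<P>(x in iid I. (b, x) \<in> S) \<le> 4 / F\<^sup>2 * (\<integral>x. Tot b x \<partial>iid I)"
    if b: "b \<in> space N" and c: "(\<integral>x. count (m b) T x \<partial>iid I) = F" for b
  proof -
    note cmb = cm[OF b]
    have i1: "integrable (iid I) (count (m b) T)" by (rule P.integrable_bounded[OF cmb cB])
    have i2: "integrable (iid I) (\<lambda>x. (count (m b) T x)\<^sup>2)"
    proof (rule P.integrable_bounded[of _ "n\<^sup>2"])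
      show "\<bar>(count (m b) T x)\<^sup>2\<bar> \<le> n\<^sup>2" for x using power_mono[OF cB[of b x], of 2] by simp
    qed (use cmb in measurable)
    have "\<P>(x in iid I. (b, x) \<in> S)
        \<le> \<P>(x in iid I. F / 2 \<le> \<bar>count (m b) T x - F\<bar>)"
    proof (rule P.finite_measure_mono)
      show "{x \<in> space (iid I). (b, x) \<in> S} \<subseteq> {x \<in> space (iid I). F / 2 \<le> \<bar>count (m b) T x - F\<bar>}"
        using Fl F0 by (auto simp: S_def abs_if)
      show "{x \<in> space (iid I). F / 2 \<le> \<bar>count (m b) T x - F\<bar>} \<in> sets (iid I)" using cmb by measurable
    qed
    also have "\<dots> \<le> P.variance (count (m b) T) / (F / 2)\<^sup>2"
      using P.Chebyshev_inequality[OF cmb i2, of "F / 2"] F0 c by simp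
    also have "P.variance (count (m b) T) \<le> (\<integral>x. Tot b x \<partial>iid I)"
      using var[OF b] P.variance_eq[OF i1 i2] by simp
    also have "(\<integral>x. Tot b x \<partial>iid I) / (F / 2)\<^sup>2 = 4 / F\<^sup>2 * (\<integral>x. Tot b x \<partial>iid I)"
      by (simp add: power2_eq_square)
    finally show ?thesis by (simp add: divide_right_mono)
  qed
  have "measure (N \<Otimes>\<^sub>M iid I) S = (\<integral>b. \<P>(x in iid I. (b, x) \<in> S) \<partial>N)"
    by (rule NP.prob_pair_eq[OF Sm])
  also have "\<dots> \<le> (\<integral>b. 4 / F\<^sup>2 * (\<integral>x. Tot b x \<partial>iid I) \<partial>N)"
  proof (rule integral_mono_AE)
    show "integrable N (\<lambda>b. 4 / F\<^sup>2 * (\<integral>x. Tot b x \<partial>iid I))"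
      using NP.integrable_fst[OF Toti] by simp
    show "integrable N (\<lambda>b. \<P>(x in iid I. (b, x) \<in> S))"
    proof (rule N.integrable_bounded[of _ 1])
      have eq: "{x \<in> space (iid I). (b, x) \<in> S} = Pair b -` S" for b
        using sets.sets_into_space[OF Sm] by (auto simp: space_pair_measure)
      show "(\<lambda>b. \<P>(x in iid I. (b, x) \<in> S)) \<in> borel_measurable N"
        unfolding eq measure_def using P.measurable_emeasure_Pair[OF Sm] by measurable
    qed auto
    show "AE b in N. \<P>(x in iid I. (b, x) \<in> S) \<le> 4 / F\<^sup>2 * (\<integral>x. Tot b x \<partial>iid I)"
      using const AE_space by eventually_elim (rule cheb)
  qed
  also have "\<dots> = 4 / F\<^sup>2 * (\<integral>x. (\<integral>b. Tot b x \<partial>N) \<partial>iid I)"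
    using NP.Fubini_integral[OF Toti] by simp
  also have "(\<integral>x. (\<integral>b. Tot b x \<partial>N) \<partial>iid I) \<le> 2 * \<pi>u * (real T + 1) * C"
  proof -
    define Q where "Q s s' = {x \<in> space (iid I). orb T s x \<inter> orb T s' x \<noteq> {}}" for s s'
    have Qm: "Q s s' \<in> sets (iid I)" for s s' unfolding Q_def using edges_pred by (auto simp: pred_def)
    obtain u0 where "u0 \<in> space M" using not_empty by auto
    then have \<pi>u0: "0 \<le> \<pi>u" using order_trans[OF measure_nonneg \<pi>u] by blast
    have Qi: "integrable (iid I) (\<lambda>x. indicator (Q s s') x :: real)" for s s'
      by (intro integrable_real_indicator Qm) (simp add: P.emeasure_eq_measure)
    have "(\<integral>x. (\<integral>b. Tot b x \<partial>N) \<partial>iid I)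
        \<le> (\<integral>x. (\<Sum>s\<in>I. \<Sum>s'\<in>I. 2 * \<pi>u * (real T + 1) * indicator (Q s s') x) \<partial>iid I)"
    proof (rule integral_mono)
      show "integrable (iid I) (\<lambda>x. \<integral>b. Tot b x \<partial>N)" using NP.integrable_snd[OF Toti] .
      show "integrable (iid I) (\<lambda>x. \<Sum>s\<in>I. \<Sum>s'\<in>I. 2 * \<pi>u * (real T + 1) * indicator (Q s s') x)"
        by (intro Bochner_Integration.integrable_sum integrable_mult_right Qi)
      fix x assume x: "x \<in> space (iid I)"
      have hi1: "integrable N (\<lambda>b. hits (m b) T I' s x)" if "I' \<subseteq> I" "s \<in> I'" for I' s
      proof (rule N.integrable_bounded[of _ 1])
        show "(\<lambda>b. hits (m b) T I' s x) \<in> borel_measurable N"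
          using measurable_compose[OF measurable_Pair2'[OF x] hm[OF that(1)], of s] by simp
      qed (use h01[OF that] in auto)
      have hle: "(\<integral>b. hits (m b) T I' s x \<partial>N) \<le> \<pi>u" if "I' \<subseteq> I" "s \<in> I'" for I' s
        unfolding hb[OF that x]
        by (rule \<pi>u) (use traj_mem[OF that(2)] that x in \<open>auto intro: space_iidD\<close>)
      have Dle: "integrable N (\<lambda>b. D i s s' b x)"
          "(\<integral>b. D i s s' b x \<partial>N) \<le> 2 * \<pi>u * of_bool (i \<in> orb T s x \<inter> orb T s' x)"
        if "i \<in> I" "s \<in> I" "s' \<in> I" for i s s'
      proof -
        have "integrable N (\<lambda>b. D i s s' b x) \<and>
            (\<integral>b. D i s s' b x \<partial>N) \<le> 2 * \<pi>u * of_bool (i \<in> orb T s x \<inter> orb T s' x)"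
        proof (cases "s = i")
          case True
          then show ?thesis using hi1[OF subset_refl that(2)] hle[OF subset_refl that(2)] \<pi>u0 by (simp add: D_def)
        next
          case False
          then have "s \<in> I - {i}" using that by auto
          then show ?thesis using False hi1[OF subset_refl that(2)] hle[OF subset_refl that(2)]
              hi1[of "I - {i}" s] hle[of "I - {i}" s] by (auto simp: D_def)
        qed
        then show "integrable N (\<lambda>b. D i s s' b x)"
          "(\<integral>b. D i s s' b x \<partial>N) \<le> 2 * \<pi>u * of_bool (i \<in> orb T s x \<inter> orb T s' x)" by auto
      qed
      have "(\<integral>b. Tot b x \<partial>N) = (\<Sum>i\<in>I. \<Sum>s\<in>I. \<Sum>s'\<in>I. \<integral>b. D i s s' b x \<partial>N)"
        unfolding Tot_def by (simp add: Dle(1) Bochner_Integration.integrable_sum)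
      also have "\<dots> \<le> (\<Sum>i\<in>I. \<Sum>s\<in>I. \<Sum>s'\<in>I. 2 * \<pi>u * of_bool (i \<in> orb T s x \<inter> orb T s' x))"
        by (intro sum_mono Dle(2))
      also have "\<dots> = (\<Sum>s\<in>I. \<Sum>i\<in>I. \<Sum>s'\<in>I. 2 * \<pi>u * of_bool (i \<in> orb T s x \<inter> orb T s' x))"
        by (rule sum.swap)
      also have "\<dots> = (\<Sum>s\<in>I. \<Sum>s'\<in>I. \<Sum>i\<in>I. 2 * \<pi>u * of_bool (i \<in> orb T s x \<inter> orb T s' x))"
        by (rule sum.cong[OF refl]) (rule sum.swap)
      also have "\<dots> \<le> (\<Sum>s\<in>I. \<Sum>s'\<in>I. 2 * \<pi>u * (real T + 1) * indicator (Q s s') x)"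
      proof (intro sum_mono)
        fix s s' assume s: "s \<in> I" "s' \<in> I"
        let ?X = "orb T s x \<inter> orb T s' x"
        have X: "?X \<subseteq> I" using orbit_subset[OF s(1), of "edges x" T] by blast
        have "(\<Sum>i\<in>I. 2 * \<pi>u * of_bool (i \<in> ?X)) = 2 * \<pi>u * (\<Sum>i\<in>I. of_bool (i \<in> ?X))"
          by (simp only: sum_distrib_left)
        also have "(\<Sum>i\<in>I. of_bool (i \<in> ?X)) = (\<Sum>i\<in>I. if i \<in> ?X then 1 else (0::real))"
          by (intro sum.cong) auto
        also have "\<dots> = real (card (I \<inter> ?X))" by (subst sum.inter_restrict[symmetric]) auto
        also have "I \<inter> ?X = ?X" using X by blast
        also have "2 * \<pi>u * real (card ?X) \<le> 2 * \<pi>u * ((real T + 1) * indicator (Q s s') x)"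
        proof (cases "?X = {}")
          case True
          then show ?thesis using \<pi>u0 by simp
        next
          case False
          then have "x \<in> Q s s'" using x by (auto simp: Q_def)
          moreover have "card ?X \<le> card (orb T s x)" by (rule card_mono) auto
          then have "real (card ?X) \<le> real T + 1" using card_orbit[of I "edges x" T s] by linarith
          ultimately show ?thesis using \<pi>u0 by (simp add: mult_left_mono)
        qed
        finally show "(\<Sum>i\<in>I. 2 * \<pi>u * of_bool (i \<in> ?X)) \<le> 2 * \<pi>u * (real T + 1) * indicator (Q s s') x"
          by (simp add: mult.assoc)
      qed
      finally show "(\<integral>b. Tot b x \<partial>N) \<le> (\<Sum>s\<in>I. \<Sum>s'\<in>I. 2 * \<pi>u * (real T + 1) * indicator (Q s s') x)" .
    qed
    also have "\<dots> = (\<Sum>s\<in>I. \<Sum>s'\<in>I. 2 * \<pi>u * (real T + 1) * P.prob (Q s s'))"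
    proof -
      have "(\<integral>x. 2 * \<pi>u * (real T + 1) * indicator (Q s s') x \<partial>iid I) = 2 * \<pi>u * (real T + 1) * P.prob (Q s s')" for s s'
        using Qm[of s s'] by simp
      then show ?thesis
        by (subst Bochner_Integration.integral_sum Bochner_Integration.integrable_sum,
            intro Bochner_Integration.integrable_sum integrable_mult_right Qi)
          (intro sum.cong refl, subst Bochner_Integration.integral_sum,
            intro integrable_mult_right Qi, simp only:)
    qed
    also have "\<dots> = 2 * \<pi>u * (real T + 1) * (\<Sum>s\<in>I. \<Sum>s'\<in>I. P.prob (Q s s'))"
      by (simp add: sum_distrib_left)
    also have "\<dots> \<le> 2 * \<pi>u * (real T + 1) * C"
      by (rule mult_left_mono) (use meet \<pi>u0 in \<open>auto simp: Q_def\<close>)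
    finally show ?thesis .
  qed
  finally have fin: "measure (N \<Otimes>\<^sub>M iid I) S \<le> 4 / F\<^sup>2 * (2 * \<pi>u * (real T + 1) * C)"
    by (simp add: mult_left_mono divide_right_mono)
  obtain u0 where "u0 \<in> space M" using not_empty by auto
  then have \<pi>u0: "0 \<le> \<pi>u" using order_trans[OF measure_nonneg \<pi>u] by blast
  have C0: "0 \<le> C" by (rule order_trans[OF _ meet]) (intro sum_nonneg measure_nonneg)
  have "4 / F\<^sup>2 \<le> 4 / (n * \<pi>l / 2)\<^sup>2"
    by (rule divide_left_mono) (use Fl F0 n0 \<pi>l(1) in \<open>auto intro!: power_mono mult_pos_pos\<close>)
  then have "4 / F\<^sup>2 * (2 * \<pi>u * (real T + 1) * C) \<le> 4 / (n * \<pi>l / 2)\<^sup>2 * (2 * \<pi>u * (real T + 1) * C)"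
    by (rule mult_right_mono) (use \<pi>u0 C0 in auto)
  also have "\<dots> = 32 * \<pi>u * (real T + 1) * C / (n * \<pi>l)\<^sup>2"
    using n0 \<pi>l(1) by (simp add: field_simps power2_eq_square)
  finally show ?thesis using fin by (simp add: S_def n_def)
qed

end

subsection \<open>Gaussian vectors\<close>

abbreviation std_normal :: "real measure" where
  "std_normal \<equiv> density lborel std_normal_density"

lemma prob_space_std_normal: "prob_space std_normal"
  by (rule prob_space_normal_density) simp

lemma nn_integral_std_normal:
  "f \<in> borel_measurable borel \<Longrightarrow> (\<integral>\<^sup>+x. f x \<partial>std_normal) = (\<integral>\<^sup>+x. ennreal (std_normal_density x) * f x \<partial>lborel)"
  by (subst nn_integral_density) auto

lemma std_normal_shift:
  assumes [measurable]: "f \<in> borel_measurable borel"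
  shows "(\<integral>\<^sup>+x. f x \<partial>std_normal) = (\<integral>\<^sup>+x. f (x + w) * ennreal (exp (- (x * w) - w\<^sup>2 / 2)) \<partial>std_normal)"
proof -
  have "(\<integral>\<^sup>+x. f x \<partial>std_normal) = (\<integral>\<^sup>+x. ennreal (std_normal_density (w + 1 * x)) * f (w + 1 * x) \<partial>lborel)"
    by (subst nn_integral_std_normal, simp, subst nn_integral_real_affine[where c=1 and t=w]) auto
  also have "\<dots> = (\<integral>\<^sup>+x. ennreal (std_normal_density x) * (f (x + w) * ennreal (exp (- (x * w) - w\<^sup>2 / 2))) \<partial>lborel)"
  proof (rule nn_integral_cong)
    fix x
    have "std_normal_density (w + x) = std_normal_density x * exp (- (x * w) - w\<^sup>2 / 2)"
      by (simp add: std_normal_density_def mult_exp_exp power2_eq_square field_simps)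
    then show "ennreal (std_normal_density (w + 1 * x)) * f (w + 1 * x)
        = ennreal (std_normal_density x) * (f (x + w) * ennreal (exp (- (x * w) - w\<^sup>2 / 2)))"
      by (simp add: ennreal_mult mult_ac add.commute)
  qed
  also have "\<dots> = (\<integral>\<^sup>+x. f (x + w) * ennreal (exp (- (x * w) - w\<^sup>2 / 2)) \<partial>std_normal)"
    by (subst nn_integral_std_normal) auto
  finally show ?thesis .
qed

lemma product_std_normal: "product_prob_space (\<lambda>_::'i. std_normal)"
  by (rule product_prob_spaceI) (rule prob_space_std_normal)

lemma shift_measurable: "(\<lambda>x. \<lambda>i\<in>A. x i + w i) \<in> PiM A (\<lambda>_. std_normal) \<rightarrow>\<^sub>M PiM A (\<lambda>_. std_normal)"
proof (rule measurable_restrict)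
  fix i assume "i \<in> A"
  then have "(\<lambda>x. x i) \<in> PiM A (\<lambda>_. std_normal) \<rightarrow>\<^sub>M std_normal" by (rule measurable_component_singleton)
  moreover have "(\<lambda>t. t + w i) \<in> std_normal \<rightarrow>\<^sub>M std_normal" by simp
  ultimately show "(\<lambda>x. x i + w i) \<in> PiM A (\<lambda>_. std_normal) \<rightarrow>\<^sub>M std_normal"
    by (rule measurable_compose)
qed

text \<open>The one-dimensional density ratios of a translation multiply. Translating into a rare
  event gives lower bounds on its probability, and bounding the exponential weight gives upper
  bounds.\<close>

theorem cameron_martin:
  fixes w :: "'i \<Rightarrow> real"
  assumes "finite A" "f \<in> borel_measurable (PiM A (\<lambda>_. std_normal))"
  shows "(\<integral>\<^sup>+x. f x \<partial>PiM A (\<lambda>_. std_normal))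
    = (\<integral>\<^sup>+x. f (\<lambda>i\<in>A. x i + w i) * ennreal (exp (- (\<Sum>i\<in>A. x i * w i) - (\<Sum>i\<in>A. (w i)\<^sup>2) / 2)) \<partial>PiM A (\<lambda>_. std_normal))"
  using assms
proof (induction A arbitrary: f rule: finite_induct)
  case empty
  interpret product_prob_space "\<lambda>_::'i. std_normal" by (rule product_std_normal)
  have "emeasure (PiM {} (\<lambda>_::'i. std_normal)) (space (PiM {} (\<lambda>_::'i. std_normal))) = 1"
    by (intro prob_space.emeasure_space_1 prob_space_PiM prob_space_std_normal)
  then show ?case by (simp add: nn_integral_empty restrict_def)
next
  case (insert i A)
  interpret product_prob_space "\<lambda>_::'i. std_normal" by (rule product_std_normal)
  let ?P = "PiM A (\<lambda>_. std_normal)"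
  let ?e = "\<lambda>t v. ennreal (exp (- (t * v) - v\<^sup>2 / 2))"
  let ?E = "\<lambda>x. ennreal (exp (- (\<Sum>i\<in>A. x i * w i) - (\<Sum>i\<in>A. (w i)\<^sup>2) / 2))"
  note f = insert.prems
  have am: "(\<lambda>(x, y). x(i := y)) \<in> ?P \<Otimes>\<^sub>M std_normal \<rightarrow>\<^sub>M PiM (insert i A) (\<lambda>_. std_normal)"
    by (rule measurable_add_dim)
  have f1: "(\<lambda>y. f (x(i := y))) \<in> borel_measurable borel" if "x \<in> space ?P" for x
    using measurable_compose[OF measurable_compose[OF measurable_Pair1'[OF that] am] f] by (simp add: fun_upd_def)
  have f2: "(\<lambda>p. f ((fst p)(i := snd p + w i))) \<in> borel_measurable (?P \<Otimes>\<^sub>M std_normal)"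
  proof -
    have "(\<lambda>p. (fst p, snd p + w i)) \<in> ?P \<Otimes>\<^sub>M std_normal \<rightarrow>\<^sub>M ?P \<Otimes>\<^sub>M std_normal" by measurable
    from measurable_compose[OF measurable_compose[OF this am] f] show ?thesis by (simp add: fun_upd_def)
  qed
  have gm: "(\<lambda>x. \<integral>\<^sup>+y. f (x(i := y + w i)) * ?e y (w i) \<partial>std_normal) \<in> borel_measurable ?P"
    by (rule M.borel_measurable_nn_integral) (use f2 in \<open>simp add: case_prod_unfold\<close>)
  have fm': "(\<lambda>x. f (\<lambda>j\<in>insert i A. x j + w j)) \<in> borel_measurable (PiM (insert i A) (\<lambda>_. std_normal))"
    by (rule measurable_compose[OF shift_measurable f])
  have "(\<integral>\<^sup>+x. f x \<partial>PiM (insert i A) (\<lambda>_. std_normal)) = (\<integral>\<^sup>+x. \<integral>\<^sup>+y. f (x(i := y)) \<partial>std_normal \<partial>?P)"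
    by (rule product_nn_integral_insert) (use insert in auto)
  also have "\<dots> = (\<integral>\<^sup>+x. \<integral>\<^sup>+y. f (x(i := y + w i)) * ?e y (w i) \<partial>std_normal \<partial>?P)"
    by (intro nn_integral_cong std_normal_shift f1)
  also have "\<dots> = (\<integral>\<^sup>+x. (\<integral>\<^sup>+y. f ((\<lambda>j\<in>A. x j + w j)(i := y + w i)) * ?e y (w i) \<partial>std_normal) * ?E x \<partial>?P)"
    by (rule insert.IH[OF gm])
  also have "\<dots> = (\<integral>\<^sup>+x. \<integral>\<^sup>+y. f (\<lambda>j\<in>insert i A. (x(i := y)) j + w j) * ennreal (exp (- (\<Sum>j\<in>insert i A. (x(i := y)) j * w j)
      - (\<Sum>j\<in>insert i A. (w j)\<^sup>2) / 2)) \<partial>std_normal \<partial>?P)"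
  proof (rule nn_integral_cong)
    fix x assume x: "x \<in> space ?P"
    have s: "(\<lambda>j\<in>A. x j + w j)(i := y + w i) = (\<lambda>j\<in>insert i A. (x(i := y)) j + w j)" for y
      using insert by (auto simp: fun_eq_iff)
    have e: "?e y (w i) * ?E x = ennreal (exp (- (\<Sum>j\<in>insert i A. (x(i := y)) j * w j) - (\<Sum>j\<in>insert i A. (w j)\<^sup>2) / 2))" for y
    proof -
      have "(\<Sum>j\<in>A. (x(i := y)) j * w j) = (\<Sum>j\<in>A. x j * w j)"
        by (rule sum.cong) (use insert in auto)
      then show ?thesis using insert
        by (simp add: ennreal_mult[symmetric] mult_exp_exp) (simp add: field_simps)
    qed
    have m: "(\<lambda>y. f (\<lambda>j\<in>insert i A. (x(i := y)) j + w j)) \<in> borel_measurable std_normal"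
      using measurable_compose[OF measurable_compose[OF measurable_Pair1'[OF x] am] fm'] by simp
    show "(\<integral>\<^sup>+y. f ((\<lambda>j\<in>A. x j + w j)(i := y + w i)) * ?e y (w i) \<partial>std_normal) * ?E x
      = (\<integral>\<^sup>+y. f (\<lambda>j\<in>insert i A. (x(i := y)) j + w j) * ennreal (exp (- (\<Sum>j\<in>insert i A. (x(i := y)) j * w j)
      - (\<Sum>j\<in>insert i A. (w j)\<^sup>2) / 2)) \<partial>std_normal)"
      unfolding s e[symmetric] by (subst nn_integral_multc[symmetric]) (use m in \<open>auto simp: mult.assoc\<close>)
  qed
  also have "\<dots> = (\<integral>\<^sup>+x. f (\<lambda>j\<in>insert i A. x j + w j) * ennreal (exp (- (\<Sum>j\<in>insert i A. x j * w j)
      - (\<Sum>j\<in>insert i A. (w j)\<^sup>2) / 2)) \<partial>PiM (insert i A) (\<lambda>_. std_normal))"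
    by (rule product_nn_integral_insert[symmetric]) (use insert fm' in auto)
  finally show ?case .
qed

definition gauss :: "nat \<Rightarrow> (nat \<Rightarrow> real) measure" where
  "gauss d = PiM {..<d} (\<lambda>_. std_normal)"

lemma prob_space_gauss: "prob_space (gauss d)"
  unfolding gauss_def by (intro prob_space_PiM prob_space_std_normal)

lemma component_gauss [measurable]: "i < d \<Longrightarrow> (\<lambda>x. x i) \<in> borel_measurable (gauss d)"
proof -
  assume "i < d"
  then have "(\<lambda>x. x i) \<in> PiM {..<d} (\<lambda>_. std_normal) \<rightarrow>\<^sub>M std_normal" by (intro measurable_component_singleton) simp
  then show ?thesis by (simp add: gauss_def)
qed

lemma ip_measurable [measurable]: "(\<lambda>x. ip d x w) \<in> borel_measurable (gauss d)"
  unfolding ip_def by measurable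

lemma ip_measurable' [measurable]: "(\<lambda>x. ip d x x) \<in> borel_measurable (gauss d)"
  unfolding ip_def by measurable

lemma ip_measurable2: "(\<lambda>(x, y). ip d x y) \<in> borel_measurable (gauss d \<Otimes>\<^sub>M gauss d)"
  unfolding ip_def case_prod_unfold
  by (intro borel_measurable_sum borel_measurable_times
      measurable_compose[OF measurable_fst component_gauss] measurable_compose[OF measurable_snd component_gauss]) auto

lemma ip_commute: "ip d x y = ip d y x"
  by (simp add: ip_def mult.commute)

lemma ip_add_left: "ip d (\<lambda>i. x i + y i) z = ip d x z + ip d y z"
  by (simp add: ip_def algebra_simps sum.distrib)

lemma ip_diff_left: "ip d (\<lambda>i. x i - y i) z = ip d x z - ip d y z"
  by (simp add: ip_def algebra_simps sum_subtractf)

lemma ip_scale_left: "ip d (\<lambda>i. a * x i) z = a * ip d x z"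
  by (simp add: ip_def sum_distrib_left mult.assoc)

lemma ip_add_right: "ip d z (\<lambda>i. x i + y i) = ip d z x + ip d z y"
  by (simp add: ip_def algebra_simps sum.distrib)

lemma ip_diff_right: "ip d z (\<lambda>i. x i - y i) = ip d z x - ip d z y"
  by (simp add: ip_def algebra_simps sum_subtractf)

lemma ip_scale_right: "ip d z (\<lambda>i. a * x i) = a * ip d z x"
  by (simp add: ip_def sum_distrib_left mult_ac)

lemmas ip_linear = ip_add_left ip_add_right ip_diff_left ip_diff_right ip_scale_left ip_scale_right

lemma ip_self_nonneg: "0 \<le> ip d x x"
  by (simp add: ip_def sum_nonneg)

lemma ip_cong: "(\<And>i. i < d \<Longrightarrow> x i = x' i) \<Longrightarrow> (\<And>i. i < d \<Longrightarrow> y i = y' i) \<Longrightarrow> ip d x y = ip d x' y'"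
  by (simp add: ip_def)

lemma ip_cauchy_schwarz: "\<bar>ip d x y\<bar> \<le> sqrt (ip d x x) * sqrt (ip d y y)"
proof -
  have "(ip d x y)\<^sup>2 \<le> ip d x x * ip d y y"
    using Cauchy_Schwarz_ineq_sum[of x y "{..<d}"] by (simp add: ip_def power2_eq_square)
  then have "sqrt ((ip d x y)\<^sup>2) \<le> sqrt (ip d x x * ip d y y)" by (rule real_sqrt_le_mono)
  then show ?thesis by (simp add: real_sqrt_mult)
qed

definition shift :: "nat \<Rightarrow> (nat \<Rightarrow> real) \<Rightarrow> (nat \<Rightarrow> real) \<Rightarrow> (nat \<Rightarrow> real)" where
  "shift d w x = (\<lambda>i\<in>{..<d}. x i + w i)"

lemma shift_gauss [measurable]: "shift d w \<in> gauss d \<rightarrow>\<^sub>M gauss d"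
  unfolding gauss_def shift_def by (rule shift_measurable)

lemma ip_shift: "ip d (shift d w x) u = ip d x u + ip d w u"
  by (simp add: ip_def shift_def algebra_simps sum.distrib)

lemma gauss_shift:
  assumes "f \<in> borel_measurable (gauss d)"
  shows "(\<integral>\<^sup>+x. f x \<partial>gauss d) = (\<integral>\<^sup>+x. f (shift d w x) * ennreal (exp (- ip d x w - ip d w w / 2)) \<partial>gauss d)"
  using cameron_martin[of "{..<d}" f w] assms
  by (simp add: gauss_def shift_def ip_def power2_eq_square)

context
  fixes d :: nat
begin

interpretation G: prob_space "gauss d" by (rule prob_space_gauss)

lemma gauss_upper: "\<P>(x in gauss d. b \<le> ip d x w) \<le> exp (ip d w w / 2 - b)"
proof -
  define w' where "w' = (\<lambda>i. - 1 * w i)"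
  have w': "ip d x w' = - ip d x w" "ip d w' x = - ip d w x" for x
    unfolding w'_def ip_scale_left ip_scale_right by simp_all
  \<comment> \<open>The moment generating function without computation: total mass one, rewritten by
    a translation along \<open>- w\<close>.\<close>
  have one: "(\<integral>\<^sup>+x. ennreal (exp (ip d x w - ip d w w / 2)) \<partial>gauss d) = 1"
    using gauss_shift[of "\<lambda>_. 1" d w'] by (simp add: w' G.emeasure_space_1)
  have "emeasure (gauss d) {x \<in> space (gauss d). b \<le> ip d x w}
      = (\<integral>\<^sup>+x. indicator {x \<in> space (gauss d). b \<le> ip d x w} x \<partial>gauss d)" by simp
  also have "\<dots> \<le> (\<integral>\<^sup>+x. ennreal (exp (ip d w w / 2 - b)) * ennreal (exp (ip d x w - ip d w w / 2)) \<partial>gauss d)"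
    by (rule nn_integral_mono)
      (auto simp: indicator_def ennreal_mult[symmetric] mult_exp_exp intro!: ennreal_leI[of 1, simplified])
  also have "\<dots> = ennreal (exp (ip d w w / 2 - b))"
    by (subst nn_integral_cmult) (auto simp: one)
  finally show ?thesis by (simp add: G.emeasure_eq_measure)
qed

text \<open>After translation by \<open>s\<close> times \<open>u\<close> the points that land in
  \<open>E\<close> have nonnegative inner product with \<open>u\<close>, so their weight is at most
  \<open>exp (- s\<^sup>2 / 2)\<close>. The probability of the translated event is kept as a factor
  because it still contains the other constraints of \<open>E\<close>.\<close>

lemma gauss_tilt_upper:
  assumes E: "E \<in> sets (gauss d)" and "\<And>x. x \<in> E \<Longrightarrow> s \<le> ip d x u" "ip d u u = 1" "0 \<le> s"
  shows "measure (gauss d) E \<le> exp (- s\<^sup>2 / 2) * \<P>(x in gauss d. shift d (\<lambda>i. s * u i) x \<in> E)"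
proof -
  let ?w = "\<lambda>i. s * u i"
  have S: "{x \<in> space (gauss d). shift d ?w x \<in> E} \<in> sets (gauss d)"
    using measurable_sets[OF shift_gauss E, of ?w] by (simp add: vimage_def Int_def conj_commute)
  have ww: "ip d ?w ?w = s\<^sup>2" "ip d x ?w = s * ip d x u" for x
    using assms(3) by (simp_all only: ip_linear) (simp_all add: power2_eq_square)
  have wu: "ip d ?w u = s" using assms(3) by (simp add: ip_linear)
  have "emeasure (gauss d) E = (\<integral>\<^sup>+x. indicator E x \<partial>gauss d)" using E by simp
  also have "\<dots> = (\<integral>\<^sup>+x. indicator E (shift d ?w x) * ennreal (exp (- ip d x ?w - ip d ?w ?w / 2)) \<partial>gauss d)"
    by (rule gauss_shift) (use E in simp)
  also have "\<dots> \<le> (\<integral>\<^sup>+x. ennreal (exp (- s\<^sup>2 / 2)) * indicator {x \<in> space (gauss d). shift d ?w x \<in> E} x \<partial>gauss d)"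
  proof (rule nn_integral_mono)
    fix x assume x: "x \<in> space (gauss d)"
    show "indicator E (shift d ?w x) * ennreal (exp (- ip d x ?w - ip d ?w ?w / 2))
      \<le> ennreal (exp (- s\<^sup>2 / 2)) * indicator {x \<in> space (gauss d). shift d ?w x \<in> E} x"
    proof (cases "shift d ?w x \<in> E")
      case True
      then have "0 \<le> ip d x u" using assms(2)[OF True] by (simp add: ip_shift wu)
      then have "exp (- (s * ip d x u) - s\<^sup>2 / 2) \<le> exp (- s\<^sup>2 / 2)" using assms(4) by simp
      then show ?thesis using True x by (simp add: ww)
    qed simp
  qed
  also have "\<dots> = ennreal (exp (- s\<^sup>2 / 2)) * emeasure (gauss d) {x \<in> space (gauss d). shift d ?w x \<in> E}"
    using S by (subst nn_integral_cmult) auto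
  finally show ?thesis by (simp add: G.emeasure_eq_measure ennreal_mult[symmetric])
qed

lemma exp_two_gt: "exp (- 2 :: real) \<le> 1 / 6"
proof -
  have "(5 / 2 :: real) \<le> exp 1" using exp_lower_Taylor_quadratic[of 1] by simp
  then have "(5 / 2 :: real)\<^sup>2 \<le> (exp 1)\<^sup>2" by (rule power_mono) simp
  also have "(exp 1)\<^sup>2 = exp (2 :: real)" by (simp add: exp_double[symmetric])
  finally have "6 \<le> exp (2::real)" by (simp add: power2_eq_square)
  then show ?thesis by (simp add: exp_minus field_simps)
qed

text \<open>Translate by \<open>w\<close>, where both constraints hold with slack 2. Three
  half-spaces have to be avoided, one for each constraint and one where the density weight is too
  small. Each lies two standard deviations out and has probability at most 1/6, so half of the mass
  remains.\<close>

lemma gauss_lower: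
  assumes u: "ip d u u = 1" "ip d v v = 1" and w: "B1 + 2 \<le> ip d w u" "B2 + 2 \<le> ip d w v"
  shows "exp (- ip d w w / 2 - 2 * sqrt (ip d w w)) / 2
    \<le> \<P>(x in gauss d. B1 \<le> ip d x u \<and> B2 \<le> ip d x v)"
proof -
  define E where "E = {x \<in> space (gauss d). B1 \<le> ip d x u \<and> B2 \<le> ip d x v}"
  define R where "R = sqrt (ip d w w)"
  have E: "E \<in> sets (gauss d)" unfolding E_def by measurable
  have tail: "\<P>(x in gauss d. 2 \<le> ip d x (\<lambda>i. a * u i)) \<le> 1 / 6"
    if "ip d u u * a\<^sup>2 = 1" for u a
  proof -
    have "\<P>(x in gauss d. 4 \<le> ip d x (\<lambda>i. 2 * a * u i)) \<le> exp (- 2)"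
    proof -
      have "ip d (\<lambda>i. 2 * a * u i) (\<lambda>i. 2 * a * u i) = 4 * (ip d u u * a\<^sup>2)"
        by (simp only: ip_linear) (simp add: power2_eq_square)
      then have "ip d (\<lambda>i. 2 * a * u i) (\<lambda>i. 2 * a * u i) = 4" using that by simp
      then show ?thesis using gauss_upper[of 4 "\<lambda>i. 2 * a * u i"] by simp
    qed
    moreover have "{x \<in> space (gauss d). 4 \<le> ip d x (\<lambda>i. 2 * a * u i)} = {x \<in> space (gauss d). 2 \<le> ip d x (\<lambda>i. a * u i)}"
      by (simp only: ip_linear) auto
    ultimately show ?thesis using exp_two_gt by simp
  qed
  define T1 where "T1 = {x \<in> space (gauss d). 2 \<le> ip d x (\<lambda>i. - 1 * u i)}"
  define T2 where "T2 = {x \<in> space (gauss d). 2 \<le> ip d x (\<lambda>i. - 1 * v i)}"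
  define T3 where "T3 = {x \<in> space (gauss d). 2 \<le> ip d x (\<lambda>i. (1 / R) * w i)}"
  have w0: "ip d w w \<noteq> 0 \<or> R = 0" by (simp add: R_def)
  have t1: "measure (gauss d) T1 \<le> 1 / 6" "measure (gauss d) T2 \<le> 1 / 6"
    unfolding T1_def T2_def by (rule tail, simp add: u)+
  have t3: "measure (gauss d) T3 \<le> 1 / 6"
  proof (cases "R = 0")
    case True
    then have "T3 = {}" by (auto simp: T3_def ip_def)
    then show ?thesis by simp
  next
    case False
    then have "R\<^sup>2 = ip d w w" using ip_self_nonneg[of d w] by (simp add: R_def)
    then have "ip d w w * (1 / R)\<^sup>2 = 1" using False by (simp add: power_divide flip: \<open>R\<^sup>2 = ip d w w\<close>)
    then show ?thesis unfolding T3_def by (rule tail)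
  qed
  define H where "H = {x \<in> space (gauss d). shift d w x \<in> E \<and> ip d x w \<le> 2 * R}"
  have Hm: "H \<in> sets (gauss d)"
  proof -
    have "{x \<in> space (gauss d). shift d w x \<in> E} \<in> sets (gauss d)"
      using measurable_sets[OF shift_gauss E, of w] by (simp add: vimage_def Int_def conj_commute)
    moreover have "{x \<in> space (gauss d). ip d x w \<le> 2 * R} \<in> sets (gauss d)" by measurable
    ultimately have "{x \<in> space (gauss d). shift d w x \<in> E} \<inter> {x \<in> space (gauss d). ip d x w \<le> 2 * R} \<in> sets (gauss d)"
      by (rule sets.Int)
    moreover have "{x \<in> space (gauss d). shift d w x \<in> E} \<inter> {x \<in> space (gauss d). ip d x w \<le> 2 * R} = H"
      by (auto simp: H_def)
    ultimately show ?thesis by simp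
  qed
  have Tm: "T1 \<in> sets (gauss d)" "T2 \<in> sets (gauss d)" "T3 \<in> sets (gauss d)"
    unfolding T1_def T2_def T3_def by measurable
  have sub: "space (gauss d) - H \<subseteq> T1 \<union> T2 \<union> T3"
  proof
    fix x assume x: "x \<in> space (gauss d) - H"
    then have xs: "x \<in> space (gauss d)" by simp
    have sh: "shift d w x \<in> space (gauss d)" using measurable_space[OF shift_gauss xs] .
    consider "ip d x u < - 2" | "ip d x v < - 2" | "2 * R < ip d x w"
      using x sh w by (force simp: H_def E_def ip_shift)
    then show "x \<in> T1 \<union> T2 \<union> T3"
    proof cases
      case 1 then show ?thesis using xs unfolding T1_def ip_scale_right by simp
    next
      case 2 then show ?thesis using xs unfolding T2_def ip_scale_right by simp
    next
      case 3
      have "R \<noteq> 0"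
      proof
        assume "R = 0"
        then have "ip d w w = 0" by (simp add: R_def)
        then have "\<bar>ip d x w\<bar> \<le> 0" using ip_cauchy_schwarz[of d x w] by simp
        then show False using 3 \<open>R = 0\<close> by simp
      qed
      moreover have "0 \<le> R" by (simp add: R_def ip_self_nonneg)
      ultimately show ?thesis using 3 xs unfolding T3_def ip_scale_right by (simp add: field_simps)
    qed
  qed
  have "measure (gauss d) (space (gauss d) - H) \<le> measure (gauss d) (T1 \<union> T2 \<union> T3)"
    by (rule G.finite_measure_mono[OF sub]) (use Tm in auto)
  also have "\<dots> \<le> measure (gauss d) (T1 \<union> T2) + measure (gauss d) T3" by (rule measure_Un_le) (use Tm in auto)
  also have "measure (gauss d) (T1 \<union> T2) \<le> measure (gauss d) T1 + measure (gauss d) T2"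
    by (rule measure_Un_le) (use Tm in auto)
  finally have "measure (gauss d) (space (gauss d) - H) \<le> 1 / 2" using t1 t3 by simp
  then have H: "1 / 2 \<le> measure (gauss d) H" using G.prob_compl[OF Hm] by simp
  let ?c = "exp (- ip d w w / 2 - 2 * R)"
  have "ennreal (?c / 2) \<le> ennreal (?c * measure (gauss d) H)"
    by (rule ennreal_leI) (use mult_left_mono[OF H, of ?c] in simp)
  also have "\<dots> = (\<integral>\<^sup>+x. ennreal ?c * indicator H x \<partial>gauss d)"
    using Hm by (subst nn_integral_cmult) (auto simp: G.emeasure_eq_measure ennreal_mult)
  also have "\<dots> \<le> (\<integral>\<^sup>+x. indicator E (shift d w x) * ennreal (exp (- ip d x w - ip d w w / 2)) \<partial>gauss d)"
    by (rule nn_integral_mono) (auto simp: indicator_def H_def intro!: ennreal_leI)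
  also have "\<dots> = (\<integral>\<^sup>+x. indicator E x \<partial>gauss d)" by (rule gauss_shift[symmetric]) (use E in simp)
  also have "\<dots> = ennreal (measure (gauss d) E)" using E by (simp add: G.emeasure_eq_measure)
  finally show ?thesis by (simp add: R_def E_def)
qed

end

lemma nn_integral_exp_square_std_normal:
  assumes "t < 1 / 2"
  shows "(\<integral>\<^sup>+x. ennreal (exp (t * x\<^sup>2)) \<partial>std_normal) = ennreal (1 / sqrt (1 - 2 * t))"
proof -
  define \<sigma> where "\<sigma> = 1 / sqrt (1 - 2 * t)"
  have \<sigma>: "0 < \<sigma>" "\<sigma>\<^sup>2 = 1 / (1 - 2 * t)" using assms by (simp_all add: \<sigma>_def power_divide)
  have "(\<integral>\<^sup>+x. ennreal (exp (t * x\<^sup>2)) \<partial>std_normal) = (\<integral>\<^sup>+x. ennreal (std_normal_density x) * ennreal (exp (t * x\<^sup>2)) \<partial>lborel)"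
    by (rule nn_integral_std_normal) simp
  also have "\<dots> = (\<integral>\<^sup>+x. ennreal \<sigma> * ennreal (normal_density 0 \<sigma> x) \<partial>lborel)"
  proof (rule nn_integral_cong)
    fix x
    have "std_normal_density x * exp (t * x\<^sup>2) = exp (- x\<^sup>2 * (1 - 2 * t) / 2) / sqrt (2 * pi)"
      by (simp add: std_normal_density_def mult_exp_exp field_simps)
    also have "\<dots> = \<sigma> * normal_density 0 \<sigma> x"
      using \<sigma> assms by (simp add: normal_density_def real_sqrt_mult real_sqrt_divide \<sigma>_def field_simps)
    finally show "ennreal (std_normal_density x) * ennreal (exp (t * x\<^sup>2)) = ennreal \<sigma> * ennreal (normal_density 0 \<sigma> x)"
      using \<sigma> by (simp add: ennreal_mult[symmetric])
  qed
  also have "\<dots> = ennreal \<sigma> * (\<integral>\<^sup>+x. ennreal (normal_density 0 \<sigma> x) \<partial>lborel)"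
    by (rule nn_integral_cmult) simp
  also have "(\<integral>\<^sup>+x. ennreal (normal_density 0 \<sigma> x) \<partial>lborel) = 1"
    using prob_space.emeasure_space_1[OF prob_space_normal_density[OF \<sigma>(1), of 0]]
    by (simp add: emeasure_density)
  finally show ?thesis by (simp add: \<sigma>_def)
qed

lemma nn_integral_exp_norm:
  assumes "t < 1 / 2"
  shows "(\<integral>\<^sup>+x. ennreal (exp (t * ip d x x)) \<partial>gauss d) = ennreal (1 / sqrt (1 - 2 * t)) ^ d"
proof -
  interpret product_prob_space "\<lambda>_::nat. std_normal" by (rule product_std_normal)
  have "(\<integral>\<^sup>+x. ennreal (exp (t * ip d x x)) \<partial>gauss d) = (\<integral>\<^sup>+x. (\<Prod>i<d. ennreal (exp (t * (x i)\<^sup>2))) \<partial>gauss d)"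
    by (intro nn_integral_cong)
      (simp add: ip_def sum_distrib_left exp_sum prod_ennreal power2_eq_square)
  also have "\<dots> = (\<Prod>i<d. \<integral>\<^sup>+x. ennreal (exp (t * x\<^sup>2)) \<partial>std_normal)"
    unfolding gauss_def by (rule product_nn_integral_prod) auto
  also have "\<dots> = ennreal (1 / sqrt (1 - 2 * t)) ^ d"
    by (simp add: nn_integral_exp_square_std_normal[OF assms])
  finally show ?thesis .
qed

lemma gauss_markov:
  assumes "t < 1 / 2" "1 / sqrt (1 - 2 * t) \<le> exp s" "E \<in> sets (gauss d)" "\<And>x. x \<in> E \<Longrightarrow> a \<le> t * ip d x x"
  shows "measure (gauss d) E \<le> exp (real d * s - a)"
proof -
  interpret G: prob_space "gauss d" by (rule prob_space_gauss)
  have "emeasure (gauss d) E = (\<integral>\<^sup>+x. indicator E x \<partial>gauss d)" using assms by simp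
  also have "\<dots> \<le> (\<integral>\<^sup>+x. ennreal (exp (- a)) * ennreal (exp (t * ip d x x)) \<partial>gauss d)"
  proof (rule nn_integral_mono)
    fix x
    show "indicator E x \<le> ennreal (exp (- a)) * ennreal (exp (t * ip d x x))"
      using assms(4)[of x] by (auto simp: indicator_def ennreal_mult[symmetric] mult_exp_exp intro!: ennreal_leI[of 1, simplified])
  qed
  also have "\<dots> = ennreal (exp (- a)) * ennreal (1 / sqrt (1 - 2 * t)) ^ d"
    by (subst nn_integral_cmult) (auto simp: nn_integral_exp_norm[OF assms(1)])
  also have "\<dots> \<le> ennreal (exp (- a)) * ennreal (exp s) ^ d"
    by (intro mult_left_mono power_mono ennreal_leI assms(2)) auto
  also have "\<dots> = ennreal (exp (real d * s - a))"
    by (simp add: ennreal_power ennreal_mult[symmetric] mult_exp_exp exp_of_nat_mult[symmetric])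
  finally show ?thesis by (simp add: G.emeasure_eq_measure)
qed

lemma sqrt_exp: "sqrt (exp a) = exp (a / 2)"
  by (rule real_sqrt_unique) (simp_all add: power2_eq_square mult_exp_exp)

lemma gauss_norm_tail:
  assumes "0 < \<eta>" "\<eta> \<le> 1"
  shows "\<P>(x in gauss d. (1 + \<eta>) * real d < ip d x x \<or> ip d x x < (1 - \<eta>) * real d)
    \<le> 2 * exp (- \<eta>\<^sup>2 * real d / 16)"
proof -
  \<comment> \<open>The exponential Markov bound is used with parameter \<open>\<eta> / 8\<close>
    above and \<open>- \<eta> / 8\<close> below; \<open>y\<close> is twice its absolute value. With
    the second-order bounds on the logarithm both exponents become exactly
    \<open>- \<eta>\<^sup>2 * real d / 16\<close>.\<close>
  define y where "y = \<eta> / 4"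
  have y: "0 < y" "y \<le> 1 / 2" using assms by (auto simp: y_def)
  have up: "\<P>(x in gauss d. (1 + \<eta>) * real d < ip d x x) \<le> exp (- \<eta>\<^sup>2 * real d / 16)"
  proof -
    have "1 / sqrt (1 - 2 * (\<eta> / 8)) \<le> exp ((y + 2 * y\<^sup>2) / 2)"
    proof -
      have "- y - 2 * y\<^sup>2 \<le> ln (1 - y)" using ln_one_minus_pos_lower_bound[of y] y by simp
      then have "exp (- y - 2 * y\<^sup>2) \<le> 1 - y" using y by (simp add: ln_ge_iff)
      then have "sqrt (exp (- y - 2 * y\<^sup>2)) \<le> sqrt (1 - y)" by (rule real_sqrt_le_mono)
      then have "exp ((- y - 2 * y\<^sup>2) / 2) \<le> sqrt (1 - y)" by (simp only: sqrt_exp)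
      then have "1 / sqrt (1 - y) \<le> 1 / exp ((- y - 2 * y\<^sup>2) / 2)"
        by (intro divide_left_mono) (use y in auto)
      also have "1 / exp ((- y - 2 * y\<^sup>2) / 2) = exp (- ((- y - 2 * y\<^sup>2) / 2))"
        by (simp only: exp_minus inverse_eq_divide)
      also have "- ((- y - 2 * y\<^sup>2) / 2) = (y + 2 * y\<^sup>2) / 2" by (simp add: field_simps)
      finally show ?thesis by (simp add: y_def)
    qed
    then have "\<P>(x in gauss d. (1 + \<eta>) * real d < ip d x x)
        \<le> exp (real d * ((y + 2 * y\<^sup>2) / 2) - (\<eta> / 8) * ((1 + \<eta>) * real d))"
      by (intro gauss_markov[where t="\<eta> / 8"]) (use assms in auto)
    also have "real d * ((y + 2 * y\<^sup>2) / 2) - (\<eta> / 8) * ((1 + \<eta>) * real d) = - \<eta>\<^sup>2 * real d / 16"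
      by (simp add: y_def power2_eq_square field_simps)
    finally show ?thesis .
  qed
  have lo: "\<P>(x in gauss d. ip d x x < (1 - \<eta>) * real d) \<le> exp (- \<eta>\<^sup>2 * real d / 16)"
  proof -
    have "1 / sqrt (1 - 2 * (- \<eta> / 8)) \<le> exp (- (y - 2 * y\<^sup>2) / 2)"
    proof -
      have "y - y\<^sup>2 \<le> ln (1 + y)" using ln_one_plus_pos_lower_bound[of y] y by simp
      then have "y - 2 * y\<^sup>2 \<le> ln (1 + y)" using zero_le_power2[of y] by linarith
      then have "exp (y - 2 * y\<^sup>2) \<le> 1 + y" using y by (simp add: ln_ge_iff)
      then have "sqrt (exp (y - 2 * y\<^sup>2)) \<le> sqrt (1 + y)" by (rule real_sqrt_le_mono)
      then have "exp ((y - 2 * y\<^sup>2) / 2) \<le> sqrt (1 + y)" by (simp only: sqrt_exp)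
      then have "1 / sqrt (1 + y) \<le> 1 / exp ((y - 2 * y\<^sup>2) / 2)"
        by (intro divide_left_mono) (use y in auto)
      also have "1 / exp ((y - 2 * y\<^sup>2) / 2) = exp (- ((y - 2 * y\<^sup>2) / 2))"
        by (simp only: exp_minus inverse_eq_divide)
      also have "- ((y - 2 * y\<^sup>2) / 2) = - (y - 2 * y\<^sup>2) / 2" by (simp only: minus_divide_left)
      finally show ?thesis by (simp add: y_def)
    qed
    then have "\<P>(x in gauss d. ip d x x < (1 - \<eta>) * real d)
        \<le> exp (real d * (- (y - 2 * y\<^sup>2) / 2) - (- \<eta> / 8) * ((1 - \<eta>) * real d))"
    proof (intro gauss_markov[where t="- \<eta> / 8"])
      show "- \<eta> / 8 * ((1 - \<eta>) * real d) \<le> - \<eta> / 8 * ip d x x"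
        if "x \<in> {x \<in> space (gauss d). ip d x x < (1 - \<eta>) * real d}" for x
        by (rule mult_left_mono_neg) (use that assms in auto)
    qed (use assms in auto)
    also have "real d * (- (y - 2 * y\<^sup>2) / 2) - (- \<eta> / 8) * ((1 - \<eta>) * real d) = - \<eta>\<^sup>2 * real d / 16"
      by (simp add: y_def power2_eq_square field_simps)
    finally show ?thesis .
  qed
  have "{x \<in> space (gauss d). (1 + \<eta>) * real d < ip d x x \<or> ip d x x < (1 - \<eta>) * real d}
      = {x \<in> space (gauss d). (1 + \<eta>) * real d < ip d x x} \<union> {x \<in> space (gauss d). ip d x x < (1 - \<eta>) * real d}" by auto
  moreover have "measure (gauss d) ({x \<in> space (gauss d). (1 + \<eta>) * real d < ip d x x} \<union> {x \<in> space (gauss d). ip d x x < (1 - \<eta>) * real d})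
      \<le> \<P>(x in gauss d. (1 + \<eta>) * real d < ip d x x) + \<P>(x in gauss d. ip d x x < (1 - \<eta>) * real d)"
    by (rule measure_Un_le) measurable
  ultimately show ?thesis using up lo by simp
qed

subsection \<open>Rotation invariance\<close>

definition rot :: "nat \<Rightarrow> nat \<Rightarrow> real \<Rightarrow> real \<Rightarrow> (nat \<Rightarrow> real) \<Rightarrow> (nat \<Rightarrow> real)" where
  "rot i j c s x = x(i := c * x i + s * x j, j := c * x j - s * x i)"

text \<open>For nonzero \<open>c\<close> the rotation is a composition of two affine substitutions
  in one variable each, with Jacobians \<open>1 / c\<close> and \<open>c\<close>. For
  \<open>c = 0\<close> it is an exchange of the coordinates up to signs.\<close>

lemma lborel_rotation:
  fixes G :: "real \<times> real \<Rightarrow> ennreal"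
  assumes G: "G \<in> borel_measurable (borel \<Otimes>\<^sub>M borel)" and cs: "c\<^sup>2 + s\<^sup>2 = 1"
  shows "(\<integral>\<^sup>+b. \<integral>\<^sup>+a. G (c * a + s * b, c * b - s * a) \<partial>lborel \<partial>lborel) = (\<integral>\<^sup>+b. \<integral>\<^sup>+a. G (a, b) \<partial>lborel \<partial>lborel)"
proof -
  have Gm: "(\<lambda>p. G (f p, g p)) \<in> borel_measurable borel"
    if "f \<in> borel_measurable borel" "g \<in> borel_measurable borel" for f g :: "real \<Rightarrow> real"
    by (rule measurable_compose[OF measurable_Pair[OF that] G])
  have Gl: "(\<lambda>(x, y). G (f x y, g x y)) \<in> borel_measurable (lborel \<Otimes>\<^sub>M lborel)"
    if "(\<lambda>p. f (fst p) (snd p)) \<in> borel_measurable (borel \<Otimes>\<^sub>M borel)"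
      "(\<lambda>p. g (fst p) (snd p)) \<in> borel_measurable (borel \<Otimes>\<^sub>M borel)" for f g :: "real \<Rightarrow> real \<Rightarrow> real"
  proof -
    have "sets (lborel \<Otimes>\<^sub>M lborel) = sets (borel \<Otimes>\<^sub>M (borel :: real measure) :: (real \<times> real) measure)"
      by (intro sets_pair_measure_cong) auto
    moreover have "(\<lambda>p. G (f (fst p) (snd p), g (fst p) (snd p))) \<in> borel_measurable (borel \<Otimes>\<^sub>M borel)"
      by (rule measurable_compose[OF measurable_Pair[OF that] G])
    ultimately show ?thesis
      unfolding case_prod_unfold using measurable_cong_sets[of _ "borel \<Otimes>\<^sub>M borel"] by blast
  qed
  have swap: "(\<integral>\<^sup>+x. \<integral>\<^sup>+y. G (f x y, g x y) \<partial>lborel \<partial>lborel) = (\<integral>\<^sup>+y. \<integral>\<^sup>+x. G (f x y, g x y) \<partial>lborel \<partial>lborel)"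
    if "(\<lambda>p. f (fst p) (snd p)) \<in> borel_measurable (borel \<Otimes>\<^sub>M borel)"
      "(\<lambda>p. g (fst p) (snd p)) \<in> borel_measurable (borel \<Otimes>\<^sub>M borel)" for f g :: "real \<Rightarrow> real \<Rightarrow> real"
    by (rule lborel_pair.Fubini'[OF Gl[OF that], symmetric])
  have inner: "(\<lambda>x. \<integral>\<^sup>+y. G (f x y, g x y) \<partial>lborel) \<in> borel_measurable lborel"
    if "(\<lambda>p. f (fst p) (snd p)) \<in> borel_measurable (borel \<Otimes>\<^sub>M borel)"
      "(\<lambda>p. g (fst p) (snd p)) \<in> borel_measurable (borel \<Otimes>\<^sub>M borel)" for f g :: "real \<Rightarrow> real \<Rightarrow> real"
    by (rule lborel.borel_measurable_nn_integral[OF Gl[OF that]])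
  have G1: "(\<lambda>b. G (x, b)) \<in> borel_measurable borel" for x by (rule Gm) measurable
  have G2: "(\<lambda>a. G (a, x)) \<in> borel_measurable borel" for x by (rule Gm) measurable
  show ?thesis
  proof (cases "c = 0")
    case True
    then have "s * s = 1" using cs by (simp add: power2_eq_square)
    then have s: "s \<noteq> 0" "\<bar>s\<bar> = 1" by (auto simp: abs_if square_eq_1_iff)
    have "(\<integral>\<^sup>+b. \<integral>\<^sup>+a. G (c * a + s * b, c * b - s * a) \<partial>lborel \<partial>lborel) = (\<integral>\<^sup>+b. \<integral>\<^sup>+a. G (s * b, a) \<partial>lborel \<partial>lborel)"
    proof (rule nn_integral_cong)
      fix b :: real
      have "(\<integral>\<^sup>+a. G (s * b, a) \<partial>lborel) = ennreal \<bar>- s\<bar> * (\<integral>\<^sup>+a. G (s * b, 0 + (- s) * a) \<partial>lborel)"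
        by (rule nn_integral_real_affine[OF G1]) (use s in simp)
      then show "(\<integral>\<^sup>+a. G (c * a + s * b, c * b - s * a) \<partial>lborel) = (\<integral>\<^sup>+a. G (s * b, a) \<partial>lborel)"
        using s True by simp
    qed
    also have "\<dots> = (\<integral>\<^sup>+a. \<integral>\<^sup>+b. G (s * b, a) \<partial>lborel \<partial>lborel)" by (rule swap) measurable
    also have "\<dots> = (\<integral>\<^sup>+a. \<integral>\<^sup>+b. G (b, a) \<partial>lborel \<partial>lborel)"
    proof (rule nn_integral_cong)
      fix a :: real
      have "(\<integral>\<^sup>+b. G (b, a) \<partial>lborel) = ennreal \<bar>s\<bar> * (\<integral>\<^sup>+b. G (0 + s * b, a) \<partial>lborel)"
        by (rule nn_integral_real_affine[OF G2]) (use s in simp)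
      then show "(\<integral>\<^sup>+b. G (s * b, a) \<partial>lborel) = (\<integral>\<^sup>+b. G (b, a) \<partial>lborel)" using s by simp
    qed
    finally show ?thesis .
  next
    case False
    have "(\<integral>\<^sup>+b. \<integral>\<^sup>+a. G (c * a + s * b, c * b - s * a) \<partial>lborel \<partial>lborel)
        = (\<integral>\<^sup>+b. ennreal \<bar>1 / c\<bar> * (\<integral>\<^sup>+u. G (u, (b - s * u) / c) \<partial>lborel) \<partial>lborel)"
    proof (rule nn_integral_cong)
      fix b :: real
      have "(\<integral>\<^sup>+a. G (c * a + s * b, c * b - s * a) \<partial>lborel)
          = ennreal \<bar>1 / c\<bar> * (\<integral>\<^sup>+u. G (c * (- s * b / c + 1 / c * u) + s * b, c * b - s * (- s * b / c + 1 / c * u)) \<partial>lborel)"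
      proof (rule nn_integral_real_affine)
        show "(\<lambda>a. G (c * a + s * b, c * b - s * a)) \<in> borel_measurable borel" by (rule Gm) measurable
        show "1 / c \<noteq> 0" using False by simp
      qed
      also have "(\<lambda>u. G (c * (- s * b / c + 1 / c * u) + s * b, c * b - s * (- s * b / c + 1 / c * u))) = (\<lambda>u. G (u, (b - s * u) / c))"
      proof
        fix u
        have "c * (c * b - s * (- s * b / c + 1 / c * u)) = (c\<^sup>2 + s\<^sup>2) * b - s * u"
          using False by (simp add: power2_eq_square distrib_left distrib_right right_diff_distrib)
        then have "c * (c * b - s * (- s * b / c + 1 / c * u)) = b - s * u" by (simp only: cs mult_1)
        then have "c * b - s * (- s * b / c + 1 / c * u) = (b - s * u) / c" using False
          by (metis nonzero_mult_div_cancel_left)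
        moreover have "c * (- s * b / c + 1 / c * u) + s * b = u"
          using False by (simp add: distrib_left right_diff_distrib)
        ultimately show "G (c * (- s * b / c + 1 / c * u) + s * b, c * b - s * (- s * b / c + 1 / c * u)) = G (u, (b - s * u) / c)"
          by (simp only:)
      qed
      finally show "(\<integral>\<^sup>+a. G (c * a + s * b, c * b - s * a) \<partial>lborel) = ennreal \<bar>1 / c\<bar> * (\<integral>\<^sup>+u. G (u, (b - s * u) / c) \<partial>lborel)" .
    qed
    also have "\<dots> = ennreal \<bar>1 / c\<bar> * (\<integral>\<^sup>+b. \<integral>\<^sup>+u. G (u, (b - s * u) / c) \<partial>lborel \<partial>lborel)"
      by (rule nn_integral_cmult, rule inner) (use False in measurable)
    also have "(\<integral>\<^sup>+b. \<integral>\<^sup>+u. G (u, (b - s * u) / c) \<partial>lborel \<partial>lborel) = (\<integral>\<^sup>+u. \<integral>\<^sup>+b. G (u, (b - s * u) / c) \<partial>lborel \<partial>lborel)"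
      by (rule swap) (use False in measurable)
    also have "\<dots> = (\<integral>\<^sup>+u. ennreal \<bar>c\<bar> * (\<integral>\<^sup>+v. G (u, v) \<partial>lborel) \<partial>lborel)"
    proof (rule nn_integral_cong)
      fix u :: real
      have "(\<integral>\<^sup>+b. G (u, (b - s * u) / c) \<partial>lborel) = ennreal \<bar>c\<bar> * (\<integral>\<^sup>+v. G (u, (s * u + c * v - s * u) / c) \<partial>lborel)"
      proof (rule nn_integral_real_affine)
        show "(\<lambda>b. G (u, (b - s * u) / c)) \<in> borel_measurable borel" by (rule Gm) measurable
      qed (rule False)
      then show "(\<integral>\<^sup>+b. G (u, (b - s * u) / c) \<partial>lborel) = ennreal \<bar>c\<bar> * (\<integral>\<^sup>+v. G (u, v) \<partial>lborel)"
        using False by simp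
    qed
    also have "\<dots> = ennreal \<bar>c\<bar> * (\<integral>\<^sup>+u. \<integral>\<^sup>+v. G (u, v) \<partial>lborel \<partial>lborel)"
      by (rule nn_integral_cmult, rule inner) measurable
    also have "ennreal \<bar>1 / c\<bar> * (ennreal \<bar>c\<bar> * (\<integral>\<^sup>+u. \<integral>\<^sup>+v. G (u, v) \<partial>lborel \<partial>lborel)) = (\<integral>\<^sup>+u. \<integral>\<^sup>+v. G (u, v) \<partial>lborel \<partial>lborel)"
    proof -
      have "ennreal \<bar>1 / c\<bar> * ennreal \<bar>c\<bar> = 1" using False by (subst ennreal_mult[symmetric]) auto
      then show ?thesis by (simp only: mult.assoc[symmetric] mult_1)
    qed
    also have "\<dots> = (\<integral>\<^sup>+b. \<integral>\<^sup>+a. G (a, b) \<partial>lborel \<partial>lborel)" by (rule swap) measurable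
    finally show ?thesis .
  qed
qed

lemma std_normal_rotation:
  fixes g :: "real \<times> real \<Rightarrow> ennreal"
  assumes g: "g \<in> borel_measurable (borel \<Otimes>\<^sub>M borel)" and cs: "c\<^sup>2 + s\<^sup>2 = 1"
  shows "(\<integral>\<^sup>+b. \<integral>\<^sup>+a. g (c * a + s * b, c * b - s * a) \<partial>std_normal \<partial>std_normal) = (\<integral>\<^sup>+b. \<integral>\<^sup>+a. g (a, b) \<partial>std_normal \<partial>std_normal)"
proof -
  define \<phi> where "\<phi> p = ennreal (std_normal_density (fst p) * std_normal_density (snd p))" for p
  have \<phi>m: "\<phi> \<in> borel_measurable (borel \<Otimes>\<^sub>M borel)" unfolding \<phi>_def by measurable
  have \<phi>rot: "\<phi> (c * a + s * b, c * b - s * a) = \<phi> (a, b)" for a b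
  proof -
    have "(c * a + s * b)\<^sup>2 + (c * b - s * a)\<^sup>2 = (c\<^sup>2 + s\<^sup>2) * (a\<^sup>2 + b\<^sup>2)"
      by (simp add: power2_eq_square algebra_simps)
    then have "(c * a + s * b)\<^sup>2 + (c * b - s * a)\<^sup>2 = a\<^sup>2 + b\<^sup>2" using cs by simp
    then have "- (c * a + s * b)\<^sup>2 / 2 + - (c * b - s * a)\<^sup>2 / 2 = - a\<^sup>2 / 2 + - b\<^sup>2 / 2" by simp
    then show ?thesis by (simp add: \<phi>_def std_normal_density_def mult_exp_exp)
  qed
  have split: "(\<integral>\<^sup>+b. \<integral>\<^sup>+a. h (a, b) \<partial>std_normal \<partial>std_normal) = (\<integral>\<^sup>+b. \<integral>\<^sup>+a. \<phi> (a, b) * h (a, b) \<partial>lborel \<partial>lborel)"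
    if h: "h \<in> borel_measurable (borel \<Otimes>\<^sub>M borel)" for h
  proof -
    have h1: "(\<lambda>a. h (a, b)) \<in> borel_measurable borel" for b
      by (rule measurable_compose[OF _ h]) simp
    have h2: "(\<lambda>b. \<integral>\<^sup>+a. h (a, b) \<partial>std_normal) \<in> borel_measurable borel"
    proof (rule sigma_finite_measure.borel_measurable_nn_integral)
      show "sigma_finite_measure std_normal"
        using prob_space_std_normal prob_space_imp_sigma_finite by blast
      have "(\<lambda>p. (snd p, fst p)) \<in> (borel \<Otimes>\<^sub>M std_normal) \<rightarrow>\<^sub>M (borel \<Otimes>\<^sub>M borel :: (real \<times> real) measure)" by measurable
      from measurable_compose[OF this h] show "(\<lambda>(b, a). h (a, b)) \<in> borel_measurable (borel \<Otimes>\<^sub>M std_normal)"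
        by (simp add: case_prod_unfold)
    qed
    show ?thesis
      by (subst nn_integral_std_normal[OF h2], subst nn_integral_std_normal[OF h1],
          subst nn_integral_cmult[symmetric])
        (use h1 in \<open>auto simp: \<phi>_def ennreal_mult mult_ac\<close>)
  qed
  have rm: "(\<lambda>p. (c * fst p + s * snd p, c * snd p - s * fst p)) \<in> (borel \<Otimes>\<^sub>M borel) \<rightarrow>\<^sub>M (borel \<Otimes>\<^sub>M borel :: (real \<times> real) measure)"
    by measurable
  have "(\<integral>\<^sup>+b. \<integral>\<^sup>+a. g (c * a + s * b, c * b - s * a) \<partial>std_normal \<partial>std_normal)
      = (\<integral>\<^sup>+b. \<integral>\<^sup>+a. \<phi> (a, b) * g (c * a + s * b, c * b - s * a) \<partial>lborel \<partial>lborel)"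
    using split[OF measurable_compose[OF rm g]] by simp
  also have "\<dots> = (\<integral>\<^sup>+b. \<integral>\<^sup>+a. (\<lambda>p. \<phi> p * g p) (c * a + s * b, c * b - s * a) \<partial>lborel \<partial>lborel)"
    by (simp add: \<phi>rot)
  also have "\<dots> = (\<integral>\<^sup>+b. \<integral>\<^sup>+a. \<phi> (a, b) * g (a, b) \<partial>lborel \<partial>lborel)"
    by (rule lborel_rotation[OF _ cs]) (use \<phi>m g in measurable)
  also have "\<dots> = (\<integral>\<^sup>+b. \<integral>\<^sup>+a. g (a, b) \<partial>std_normal \<partial>std_normal)" by (rule split[OF g, symmetric])
  finally show ?thesis .
qed

text \<open>Inner products are preserved for arbitrary arguments, because the query and the planted
  direction are zero beyond coordinate \<open>d\<close> and need not lie in the extensional space of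
  \<open>gauss d\<close>.\<close>

definition gauss_isometry :: "nat \<Rightarrow> ((nat \<Rightarrow> real) \<Rightarrow> (nat \<Rightarrow> real)) \<Rightarrow> bool" where
  "gauss_isometry d T \<longleftrightarrow> T \<in> gauss d \<rightarrow>\<^sub>M gauss d \<and> distr (gauss d) (gauss d) T = gauss d \<and>
     (\<forall>x y. ip d (T x) (T y) = ip d x y)"

lemma gauss_isometry_comp:
  assumes "gauss_isometry d T" "gauss_isometry d S"
  shows "gauss_isometry d (\<lambda>x. T (S x))"
proof -
  have m: "T \<in> gauss d \<rightarrow>\<^sub>M gauss d" "S \<in> gauss d \<rightarrow>\<^sub>M gauss d" using assms by (auto simp: gauss_isometry_def)
  have "distr (gauss d) (gauss d) (\<lambda>x. T (S x)) = distr (distr (gauss d) (gauss d) S) (gauss d) T"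
    by (subst distr_distr[OF m]) (simp add: comp_def)
  then show ?thesis using assms measurable_compose[OF m(2,1)] by (simp add: gauss_isometry_def)
qed

lemma ip_rot:
  assumes ij: "i < d" "j < d" "i \<noteq> j" and cs: "c\<^sup>2 + s\<^sup>2 = 1"
  shows "ip d (rot i j c s x) (rot i j c s y) = ip d x y"
proof -
  have split: "ip d u v = u i * v i + u j * v j + (\<Sum>k\<in>{..<d} - {i} - {j}. u k * v k)" for u v
    using ij by (simp add: ip_def sum.remove[of "{..<d}" i] sum.remove[of "{..<d} - {i}" j])
  have "(c * x i + s * x j) * (c * y i + s * y j) + (c * x j - s * x i) * (c * y j - s * y i)
      = (c\<^sup>2 + s\<^sup>2) * (x i * y i + x j * y j)"
    by (simp add: power2_eq_square algebra_simps)
  then have "rot i j c s x i * rot i j c s y i + rot i j c s x j * rot i j c s y j = x i * y i + x j * y j"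
    using ij cs by (simp add: rot_def)
  moreover have "(\<Sum>k\<in>{..<d} - {i} - {j}. rot i j c s x k * rot i j c s y k) = (\<Sum>k\<in>{..<d} - {i} - {j}. x k * y k)"
    by (rule sum.cong) (auto simp: rot_def)
  ultimately show ?thesis unfolding split[of x y] split[of "rot i j c s x"] by simp
qed

lemma rot_measurable: "i < d \<Longrightarrow> j < d \<Longrightarrow> rot i j c s \<in> gauss d \<rightarrow>\<^sub>M gauss d"
proof -
  assume ij: "i < d" "j < d"
  have std: "f \<in> gauss d \<rightarrow>\<^sub>M std_normal \<longleftrightarrow> f \<in> borel_measurable (gauss d)" for f
    using measurable_cong_sets[of "gauss d" "gauss d" std_normal borel] by simp
  have "(\<lambda>x. rot i j c s x k) \<in> borel_measurable (gauss d)" if "k < d" for k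
    using ij that unfolding rot_def fun_upd_def by measurable
  then have "(\<lambda>x. \<lambda>k\<in>{..<d}. rot i j c s x k) \<in> gauss d \<rightarrow>\<^sub>M PiM {..<d} (\<lambda>_. std_normal)"
    by (intro measurable_restrict) (auto simp: std)
  then have "(\<lambda>x. \<lambda>k\<in>{..<d}. rot i j c s x k) \<in> gauss d \<rightarrow>\<^sub>M gauss d" by (simp add: gauss_def)
  moreover have "(\<lambda>k\<in>{..<d}. rot i j c s x k) = rot i j c s x" if "x \<in> space (gauss d)" for x
    using that ij by (auto simp: gauss_def space_PiM rot_def fun_eq_iff restrict_def PiE_def extensional_def)
  ultimately show ?thesis by (rule measurable_cong[THEN iffD1, rotated]) simp
qed

lemma gauss_isometry_rot:
  assumes ij: "i < d" "j < d" "i \<noteq> j" and cs: "c\<^sup>2 + s\<^sup>2 = 1"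
  shows "gauss_isometry d (rot i j c s)"
proof -
  interpret P: product_prob_space "\<lambda>_::nat. std_normal" by (rule product_std_normal)
  let ?A = "{..<d} - {i} - {j}"
  let ?P = "PiM ?A (\<lambda>_. std_normal)"
  have A: "{..<d} = insert i (insert j ?A)" using ij by auto
  have B: "insert i (insert j ?A) = insert j (insert i ?A)" by auto
  have nn: "(\<integral>\<^sup>+x. f x \<partial>gauss d) = (\<integral>\<^sup>+x. \<integral>\<^sup>+b. \<integral>\<^sup>+a. f (x(j := b, i := a)) \<partial>std_normal \<partial>std_normal \<partial>?P)"
    and sec: "\<And>x. x \<in> space ?P \<Longrightarrow> (\<lambda>p. f (x(j := snd p, i := fst p))) \<in> borel_measurable (borel \<Otimes>\<^sub>M borel)"
    if f: "f \<in> borel_measurable (gauss d)" for f :: "_ \<Rightarrow> ennreal"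
  proof -
    have f': "f \<in> borel_measurable (PiM (insert i (insert j ?A)) (\<lambda>_. std_normal))"
      using f A by (simp add: gauss_def)
    have ai: "(\<lambda>(x, y). x(i := y)) \<in> PiM (insert j ?A) (\<lambda>_. std_normal) \<Otimes>\<^sub>M std_normal \<rightarrow>\<^sub>M PiM (insert i (insert j ?A)) (\<lambda>_. std_normal)"
      by (rule measurable_add_dim)
    have aj: "(\<lambda>(x, y). x(j := y)) \<in> ?P \<Otimes>\<^sub>M std_normal \<rightarrow>\<^sub>M PiM (insert j ?A) (\<lambda>_. std_normal)"
      by (rule measurable_add_dim)
    have g: "(\<lambda>x. \<integral>\<^sup>+a. f (x(i := a)) \<partial>std_normal) \<in> borel_measurable (PiM (insert j ?A) (\<lambda>_. std_normal))"
      by (rule P.M.borel_measurable_nn_integral)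
        (use measurable_compose[OF ai f'] in \<open>simp add: case_prod_unfold\<close>)
    have "(\<integral>\<^sup>+x. f x \<partial>gauss d) = (\<integral>\<^sup>+x. \<integral>\<^sup>+a. f (x(i := a)) \<partial>std_normal \<partial>PiM (insert j ?A) (\<lambda>_. std_normal))"
      unfolding gauss_def by (subst A, rule P.product_nn_integral_insert) (use f' ij in auto)
    also have "\<dots> = (\<integral>\<^sup>+x. \<integral>\<^sup>+b. \<integral>\<^sup>+a. f (x(j := b, i := a)) \<partial>std_normal \<partial>std_normal \<partial>?P)"
      by (rule P.product_nn_integral_insert[OF _ _ g]) auto
    finally show "(\<integral>\<^sup>+x. f x \<partial>gauss d) = (\<integral>\<^sup>+x. \<integral>\<^sup>+b. \<integral>\<^sup>+a. f (x(j := b, i := a)) \<partial>std_normal \<partial>std_normal \<partial>?P)" .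
    fix x assume x: "x \<in> space ?P"
    have sm: "(\<lambda>p. snd p) \<in> borel \<Otimes>\<^sub>M borel \<rightarrow>\<^sub>M std_normal" "(\<lambda>p. fst p) \<in> borel \<Otimes>\<^sub>M borel \<rightarrow>\<^sub>M std_normal" by simp_all
    have "(\<lambda>p. (x, snd p)) \<in> borel \<Otimes>\<^sub>M borel \<rightarrow>\<^sub>M ?P \<Otimes>\<^sub>M std_normal"
      by (rule measurable_Pair[OF measurable_const[OF x] sm(1)])
    from measurable_compose[OF this aj]
    have "(\<lambda>p. (x(j := snd p), fst p)) \<in> borel \<Otimes>\<^sub>M borel \<rightarrow>\<^sub>M PiM (insert j ?A) (\<lambda>_. std_normal) \<Otimes>\<^sub>M std_normal"
      by (intro measurable_Pair sm(2)) (simp add: fun_upd_def)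
    from measurable_compose[OF measurable_compose[OF this ai] f']
    show "(\<lambda>p. f (x(j := snd p, i := fst p))) \<in> borel_measurable (borel \<Otimes>\<^sub>M borel)" by (simp add: fun_upd_def)
  qed
  have inv: "(\<integral>\<^sup>+x. f (rot i j c s x) \<partial>gauss d) = (\<integral>\<^sup>+x. f x \<partial>gauss d)" if f: "f \<in> borel_measurable (gauss d)" for f :: "_ \<Rightarrow> ennreal"
  proof -
    have upd: "rot i j c s (x(j := b, i := a)) = x(j := c * b - s * a, i := c * a + s * b)" for x a b
      using ij by (auto simp: rot_def fun_eq_iff)
    have "(\<integral>\<^sup>+x. f (rot i j c s x) \<partial>gauss d)
        = (\<integral>\<^sup>+x. \<integral>\<^sup>+b. \<integral>\<^sup>+a. f (x(j := c * b - s * a, i := c * a + s * b)) \<partial>std_normal \<partial>std_normal \<partial>?P)"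
      by (subst nn[OF measurable_compose[OF rot_measurable[OF ij(1,2)] f]]) (simp only: upd)
    also have "\<dots> = (\<integral>\<^sup>+x. \<integral>\<^sup>+b. \<integral>\<^sup>+a. f (x(j := b, i := a)) \<partial>std_normal \<partial>std_normal \<partial>?P)"
    proof (rule nn_integral_cong)
      fix x assume x: "x \<in> space ?P"
      show "(\<integral>\<^sup>+b. \<integral>\<^sup>+a. f (x(j := c * b - s * a, i := c * a + s * b)) \<partial>std_normal \<partial>std_normal)
          = (\<integral>\<^sup>+b. \<integral>\<^sup>+a. f (x(j := b, i := a)) \<partial>std_normal \<partial>std_normal)"
        using std_normal_rotation[OF sec[OF f x] cs] by simp
    qed
    also have "\<dots> = (\<integral>\<^sup>+x. f x \<partial>gauss d)" by (rule nn[OF f, symmetric])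
    finally show ?thesis .
  qed
  have "distr (gauss d) (gauss d) (rot i j c s) = gauss d"
  proof (rule measure_eqI)
    fix E assume "E \<in> sets (distr (gauss d) (gauss d) (rot i j c s))"
    then have E: "E \<in> sets (gauss d)" by simp
    have "emeasure (distr (gauss d) (gauss d) (rot i j c s)) E = (\<integral>\<^sup>+x. indicator E x \<partial>distr (gauss d) (gauss d) (rot i j c s))"
      using E by simp
    also have "\<dots> = (\<integral>\<^sup>+x. indicator E (rot i j c s x) \<partial>gauss d)"
      by (rule nn_integral_distr[OF rot_measurable[OF ij(1,2)]]) (use E in simp)
    also have "\<dots> = (\<integral>\<^sup>+x. indicator E x \<partial>gauss d)" by (rule inv) (use E in simp)
    finally show "emeasure (distr (gauss d) (gauss d) (rot i j c s)) E = emeasure (gauss d) E" using E by simp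
  qed simp
  then show ?thesis using rot_measurable[OF ij(1,2)] ip_rot[OF ij cs] by (simp add: gauss_isometry_def)
qed

lemma givens_coefficients:
  "\<exists>c s :: real. c\<^sup>2 + s\<^sup>2 = 1 \<and> c * b - s * a = 0 \<and> 0 \<le> c * a + s * b"
proof (cases "a\<^sup>2 + b\<^sup>2 = 0")
  case True
  then have "a = 0" "b = 0" by (auto simp: add_nonneg_eq_0_iff)
  then show ?thesis by (intro exI[of _ 1] exI[of _ 0]) auto
next
  case False
  define r where "r = sqrt (a\<^sup>2 + b\<^sup>2)"
  have r: "r\<^sup>2 = a\<^sup>2 + b\<^sup>2" "0 \<le> r" by (simp_all add: r_def)
  have "(a / r)\<^sup>2 + (b / r)\<^sup>2 = (a\<^sup>2 + b\<^sup>2) / r\<^sup>2" by (simp add: power_divide add_divide_distrib)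
  then have "(a / r)\<^sup>2 + (b / r)\<^sup>2 = 1" using False r by simp
  moreover have "a / r * a + b / r * b = (a\<^sup>2 + b\<^sup>2) / r"
    by (simp add: power2_eq_square add_divide_distrib)
  then have "0 \<le> a / r * a + b / r * b" using r by simp
  ultimately show ?thesis by (intro exI[of _ "a / r"] exI[of _ "b / r"]) auto
qed

text \<open>Givens rotations in the planes \<open>(k, m)\<close>, \<open>m > k\<close>, sweep all mass of the coordinates
  from \<open>k\<close> on into coordinate \<open>k\<close>.\<close>

lemma givens_sweep:
  assumes "Suc k < d" "Suc k \<le> m" "m < d"
  shows "\<exists>T. gauss_isometry d T \<and> (\<forall>i. k < i \<longrightarrow> i \<le> m \<longrightarrow> T x i = 0) \<and> 0 \<le> T x k \<and>
    (\<forall>y i. i < k \<longrightarrow> T y i = y i) \<and> (\<forall>y. (\<forall>i\<ge>k. y i = 0) \<longrightarrow> T y = y)"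
  using assms(2,3)
proof (induction m rule: dec_induct)
  case base
  obtain c s where cs: "c\<^sup>2 + s\<^sup>2 = 1" "c * x (Suc k) - s * x k = 0" "0 \<le> c * x k + s * x (Suc k)"
    using givens_coefficients by blast
  show ?case
  proof (intro exI conjI)
    show "gauss_isometry d (rot k (Suc k) c s)" by (rule gauss_isometry_rot) (use cs assms(1) in auto)
    show "\<forall>i>k. i \<le> Suc k \<longrightarrow> rot k (Suc k) c s x i = 0" using cs by (auto simp: rot_def le_Suc_eq)
    show "0 \<le> rot k (Suc k) c s x k" using cs by (simp add: rot_def)
    show "\<forall>y i. i < k \<longrightarrow> rot k (Suc k) c s y i = y i" by (simp add: rot_def)
    show "\<forall>y. (\<forall>i\<ge>k. y i = 0) \<longrightarrow> rot k (Suc k) c s y = y"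
    proof (intro allI impI)
      fix y :: "nat \<Rightarrow> real" assume "\<forall>i\<ge>k. y i = 0"
      then have y0: "y k = 0" "y (Suc k) = 0" by auto
      show "rot k (Suc k) c s y = y" by (rule ext) (simp add: rot_def y0)
    qed
  qed
next
  case (step m)
  then obtain T where T: "gauss_isometry d T" "\<And>i. k < i \<Longrightarrow> i \<le> m \<Longrightarrow> T x i = 0" "0 \<le> T x k"
    "\<And>y i. i < k \<Longrightarrow> T y i = y i" "\<And>y. (\<forall>i\<ge>k. y i = 0) \<Longrightarrow> T y = y" by (metis Suc_lessD)
  define z where "z = T x"
  obtain c s where cs: "c\<^sup>2 + s\<^sup>2 = 1" "c * z (Suc m) - s * z k = 0" "0 \<le> c * z k + s * z (Suc m)"
    using givens_coefficients by blast
  let ?R = "rot k (Suc m) c s"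
  show ?case
  proof (intro exI conjI)
    show "gauss_isometry d (\<lambda>x. ?R (T x))"
      by (rule gauss_isometry_comp[OF gauss_isometry_rot T(1)]) (use cs assms(1) step in auto)
    show "\<forall>i>k. i \<le> Suc m \<longrightarrow> ?R (T x) i = 0"
      using cs T(2) step by (auto simp: rot_def z_def[symmetric] le_Suc_eq)
    show "0 \<le> ?R (T x) k" using cs step by (simp add: rot_def z_def[symmetric])
    show "\<forall>y i. i < k \<longrightarrow> ?R (T y) i = y i" using T(4) step by (simp add: rot_def)
    show "\<forall>y. (\<forall>i\<ge>k. y i = 0) \<longrightarrow> ?R (T y) = y"
    proof (intro allI impI)
      fix y :: "nat \<Rightarrow> real" assume y: "\<forall>i\<ge>k. y i = 0"
      then have y0: "y k = 0" "y (Suc m) = 0" using step by auto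
      show "?R (T y) = y" unfolding T(5)[OF y] by (rule ext) (simp add: rot_def y0)
    qed
  qed
qed

definition unit :: "nat \<Rightarrow> nat \<Rightarrow> real" where
  "unit k i = of_bool (i = k)"

lemma ip_unit_right: "k < d \<Longrightarrow> ip d x (unit k) = x k"
proof -
  assume k: "k < d"
  have "ip d x (unit k) = (\<Sum>i<d. if i = k then x i else 0)"
    unfolding ip_def unit_def by (intro sum.cong) auto
  then show ?thesis using k by simp
qed

text \<open>A first sweep carries \<open>q\<close> to the first unit vector. The image of
  \<open>z\<close> then has zero coordinate 0 by orthogonality, so a second sweep, which starts at
  coordinate 1 and leaves coordinate 0 alone, carries it to the second unit vector. The second sweep
  needs a coordinate 2, hence \<open>3 \<le> d\<close>. Nonnegativity of the pivots excludes the
  value -1.\<close>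

lemma isometry_to_units:
  assumes d: "3 \<le> d" and q: "ip d q q = 1" and z: "ip d z z = 1" and qz: "ip d q z = 0"
  shows "\<exists>T. gauss_isometry d T \<and> (\<forall>x. ip d x q = T x 0) \<and> (\<forall>x. ip d x z = T x 1)"
proof -
  obtain T where T: "gauss_isometry d T" "\<And>i. 0 < i \<Longrightarrow> i \<le> d - 1 \<Longrightarrow> T q i = 0" "0 \<le> T q 0"
  proof -
    have "Suc 0 < d" "Suc 0 \<le> d - 1" "d - 1 < d" using d by auto
    from givens_sweep[OF this, of q] show ?thesis using that by blast
  qed
  have Tip: "ip d (T x) (T y) = ip d x y" for x y using T(1) by (auto simp: gauss_isometry_def)
  have eq: "ip d x (T q) = x 0 * T q 0" for x
  proof -
    have "ip d x (T q) = (\<Sum>i<d. if i = 0 then x i * T q i else 0)"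
      unfolding ip_def using T(2) by (intro sum.cong) auto
    then show ?thesis using d by simp
  qed
  have "T q 0 * T q 0 = 1" using eq[of "T q"] Tip[of q q] q by simp
  then have q0: "T q 0 = 1" using T(3) square_eq_1_iff[of "T q 0"] by linarith
  have Tz0: "T z 0 = 0" using eq[of "T z"] Tip[of z q] qz q0 by (simp add: ip_commute)
  obtain S where S: "gauss_isometry d S" "\<And>i. 1 < i \<Longrightarrow> i \<le> d - 1 \<Longrightarrow> S (T z) i = 0" "0 \<le> S (T z) 1"
    "\<And>y i. i < 1 \<Longrightarrow> S y i = y i"
  proof -
    have "Suc 1 < d" "Suc 1 \<le> d - 1" "d - 1 < d" using d by auto
    from givens_sweep[OF this, of "T z"] show ?thesis using that by blast
  qed
  have Sip: "ip d (S x) (S y) = ip d x y" for x y using S(1) by (auto simp: gauss_isometry_def)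
  have eqz: "ip d x (S (T z)) = x 1 * S (T z) 1" for x
  proof -
    have "ip d x (S (T z)) = (\<Sum>i<d. if i = 1 then x i * S (T z) i else 0)"
      unfolding ip_def
    proof (intro sum.cong refl)
      fix i assume "i \<in> {..<d}"
      consider "i = 0" | "i = 1" | "1 < i" by linarith
      then show "x i * S (T z) i = (if i = 1 then x i * S (T z) i else 0)"
      proof cases
        case 1
        then show ?thesis using S(4)[of 0 "T z"] Tz0 by simp
      next
        case 3
        then show ?thesis using S(2)[of i] \<open>i \<in> {..<d}\<close> by simp
      qed simp
    qed
    then show ?thesis using d by simp
  qed
  have "S (T z) 1 * S (T z) 1 = 1" using eqz[of "S (T z)"] Sip[of "T z" "T z"] Tip[of z z] z by simp
  then have z1: "S (T z) 1 = 1" using S(3) square_eq_1_iff[of "S (T z) 1"] by linarith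
  show ?thesis
  proof (intro exI conjI allI)
    show "gauss_isometry d (\<lambda>x. S (T x))" by (rule gauss_isometry_comp[OF S(1) T(1)])
    show "ip d x q = S (T x) 0" for x using eq[of "T x"] Tip[of x q] q0 S(4)[of 0 "T x"] by simp
    show "ip d x z = S (T x) 1" for x using eqz[of "S (T x)"] Sip[of "T x" "T z"] Tip[of x z] z1 by simp
  qed
qed

lemma exists_orthogonal_unit:
  assumes d: "3 \<le> d" and q: "ip d q q = 1"
  shows "\<exists>z. ip d z z = 1 \<and> ip d q z = 0"
proof -
  define y where "y = (if q 0 = 0 \<and> q 1 = 0 then unit 0 else (\<lambda>i. q 1 * unit 0 i - q 0 * unit 1 i))"
  have d': "0 < d" "1 < d" using d by auto
  have yq: "ip d q y = 0" unfolding y_def using d'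
    by (auto simp: ip_linear ip_unit_right)
  have "ip d y y = (if q 0 = 0 \<and> q 1 = 0 then 1 else (q 1)\<^sup>2 + (q 0)\<^sup>2)"
    unfolding y_def using d'
    by (auto simp: ip_linear ip_unit_right power2_eq_square) (auto simp: unit_def)
  then have yy: "0 < ip d y y" by (auto simp: sum_power2_gt_zero_iff)
  define z where "z = (\<lambda>i. 1 / sqrt (ip d y y) * y i)"
  have "ip d z z = 1" unfolding z_def ip_linear using yy by (simp add: field_simps)
  moreover have "ip d q z = 0" unfolding z_def ip_linear using yq by simp
  ultimately show ?thesis by blast
qed

lemma distr_ip_gauss:
  assumes d: "3 \<le> d" and q: "ip d q q = 1" and B: "B \<in> sets borel"
  shows "\<P>(x in gauss d. ip d x q \<in> B) = measure std_normal B"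
proof -
  obtain z where z: "ip d z z = 1" "ip d q z = 0" using exists_orthogonal_unit[OF d q] by blast
  from isometry_to_units[OF d q z] obtain T
    where T: "gauss_isometry d T" "\<forall>x. ip d x q = T x 0" by (elim exE conjE)
  have Tm: "T \<in> gauss d \<rightarrow>\<^sub>M gauss d" and Td: "distr (gauss d) (gauss d) T = gauss d"
    using T(1) by (auto simp: gauss_isometry_def)
  have c0: "(\<lambda>x. x 0) \<in> borel_measurable (gauss d)" using d by (intro component_gauss) auto
  have "\<P>(x in gauss d. ip d x q \<in> B) = measure (gauss d) (T -` {x \<in> space (gauss d). x 0 \<in> B} \<inter> space (gauss d))"
    proof (intro arg_cong[where f="measure (gauss d)"] set_eqI iffI)
    fix x assume "x \<in> {x \<in> space (gauss d). ip d x q \<in> B}"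
    then show "x \<in> T -` {x \<in> space (gauss d). x 0 \<in> B} \<inter> space (gauss d)"
      using measurable_space[OF Tm, of x] T(2)[rule_format, of x] by simp
  next
    fix x assume "x \<in> T -` {x \<in> space (gauss d). x 0 \<in> B} \<inter> space (gauss d)"
    then show "x \<in> {x \<in> space (gauss d). ip d x q \<in> B}" using T(2)[rule_format, of x] by simp
  qed
  also have "\<dots> = measure (distr (gauss d) (gauss d) T) {x \<in> space (gauss d). x 0 \<in> B}"
  proof (rule measure_distr[symmetric, OF Tm])
    show "{x \<in> space (gauss d). x 0 \<in> B} \<in> sets (gauss d)"
      using measurable_sets[OF c0 B] unfolding vimage_def Int_def by (simp add: conj_commute)
  qed
  also have "\<dots> = \<P>(x in gauss d. x 0 \<in> B)" by (simp add: Td)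
  also have "{x \<in> space (gauss d). x 0 \<in> B} = (\<lambda>x. x 0) -` B \<inter> space (gauss d)" by blast
  also have "measure (gauss d) \<dots> = measure (distr (gauss d) std_normal (\<lambda>x. x 0)) B"
  proof (rule measure_distr[symmetric])
    show "(\<lambda>x. x 0) \<in> gauss d \<rightarrow>\<^sub>M std_normal" using c0 by simp
    show "B \<in> sets std_normal" using B by simp
  qed
  also have "distr (gauss d) std_normal (\<lambda>x. x 0) = std_normal"
    unfolding gauss_def by (rule distr_PiM_component[OF prob_space_std_normal]) (use d in simp)
  finally show ?thesis .
qed

lemma std_normal_interval:
  assumes "a \<le> b" "c \<ge> 0" "c \<le> a \<or> c = 0"
  shows "measure std_normal {a..b} \<le> (b - a) * exp (- c\<^sup>2 / 2)"
proof -
  interpret S: prob_space std_normal by (rule prob_space_std_normal)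
  have "emeasure std_normal {a..b} = (\<integral>\<^sup>+x. ennreal (std_normal_density x) * indicator {a..b} x \<partial>lborel)"
    by (subst emeasure_density) auto
  also have "\<dots> \<le> (\<integral>\<^sup>+x. ennreal (exp (- c\<^sup>2 / 2)) * indicator {a..b} x \<partial>lborel)"
  proof (rule nn_integral_mono)
    fix x :: real
    show "ennreal (std_normal_density x) * indicator {a..b} x \<le> ennreal (exp (- c\<^sup>2 / 2)) * indicator {a..b} x"
    proof (cases "x \<in> {a..b}")
      case True
      then have "c\<^sup>2 \<le> x\<^sup>2" using assms by (cases "c = 0") (auto intro!: power_mono)
      then have e: "exp (- x\<^sup>2 / 2) \<le> exp (- c\<^sup>2 / 2)" by simp
      have "1 \<le> sqrt (2 * pi)" using pi_ge_two by simp
      then have "std_normal_density x \<le> exp (- x\<^sup>2 / 2)"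
        using mult_left_mono[of 1 "sqrt (2 * pi)" "exp (- x\<^sup>2 / 2)"] by (simp add: std_normal_density_def divide_le_eq)
      then have "std_normal_density x \<le> exp (- c\<^sup>2 / 2)" using e by (rule order_trans)
      then show ?thesis by (intro mult_right_mono ennreal_leI) auto
    qed simp
  qed
  also have "\<dots> = ennreal (exp (- c\<^sup>2 / 2)) * ennreal (b - a)"
    by (subst nn_integral_cmult) (use assms(1) in auto)
  finally have "ennreal (measure std_normal {a..b}) \<le> ennreal ((b - a) * exp (- c\<^sup>2 / 2))"
    using assms(1) by (simp add: S.emeasure_eq_measure ennreal_mult[symmetric] mult.commute)
  then show ?thesis using assms(1) by (subst (asm) ennreal_le_iff) auto
qed

lemma distr_PiM_isometry:
  assumes I: "finite I" and T: "gauss_isometry d T"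
  shows "distr (PiM I (\<lambda>_. gauss d)) (PiM I (\<lambda>_. gauss d)) (\<lambda>x. \<lambda>i\<in>I. T (x i)) = PiM I (\<lambda>_::nat. gauss d)"
proof -
  interpret P: product_prob_space "\<lambda>_::nat. gauss d"
    by (rule product_prob_spaceI) (rule prob_space_gauss)
  have Tm: "T \<in> gauss d \<rightarrow>\<^sub>M gauss d" and Td: "distr (gauss d) (gauss d) T = gauss d"
    using T by (auto simp: gauss_isometry_def)
  have m: "(\<lambda>x. \<lambda>i\<in>I. T (x i)) \<in> PiM I (\<lambda>_. gauss d) \<rightarrow>\<^sub>M PiM I (\<lambda>_. gauss d)"
  proof (rule measurable_restrict)
    fix i assume "i \<in> I"
    then have "(\<lambda>x. x i) \<in> PiM I (\<lambda>_. gauss d) \<rightarrow>\<^sub>M gauss d" by (rule measurable_component_singleton)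
    from measurable_compose[OF this Tm] show "(\<lambda>x. T (x i)) \<in> PiM I (\<lambda>_. gauss d) \<rightarrow>\<^sub>M gauss d" .
  qed
  show ?thesis
  proof (rule P.PiM_eqI[OF I])
    show "sets (distr (PiM I (\<lambda>_. gauss d)) (PiM I (\<lambda>_. gauss d)) (\<lambda>x. \<lambda>i\<in>I. T (x i))) = sets (PiM I (\<lambda>_. gauss d))" by simp
    fix A assume A: "\<And>i. i \<in> I \<Longrightarrow> A i \<in> sets (gauss d)"
    have B: "T -` A i \<inter> space (gauss d) \<in> sets (gauss d)" if "i \<in> I" for i
      using measurable_sets[OF Tm A[OF that]] .
    have "emeasure (distr (PiM I (\<lambda>_. gauss d)) (PiM I (\<lambda>_. gauss d)) (\<lambda>x. \<lambda>i\<in>I. T (x i))) (Pi\<^sub>E I A)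
        = emeasure (PiM I (\<lambda>_. gauss d)) ((\<lambda>x. \<lambda>i\<in>I. T (x i)) -` (Pi\<^sub>E I A) \<inter> space (PiM I (\<lambda>_. gauss d)))"
      by (rule emeasure_distr[OF m]) (rule sets_PiM_I_finite[OF I A])
    also have "(\<lambda>x. \<lambda>i\<in>I. T (x i)) -` (Pi\<^sub>E I A) \<inter> space (PiM I (\<lambda>_. gauss d)) = Pi\<^sub>E I (\<lambda>i. T -` A i \<inter> space (gauss d))"
      by (auto simp: space_PiM PiE_def Pi_def)
    also have "emeasure (PiM I (\<lambda>_. gauss d)) \<dots> = (\<Prod>i\<in>I. emeasure (gauss d) (T -` A i \<inter> space (gauss d)))"
      by (rule P.emeasure_PiM[OF I B])
    also have "\<dots> = (\<Prod>i\<in>I. emeasure (distr (gauss d) (gauss d) T) (A i))"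
      by (intro prod.cong refl emeasure_distr[symmetric] Tm A)
    finally show "emeasure (distr (PiM I (\<lambda>_. gauss d)) (PiM I (\<lambda>_. gauss d)) (\<lambda>x. \<lambda>i\<in>I. T (x i))) (Pi\<^sub>E I A)
        = (\<Prod>i\<in>I. emeasure (gauss d) (A i))" unfolding Td .
  qed
qed

declare component_gauss [measurable del]

lemma gauss_upper1:
  assumes u: "ip d u u \<le> 1" and a: "0 \<le> a"
  shows "\<P>(x in gauss d. a \<le> ip d x u) \<le> exp (- a\<^sup>2 / 2)"
proof -
  interpret G: prob_space "gauss d" by (rule prob_space_gauss)
  have "\<P>(x in gauss d. a \<le> ip d x u)
      \<le> \<P>(x in gauss d. a\<^sup>2 \<le> ip d x (\<lambda>i. a * u i))"
    by (rule G.finite_measure_mono)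
      (use a in \<open>auto simp: ip_scale_right power2_eq_square intro: mult_left_mono\<close>)
  also have "\<dots> \<le> exp (ip d (\<lambda>i. a * u i) (\<lambda>i. a * u i) / 2 - a\<^sup>2)" by (rule gauss_upper)
  also have "ip d (\<lambda>i. a * u i) (\<lambda>i. a * u i) = a\<^sup>2 * ip d u u" unfolding ip_linear by (simp add: power2_eq_square)
  also have "exp (a\<^sup>2 * ip d u u / 2 - a\<^sup>2) \<le> exp (- a\<^sup>2 / 2)"
    using mult_left_mono[OF u, of "a\<^sup>2"] by simp
  finally show ?thesis .
qed

text \<open>Exponential Markov along the sum of the three directions weighted by their thresholds;
  for nearly orthogonal directions the cross terms are small. The alternative \<open>b = 0\<close>
  covers vertices of negative level, whose level constraint gives nothing.\<close>

lemma gauss_upper3: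
  assumes u: "ip d u u = 1" "ip d v v = 1" "ip d w w = 1" and ab: "0 \<le> a" "0 \<le> b" "0 \<le> c"
  shows "\<P>(x in gauss d. a \<le> ip d x u \<and> (b = 0 \<or> b \<le> ip d x v) \<and> c \<le> ip d x w)
    \<le> exp (- (a\<^sup>2 + b\<^sup>2 + c\<^sup>2) / 2 + a * b * ip d u v + a * c * ip d u w + b * c * ip d v w)"
proof -
  interpret G: prob_space "gauss d" by (rule prob_space_gauss)
  define s where "s = (\<lambda>i. a * u i + (b * v i + c * w i))"
  have s: "ip d x s = a * ip d x u + (b * ip d x v + c * ip d x w)" for x by (simp add: s_def ip_linear)
  have ss: "ip d s s = a\<^sup>2 + b\<^sup>2 + c\<^sup>2 + 2 * (a * b * ip d u v) + 2 * (a * c * ip d u w) + 2 * (b * c * ip d v w)"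
    unfolding s_def ip_linear using u
    by (simp add: ip_commute[of d v u] ip_commute[of d w u] ip_commute[of d w v] power2_eq_square algebra_simps)
  have "\<P>(x in gauss d. a \<le> ip d x u \<and> (b = 0 \<or> b \<le> ip d x v) \<and> c \<le> ip d x w)
      \<le> \<P>(x in gauss d. a\<^sup>2 + b\<^sup>2 + c\<^sup>2 \<le> ip d x s)"
  proof (rule G.finite_measure_mono)
    show "{x \<in> space (gauss d). a \<le> ip d x u \<and> (b = 0 \<or> b \<le> ip d x v) \<and> c \<le> ip d x w}
        \<subseteq> {x \<in> space (gauss d). a\<^sup>2 + b\<^sup>2 + c\<^sup>2 \<le> ip d x s}"
    proof (rule subsetI, rule CollectI, elim CollectE conjE, rule conjI)
      fix x assume "a \<le> ip d x u" "c \<le> ip d x w" "b = 0 \<or> b \<le> ip d x v"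
      then have "a * a \<le> a * ip d x u" "b * b \<le> b * ip d x v" "c * c \<le> c * ip d x w"
        using ab by (auto intro: mult_left_mono)
      then show "a\<^sup>2 + b\<^sup>2 + c\<^sup>2 \<le> ip d x s" by (simp add: s power2_eq_square)
    qed
  qed measurable
  also have "\<dots> \<le> exp (ip d s s / 2 - (a\<^sup>2 + b\<^sup>2 + c\<^sup>2))" by (rule gauss_upper)
  also have "ip d s s / 2 - (a\<^sup>2 + b\<^sup>2 + c\<^sup>2)
      = - (a\<^sup>2 + b\<^sup>2 + c\<^sup>2) / 2 + a * b * ip d u v + a * c * ip d u w + b * c * ip d v w"
    by (simp add: ss add_divide_distrib)
  finally show ?thesis .
qed

abbreviation gauss2 :: "nat \<Rightarrow> ((nat \<Rightarrow> real) \<times> (nat \<Rightarrow> real)) measure" where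
  "gauss2 d \<equiv> gauss d \<Otimes>\<^sub>M gauss d"

text \<open>Unlike \<open>normalize\<close> this is a plain scalar multiple, so the rules
  \<open>ip_linear\<close> apply to it.\<close>

definition dir :: "nat \<Rightarrow> (nat \<Rightarrow> real) \<Rightarrow> (nat \<Rightarrow> real)" where
  "dir d u = (\<lambda>i. 1 / nrm d u * u i)"

lemma ip_dir_right: "ip d x (dir d u) = ip d x u / nrm d u"
  unfolding dir_def ip_scale_right by simp

lemma ip_dir_left: "ip d (dir d u) x = ip d u x / nrm d u"
  unfolding dir_def ip_scale_left by simp

lemma nrm_square: "nrm d u * nrm d u = ip d u u"
  using ip_self_nonneg[of d u] by (simp add: nrm_def)

lemma nrm_measurable [measurable]: "nrm d \<in> borel_measurable (gauss d)"
  unfolding nrm_def by measurable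

lemma ip_dir_self: "0 < nrm d u \<Longrightarrow> ip d (dir d u) (dir d u) = 1"
  using nrm_square[of d u, symmetric] by (simp add: ip_dir_left ip_dir_right)

subsection \<open>The Gaussian near neighbor graph\<close>

text \<open>\<open>\<xi>\<close> is the tolerance in exponents. The lower bound on
  \<open>sqrt lam\<close> lets factors \<open>exp (\<xi> * lam)\<close> swallow constants and powers
  of \<open>lam\<close>. \<open>\<sigma>\<close> is the scale on which relevant inner products of
  unit vectors live; its smallness encodes \<open>n = 2 powr o(d)\<close>. The relative fluctuation
  \<open>\<eta>\<close> of squared norms is taken as \<open>12 * \<sigma>\<close> so that
  \<open>\<eta>\<^sup>2 * real d / 16 = 9 * lam\<close>. The loss \<open>6 * \<xi>\<close> in
  \<open>\<kappa>\<close> keeps the index cutoff \<open>J\<close> below \<open>n\<close>.\<close>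

locale regime =
  fixes d n :: nat and \<kappa> \<rho> \<xi> lam \<sigma> \<eta> :: real
  assumes d3: "3 \<le> d"
    and eps: "0 < \<xi>" "\<xi> \<le> 1 / 100"
    and rho: "0 \<le> \<rho>" "\<rho> \<le> 1 / 2"
    and kappa: "\<kappa> = 1 - \<rho> - 6 * \<xi>"
    and lam: "lam = ln (real n)" "400 / \<xi> \<le> sqrt lam"
    and sigma: "\<sigma> = sqrt (lam / real d)" "\<sigma> \<le> \<xi> / 1000"
    and eta: "\<eta> = 12 * \<sigma>"
begin

sublocale G: prob_space "gauss d" by (rule prob_space_gauss)

text \<open>Multiplied by \<open>rd\<close>, thresholds on unit vectors turn into thresholds on
  standard Gaussian inner products: \<open>A\<close> has tail exponent \<open>\<kappa> * lam\<close>
  and \<open>g0 * rd\<close> has tail exponent \<open>\<rho> * lam\<close>.\<close>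

definition A where "A = sqrt (2 * \<kappa> * lam)"
definition \<alpha> where "\<alpha> = A / sqrt (real d)"
definition g0 where "g0 = sqrt (2 * \<rho> * lam) / sqrt (real d)"
definition rd where "rd = sqrt (real d)"

lemma basic:
  shows "0 < rd" "rd\<^sup>2 = real d" "40000 \<le> sqrt lam" "0 < lam" "1 \<le> lam" "sqrt lam * sqrt lam = lam" "sqrt lam \<le> lam / 40000"
    "0 < \<sigma>" "\<sigma> * rd = sqrt lam" "\<sigma> \<le> 1 / 100000" "0 < \<eta>" "\<eta> \<le> 1 / 1000"
    "1 / 4 \<le> \<kappa>" "\<kappa> \<le> 1" "1 < n"
    "0 \<le> A" "A\<^sup>2 = 2 * \<kappa> * lam" "A \<le> 3 / 2 * sqrt lam" "\<alpha> * rd = A" "0 < \<alpha>" "0 \<le> g0"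
    "exp lam = real n"
proof -
  show rd: "0 < rd" "rd\<^sup>2 = real d" using d3 by (auto simp: rd_def)
  have "40000 \<le> 400 / \<xi>" using eps by (simp add: field_simps)
  then show sl: "40000 \<le> sqrt lam" using lam by simp
  then have "0 < sqrt lam" by linarith
  then show l0: "0 < lam" by simp
  then show ll: "sqrt lam * sqrt lam = lam" by simp
  then have "40000 * sqrt lam \<le> lam" using mult_right_mono[OF sl, of "sqrt lam"] l0 by simp
  then show "sqrt lam \<le> lam / 40000" by simp
  then show l1: "1 \<le> lam" using sl by linarith
  show s0: "0 < \<sigma>" using l0 d3 by (simp add: sigma)
  show "\<sigma> * rd = sqrt lam" using d3 by (simp add: sigma rd_def real_sqrt_divide)
  show "\<sigma> \<le> 1 / 100000" using sigma eps by linarith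
  show "0 < \<eta>" "\<eta> \<le> 1 / 1000" using s0 sigma eps by (auto simp: eta)
  show k: "1 / 4 \<le> \<kappa>" "\<kappa> \<le> 1" using kappa rho eps by auto
  show "1 < n" using l0 lam by (metis ln_gt_zero_iff not_less_iff_gr_or_eq of_nat_0_eq_iff of_nat_0_less_iff
      of_nat_1 of_nat_less_iff less_irrefl ln_0 neq0_conv)
  have kl: "0 \<le> 2 * \<kappa> * lam" using k l0 by (auto intro!: mult_nonneg_nonneg)
  show "0 \<le> A" using kl by (simp add: A_def)
  show A2: "A\<^sup>2 = 2 * \<kappa> * lam" using kl by (simp add: A_def)
  have "A\<^sup>2 \<le> (3 / 2 * sqrt lam)\<^sup>2" using A2 k l0 ll by (simp add: power2_eq_square mult_right_mono)
  then show "A \<le> 3 / 2 * sqrt lam" by (rule power2_le_imp_le) (use l0 in simp)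
  show "\<alpha> * rd = A" using rd by (simp add: \<alpha>_def rd_def)
  show "0 < \<alpha>" using k l0 d3 by (simp add: \<alpha>_def A_def)
  show "0 \<le> g0" using rho l0 by (simp add: g0_def)
  show "exp lam = real n" using lam l0 \<open>1 < n\<close> by simp
qed

end

text \<open>The query is a fixed unit vector from here on; its randomness returns at the end through
  conditioning on row 0 of the matrix.\<close>

locale query_regime = regime +
  fixes q :: "nat \<Rightarrow> real"
  assumes q: "ip d q q = 1"
begin

definition lev where "lev u = ip d u q / nrm d u"
definition good where "good u \<longleftrightarrow> (1 - \<eta>) * real d \<le> ip d u u \<and> ip d u u \<le> (1 + \<eta>) * real d \<and> \<bar>ip d u q\<bar> \<le> 4 * sqrt lam"
definition lp where "lp u = max (lev u) 0"
text \<open>The Gaussian tail exponent of the level of \<open>u\<close>: reaching that level costs a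
  fresh point a factor \<open>exp (- Lv u)\<close> up to the tolerance. The positive part enters
  because a negative level costs nothing.\<close>

definition Lv where "Lv u = real d * (lp u)\<^sup>2 / 2"
text \<open>Cutting the walk off at neighbours of index at most \<open>J u\<close> does not change it with high
  probability, because a vertex below \<open>g0\<close> has an improving neighbour of such an index; but it
  keeps the expected number of examined improving neighbours at \<open>n powr O(\<xi>)\<close>.\<close>

definition J where "J u = (if lev u < g0 then exp (\<kappa> * lam + Lv u + 2 * \<xi> * lam) else real n)"

definition adj where "adj u y \<longleftrightarrow> \<alpha> * (nrm d u * nrm d y) \<le> ip d u y"
definition imp where "imp u y \<longleftrightarrow> good u \<and> good y \<and> adj u y \<and> lev u + 1 / real d \<le> lev y"
definition Rel0 :: "nat \<Rightarrow> (nat \<Rightarrow> real) \<Rightarrow> (nat \<Rightarrow> real) \<Rightarrow> bool" where "Rel0 j u y \<longleftrightarrow> imp u y \<and> real j \<le> J u"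
text \<open>Belongs to the walk frozen once it has reached level \<open>g0\<close>; its endpoints
  are the vertices that are tested against the planted direction.\<close>

definition Rel1 :: "nat \<Rightarrow> (nat \<Rightarrow> real) \<Rightarrow> (nat \<Rightarrow> real) \<Rightarrow> bool" where "Rel1 j u y \<longleftrightarrow> Rel0 j u y \<and> lev u < g0"
text \<open>One-sided, since only positive correlation of two vertices makes a common neighbour more
  likely. The bound \<open>\<xi> / 4\<close> limits the corresponding cross term in the exponent to
  \<open>\<xi> * lam / 2\<close>.\<close>

definition Orth where "Orth u y \<longleftrightarrow> (good u \<and> good y \<longrightarrow> ip d u y \<le> \<xi> / 4 * (nrm d u * nrm d y))"

lemma lev_measurable [measurable]: "lev \<in> borel_measurable (gauss d)"
  unfolding lev_def by measurable

lemma good_measurable [measurable]: "Measurable.pred (gauss d) good"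
  unfolding good_def by measurable

lemma lp_measurable [measurable]: "lp \<in> borel_measurable (gauss d)"
  unfolding lp_def by measurable

lemma J_measurable [measurable]: "J \<in> borel_measurable (gauss d)"
  unfolding J_def Lv_def by measurable

lemma ip2_measurable [measurable]: "(\<lambda>p. ip d (fst p) (snd p)) \<in> borel_measurable (gauss2 d)"
  using ip_measurable2[of d] by (simp add: case_prod_unfold)

lemma pair_measurable:
  "Measurable.pred (gauss2 d) (\<lambda>(u, y). adj u y)"
  "Measurable.pred (gauss2 d) (\<lambda>(u, y). imp u y)"
  "Measurable.pred (gauss2 d) (\<lambda>(u, y). Rel0 j u y)"
  "Measurable.pred (gauss2 d) (\<lambda>(u, y). Rel1 j u y)"
  "Measurable.pred (gauss2 d) (\<lambda>(u, y). Rel0 j u y \<and> lev y < lev u + W)"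
  "Measurable.pred (gauss2 d) (\<lambda>(u, y). Orth u y)"
  unfolding Rel1_def Rel0_def imp_def adj_def Orth_def case_prod_unfold by measurable

text \<open>Both causes of failure have exponent at least 8: the norm by the choice of
  \<open>\<eta>\<close>, the inner product with the query because \<open>4 * sqrt lam\<close> has
  Gaussian exponent \<open>8 * lam\<close>. This survives a union bound over the vertices and is
  negligible against events of probability at least \<open>exp (- 2 * lam)\<close>.\<close>

lemma not_good_le: "\<P>(x in gauss d. \<not> good x) \<le> 4 * exp (- 8 * lam)"
proof -
  note b = basic
  define N where "N = {x \<in> space (gauss d). (1 + \<eta>) * real d < ip d x x \<or> ip d x x < (1 - \<eta>) * real d}"
  define P where "P = {x \<in> space (gauss d). 16 * lam \<le> ip d x (\<lambda>i. (4 * sqrt lam) * q i)}"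
  define Q where "Q = {x \<in> space (gauss d). 16 * lam \<le> ip d x (\<lambda>i. (- 4 * sqrt lam) * q i)}"
  have m: "N \<in> G.events" "P \<in> G.events" "Q \<in> G.events" unfolding N_def P_def Q_def by measurable
  have "\<eta>\<^sup>2 * real d = 144 * lam"
  proof -
    have "\<eta>\<^sup>2 * real d = 144 * (\<sigma> * rd)\<^sup>2" using b(2) by (simp add: eta power_mult_distrib)
    then show ?thesis using b by (simp add: power2_eq_square)
  qed
  then have N: "G.prob N \<le> 2 * exp (- 9 * lam)"
    using gauss_norm_tail[of \<eta> d] b(11,12) unfolding N_def by simp
  have PQ: "G.prob P \<le> exp (- 8 * lam)" "G.prob Q \<le> exp (- 8 * lam)"
  proof -
    have 1: "ip d (\<lambda>i. (4 * sqrt lam) * q i) (\<lambda>i. (4 * sqrt lam) * q i) = 16 * lam"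
      using q b(6) unfolding ip_linear by simp
    have 2: "ip d (\<lambda>i. (- 4 * sqrt lam) * q i) (\<lambda>i. (- 4 * sqrt lam) * q i) = 16 * lam"
      using q b(6) unfolding ip_linear by simp
    show "G.prob P \<le> exp (- 8 * lam)"
      using gauss_upper[of d "16 * lam" "\<lambda>i. (4 * sqrt lam) * q i"] unfolding P_def 1 by simp
    show "G.prob Q \<le> exp (- 8 * lam)"
      using gauss_upper[of d "16 * lam" "\<lambda>i. (- 4 * sqrt lam) * q i"] unfolding Q_def 2 by simp
  qed
  have "\<P>(x in gauss d. \<not> good x) \<le> G.prob (N \<union> P \<union> Q)"
  proof (rule G.finite_measure_mono)
    show "{x \<in> space (gauss d). \<not> good x} \<subseteq> N \<union> P \<union> Q"
    proof
      fix x assume "x \<in> {x \<in> space (gauss d). \<not> good x}"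
      then have x: "x \<in> space (gauss d)" "\<not> good x" by auto
      show "x \<in> N \<union> P \<union> Q"
      proof (cases "x \<in> N")
        case False
        then have "4 * sqrt lam < \<bar>ip d x q\<bar>" using x by (auto simp: N_def good_def)
        then have "4 * sqrt lam * (4 * sqrt lam) \<le> 4 * sqrt lam * \<bar>ip d x q\<bar>"
          using b(3,4) by (intro mult_left_mono) auto
        then have "16 * lam \<le> 4 * sqrt lam * \<bar>ip d x q\<bar>" using b(4,6) by simp
        then have "16 * lam \<le> ip d x (\<lambda>i. (4 * sqrt lam) * q i) \<or> 16 * lam \<le> ip d x (\<lambda>i. (- 4 * sqrt lam) * q i)"
          unfolding ip_scale_right by (cases "0 \<le> ip d x q") auto
        then show ?thesis using x unfolding P_def Q_def by blast
      qed simp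
    qed
  qed (use m in auto)
  also have "\<dots> \<le> G.prob (N \<union> P) + G.prob Q" by (rule measure_Un_le) (use m in auto)
  also have "G.prob (N \<union> P) \<le> G.prob N + G.prob P" by (rule measure_Un_le) (use m in auto)
  also have "G.prob N + G.prob P + G.prob Q \<le> 2 * exp (- 9 * lam) + exp (- 8 * lam) + exp (- 8 * lam)"
    using N PQ by linarith
  also have "\<dots> \<le> 4 * exp (- 8 * lam)" using b(4) by simp
  finally show ?thesis by simp
qed

lemma good_bounds:
  assumes "good u"
  shows "0 < nrm d u" "(1 - \<eta>) * rd \<le> nrm d u" "nrm d u \<le> (1 + \<eta>) * rd" "\<bar>lev u\<bar> \<le> 5 * \<sigma>"
    "0 \<le> lp u" "lp u \<le> 5 * \<sigma>" "lp u * rd \<le> 5 * sqrt lam" "Lv u = (lp u * rd)\<^sup>2 / 2" "Lv u \<le> 25 / 2 * lam"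
proof -
  note b = basic
  have "((1 - \<eta>) * rd)\<^sup>2 \<le> (nrm d u)\<^sup>2"
  proof -
    have "((1 - \<eta>) * rd)\<^sup>2 = (1 - \<eta>) * ((1 - \<eta>) * real d)" using b(2) by (simp add: power_mult_distrib power2_eq_square)
    also have "\<dots> \<le> 1 * ((1 - \<eta>) * real d)" using b(11,12) by (intro mult_right_mono) auto
    also have "\<dots> \<le> ip d u u" using assms by (simp add: good_def)
    finally show ?thesis using nrm_square[of d u] by (simp add: power2_eq_square)
  qed
  then show l: "(1 - \<eta>) * rd \<le> nrm d u" by (rule power2_le_imp_le) (simp add: nrm_def ip_self_nonneg)
  have "(nrm d u)\<^sup>2 \<le> ((1 + \<eta>) * rd)\<^sup>2"
  proof -
    have "(nrm d u)\<^sup>2 \<le> 1 * ((1 + \<eta>) * real d)" using assms nrm_square[of d u] by (simp add: power2_eq_square good_def)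
    also have "\<dots> \<le> (1 + \<eta>) * ((1 + \<eta>) * real d)" using b(11,12) by (intro mult_right_mono) auto
    also have "\<dots> = ((1 + \<eta>) * rd)\<^sup>2" using b(2) by (simp add: power_mult_distrib power2_eq_square)
    finally show ?thesis .
  qed
  then show "nrm d u \<le> (1 + \<eta>) * rd" by (rule power2_le_imp_le) (use b in auto)
  have "9 / 10 * rd \<le> (1 - \<eta>) * rd" using b by (intro mult_right_mono) auto
  then have l': "9 / 10 * rd \<le> nrm d u" using l by linarith
  then show n0: "0 < nrm d u" using b(1) by linarith
  have "\<bar>ip d u q\<bar> \<le> 4 * (\<sigma> * rd)" using assms b(9) by (simp add: good_def)
  also have "\<dots> \<le> 5 * \<sigma> * (9 / 10 * rd)" using b(1,8) by simp
  also have "\<dots> \<le> 5 * \<sigma> * nrm d u" using l' b(8) by (intro mult_left_mono) auto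
  finally show lv: "\<bar>lev u\<bar> \<le> 5 * \<sigma>" using n0 by (simp add: lev_def divide_le_eq)
  show lp: "0 \<le> lp u" "lp u \<le> 5 * \<sigma>" using lv b(8) by (auto simp: lp_def)
  have "lp u * rd \<le> 5 * \<sigma> * rd" using lp b by (intro mult_right_mono) auto
  then show lr: "lp u * rd \<le> 5 * sqrt lam" using b(9) by (simp add: mult.assoc)
  show Lv: "Lv u = (lp u * rd)\<^sup>2 / 2" using b(2) by (simp add: Lv_def power_mult_distrib)
  have "(lp u * rd)\<^sup>2 \<le> (5 * sqrt lam)\<^sup>2" using lr lp b by (intro power_mono) auto
  then show "Lv u \<le> 25 / 2 * lam" unfolding Lv using b(6) by (simp add: power2_eq_square)
qed

lemma good_adj:
  assumes "good y" "adj u y" "0 < nrm d u"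
  shows "A * (1 - \<eta>) \<le> ip d y (dir d u)"
proof -
  have "A * (1 - \<eta>) = \<alpha> * ((1 - \<eta>) * rd)" using basic(19) by (simp add: mult_ac)
  also have "\<dots> \<le> \<alpha> * nrm d y" using good_bounds(2)[OF assms(1)] basic by (intro mult_left_mono) auto
  also have "\<dots> \<le> ip d y (dir d u)"
    using assms(2,3) by (simp add: adj_def ip_dir_right ip_commute[of d u y] field_simps)
  finally show ?thesis .
qed

lemma good_lev:
  assumes "good y" "l \<le> lev y" "0 \<le> l"
  shows "l * rd * (1 - \<eta>) \<le> ip d y q"
proof -
  have "l * rd * (1 - \<eta>) = l * ((1 - \<eta>) * rd)" by simp
  also have "\<dots> \<le> lev y * nrm d y" using assms good_bounds(1,2)[OF assms(1)] basic
    by (intro mult_mono) auto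
  also have "\<dots> = ip d y q" using good_bounds(1)[OF assms(1)] by (simp add: lev_def)
  finally show ?thesis .
qed

lemma square_loss: "0 \<le> x \<Longrightarrow> x \<le> X \<Longrightarrow> x - 24 * \<sigma> * X \<le> x * (1 - \<eta>)\<^sup>2"
proof -
  assume x: "0 \<le> x" "x \<le> X"
  have "(1 - \<eta>)\<^sup>2 = 1 - 24 * \<sigma> + \<eta>\<^sup>2" by (simp add: power2_eq_square eta algebra_simps)
  then have "x * (1 - 24 * \<sigma>) \<le> x * (1 - \<eta>)\<^sup>2" using x by (intro mult_left_mono) auto
  moreover have "\<sigma> * x \<le> \<sigma> * X" using x basic by (intro mult_left_mono) auto
  ultimately show ?thesis by (simp add: algebra_simps)
qed

lemma eps_lam: "\<sigma> * lam \<le> \<xi> * lam / 1000" "0 < \<xi> * lam" "400 \<le> \<xi> * sqrt lam" "sqrt lam \<le> \<xi> * lam / 400" "1600 \<le> \<xi> * lam"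
proof -
  note b = basic
  show "\<sigma> * lam \<le> \<xi> * lam / 1000" using mult_right_mono[OF sigma(2), of lam] b(4) by simp
  show "0 < \<xi> * lam" using eps b by simp
  show e: "400 \<le> \<xi> * sqrt lam" using lam(2) eps by (simp add: field_simps)
  have "400 * sqrt lam \<le> (\<xi> * sqrt lam) * sqrt lam" using e b(3,4) by (intro mult_right_mono) auto
  then show s: "sqrt lam \<le> \<xi> * lam / 400" using b(6) by (simp add: mult.assoc)
  show "1600 \<le> \<xi> * lam" using s b(3) by simp
qed

lemma kappa_loss: "\<kappa> * lam - \<xi> * lam / 40 \<le> (A * (1 - \<eta>))\<^sup>2 / 2"
proof -
  note b = basic
  have "\<kappa> * lam - 24 * \<sigma> * lam \<le> \<kappa> * lam * (1 - \<eta>)\<^sup>2"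
    by (rule square_loss) (use b in \<open>auto intro!: mult_nonneg_nonneg simp: mult_le_cancel_right1\<close>)
  moreover have "(A * (1 - \<eta>))\<^sup>2 / 2 = \<kappa> * lam * (1 - \<eta>)\<^sup>2" using b(17) by (simp add: power_mult_distrib)
  ultimately show ?thesis using eps_lam by simp
qed

lemma A_eta: "0 \<le> A * (1 - \<eta>)" "A * (1 - \<eta>) \<le> A"
proof -
  note b = basic
  show "0 \<le> A * (1 - \<eta>)" using b by auto
  show "A * (1 - \<eta>) \<le> A" using mult_left_mono[of "1 - \<eta>" 1 A] b by simp
qed

lemma prob_adj_le:
  assumes "0 < nrm d u"
  shows "\<P>(y in gauss d. good y \<and> adj u y) \<le> exp (- \<kappa> * lam + \<xi> * lam)"
proof -
  have "\<P>(y in gauss d. good y \<and> adj u y)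
      \<le> \<P>(x in gauss d. A * (1 - \<eta>) \<le> ip d x (dir d u))"
    by (rule G.finite_measure_mono) (use good_adj assms in auto)
  also have "\<dots> \<le> exp (- (A * (1 - \<eta>))\<^sup>2 / 2)"
    by (rule gauss_upper1) (use ip_dir_self[OF assms] A_eta in auto)
  also have "\<dots> \<le> exp (- \<kappa> * lam + \<xi> * lam)" using kappa_loss eps_lam(2) by simp
  finally show ?thesis .
qed

lemma imp_level:
  assumes "imp u y"
  shows "lp u * rd * (1 - \<eta>) = 0 \<or> lp u * rd * (1 - \<eta>) \<le> ip d y q"
proof (cases "0 < lev u")
  case True
  have "lev u \<le> lev y" using assms by (auto simp: imp_def) (meson add_increasing2 le_add_same_cancel1 of_nat_0_le_iff order_trans zero_le_divide_1_iff)
  then show ?thesis using True assms by (intro disjI2 good_lev) (auto simp: lp_def imp_def)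
qed (simp add: lp_def)

text \<open>The directions of \<open>u\<close>, of \<open>q\<close> and of \<open>v\<close> are
  nearly orthogonal, so the exponents of the three constraints add up: \<open>\<kappa> * lam\<close>
  twice for the adjacencies and \<open>Lv u\<close> for the level. The cross terms with
  \<open>q\<close> are of order \<open>\<sigma> * lam\<close> because good vertices have level at
  most \<open>5 * \<sigma>\<close>.\<close>

lemma prob_two_adj_le:
  assumes "good u" "good v" "Orth u v"
  shows "\<P>(y in gauss d. imp u y \<and> adj v y) \<le> exp (- (2 * \<kappa> * lam + Lv u) + \<xi> * lam)"
proof -
  note b = basic
  note u = good_bounds[OF assms(1)] and v = good_bounds[OF assms(2)]
  define a where "a = A * (1 - \<eta>)"
  define B where "B = lp u * rd"
  define b' where "b' = B * (1 - \<eta>)"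
  have a: "0 \<le> a" "a \<le> A" using A_eta by (auto simp: a_def)
  have B: "0 \<le> B" "B \<le> 5 * sqrt lam" using u b by (auto simp: B_def)
  have b'0: "0 \<le> b'" using B b by (auto simp: b'_def)
  have b'B: "b' \<le> B" using mult_left_mono[of "1 - \<eta>" 1 B] b B by (simp add: b'_def)
  have "\<P>(y in gauss d. imp u y \<and> adj v y)
      \<le> \<P>(x in gauss d. a \<le> ip d x (dir d u) \<and> (b' = 0 \<or> b' \<le> ip d x q) \<and> a \<le> ip d x (dir d v))"
  proof (rule G.finite_measure_mono)
    show "{y \<in> space (gauss d). imp u y \<and> adj v y}
      \<subseteq> {x \<in> space (gauss d). a \<le> ip d x (dir d u) \<and> (b' = 0 \<or> b' \<le> ip d x q) \<and> a \<le> ip d x (dir d v)}"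
      using imp_level[of u] good_adj[OF _ _ u(1)] good_adj[OF _ _ v(1)]
      by (auto simp: a_def b'_def B_def imp_def simp del: mult_eq_0_iff)
  qed measurable
  also have "\<dots> \<le> exp (- (a\<^sup>2 + b'\<^sup>2 + a\<^sup>2) / 2 + a * b' * ip d (dir d u) q + a * a * ip d (dir d u) (dir d v) + b' * a * ip d q (dir d v))"
    by (rule gauss_upper3[OF ip_dir_self[OF u(1)] q ip_dir_self[OF v(1)] a(1) b'0 a(1)])
  also have "\<dots> \<le> exp (- (2 * \<kappa> * lam + Lv u) + \<xi> * lam)"
  proof -
    have ab: "a * b' \<le> 15 / 2 * lam"
    proof -
      have "a * b' \<le> (3 / 2 * sqrt lam) * (5 * sqrt lam)"
        using a b(4,18) b'B B(2) b'0 by (intro mult_mono) auto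
      then show ?thesis using b(6) by simp
    qed
    have c: "a * b' * x \<le> 75 / 2 * (\<sigma> * lam)" if "\<bar>x\<bar> \<le> 5 * \<sigma>" for x
    proof -
      have "a * b' * x \<le> a * b' * (5 * \<sigma>)" using that a b'0 by (intro mult_left_mono) auto
      also have "\<dots> \<le> 15 / 2 * lam * (5 * \<sigma>)" using ab b by (intro mult_right_mono) auto
      finally show ?thesis by (simp add: mult_ac)
    qed
    have c1: "a * b' * ip d (dir d u) q \<le> 75 / 2 * (\<sigma> * lam)"
      by (rule c) (use u(4) in \<open>simp add: ip_dir_left lev_def\<close>)
    have c2: "b' * a * ip d q (dir d v) \<le> 75 / 2 * (\<sigma> * lam)"
      using c[of "ip d q (dir d v)"] v(4) by (simp add: ip_dir_right lev_def ip_commute[of d q v] mult.commute)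
    have "ip d (dir d u) (dir d v) \<le> \<xi> / 4"
      using assms u(1) v(1) by (simp add: ip_dir_left ip_dir_right Orth_def field_simps)
    then have "a * a * ip d (dir d u) (dir d v) \<le> a * a * (\<xi> / 4)" using a by (intro mult_left_mono) auto
    also have "\<dots> \<le> A * A * (\<xi> / 4)" using a eps by (intro mult_right_mono mult_mono) auto
    also have "\<dots> \<le> 2 * lam * (\<xi> / 4)"
      using b eps by (intro mult_right_mono) (auto simp: power2_eq_square)
    finally have c3: "a * a * ip d (dir d u) (dir d v) \<le> \<xi> * lam / 2" by simp
    have "B\<^sup>2 / 2 - 24 * \<sigma> * (25 / 2 * lam) \<le> B\<^sup>2 / 2 * (1 - \<eta>)\<^sup>2"
      by (rule square_loss) (use u(8,9) in \<open>auto simp: B_def\<close>)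
    then have c4: "Lv u - 300 * (\<sigma> * lam) \<le> b'\<^sup>2 / 2" using u(8) by (simp add: B_def b'_def power_mult_distrib)
    have c5: "2 * \<kappa> * lam - \<xi> * lam / 20 \<le> a\<^sup>2" using kappa_loss by (simp add: a_def)
    have "- (a\<^sup>2 + b'\<^sup>2 + a\<^sup>2) / 2 + a * b' * ip d (dir d u) q + a * a * ip d (dir d u) (dir d v) + b' * a * ip d q (dir d v)
        = - a\<^sup>2 - b'\<^sup>2 / 2 + a * b' * ip d (dir d u) q + a * a * ip d (dir d u) (dir d v) + b' * a * ip d q (dir d v)"
      by (simp add: field_simps)
    also have "\<dots> \<le> - (2 * \<kappa> * lam + Lv u) + \<xi> * lam" using c1 c2 c3 c4 c5 eps_lam(1,2) by linarith
    finally show ?thesis by simp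
  qed
  finally show ?thesis .
qed

lemma prob_not_orth_le:
  shows "\<P>(y in gauss d. \<not> Orth u y) \<le> exp (- 8 * lam)"
proof (cases "good u")
  case False
  then show ?thesis by (simp add: Orth_def)
next
  case True
  note b = basic and u = good_bounds[OF True]
  have sub: "{y \<in> space (gauss d). \<not> Orth u y} \<subseteq> {y \<in> space (gauss d). \<xi> / 5 * rd \<le> ip d y (dir d u)}"
  proof safe
    fix y assume y: "\<not> Orth u y"
    then have gy: "good y" and i: "\<xi> / 4 * (nrm d u * nrm d y) < ip d u y" by (auto simp: Orth_def)
    have "\<xi> / 5 * rd \<le> \<xi> / 4 * ((1 - \<eta>) * rd)"
      using mult_left_mono[of "1 / 5" "(1 - \<eta>) / 4" "\<xi> * rd"] b eps by (simp add: mult_ac)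
    also have "\<dots> \<le> \<xi> / 4 * nrm d y" using good_bounds(2)[OF gy] eps by (intro mult_left_mono) auto
    also have "\<dots> \<le> ip d y (dir d u)" using i u(1) by (simp add: ip_dir_right ip_commute[of d u y] field_simps)
    finally show "\<xi> / 5 * rd \<le> ip d y (dir d u)" .
  qed
  have "\<P>(y in gauss d. \<not> Orth u y) \<le> \<P>(y in gauss d. \<xi> / 5 * rd \<le> ip d y (dir d u))"
    by (rule G.finite_measure_mono[OF sub]) measurable
  also have "\<dots> \<le> exp (- (\<xi> / 5 * rd)\<^sup>2 / 2)"
    by (rule gauss_upper1) (use ip_dir_self[OF u(1)] eps b in auto)
  also have "\<dots> \<le> exp (- 8 * lam)"
  proof -
    \<comment> \<open>The subexponential size of \<open>n\<close> enters here: a correlation of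
      constant order \<open>\<xi>\<close> is far beyond the scale \<open>\<sigma>\<close> reached by
      \<open>n\<close> points.\<close>
    have "1000 * (\<sigma> * rd) \<le> \<xi> * rd" using mult_right_mono[OF sigma(2), of rd] b(1) by simp
    then have "200 * sqrt lam \<le> \<xi> / 5 * rd" using b(9) by simp
    then have "(200 * sqrt lam)\<^sup>2 \<le> (\<xi> / 5 * rd)\<^sup>2" using b by (intro power_mono) auto
    then have "40000 * lam \<le> (\<xi> / 5 * rd)\<^sup>2" using b(6) by (simp add: power_mult_distrib power2_eq_square)
    then show ?thesis using b(4) by simp
  qed
  finally show ?thesis .
qed

text \<open>Lower bounds on probabilities lose a factor 1/2 in \<open>gauss_lower\<close> and a term
  for points that are not good. As long as the main term is at least \<open>exp (- 2 * lam)\<close>,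
  both losses together cost only half a tolerance in the exponent.\<close>

lemma absorb:
  assumes "x \<le> 2 * lam"
  shows "exp (- x - \<xi> * lam / 2) \<le> exp (- x) / 2 - 4 * exp (- 8 * lam)"
proof -
  note b = basic
  have e: "16 \<le> exp z" if "15 \<le> z" for z :: real using exp_ge_add_one_self[of z] that by linarith
  have "16 * exp (- 8 * lam) \<le> exp (6 * lam) * exp (- 8 * lam)"
    by (intro mult_right_mono e) (use b in auto)
  also have "\<dots> = exp (- 2 * lam)" by (simp add: mult_exp_exp)
  also have "\<dots> \<le> exp (- x)" using assms by simp
  finally have 1: "16 * exp (- 8 * lam) \<le> exp (- x)" .
  have "exp (- x - \<xi> * lam / 2) * 16 \<le> exp (- x - \<xi> * lam / 2) * exp (\<xi> * lam / 2)"
    by (intro mult_left_mono e) (use eps_lam(5) in auto)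
  also have "\<dots> = exp (- x)" by (simp add: mult_exp_exp)
  finally have 2: "exp (- x - \<xi> * lam / 2) * 16 \<le> exp (- x)" .
  show ?thesis using 1 2 exp_gt_zero[of "- x"] by linarith
qed

lemma prob_good_and:
  assumes "E \<in> G.events"
  shows "G.prob E - 4 * exp (- 8 * lam) \<le> \<P>(x in gauss d. good x \<and> x \<in> E)"
proof -
  have m: "{x \<in> space (gauss d). good x \<and> x \<in> E} \<in> G.events" "{x \<in> space (gauss d). \<not> good x} \<in> G.events"
    using assms by measurable
  have "G.prob E \<le> G.prob ({x \<in> space (gauss d). good x \<and> x \<in> E} \<union> {x \<in> space (gauss d). \<not> good x})"
    by (rule G.finite_measure_mono) (use m sets.sets_into_space[OF assms] in auto)
  also have "\<dots> \<le> \<P>(x in gauss d. good x \<and> x \<in> E) + \<P>(x in gauss d. \<not> good x)"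
    by (rule measure_Un_le[OF m])
  finally show ?thesis using not_good_le by simp
qed

end

section \<open>Lower bounds for improving neighbours and upper bounds for small improvements\<close>

context query_regime
begin

lemma g0_rd: "g0 * rd \<le> sqrt lam"
proof -
  have "g0 * rd = sqrt (2 * \<rho> * lam)" using basic(1) by (simp add: g0_def rd_def)
  also have "\<dots> \<le> sqrt lam" using rho basic(4) by (simp add: mult_le_cancel_right1)
  finally show ?thesis .
qed

lemma below_g0:
  assumes "good u" "lev u < g0"
  shows "lp u \<le> g0" "lp u * rd \<le> sqrt lam" "Lv u \<le> \<rho> * lam"
proof -
  note b = basic
  show l: "lp u \<le> g0" using assms(2) b(21) by (simp add: lp_def)
  then have l2: "lp u * rd \<le> g0 * rd" using b(1) by (intro mult_right_mono) auto
  then show "lp u * rd \<le> sqrt lam" using g0_rd by linarith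
  have "(lp u * rd)\<^sup>2 \<le> (g0 * rd)\<^sup>2" using l2 good_bounds(5)[OF assms(1)] b(1) by (intro power_mono) auto
  also have "(g0 * rd)\<^sup>2 = 2 * \<rho> * lam"
    using b(1,4) rho by (simp add: g0_def rd_def)
  finally show "Lv u \<le> \<rho> * lam" using good_bounds(8)[OF assms(1)] by simp
qed

lemma adj_measurable1: "Measurable.pred (gauss d) (\<lambda>y. adj u y)"
  unfolding adj_def pred_def ip_commute[of d u]
  by (intro borel_measurable_le borel_measurable_times borel_measurable_const nrm_measurable ip_measurable)

lemma imp_measurable1: "Measurable.pred (gauss d) (\<lambda>y. imp u y)"
proof -
  have "Measurable.pred (gauss d) (\<lambda>y. lev u + 1 / real d \<le> lev y)"
    unfolding pred_def by (intro borel_measurable_le borel_measurable_const lev_measurable)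
  then show ?thesis unfolding imp_def
    by (intro pred_intros_logic adj_measurable1 good_measurable) auto
qed

text \<open>If \<open>a\<close> exceeds \<open>P\<close> by at most a small multiple of the scale \<open>sqrt lam\<close>, so does the exponent.\<close>

lemma square_perturb:
  assumes "0 \<le> a" "a \<le> P + t * \<xi> * sqrt lam" "0 \<le> P" "P \<le> 2 * sqrt lam" "0 \<le> t" "t \<le> 1"
  shows "a\<^sup>2 \<le> P\<^sup>2 + 5 * t * \<xi> * lam"
proof -
  note b = basic
  have "a\<^sup>2 \<le> (P + t * \<xi> * sqrt lam)\<^sup>2" using assms by (intro power_mono) auto
  also have "\<dots> = P\<^sup>2 + (2 * t * \<xi> * (P * sqrt lam) + (t * \<xi>) * (t * \<xi>) * (sqrt lam * sqrt lam))"
    by (simp add: power2_eq_square algebra_simps)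
  also have "2 * t * \<xi> * (P * sqrt lam) \<le> 2 * t * \<xi> * (2 * lam)"
  proof (rule mult_left_mono)
    have "P * sqrt lam \<le> 2 * sqrt lam * sqrt lam" using assms b by (intro mult_right_mono) auto
    then show "P * sqrt lam \<le> 2 * lam" by (simp only: mult.assoc b(6))
  qed (use assms eps in auto)
  also have "(t * \<xi>) * (t * \<xi>) * (sqrt lam * sqrt lam) \<le> (t * \<xi>) * lam"
  proof -
    have "t * \<xi> \<le> 1 * 1" using assms eps by (intro mult_mono) auto
    then have "(t * \<xi>) * (t * \<xi>) \<le> (t * \<xi>) * 1" using assms eps by (intro mult_left_mono) auto
    then have "(t * \<xi>) * (t * \<xi>) * lam \<le> (t * \<xi>) * lam" using b(4) by (intro mult_right_mono) auto
    then show ?thesis using b(6) by simp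
  qed
  finally show ?thesis by (simp add: mult_ac)
qed

lemma sigma_sqrt: "\<sigma> * sqrt lam \<le> \<xi> * sqrt lam / 1000"
  using mult_right_mono[OF sigma(2), of "sqrt lam"] basic(4) by simp

text \<open>The centre \<open>w\<close> lies in the plane of \<open>u\<close> and the query. The
  thresholds \<open>B1\<close> and \<open>B2\<close> are inflated by \<open>1 + \<eta>\<close>,
  which covers every norm that a good point may have, and \<open>B2\<close> contains the required
  gain \<open>1 / real d\<close>. The squared length of \<open>w\<close> is about
  \<open>2 * \<kappa> * lam + 2 * Lv u\<close>.\<close>

lemma prob_imp_ge:
  assumes u: "good u" "lev u < g0"
  shows "exp (- \<kappa> * lam - Lv u - \<xi> * lam) \<le> \<P>(y in gauss d. imp u y)"
proof -
  note b = basic and gb = good_bounds[OF u(1)] and lo = below_g0[OF u]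
  define S where "S = \<xi> * sqrt lam"
  have S: "400 \<le> S" using eps_lam by (simp add: S_def)
  \<comment> \<open>Since \<open>S\<close> is at least 400, this slack covers the margin 2 of
    \<open>gauss_lower\<close> together with the error \<open>S / 100\<close> that arises because
    \<open>u\<close> and the query are not exactly orthogonal.\<close>
  define D where "D = S / 20"
  define Q where "Q = lp u * rd"
  have Q: "0 \<le> Q" "Q \<le> sqrt lam" using gb lo b by (auto simp: Q_def)
  define B1 where "B1 = A * (1 + \<eta>)"
  define B2 where "B2 = (Q + 1 / rd) * (1 + \<eta>)"
  have rd1: "1 / rd \<le> 1"
    using d3 by (simp add: rd_def)
  have ss: "\<sigma> * sqrt lam \<le> S / 1000" using sigma_sqrt by (simp add: S_def)
  have sl: "S \<le> sqrt lam / 100" using eps b(4) by (simp add: S_def mult_right_mono)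
  have Aeta: "A * \<eta> \<le> 18 * (S / 1000)"
  proof -
    have "A * \<eta> \<le> (3 / 2 * sqrt lam) * (12 * \<sigma>)" using b unfolding eta by (intro mult_mono) auto
    then show ?thesis using ss by (simp add: mult_ac)
  qed
  have Qeta: "Q * \<eta> \<le> 12 * (S / 1000)"
  proof -
    have "Q * \<eta> \<le> sqrt lam * (12 * \<sigma>)" using b Q unfolding eta by (intro mult_mono) auto
    then show ?thesis using ss by (simp add: mult_ac)
  qed
  have B1: "0 \<le> B1 + D" "B1 + D \<le> A + 7 / 100 * S"
  proof -
    have "B1 = A + A * \<eta>" "0 \<le> A * \<eta>" using b by (auto simp: B1_def distrib_left)
    then show "0 \<le> B1 + D" "B1 + D \<le> A + 7 / 100 * S" using Aeta S b(16) unfolding D_def by linarith+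
  qed
  have rde: "1 / rd * (1 + \<eta>) \<le> 2"
    using mult_mono[OF rd1, of "1 + \<eta>" 2] b by auto
  have B2: "0 \<le> B2 + D" "B2 + D \<le> Q + 7 / 100 * S"
  proof -
    have "B2 = Q + Q * \<eta> + 1 / rd * (1 + \<eta>)" by (simp add: B2_def distrib_left distrib_right)
    then show "B2 + D \<le> Q + 7 / 100 * S" using Qeta rde S unfolding D_def by linarith
    show "0 \<le> B2 + D" using Q b S by (auto simp: B2_def D_def intro!: add_nonneg_nonneg mult_nonneg_nonneg)
  qed
  have B12: "B1 + D \<le> 2 * sqrt lam" "B2 + D \<le> 2 * sqrt lam"
    using B1 B2 b(18) Q sl b(3) by linarith+
  define w where "w = (\<lambda>i. (B1 + D) * dir d u i + (B2 + D) * q i)"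
  have uu: "ip d (dir d u) (dir d u) = 1" by (rule ip_dir_self[OF gb(1)])
  have uq: "ip d (dir d u) q = lev u" "ip d q (dir d u) = lev u"
    by (simp_all add: ip_dir_left ip_dir_right lev_def ip_commute[of d q u])
  have h: "c * lev u \<ge> - (S / 100)" "c * lev u \<le> S / 100" if "0 \<le> c" "c \<le> 2 * sqrt lam" for c
  proof -
    have "\<bar>c * lev u\<bar> \<le> (2 * sqrt lam) * (5 * \<sigma>)" unfolding abs_mult using that gb(4) b(4) by (intro mult_mono) auto
    then have "\<bar>c * lev u\<bar> \<le> S / 100" using ss by (simp add: mult_ac)
    then show "c * lev u \<ge> - (S / 100)" "c * lev u \<le> S / 100" by auto
  qed
  have wu: "B1 + 2 \<le> ip d w (dir d u)"
  proof -
    have "ip d w (dir d u) = B1 + D + (B2 + D) * lev u" unfolding w_def ip_linear uu uq by simp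
    then show ?thesis using h(1)[OF B2(1) B12(2)] S by (simp add: D_def)
  qed
  have wq: "B2 + 2 \<le> ip d w q"
  proof -
    have "ip d w q = (B1 + D) * lev u + (B2 + D)" unfolding w_def ip_linear uq q by simp
    then show ?thesis using h(1)[OF B1(1) B12(1)] S by (simp add: D_def)
  qed
  have ww: "ip d w w = (B1 + D)\<^sup>2 + (B2 + D)\<^sup>2 + 2 * ((B1 + D) * ((B2 + D) * lev u))"
    unfolding w_def ip_linear uu uq q by (simp add: power2_eq_square algebra_simps)
  have e1: "(B1 + D)\<^sup>2 \<le> 2 * \<kappa> * lam + 35 / 100 * (\<xi> * lam)"
    using square_perturb[of "B1 + D" A "7 / 100"] B1 b(16,17,18) b(3) by (simp add: S_def)
  have e2: "(B2 + D)\<^sup>2 \<le> 2 * Lv u + 35 / 100 * (\<xi> * lam)"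
    using square_perturb[of "B2 + D" Q "7 / 100"] B2 Q b(3) gb(8) by (simp add: S_def Q_def)
  have e3: "(B1 + D) * ((B2 + D) * lev u) \<le> 2 / 100 * (\<xi> * lam)"
  proof -
    have "(B1 + D) * ((B2 + D) * lev u) \<le> (B1 + D) * (S / 100)"
      by (rule mult_left_mono[OF h(2)[OF B2(1) B12(2)] B1(1)])
    also have "\<dots> \<le> 2 * sqrt lam * (S / 100)" using B12 S by (intro mult_right_mono) auto
    also have "\<dots> = 2 / 100 * (\<xi> * (sqrt lam * sqrt lam))" by (simp add: S_def)
    finally show ?thesis using b(6) by simp
  qed
  have ww1: "ip d w w / 2 \<le> \<kappa> * lam + Lv u + 37 / 100 * (\<xi> * lam)" using ww e1 e2 e3 by linarith
  have "ip d w w \<le> 4 * lam"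
    using ww1 lo(3) rho kappa b(4) mult_right_mono[of \<rho> "1/2" lam] mult_right_mono[of \<kappa> 1 lam]
      mult_right_mono[of \<xi> "1/100" lam] eps b(14) by linarith
  then have "sqrt (ip d w w) \<le> sqrt (4 * lam)" by (rule real_sqrt_le_mono)
  also have "\<dots> = 2 * sqrt lam" by (simp add: real_sqrt_mult)
  finally have ww2: "2 * sqrt (ip d w w) \<le> \<xi> * lam / 100" using eps_lam(4) by linarith
  define x where "x = \<kappa> * lam + Lv u + 38 / 100 * (\<xi> * lam)"
  have x2: "x \<le> 2 * lam"
    using lo(3) rho kappa b(4) mult_right_mono[of \<rho> "1/2" lam] mult_right_mono[of \<kappa> 1 lam]
      mult_right_mono[of \<xi> "1/100" lam] eps b(14) unfolding x_def by linarith
  define E where "E = {y \<in> space (gauss d). B1 \<le> ip d y (dir d u) \<and> B2 \<le> ip d y q}"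
  have Em: "E \<in> G.events" unfolding E_def by measurable
  have "exp (- \<kappa> * lam - Lv u - \<xi> * lam) \<le> exp (- x - \<xi> * lam / 2)" unfolding x_def using eps_lam(2) by simp
  also have "\<dots> \<le> exp (- x) / 2 - 4 * exp (- 8 * lam)" by (rule absorb[OF x2])
  also have "exp (- x) / 2 \<le> exp (- ip d w w / 2 - 2 * sqrt (ip d w w)) / 2" using ww1 ww2 by (simp add: x_def)
  also have "\<dots> \<le> G.prob E" unfolding E_def by (rule gauss_lower[OF uu q wu wq])
  also have "G.prob E - 4 * exp (- 8 * lam) \<le> \<P>(x in gauss d. good x \<and> x \<in> E)"
    by (rule prob_good_and[OF Em])
  also have "\<dots> \<le> \<P>(y in gauss d. imp u y)"
  proof (rule G.finite_measure_mono)
    show "{x \<in> space (gauss d). good x \<and> x \<in> E} \<subseteq> {y \<in> space (gauss d). imp u y}"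
    proof safe
      fix y assume y: "good y" "y \<in> E" "y \<in> space (gauss d)"
      note gy = good_bounds[OF y(1)]
      have "adj u y"
      proof -
        have "\<alpha> * nrm d y \<le> \<alpha> * ((1 + \<eta>) * rd)" using gy(3) b(20) by (intro mult_left_mono) auto
        also have "\<dots> = B1" using b(19) by (simp add: B1_def mult_ac)
        also have "\<dots> \<le> ip d y (dir d u)" using y(2) by (simp add: E_def)
        finally show ?thesis using gb(1) by (simp add: adj_def ip_dir_right ip_commute[of d u y] field_simps)
      qed
      moreover have "lev u + 1 / real d \<le> lev y"
      proof -
        have "(lp u + 1 / real d) * nrm d y \<le> (lp u + 1 / real d) * ((1 + \<eta>) * rd)"
          using gy(3) gb(5) by (intro mult_left_mono) auto
        also have "\<dots> = B2" using b(1) unfolding B2_def Q_def b(2)[symmetric]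
          by (simp add: field_simps power2_eq_square)
        also have "\<dots> \<le> ip d y q" using y(2) by (simp add: E_def)
        finally have "lp u + 1 / real d \<le> lev y" using gy(1) by (simp add: lev_def le_divide_eq)
        then show ?thesis by (simp add: lp_def)
      qed
      ultimately show "imp u y" using u y by (simp add: imp_def)
    qed
    show "{y \<in> space (gauss d). imp u y} \<in> G.events" using imp_measurable1[of u] by (simp add: pred_def)
  qed
  finally show ?thesis by simp
qed

lemma planted_adj_measurable [measurable]: "Measurable.pred (gauss d) (\<lambda>y. t * nrm d y \<le> ip d y p)"
  unfolding pred_def
  by (rule borel_measurable_le, rule borel_measurable_times, rule borel_measurable_const,
      rule nrm_measurable, rule ip_measurable)

lemma prob_planted_adj_ge:
  assumes p: "ip d p p = 1"
  shows "exp (- \<kappa> * lam - \<xi> * lam) \<le> \<P>(y in gauss d. good y \<and> \<alpha> * nrm d y \<le> ip d y p)"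
proof -
  note b = basic
  define S where "S = \<xi> * sqrt lam"
  have S: "400 \<le> S" using eps_lam by (simp add: S_def)
  have ss: "\<sigma> * sqrt lam \<le> S / 1000" using sigma_sqrt by (simp add: S_def)
  have sl: "S \<le> sqrt lam / 100" using eps b(4) by (simp add: S_def mult_right_mono)
  define B where "B = A * (1 + \<eta>)"
  have Aeta: "A * \<eta> \<le> 18 * (S / 1000)"
  proof -
    have "A * \<eta> \<le> (3 / 2 * sqrt lam) * (12 * \<sigma>)" using b unfolding eta by (intro mult_mono) auto
    then show ?thesis using ss by (simp add: mult_ac)
  qed
  have B: "0 \<le> B + 2" "B + 2 \<le> A + 3 / 100 * S"
  proof -
    have "B = A + A * \<eta>" "0 \<le> A * \<eta>" using b by (auto simp: B_def distrib_left)
    then show "0 \<le> B + 2" "B + 2 \<le> A + 3 / 100 * S" using Aeta S b(16) by linarith+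
  qed
  define w where "w = (\<lambda>i. (B + 2) * p i)"
  have ww: "ip d w w = (B + 2)\<^sup>2" unfolding w_def ip_linear p by (simp add: power2_eq_square)
  have wp: "B + 2 \<le> ip d w p" unfolding w_def ip_linear p by simp
  have e1: "(B + 2)\<^sup>2 \<le> 2 * \<kappa> * lam + 15 / 100 * (\<xi> * lam)"
    using square_perturb[of "B + 2" A "3 / 100"] B b(16,17,18) b(3) by (simp add: S_def)
  have "B + 2 \<le> 2 * sqrt lam" using B b(18) sl b(3) by linarith
  then have e2: "2 * sqrt (ip d w w) \<le> \<xi> * lam / 100" unfolding ww using B(1) eps_lam(4) by simp
  define x where "x = \<kappa> * lam + 10 / 100 * (\<xi> * lam)"
  have x2: "x \<le> 2 * lam"
    using b(4) mult_right_mono[of \<kappa> 1 lam] mult_right_mono[of \<xi> "1/100" lam] eps b(14) unfolding x_def by linarith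
  define E where "E = {y \<in> space (gauss d). B \<le> ip d y p \<and> B \<le> ip d y p}"
  have Em: "E \<in> G.events" unfolding E_def by measurable
  have "exp (- \<kappa> * lam - \<xi> * lam) \<le> exp (- x - \<xi> * lam / 2)" unfolding x_def using eps_lam(2) by simp
  also have "\<dots> \<le> exp (- x) / 2 - 4 * exp (- 8 * lam)" by (rule absorb[OF x2])
  also have "exp (- x) / 2 \<le> exp (- ip d w w / 2 - 2 * sqrt (ip d w w)) / 2"
    using e1 e2 eps_lam(2) ww by (simp add: x_def)
  also have "\<dots> \<le> G.prob E" unfolding E_def by (rule gauss_lower[OF p p wp wp])
  also have "G.prob E - 4 * exp (- 8 * lam) \<le> \<P>(x in gauss d. good x \<and> x \<in> E)"
    by (rule prob_good_and[OF Em])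
  also have "\<dots> \<le> \<P>(y in gauss d. good y \<and> \<alpha> * nrm d y \<le> ip d y p)"
  proof (rule G.finite_measure_mono)
    show "{x \<in> space (gauss d). good x \<and> x \<in> E} \<subseteq> {y \<in> space (gauss d). good y \<and> \<alpha> * nrm d y \<le> ip d y p}"
    proof safe
      fix y assume y: "good y" "y \<in> E" "y \<in> space (gauss d)"
      have "\<alpha> * nrm d y \<le> \<alpha> * ((1 + \<eta>) * rd)" using good_bounds(3)[OF y(1)] b(20) by (intro mult_left_mono) auto
      also have "\<dots> = B" using b(19) by (simp add: B_def mult_ac)
      also have "\<dots> \<le> ip d y p" using y(2) by (simp add: E_def)
      finally show "\<alpha> * nrm d y \<le> ip d y p" .
    qed
  qed measurable
  finally show ?thesis by simp
qed

text \<open>Tilting along \<open>u\<close> pays for the adjacency. What remains is that a standard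
  normal variable falls into a window around the level of \<open>u\<close>, which costs the density
  there, about \<open>exp (- Lv u)\<close>, times the width. The window cannot be narrower than the
  blur caused by fluctuating norms, which is why \<open>Mb \<le> rd\<close> is assumed.\<close>

lemma prob_small_step_le:
  assumes u: "good u" and Mb: "1 \<le> Mb" "Mb \<le> rd" "6200 * sqrt lam \<le> \<xi> * Mb" and W: "W = sqrt lam / (Mb * rd)"
  shows "\<P>(y in gauss d. imp u y \<and> lev y < lev u + W)
    \<le> exp (- \<kappa> * lam - Lv u + \<xi> * lam) * (124 * lam / Mb)"
proof -
  note b = basic and gb = good_bounds[OF u]
  define S where "S = \<xi> * sqrt lam"
  have S: "400 \<le> S" using eps_lam by (simp add: S_def)
  have ss: "\<sigma> * sqrt lam \<le> S / 1000" using sigma_sqrt by (simp add: S_def)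
  define a where "a = A * (1 - \<eta>)"
  \<comment> \<open>Of the 62, 2 comes from the permitted gain \<open>W\<close> at norm up to
    \<open>2 * rd\<close>, and 60 from the fluctuation of norms,
    \<open>5 * \<sigma> * (\<eta> * rd) = 60 * (\<sigma> * sqrt lam)\<close>.\<close>
  define \<delta> where "\<delta> = 62 * lam / Mb"
  have a: "0 \<le> a" "a \<le> A" using A_eta by (auto simp: a_def)
  have \<delta>0: "0 < \<delta>" using b Mb by (simp add: \<delta>_def)
  have \<delta>S: "\<delta> \<le> S / 100"
  proof -
    have "6200 * sqrt lam * sqrt lam \<le> \<xi> * Mb * sqrt lam" using Mb(3) b by (intro mult_right_mono) auto
    then have "6200 * (sqrt lam * sqrt lam) \<le> S * Mb" by (simp only: S_def mult_ac)
    then have "6200 * lam \<le> S * Mb" by (simp only: b(6))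
    then show ?thesis using Mb by (simp add: \<delta>_def field_simps)
  qed
  define t where "t = lev u * rd"
  define E where "E = {y \<in> space (gauss d). a \<le> ip d y (dir d u) \<and> ip d y q \<in> {t - \<delta>..t + \<delta>}}"
  have uu: "ip d (dir d u) (dir d u) = 1" by (rule ip_dir_self[OF gb(1)])
  have uq: "ip d (dir d u) q = lev u" by (simp add: ip_dir_left lev_def)
  have Em: "E \<in> G.events" unfolding E_def by measurable
  have "\<P>(y in gauss d. imp u y \<and> lev y < lev u + W) \<le> G.prob E"
  proof (rule G.finite_measure_mono[OF _ Em], safe)
    fix y assume y: "y \<in> space (gauss d)" "imp u y" "lev y < lev u + W"
    have gy: "good y" "adj u y" "lev u \<le> lev y"
      using y(2) by (auto simp: imp_def) (meson add_increasing2 le_add_same_cancel1 of_nat_0_le_iff order_trans zero_le_divide_1_iff)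
    note gby = good_bounds[OF gy(1)]
    have W0: "0 \<le> W" using W Mb b by simp
    have iy: "ip d y q = lev y * nrm d y" using gby(1) by (simp add: lev_def)
    have "\<bar>ip d y q - t\<bar> = \<bar>(lev y - lev u) * nrm d y + lev u * (nrm d y - rd)\<bar>"
      unfolding iy t_def by (simp add: algebra_simps)
    also have "\<dots> \<le> \<bar>(lev y - lev u) * nrm d y\<bar> + \<bar>lev u * (nrm d y - rd)\<bar>" by (rule abs_triangle_ineq)
    also have "\<dots> \<le> W * (2 * rd) + 5 * \<sigma> * (\<eta> * rd)"
    proof (rule add_mono)
      have "nrm d y \<le> 2 * rd" using gby(3) mult_right_mono[of "1 + \<eta>" 2 rd] b by linarith
      then show "\<bar>(lev y - lev u) * nrm d y\<bar> \<le> W * (2 * rd)"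
        unfolding abs_mult using gy(3) y(3) gby(1) W0 by (intro mult_mono) auto
      have "\<bar>nrm d y - rd\<bar> \<le> \<eta> * rd" using gby(2,3) by (simp add: algebra_simps abs_le_iff)
      then show "\<bar>lev u * (nrm d y - rd)\<bar> \<le> 5 * \<sigma> * (\<eta> * rd)"
        unfolding abs_mult using gb(4) b by (intro mult_mono) auto
    qed
    also have "\<dots> \<le> \<delta>"
    proof -
      have "W * (2 * rd) = 2 * sqrt lam / Mb" using W b Mb by simp
      also have "\<dots> \<le> 2 * lam / Mb" using b(7) b(4) Mb by (intro divide_right_mono) auto
      finally have 1: "W * (2 * rd) \<le> 2 * lam / Mb" .
      have "5 * \<sigma> * (\<eta> * rd) = 60 * (\<sigma> * (\<sigma> * rd))" by (simp add: eta)
      also have "\<dots> = 60 * (\<sigma> * sqrt lam)" unfolding b(9) ..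
      also have "\<sigma> * sqrt lam \<le> lam / Mb"
      proof -
        have "\<sigma> = sqrt lam / rd" using b(1,9) by (simp add: field_simps)
        also have "\<dots> \<le> sqrt lam / Mb" using Mb b by (intro divide_left_mono) auto
        finally have "\<sigma> * sqrt lam \<le> sqrt lam / Mb * sqrt lam" using b by (intro mult_right_mono) auto
        then show ?thesis using b(6) by simp
      qed
      finally show ?thesis using 1 by (simp add: \<delta>_def)
    qed
    finally have "ip d y q \<in> {t - \<delta>..t + \<delta>}" by (simp add: abs_le_iff)
    then show "y \<in> E" using good_adj[OF gy(1,2) gb(1)] y(1) by (simp add: E_def a_def)
  qed
  also have "G.prob E \<le> exp (- a\<^sup>2 / 2) * \<P>(x in gauss d. shift d (\<lambda>i. a * dir d u i) x \<in> E)"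
    by (rule gauss_tilt_upper[OF Em _ uu a(1)]) (simp add: E_def)
  also have "\<dots> \<le> exp (- \<kappa> * lam + \<xi> * lam / 10) * (2 * \<delta> * exp (- Lv u + \<xi> * lam / 5))"
  proof (rule mult_mono)
    show "exp (- a\<^sup>2 / 2) \<le> exp (- \<kappa> * lam + \<xi> * lam / 10)" using kappa_loss eps_lam(2) by (simp add: a_def)
    \<comment> \<open>A lower bound for the window when the level is positive: \<open>S / 50\<close>
      covers the half-width \<open>\<delta>\<close> and the shift \<open>a * lev u\<close>, each at
      most \<open>S / 100\<close>. The value 0 stands for the trivial bound on the density.\<close>
    define c where "c = max 0 (lp u * rd - S / 50)"
    have au: "\<bar>a * lev u\<bar> \<le> S / 100"
    proof -
      have "\<bar>a * lev u\<bar> \<le> (3 / 2 * sqrt lam) * (5 * \<sigma>)"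
        unfolding abs_mult using a b gb(4) by (intro mult_mono) auto
      then show ?thesis using ss S by (simp add: mult_ac)
    qed
    have "\<P>(x in gauss d. shift d (\<lambda>i. a * dir d u i) x \<in> E)
        \<le> \<P>(x in gauss d. ip d x q \<in> {t - \<delta> - a * lev u..t + \<delta> - a * lev u})"
      by (rule G.finite_measure_mono) (auto simp: E_def ip_shift ip_scale_left uq, measurable)
    also have "\<dots> = measure std_normal {t - \<delta> - a * lev u..t + \<delta> - a * lev u}"
      by (rule distr_ip_gauss[OF d3 q]) simp
    also have "\<dots> \<le> ((t + \<delta> - a * lev u) - (t - \<delta> - a * lev u)) * exp (- c\<^sup>2 / 2)"
    proof (rule std_normal_interval)
      show "c \<le> t - \<delta> - a * lev u \<or> c = 0"
      proof (cases "0 \<le> lp u * rd - S / 50 \<and> 0 < lev u")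
        case True
        then have "lp u = lev u" by (simp add: lp_def)
        then have "c = t - S / 50" using True by (simp add: c_def t_def)
        moreover have "a * lev u \<le> S / 100" using au by linarith
        ultimately show ?thesis using \<delta>S by (intro disjI1) linarith
      next
        case False
        then show ?thesis using S by (auto simp: c_def lp_def max_def)
      qed
    qed (use \<delta>0 in \<open>auto simp: c_def\<close>)
    also have "\<dots> = 2 * \<delta> * exp (- c\<^sup>2 / 2)" by simp
    also have "\<dots> \<le> 2 * \<delta> * exp (- Lv u + \<xi> * lam / 5)"
    proof -
      define P where "P = lp u * rd"
      have P: "0 \<le> P" "P \<le> 5 * sqrt lam" using gb b by (auto simp: P_def)
      have "P\<^sup>2 - 2 * P * (S / 50) \<le> c\<^sup>2"
      proof (cases "P \<le> S / 50")
        case True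
        have "P * P \<le> P * (S / 50)" using True P by (intro mult_left_mono) auto
        moreover have "0 \<le> P * (S / 50)" using P S by auto
        ultimately have "P\<^sup>2 - 2 * P * (S / 50) \<le> 0" by (simp add: power2_eq_square)
        then show ?thesis using zero_le_power2[of c] by linarith
      next
        case False
        then have "c = P - S / 50" by (simp add: c_def P_def)
        have "c\<^sup>2 = P\<^sup>2 - 2 * P * (S / 50) + (S / 50)\<^sup>2"
          unfolding \<open>c = P - S / 50\<close> by (simp add: power2_eq_square algebra_simps)
        then show ?thesis using zero_le_power2[of "S / 50"] by linarith
      qed
      moreover have "P * (S / 50) \<le> \<xi> * lam / 10"
      proof -
        have "P * (S / 50) \<le> 5 * sqrt lam * (S / 50)" using P S by (intro mult_right_mono) auto
        also have "\<dots> = \<xi> * (sqrt lam * sqrt lam) / 10" by (simp add: S_def)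
        finally show ?thesis using b(6) by simp
      qed
      ultimately have "Lv u - \<xi> * lam / 10 \<le> c\<^sup>2 / 2" using gb(8) by (simp add: P_def)
      then show ?thesis using \<delta>0 eps_lam(2) by (intro mult_left_mono) auto
    qed
    finally show "\<P>(x in gauss d. shift d (\<lambda>i. a * dir d u i) x \<in> E) \<le> 2 * \<delta> * exp (- Lv u + \<xi> * lam / 5)" .
  qed auto
  also have "\<dots> = exp (- \<kappa> * lam - Lv u + 3 / 10 * (\<xi> * lam)) * (124 * lam / Mb)"
    by (simp add: \<delta>_def mult_exp_exp[symmetric] exp_add[symmetric] exp_diff exp_minus field_simps)
  also have "\<dots> \<le> exp (- \<kappa> * lam - Lv u + \<xi> * lam) * (124 * lam / Mb)"
    using eps_lam(2) b(4) Mb(1) by (intro mult_right_mono) auto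
  finally show ?thesis .
qed

end

section \<open>The random direction of the planted point\<close>

context query_regime
begin

definition perp :: "(nat \<Rightarrow> real) \<Rightarrow> (nat \<Rightarrow> real)" where
  "perp b = (\<lambda>i. b i - ip d b q * q i)"

text \<open>The direction \<open>z\<close> in the definition of \<open>planted\<close>, with
  \<open>b\<close> in the place of row 1 of the matrix.\<close>

definition zdir :: "(nat \<Rightarrow> real) \<Rightarrow> (nat \<Rightarrow> real)" where
  "zdir b = normalize d (perp b)"

lemma ip_normalize: "ip d x (normalize d y) = ip d x y / nrm d y"
  by (simp add: ip_def normalize_def sum_divide_distrib)

lemma ip_zdir: "ip d x (zdir b) = ip d x (perp b) / nrm d (perp b)"
  by (simp add: zdir_def ip_normalize)

lemma ip_perp: "ip d x (perp b) = ip d x b - ip d b q * ip d x q" "ip d (perp b) x = ip d b x - ip d b q * ip d q x"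
  unfolding perp_def ip_linear by simp_all

text \<open>Self-adjointness of the projection. For fixed \<open>u\<close> it turns a condition on
  the direction \<open>zdir b\<close> into a linear condition on the Gaussian vector
  \<open>b\<close>, up to the norm of \<open>perp b\<close>.\<close>

lemma ip_perp_swap: "ip d u (perp b) = ip d b (perp u)"
  by (simp add: ip_perp ip_commute[of d b u])

lemma ip_perp_perp: "ip d (perp b) (perp b) = ip d b b - (ip d b q)\<^sup>2"
  by (simp add: ip_perp q ip_commute[of d q b] power2_eq_square)

text \<open>For suitable \<open>\<tau>\<close>, level \<open>g0\<close> together with component
  \<open>\<tau>\<close> along the planted direction forces adjacency to the planted point (see
  \<open>time_count\<close>). The walks ignore \<open>b\<close>, so it may be drawn after
  them.\<close>

definition mark :: "real \<Rightarrow> (nat \<Rightarrow> real) \<Rightarrow> (nat \<Rightarrow> real) \<Rightarrow> bool" where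
  "mark \<tau> b u \<longleftrightarrow> good u \<and> g0 \<le> lev u \<and> \<tau> * nrm d u \<le> ip d u (zdir b)"

lemma perp_good:
  assumes "good b"
  shows "(1 - 2 * \<eta>) * rd \<le> nrm d (perp b)" "nrm d (perp b) \<le> (1 + \<eta>) * rd" "0 < nrm d (perp b)"
proof -
  note bs = basic
  have sq: "(nrm d (perp b))\<^sup>2 = ip d b b - (ip d b q)\<^sup>2" using nrm_square[of d "perp b"] ip_perp_perp by (simp add: power2_eq_square)
  have "\<bar>ip d b q\<bar>\<^sup>2 \<le> (4 * sqrt lam)\<^sup>2" using assms by (intro power_mono) (auto simp: good_def)
  then have "(ip d b q)\<^sup>2 \<le> 16 * lam" using bs(4) by (simp add: power_mult_distrib)
  also have "lam = \<sigma> * (\<sigma> * (rd * rd))" using bs(6) unfolding bs(9)[symmetric] by (simp add: mult_ac)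
  also have "16 * (\<sigma> * (\<sigma> * (rd * rd))) \<le> \<eta> * (rd * rd)"
  proof -
    have "16 * \<sigma> * \<sigma> \<le> 12 * \<sigma>" by (rule mult_right_mono) (use bs(8,10) in linarith)+
    then have "16 * \<sigma> * \<sigma> * (rd * rd) \<le> 12 * \<sigma> * (rd * rd)" by (rule mult_right_mono) simp
    then show ?thesis by (simp add: eta mult_ac)
  qed
  finally have i: "(ip d b q)\<^sup>2 \<le> \<eta> * (rd * rd)" .
  have dd: "real d = rd * rd" using bs(2) by (simp add: power2_eq_square)
  have "((1 - 2 * \<eta>) * rd)\<^sup>2 \<le> (nrm d (perp b))\<^sup>2"
  proof -
    have "((1 - 2 * \<eta>) * rd)\<^sup>2 = (1 - 2 * \<eta>) * ((1 - 2 * \<eta>) * (rd * rd))" by (simp add: power2_eq_square)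
    also have "\<dots> \<le> 1 * ((1 - 2 * \<eta>) * (rd * rd))" using bs(11,12) by (intro mult_right_mono) auto
    also have "\<dots> = (1 - \<eta>) * real d - \<eta> * (rd * rd)" unfolding dd by (simp add: algebra_simps)
    also have "\<dots> \<le> (nrm d (perp b))\<^sup>2" unfolding sq using assms i by (simp add: good_def)
    finally show ?thesis .
  qed
  then show l: "(1 - 2 * \<eta>) * rd \<le> nrm d (perp b)" by (rule power2_le_imp_le) (simp add: nrm_def ip_self_nonneg)
  have "(nrm d (perp b))\<^sup>2 \<le> (nrm d b)\<^sup>2" unfolding sq using nrm_square[of d b] by (simp add: power2_eq_square)
  then have "nrm d (perp b) \<le> nrm d b" by (rule power2_le_imp_le) (simp add: nrm_def ip_self_nonneg)
  then show "nrm d (perp b) \<le> (1 + \<eta>) * rd" using good_bounds(3)[OF assms] by linarith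
  have "0 < (1 - 2 * \<eta>) * rd" using bs by (intro mult_pos_pos) auto
  then show "0 < nrm d (perp b)" using l by linarith
qed

lemma zdir_unit: "0 < nrm d (perp b) \<Longrightarrow> ip d (zdir b) (zdir b) = 1" "ip d q (zdir b) = 0"
proof -
  show "ip d q (zdir b) = 0" by (simp add: ip_zdir ip_perp q ip_commute[of d q b])
  assume p: "0 < nrm d (perp b)"
  have "ip d (zdir b) (zdir b) = ip d (perp b) (zdir b) / nrm d (perp b)"
    by (simp add: ip_zdir ip_commute[of d "zdir b"])
  then show "ip d (zdir b) (zdir b) = 1" using p nrm_square[of d "perp b", symmetric] by (simp add: ip_zdir)
qed

lemma perp_measurable: "(\<lambda>(b, u). ip d u (zdir b)) \<in> borel_measurable (gauss2 d)"
proof -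
  have [measurable]: "(\<lambda>p. ip d (snd p) (fst p)) \<in> borel_measurable (gauss2 d)"
    using measurable_compose[OF measurable_pair_swap' ip2_measurable] by (simp add: case_prod_unfold)
  have [measurable]: "(\<lambda>p. ip d (fst p) q) \<in> borel_measurable (gauss2 d)"
    by (rule measurable_compose[OF measurable_fst ip_measurable])
  have [measurable]: "(\<lambda>p. ip d (snd p) q) \<in> borel_measurable (gauss2 d)"
    by (rule measurable_compose[OF measurable_snd ip_measurable])
  have [measurable]: "(\<lambda>p. ip d (fst p) (fst p)) \<in> borel_measurable (gauss2 d)"
    by (rule measurable_compose[OF measurable_fst ip_measurable'])
  have "nrm d (perp b) = sqrt (ip d b b - (ip d b q)\<^sup>2)" for b
    by (simp only: nrm_def ip_perp_perp)
  then show ?thesis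
    unfolding case_prod_unfold by (simp only: ip_zdir ip_perp(1)) measurable
qed

lemma mark_measurable: "Measurable.pred (gauss2 d) (\<lambda>(b, u). mark \<tau> b u)"
proof -
  have [measurable]: "(\<lambda>p. ip d (snd p) (zdir (fst p))) \<in> borel_measurable (gauss2 d)"
    using perp_measurable by (simp add: case_prod_unfold)
  show ?thesis unfolding mark_def case_prod_unfold by measurable
qed

lemma prob_mark_le:
  assumes e: "0 \<le> e" "e \<le> 1" and \<tau>: "\<tau> * rd = sqrt (2 * e * lam)" and u: "u \<in> space (gauss d)"
  shows "\<P>(b in gauss d. mark \<tau> b u) \<le> exp (- e * lam + \<xi> * lam)"
proof (cases "good u")
  case False
  then show ?thesis by (simp add: mark_def)
next
  case True
  note bs = basic and gu = good_bounds[OF True]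
  define t where "t = sqrt (2 * e * lam) * (1 - 2 * \<eta>)"
  define v where "v = (\<lambda>i. 1 / nrm d u * perp u i)"
  have t0: "0 \<le> t" using e bs by (auto simp: t_def intro!: mult_nonneg_nonneg)
  have vv: "ip d v v \<le> 1"
  proof -
    have "ip d v v = ip d (perp u) (perp u) / (nrm d u * nrm d u)" unfolding v_def ip_linear by simp
    also have "\<dots> \<le> 1"
    proof -
      have "0 < ip d u u" using mult_pos_pos[OF gu(1) gu(1)] by (simp only: nrm_square)
      then show ?thesis unfolding nrm_square ip_perp_perp by simp
    qed
    finally show ?thesis .
  qed
  define E where "E = {b \<in> space (gauss d). t \<le> ip d b v}"
  define N where "N = {b \<in> space (gauss d). \<not> good b}"
  have m: "E \<in> G.events" "N \<in> G.events" unfolding E_def N_def by measurable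
  have "\<P>(b in gauss d. mark \<tau> b u) \<le> G.prob (E \<union> N)"
  proof (rule G.finite_measure_mono)
    show "{b \<in> space (gauss d). mark \<tau> b u} \<subseteq> E \<union> N"
    proof safe
      fix b assume b: "b \<in> space (gauss d)" "mark \<tau> b u" "b \<notin> N"
      then have gb: "good b" by (simp add: N_def)
      note p = perp_good[OF gb]
      have "0 \<le> \<tau> * rd" unfolding \<tau> using e bs(4) by simp
      then have \<tau>0: "0 \<le> \<tau>" using bs(1) by (simp add: zero_le_mult_iff)
      have "t * nrm d u = \<tau> * ((1 - 2 * \<eta>) * rd) * nrm d u" unfolding t_def \<tau>[symmetric] by simp
      also have "\<dots> \<le> \<tau> * nrm d (perp b) * nrm d u" using p(1) \<tau>0 gu(1) by (intro mult_right_mono mult_left_mono) auto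
      also have "\<dots> = \<tau> * nrm d u * nrm d (perp b)" by simp
      also have "\<dots> \<le> ip d u (zdir b) * nrm d (perp b)" using b(2) p(3) by (intro mult_right_mono) (auto simp: mark_def)
      also have "\<dots> = ip d b (perp u)" using p(3) by (simp add: ip_zdir ip_perp_swap)
      finally have "t \<le> ip d b (perp u) / nrm d u" using gu(1) by (simp add: le_divide_eq)
      also have "\<dots> = ip d b v" unfolding v_def ip_linear by simp
      finally show "b \<in> E" using b(1) by (simp add: E_def)
    qed
  qed (use m in auto)
  also have "\<dots> \<le> G.prob E + G.prob N" by (rule measure_Un_le[OF m])
  also have "\<dots> \<le> exp (- t\<^sup>2 / 2) + 4 * exp (- 8 * lam)"
    unfolding E_def N_def by (intro add_mono gauss_upper1[OF vv t0] not_good_le)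
  also have "\<dots> \<le> exp (- e * lam + \<xi> * lam)"
  proof -
    have "t\<^sup>2 / 2 = e * lam * (1 - 2 * \<eta>)\<^sup>2" using e bs(4) by (simp add: t_def power_mult_distrib)
    also have "\<dots> \<ge> e * lam * (1 - 4 * \<eta>)"
      using e bs(4) by (intro mult_left_mono mult_nonneg_nonneg) (auto simp: power2_eq_square algebra_simps)
    finally have "e * lam - 48 * (e * (\<sigma> * lam)) \<le> t\<^sup>2 / 2" by (simp add: eta algebra_simps)
    moreover have "e * (\<sigma> * lam) \<le> 1 * (\<sigma> * lam)" using e bs by (intro mult_right_mono) auto
    ultimately have t2: "e * lam - \<xi> * lam / 2 \<le> t\<^sup>2 / 2" using eps_lam by linarith
    have "exp (- t\<^sup>2 / 2) \<le> exp (- (e * lam) + \<xi> * lam / 2)" using t2 by simp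
    moreover have "4 * exp (- 8 * lam) \<le> exp (- (e * lam)) / 2 - exp (- (e * lam) - \<xi> * lam / 2)"
      using absorb[of "e * lam"] e bs(4) by (simp add: mult_right_mono)
    then have "4 * exp (- 8 * lam) \<le> exp (- (e * lam)) / 2" using exp_gt_zero[of "- (e * lam) - \<xi> * lam / 2"] by linarith
    moreover have "exp (- (e * lam)) \<le> exp (- (e * lam) + \<xi> * lam / 2)" using eps_lam(2) by simp
    moreover have "2 * exp (- (e * lam) + \<xi> * lam / 2) \<le> exp (- e * lam + \<xi> * lam)"
    proof -
      have "2 \<le> exp (\<xi> * lam / 2)" using exp_ge_add_one_self[of "\<xi> * lam / 2"] eps_lam(5) by linarith
      then have "2 * exp (- (e * lam) + \<xi> * lam / 2) \<le> exp (\<xi> * lam / 2) * exp (- (e * lam) + \<xi> * lam / 2)" by (rule mult_right_mono) simp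
      also have "\<dots> = exp (- e * lam + \<xi> * lam)" by (simp add: mult_exp_exp)
      finally show ?thesis .
    qed
    ultimately show ?thesis using exp_gt_zero[of "- (e * lam)"] by linarith
  qed
  finally show ?thesis .
qed

lemma prob_mark_ge:
  assumes e: "0 \<le> e" "e \<le> 1" and \<tau>: "\<tau> * rd = sqrt (2 * e * lam)" and u: "good u" "g0 \<le> lev u" and us: "u \<in> space (gauss d)"
  shows "exp (- e * lam - \<xi> * lam) \<le> \<P>(b in gauss d. mark \<tau> b u)"
proof -
  note bs = basic and gu = good_bounds[OF u(1)]
  define S where "S = \<xi> * sqrt lam"
  have S: "400 \<le> S" using eps_lam by (simp add: S_def)
  have ss: "\<sigma> * sqrt lam \<le> S / 1000" using sigma_sqrt by (simp add: S_def)
  have sl: "S \<le> sqrt lam / 100" using eps bs(4) by (simp add: S_def mult_right_mono)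
  define P where "P = sqrt (2 * e * lam)"
  have P: "0 \<le> P" "P\<^sup>2 = 2 * e * lam" "P \<le> 3 / 2 * sqrt lam"
  proof -
    show P0: "0 \<le> P" and P2: "P\<^sup>2 = 2 * e * lam" using e bs(4) by (auto simp: P_def)
    have "(3 / 2 * sqrt lam)\<^sup>2 = 9 / 4 * (sqrt lam * sqrt lam)" by (simp add: power2_eq_square)
    then have "(3 / 2 * sqrt lam)\<^sup>2 = 9 / 4 * lam" by (simp only: bs(6))
    moreover have "e * lam \<le> 1 * lam" using e bs(4) by (intro mult_right_mono) auto
    ultimately have "P\<^sup>2 \<le> (3 / 2 * sqrt lam)\<^sup>2" unfolding P2 using bs(4) by linarith
    then show "P \<le> 3 / 2 * sqrt lam" by (rule power2_le_imp_le) (use bs(4) in simp)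
  qed
  have "0 \<le> \<tau> * rd" unfolding \<tau> using P(1) by (simp add: P_def)
  then have \<tau>0: "0 \<le> \<tau>" using bs(1) by (simp add: zero_le_mult_iff)
  define B where "B = P * (1 + 2 * \<eta>)"
  have Peta: "P * (2 * \<eta>) \<le> 36 * (S / 1000)"
  proof -
    have "P * (2 * \<eta>) \<le> (3 / 2 * sqrt lam) * (24 * \<sigma>)"
      unfolding eta by (rule mult_mono) (use bs(4,8) P(1,3) in auto)
    then show ?thesis using ss by (simp add: mult_ac)
  qed
  have B: "0 \<le> B + 2" "B + 2 \<le> P + 5 / 100 * S"
  proof -
    have "B = P + P * (2 * \<eta>)" by (simp add: B_def distrib_left)
    moreover have "0 \<le> P * (2 * \<eta>)" by (rule mult_nonneg_nonneg) (use bs(11) P(1) in auto)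
    ultimately show "0 \<le> B + 2" "B + 2 \<le> P + 5 / 100 * S" using Peta S P(1) by linarith+
  qed
  text \<open>the component of \<open>u\<close> orthogonal to the query has almost full length\<close>
  have pu2: "(nrm d (perp u))\<^sup>2 = (nrm d u)\<^sup>2 * (1 - (lev u)\<^sup>2)"
  proof -
    have "(nrm d u)\<^sup>2 * (lev u)\<^sup>2 = (ip d u q)\<^sup>2" using gu(1) by (simp add: lev_def power_divide)
    then show ?thesis using nrm_square[of d "perp u"] nrm_square[of d u] unfolding ip_perp_perp
      by (simp add: power2_eq_square right_diff_distrib)
  qed
  have lv: "(lev u)\<^sup>2 \<le> \<sigma>"
  proof -
    have "\<bar>lev u\<bar>\<^sup>2 \<le> (5 * \<sigma>)\<^sup>2" using gu(4) by (intro power_mono) auto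
    also have "\<dots> = (25 * \<sigma>) * \<sigma>" by (simp add: power2_eq_square)
    also have "\<dots> \<le> 1 * \<sigma>" using bs by (intro mult_right_mono) auto
    finally show ?thesis by simp
  qed
  have "((1 - \<sigma>) * nrm d u)\<^sup>2 \<le> (nrm d (perp u))\<^sup>2"
  proof -
    have "(1 - \<sigma>)\<^sup>2 \<le> 1 - \<sigma>" using bs by (simp add: power2_eq_square algebra_simps mult_left_le)
    also have "\<dots> \<le> 1 - (lev u)\<^sup>2" using lv by simp
    finally show ?thesis unfolding pu2 power_mult_distrib by (simp add: mult.commute mult_left_mono)
  qed
  then have pul: "(1 - \<sigma>) * nrm d u \<le> nrm d (perp u)" by (rule power2_le_imp_le) (simp add: nrm_def ip_self_nonneg)
  have "0 < (1 - \<sigma>) * nrm d u" using bs gu(1) by (intro mult_pos_pos) auto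
  then have pu0: "0 < nrm d (perp u)" using pul by linarith
  define v where "v = dir d (perp u)"
  have vv: "ip d v v = 1" unfolding v_def by (rule ip_dir_self[OF pu0])
  define w where "w = (\<lambda>i. (B + 2) * v i)"
  have ww: "ip d w w = (B + 2)\<^sup>2" unfolding w_def ip_linear vv by (simp add: power2_eq_square)
  have wv: "B + 2 \<le> ip d w v" unfolding w_def ip_linear vv by simp
  have e1: "(B + 2)\<^sup>2 \<le> 2 * e * lam + 25 / 100 * (\<xi> * lam)"
    using square_perturb[of "B + 2" P "5 / 100"] B P bs(3) by (simp add: S_def)
  have "B + 2 \<le> 2 * sqrt lam" using B P(3) sl bs(3) by linarith
  then have e2: "2 * sqrt (ip d w w) \<le> \<xi> * lam / 100" unfolding ww using B(1) eps_lam(4) by simp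
  define x where "x = e * lam + 15 / 100 * (\<xi> * lam)"
  have x2: "x \<le> 2 * lam"
    using bs(4) mult_right_mono[of e 1 lam] mult_right_mono[of \<xi> "1/100" lam] eps e unfolding x_def by linarith
  define E where "E = {y \<in> space (gauss d). B \<le> ip d y v \<and> B \<le> ip d y v}"
  have Em: "E \<in> G.events" unfolding E_def by measurable
  have "exp (- e * lam - \<xi> * lam) \<le> exp (- x - \<xi> * lam / 2)" unfolding x_def using eps_lam(2) by simp
  also have "\<dots> \<le> exp (- x) / 2 - 4 * exp (- 8 * lam)" by (rule absorb[OF x2])
  also have "exp (- x) / 2 \<le> exp (- ip d w w / 2 - 2 * sqrt (ip d w w)) / 2"
    using e1 e2 eps_lam(2) ww by (simp add: x_def)
  also have "\<dots> \<le> G.prob E" unfolding E_def by (rule gauss_lower[OF vv vv wv wv])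
  also have "G.prob E - 4 * exp (- 8 * lam) \<le> \<P>(x in gauss d. good x \<and> x \<in> E)"
    by (rule prob_good_and[OF Em])
  also have "\<dots> \<le> \<P>(b in gauss d. mark \<tau> b u)"
  proof (rule G.finite_measure_mono)
    show "{x \<in> space (gauss d). good x \<and> x \<in> E} \<subseteq> {b \<in> space (gauss d). mark \<tau> b u}"
    proof safe
      fix b assume b: "good b" "b \<in> E" "b \<in> space (gauss d)"
      note p = perp_good[OF b(1)]
      have "\<tau> * nrm d u * nrm d (perp b) \<le> \<tau> * nrm d u * ((1 + \<eta>) * rd)"
        using p(2) \<tau>0 gu(1) by (intro mult_left_mono) auto
      also have "\<dots> = P * ((1 + \<eta>) * nrm d u)" unfolding P_def \<tau>[symmetric] by simp
      also have "\<dots> \<le> P * ((1 + 2 * \<eta>) * ((1 - \<sigma>) * nrm d u))"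
      proof -
        have "2 * \<eta> * \<sigma> \<le> 1 * \<sigma>" using bs by (intro mult_right_mono) auto
        then have "1 + \<eta> \<le> (1 + 2 * \<eta>) * (1 - \<sigma>)" using bs(8) by (simp add: eta algebra_simps)
        then have "(1 + \<eta>) * nrm d u \<le> (1 + 2 * \<eta>) * (1 - \<sigma>) * nrm d u" using gu(1) by (intro mult_right_mono) auto
        then show ?thesis using P(1) by (intro mult_left_mono) (auto simp: mult.assoc)
      qed
      also have "\<dots> = B * ((1 - \<sigma>) * nrm d u)" by (simp add: B_def)
      also have "\<dots> \<le> B * nrm d (perp u)" using pul P(1) bs by (intro mult_left_mono) (auto simp: B_def)
      also have "\<dots> \<le> ip d b v * nrm d (perp u)" using b(2) pu0 by (intro mult_right_mono) (auto simp: E_def)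
      also have "\<dots> = ip d u (perp b)" using pu0 by (simp add: v_def ip_dir_right ip_perp_swap)
      finally have "\<tau> * nrm d u \<le> ip d u (zdir b)" using p(3) by (simp add: ip_zdir le_divide_eq)
      then show "mark \<tau> b u" using u by (simp add: mark_def)
    qed
    show "{b \<in> space (gauss d). mark \<tau> b u} \<in> G.events"
      using measurable_compose[OF measurable_Pair2'[OF us] mark_measurable[of \<tau>]] by (simp add: pred_def)
  qed
  finally show ?thesis by simp
qed

end

section \<open>Chernoff bounds for independent points\<close>

context prob_space
begin

text \<open>Fubini in the other order: the \<open>k\<close>-th point is fixed and the rest varies.
  For a fixed vertex the candidates for its neighbours are then independent trials.\<close>

lemma resample_rev_le:
  assumes I: "finite I" "k \<in> I" and A: "A \<in> sets (iid I)"
    and c: "\<And>y. y \<in> space M \<Longrightarrow> \<P>(x in iid I. x(k := y) \<in> A) \<le> c"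
  shows "measure (iid I) A \<le> c"
proof -
  interpret P: prob_space "iid I" by (rule prob_space_iid)
  interpret MP: pair_sigma_finite "iid I" M by unfold_locales
  obtain y0 where "y0 \<in> space M" using not_empty by auto
  then have c0: "0 \<le> c" using order_trans[OF measure_nonneg c] by blast
  have m: "(\<lambda>(x, y). indicator A (x(k := y)) :: ennreal) \<in> borel_measurable (iid I \<Otimes>\<^sub>M M)"
    using measurable_compose[OF iid_upd_measurable[OF I(2)] borel_measurable_indicator[OF A]]
    by (simp add: case_prod_unfold)
  have "emeasure (iid I) A = (\<integral>\<^sup>+x. indicator A x \<partial>iid I)" using A by simp
  also have "\<dots> = (\<integral>\<^sup>+x. \<integral>\<^sup>+y. indicator A (x(k := y)) \<partial>M \<partial>iid I)"
    by (rule resample_nn[OF I]) (use A in simp)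
  also have "\<dots> = (\<integral>\<^sup>+y. \<integral>\<^sup>+x. indicator A (x(k := y)) \<partial>iid I \<partial>M)"
    by (rule MP.Fubini'[OF m, symmetric])
  also have "\<dots> \<le> (\<integral>\<^sup>+y. ennreal c \<partial>M)"
  proof (rule nn_integral_mono)
    fix y assume y: "y \<in> space M"
    have "(\<lambda>x. x(k := y)) \<in> iid I \<rightarrow>\<^sub>M iid I"
      using measurable_compose[OF measurable_Pair2'[OF y] iid_upd_measurable[OF I(2)]] by simp
    from measurable_sets[OF this A] have "{x \<in> space (iid I). x(k := y) \<in> A} \<in> sets (iid I)"
      by (simp add: vimage_def Int_def conj_commute)
    then have "(\<integral>\<^sup>+x. indicator {x \<in> space (iid I). x(k := y) \<in> A} x \<partial>iid I) \<le> ennreal c"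
      using c[OF y] by (simp add: P.emeasure_eq_measure ennreal_leI)
    moreover have "(\<integral>\<^sup>+x. indicator A (x(k := y)) \<partial>iid I) = (\<integral>\<^sup>+x. indicator {x \<in> space (iid I). x(k := y) \<in> A} x \<partial>iid I)"
      by (intro nn_integral_cong) (auto simp: indicator_def)
    ultimately show "(\<integral>\<^sup>+x. indicator A (x(k := y)) \<partial>iid I) \<le> ennreal c" by simp
  qed
  also have "\<dots> = ennreal c" by (simp add: emeasure_space_1)
  finally show ?thesis using c0 by (simp add: P.emeasure_eq_measure)
qed

text \<open>Exponential Markov with a free sign of \<open>t\<close>, so that both tails come from
  one argument. Indices outside \<open>L\<close> contribute a factor one.\<close>

lemma chernoff:
  assumes I: "finite I" "L \<subseteq> I" and A: "A \<in> sets M"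
  shows "\<P>(x in iid I. a \<le> t * real (card {l \<in> L. x l \<in> A}))
    \<le> exp ((exp t - 1) * (real (card L) * prob A) - a)"
proof -
  interpret P: prob_space "iid I" by (rule prob_space_iid)
  interpret PP: product_prob_space "\<lambda>_::nat. M" by (rule product_prob)
  have fL: "finite L" using I finite_subset by blast
  define f where "f l y = (if l \<in> L then ennreal (exp (t * indicator A y)) else 1)" for l y
  have fm: "f l \<in> borel_measurable M" for l unfolding f_def using A by measurable
  have prodf: "(\<Prod>l\<in>I. f l (x l)) = ennreal (exp (t * real (card {l \<in> L. x l \<in> A})))" for x
  proof -
    have "(\<Prod>l\<in>I. f l (x l)) = (\<Prod>l\<in>L. ennreal (exp (t * indicator A (x l))))"
      unfolding f_def using I fL by (subst prod.inter_restrict[symmetric]) (auto simp: Int_absorb1)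
    also have "\<dots> = ennreal (exp (\<Sum>l\<in>L. t * indicator A (x l)))" by (simp only: prod_ennreal[OF exp_ge_zero] exp_sum[OF fL])
    also have "(\<Sum>l\<in>L. t * indicator A (x l)) = t * real (card {l \<in> L. x l \<in> A})"
    proof -
      have "(\<Sum>l\<in>L. indicator A (x l)) = (\<Sum>l\<in>L. if x l \<in> A then 1 else (0::real))" by (intro sum.cong) auto
      also have "\<dots> = real (card {l \<in> L. x l \<in> A})" using fL by (simp add: sum.If_cases Int_def)
      finally show ?thesis by (simp add: sum_distrib_left[symmetric])
    qed
    finally show ?thesis .
  qed
  have one: "(\<integral>\<^sup>+y. f l y \<partial>M) \<le> (if l \<in> L then ennreal (exp ((exp t - 1) * prob A)) else 1)" for l
  proof (cases "l \<in> L")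
    case True
    have i: "integrable M (\<lambda>y. exp (t * indicator A y))"
      by (rule integrable_bounded[of _ "max 1 (exp t)"]) (use A in \<open>auto simp: indicator_def\<close>)
    have "(\<integral>y. exp (t * indicator A y) \<partial>M) = (\<integral>y. 1 + (exp t - 1) * indicator A y \<partial>M)"
      by (intro Bochner_Integration.integral_cong) (auto simp: indicator_def)
    also have "\<dots> = 1 + (exp t - 1) * prob A"
      using A by (simp add: prob_space emeasure_eq_measure)
    also have "\<dots> \<le> exp ((exp t - 1) * prob A)" using exp_ge_add_one_self[of "(exp t - 1) * prob A"] by simp
    finally have "ennreal (\<integral>y. exp (t * indicator A y) \<partial>M) \<le> ennreal (exp ((exp t - 1) * prob A))" by (rule ennreal_leI)
    then show ?thesis using True nn_integral_eq_integral[OF i] by (simp add: f_def)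
  qed (simp add: f_def emeasure_space_1)
  let ?S = "{x \<in> space (iid I). a \<le> t * real (card {l \<in> L. x l \<in> A})}"
  have gm: "(\<lambda>x. \<Prod>l\<in>I. f l (x l)) \<in> borel_measurable (iid I)"
  proof (rule borel_measurable_prod_ennreal)
    fix l assume "l \<in> I"
    then have "(\<lambda>x. x l) \<in> iid I \<rightarrow>\<^sub>M M" by (rule measurable_component_singleton)
    from measurable_compose[OF this fm] show "(\<lambda>x. f l (x l)) \<in> borel_measurable (iid I)" .
  qed
  have Sm: "?S \<in> sets (iid I)"
  proof -
    have "?S = {x \<in> space (iid I). ennreal (exp a) \<le> (\<Prod>l\<in>I. f l (x l))}"
      unfolding prodf by (auto simp: ennreal_le_iff)
    then show ?thesis using gm by simp
  qed
  have "emeasure (iid I) ?S = (\<integral>\<^sup>+x. indicator ?S x \<partial>iid I)" using Sm by simp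
  also have "\<dots> \<le> (\<integral>\<^sup>+x. ennreal (exp (- a)) * (\<Prod>l\<in>I. f l (x l)) \<partial>iid I)"
    unfolding prodf
    by (intro nn_integral_mono)
      (auto simp: indicator_def ennreal_mult[symmetric] mult_exp_exp intro!: ennreal_leI[of 1, simplified])
  also have "\<dots> = ennreal (exp (- a)) * (\<integral>\<^sup>+x. (\<Prod>l\<in>I. f l (x l)) \<partial>iid I)" by (rule nn_integral_cmult[OF gm])
  also have "(\<integral>\<^sup>+x. (\<Prod>l\<in>I. f l (x l)) \<partial>iid I) = (\<Prod>l\<in>I. \<integral>\<^sup>+y. f l y \<partial>M)"
    by (rule PP.product_nn_integral_prod[OF I(1) fm])
  also have "\<dots> \<le> (\<Prod>l\<in>I. if l \<in> L then ennreal (exp ((exp t - 1) * prob A)) else 1)"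
    by (rule prod_mono_ennreal) (rule one)
  also have "\<dots> = ennreal (exp ((exp t - 1) * prob A)) ^ card L"
    using I fL by (subst prod.inter_restrict[symmetric]) (auto simp: Int_absorb1)
  also have "\<dots> = ennreal (exp ((exp t - 1) * (real (card L) * prob A)))"
    by (simp add: ennreal_power exp_of_nat_mult[symmetric] mult_ac)
  finally have "emeasure (iid I) ?S \<le> ennreal (exp (- a)) * ennreal (exp ((exp t - 1) * (real (card L) * prob A)))"
    by (simp add: mult_left_mono)
  also have "\<dots> = ennreal (exp ((exp t - 1) * (real (card L) * prob A) - a))"
    by (simp add: ennreal_mult[symmetric] mult_exp_exp)
  finally show ?thesis by (simp add: P.emeasure_eq_measure)
qed

lemma chernoff_upper:
  assumes I: "finite I" "L \<subseteq> I" and A: "A \<in> sets M"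
  shows "\<P>(x in iid I. a \<le> real (card {l \<in> L. x l \<in> A})) \<le> exp (2 * (real (card L) * prob A) - a)"
proof -
  have "\<P>(x in iid I. a \<le> real (card {l \<in> L. x l \<in> A})) \<le> exp ((exp 1 - 1) * (real (card L) * prob A) - a)"
    using chernoff[OF assms, of a 1] by simp
  also have "\<dots> \<le> exp (2 * (real (card L) * prob A) - a)"
    using exp_le by (simp add: mult_right_mono)
  finally show ?thesis .
qed

lemma chernoff_lower:
  assumes I: "finite I" "L \<subseteq> I" and A: "A \<in> sets M"
  shows "\<P>(x in iid I. real (card {l \<in> L. x l \<in> A}) \<le> a) \<le> exp (a - real (card L) * prob A / 2)"
proof -
  have "exp (- 1 :: real) \<le> 1 / 2" using exp_ge_add_one_self[of "1::real"] by (simp add: exp_minus field_simps)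
  then have "(exp (- 1) - 1) * (real (card L) * prob A) \<le> (- 1 / 2) * (real (card L) * prob A)"
    by (intro mult_right_mono) auto
  moreover have "\<P>(x in iid I. real (card {l \<in> L. x l \<in> A}) \<le> a)
      \<le> exp ((exp (- 1) - 1) * (real (card L) * prob A) - (- a))"
    using chernoff[OF assms, of "- a" "- 1"] by simp
  ultimately show ?thesis by (elim order_trans) simp
qed

lemma iid_union_le:
  assumes "finite K" "\<And>k. k \<in> K \<Longrightarrow> A k \<in> sets (iid I)" "\<And>k. k \<in> K \<Longrightarrow> measure (iid I) (A k) \<le> c"
  shows "measure (iid I) (\<Union>k\<in>K. A k) \<le> real (card K) * c"
proof -
  interpret P: prob_space "iid I" by (rule prob_space_iid)
  have "measure (iid I) (\<Union>k\<in>K. A k) \<le> (\<Sum>k\<in>K. measure (iid I) (A k))"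
    by (rule P.finite_measure_subadditive_finite) (use assms in auto)
  also have "\<dots> \<le> (\<Sum>k\<in>K. c)" by (rule sum_mono) (rule assms)
  finally show ?thesis by simp
qed

end

context query_regime
begin

text \<open>Index 0 belongs to the planted point, which takes no part in the random graph of
  independent points.\<close>

definition V :: "nat set" where "V = {1..<n}"

lemma finite_V [simp]: "finite V"
  by (simp add: V_def)

abbreviation P where "P \<equiv> G.iid V"

abbreviation Pb where "Pb \<equiv> gauss d \<Otimes>\<^sub>M P"

lemma Rel_lev: "Rel0 j u y \<Longrightarrow> lev u < lev y"
proof -
  assume "Rel0 j u y"
  then have "lev u + 1 / real d \<le> lev y" by (simp add: Rel0_def imp_def)
  moreover have "0 < 1 / real d" using d3 by simp
  ultimately show ?thesis by linarith
qed

sublocale W0: walk_model "gauss d" V Rel0 lev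
  by (unfold_locales, rule finite_V, rule pair_measurable(3), rule Rel_lev)

sublocale W1: walk_model "gauss d" V Rel1 lev
  by (unfold_locales, rule finite_V, rule pair_measurable(4), rule Rel_lev, unfold Rel1_def, erule conjunct1)

interpretation PP: prob_space P by (rule G.prob_space_iid)

text \<open>The reservoir for constants and factors \<open>lam\<close>: from
  \<open>400 \<le> \<xi> * sqrt lam\<close> one gets
  \<open>160000 * lam \<le> (\<xi> * lam)\<^sup>2\<close>, and half of that square is the quadratic
  Taylor term of the exponential.\<close>

lemma exp_big:
  shows "80000 * lam \<le> exp (\<xi> * lam)" "real n = exp lam" "real (card V) \<le> exp lam" "exp lam / 2 \<le> real (card V)" "V \<noteq> {}"
proof -
  note b = basic
  have "400 * (400 * lam) \<le> (\<xi> * sqrt lam) * ((\<xi> * sqrt lam) * lam)"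
    using eps_lam(3) b(4) by (intro mult_mono) auto
  also have "\<dots> = (\<xi> * lam)\<^sup>2"
  proof -
    have "(\<xi> * sqrt lam) * ((\<xi> * sqrt lam) * lam) = \<xi> * \<xi> * (sqrt lam * sqrt lam) * lam" by (simp only: mult_ac)
    then show ?thesis by (simp only: b(6) power2_eq_square mult_ac)
  qed
  finally have 1: "160000 * lam \<le> (\<xi> * lam)\<^sup>2" by simp
  have "1 + \<xi> * lam + (\<xi> * lam)\<^sup>2 / 2 \<le> exp (\<xi> * lam)"
    by (rule exp_lower_Taylor_quadratic) (use eps_lam(2) in simp)
  then show "80000 * lam \<le> exp (\<xi> * lam)" using 1 eps_lam(2) by linarith
  show n: "real n = exp lam" using b by simp
  have "1 \<le> exp lam / 2" using exp_ge_add_one_self[of lam] b(5) by linarith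
  then show "exp lam / 2 \<le> real (card V)" "real (card V) \<le> exp lam" using n b(15) by (auto simp: V_def of_nat_diff)
  show "V \<noteq> {}" using b(15) by (simp add: V_def)
qed

lemma component_P: "k \<in> V \<Longrightarrow> (\<lambda>x. x k) \<in> P \<rightarrow>\<^sub>M gauss d"
  by (rule measurable_component_singleton)

subsection \<open>Structural events\<close>

definition EGood where "EGood = {x \<in> space P. \<forall>k\<in>V. good (x k)}"
text \<open>In contrast to the other structural events this is the event of failure.\<close>

definition EOrth where "EOrth = {x \<in> space P. \<exists>k\<in>V. \<exists>l\<in>V. k \<noteq> l \<and> \<not> Orth (x k) (x l)}"
definition EProg where "EProg = {x \<in> space P. \<forall>k\<in>V. good (x k) \<and> lev (x k) < g0 \<longrightarrow>
   (\<exists>l\<in>V - {k}. real l \<le> J (x k) \<and> imp (x k) (x l))}"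
definition EDeg where "EDeg = {x \<in> space P. \<forall>k\<in>V. good (x k) \<longrightarrow>
   real (card {l \<in> V - {k}. good (x l) \<and> adj (x k) (x l)}) \<le> exp ((\<rho> + 8 * \<xi>) * lam)}"

lemma good_P: "k \<in> V \<Longrightarrow> Measurable.pred P (\<lambda>x. good (x k))"
  using measurable_compose[OF component_P good_measurable] by simp

lemma lev_P: "k \<in> V \<Longrightarrow> (\<lambda>x. lev (x k)) \<in> borel_measurable P"
  using measurable_compose[OF component_P lev_measurable] by simp

lemma J_P: "k \<in> V \<Longrightarrow> (\<lambda>x. J (x k)) \<in> borel_measurable P"
  using measurable_compose[OF component_P J_measurable] by simp

lemma pair_P:
  assumes "k \<in> V" "l \<in> V" "Measurable.pred (gauss2 d) (\<lambda>(u, y). R u y)"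
  shows "Measurable.pred P (\<lambda>x. R (x k) (x l))"
proof -
  have "(\<lambda>x. (x k, x l)) \<in> P \<rightarrow>\<^sub>M gauss2 d"
    by (intro measurable_Pair component_P assms)
  from measurable_compose[OF this assms(3)] show ?thesis by simp
qed

lemma EGood_prob: "EGood \<in> sets P" "measure P (space P - EGood) \<le> 4 * exp (- 7 * lam)"
proof -
  define B where "B k = {x \<in> space P. \<not> good (x k)}" for k
  have Bm: "B k \<in> sets P" if "k \<in> V" for k
    using good_P[OF that] unfolding B_def by measurable
  have Bp: "measure P (B k) \<le> 4 * exp (- 8 * lam)" if k: "k \<in> V" for k
  proof -
    have "measure P (B k) \<le> (\<integral>x. 4 * exp (- 8 * lam) \<partial>P)"
    proof (rule G.resample_prob_le[OF _ k Bm[OF k]])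
      fix x assume x: "x \<in> space P"
      have "{y \<in> space (gauss d). x(k := y) \<in> B k} \<subseteq> {y \<in> space (gauss d). \<not> good y}" by (auto simp: B_def)
      then have "\<P>(y in gauss d. x(k := y) \<in> B k) \<le> \<P>(y in gauss d. \<not> good y)"
        by (rule G.finite_measure_mono) measurable
      then show "\<P>(y in gauss d. x(k := y) \<in> B k) \<le> 4 * exp (- 8 * lam)"
        using not_good_le by linarith
    qed auto
    then show ?thesis by (simp add: PP.prob_space)
  qed
  have eq: "space P - EGood = (\<Union>k\<in>V. B k)" by (auto simp: EGood_def B_def)
  have "(\<Union>k\<in>V. B k) \<in> sets P" using Bm by auto
  then have "space P - (\<Union>k\<in>V. B k) \<in> sets P" by (rule sets.compl_sets)
  moreover have "EGood = space P - (\<Union>k\<in>V. B k)" unfolding eq[symmetric] by (auto simp: EGood_def)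
  ultimately show "EGood \<in> sets P" by simp
  have "measure P (space P - EGood) \<le> real (card V) * (4 * exp (- 8 * lam))"
    unfolding eq by (rule G.iid_union_le) (use Bm Bp in auto)
  also have "\<dots> \<le> exp lam * (4 * exp (- 8 * lam))" using exp_big(3) by (intro mult_right_mono) auto
  also have "\<dots> = 4 * exp (- 7 * lam)" by (simp add: mult_exp_exp)
  finally show "measure P (space P - EGood) \<le> 4 * exp (- 7 * lam)" .
qed

lemma EOrth_prob: "measure P EOrth \<le> exp (- 6 * lam)"
proof -
  define B where "B kl = {x \<in> space P. \<not> Orth (x (fst kl)) (x (snd kl))}" for kl
  let ?K = "{kl \<in> V \<times> V. fst kl \<noteq> snd kl}"
  have Bm: "B kl \<in> sets P" if "kl \<in> ?K" for kl
    using pair_P[OF _ _ pair_measurable(6), of "fst kl" "snd kl"] that unfolding B_def by (auto simp: pred_def)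
  have Bp: "measure P (B kl) \<le> exp (- 8 * lam)" if kl: "kl \<in> ?K" for kl
  proof -
    have "measure P (B kl) \<le> (\<integral>x. exp (- 8 * lam) \<partial>P)"
    proof (rule G.resample_prob_le[OF finite_V, of "snd kl"])
      fix x assume x: "x \<in> space P"
      have "{y \<in> space (gauss d). x(snd kl := y) \<in> B kl} \<subseteq> {y \<in> space (gauss d). \<not> Orth (x (fst kl)) y}"
        using kl by (auto simp: B_def)
      moreover have "{y \<in> space (gauss d). \<not> Orth (x (fst kl)) y} \<in> G.events"
      proof -
        have "x (fst kl) \<in> space (gauss d)" using x kl by (auto intro: W0.space_iidD)
        from measurable_compose[OF measurable_Pair1'[OF this] pair_measurable(6)] show ?thesis by (simp add: pred_def)
      qed
      ultimately have "\<P>(y in gauss d. x(snd kl := y) \<in> B kl) \<le> \<P>(y in gauss d. \<not> Orth (x (fst kl)) y)"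
        by (rule G.finite_measure_mono)
      then show "\<P>(y in gauss d. x(snd kl := y) \<in> B kl) \<le> exp (- 8 * lam)"
        using prob_not_orth_le[of "x (fst kl)"] by linarith
    qed (use kl Bm in auto)
    then show ?thesis by (simp add: PP.prob_space)
  qed
  have "EOrth = (\<Union>kl\<in>?K. B kl)" by (auto simp: EOrth_def B_def; blast)
  then have "measure P EOrth \<le> real (card ?K) * exp (- 8 * lam)"
    using G.iid_union_le[of ?K B V] Bm Bp by simp
  also have "\<dots> \<le> (exp lam * exp lam) * exp (- 8 * lam)"
  proof (rule mult_right_mono)
    have "card ?K \<le> card (V \<times> V)" by (rule card_mono) auto
    then have "real (card ?K) \<le> real (card V) * real (card V)" by (simp add: card_cartesian_product flip: of_nat_mult)
    also have "\<dots> \<le> exp lam * exp lam" using exp_big(3) by (intro mult_mono) auto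
    finally show "real (card ?K) \<le> exp lam * exp lam" .
  qed simp
  also have "\<dots> = exp (- 6 * lam)" by (simp add: mult_exp_exp)
  finally show ?thesis .
qed

lemma p_bounds: "exp (- \<kappa> * lam + \<xi> * lam) = exp ((\<rho> + 7 * \<xi>) * lam) / exp lam"
proof -
  have "- \<kappa> * lam + \<xi> * lam = (\<rho> + 7 * \<xi>) * lam - lam" unfolding kappa by (simp add: algebra_simps)
  then show ?thesis by (simp only: exp_diff)
qed

text \<open>With \<open>x k\<close> fixed, the degree among the independent points is a sum of
  independent indicators of mean at most \<open>exp ((\<rho> + 7 * \<xi>) * lam)\<close>. The
  threshold carries one more \<open>\<xi>\<close>, so the Chernoff exponent exceeds
  \<open>8 * lam\<close> and leaves room for a union bound over the vertices.\<close>

lemma EDeg_prob: "EDeg \<in> sets P" "measure P (space P - EDeg) \<le> exp (- 7 * lam)"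
proof -
  define a where "a = exp ((\<rho> + 8 * \<xi>) * lam)"
  define B where "B k = {x \<in> space P. good (x k) \<and> a < real (card {l \<in> V - {k}. good (x l) \<and> adj (x k) (x l)})}" for k
  have Bm: "B k \<in> sets P" if k: "k \<in> V" for k
  proof -
    have "(\<lambda>x. \<Sum>l\<in>V - {k}. if good (x l) \<and> adj (x k) (x l) then 1 else (0::real)) \<in> borel_measurable P"
    proof (intro borel_measurable_sum measurable_If borel_measurable_const)
      fix l assume "l \<in> V - {k}"
      then have l: "l \<in> V" by simp
      have "Measurable.pred P (\<lambda>x. good (x l) \<and> adj (x k) (x l))"
        using good_P[OF l] pair_P[OF k l pair_measurable(1)] by simp
      then show "{x \<in> space P. good (x l) \<and> adj (x k) (x l)} \<in> sets P" by (simp add: pred_def)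
    qed
    moreover have "(\<Sum>l\<in>V - {k}. if good (x l) \<and> adj (x k) (x l) then 1 else (0::real))
        = real (card {l \<in> V - {k}. good (x l) \<and> adj (x k) (x l)})" for x
      by (simp add: sum.If_cases Int_def)
    ultimately have cm: "(\<lambda>x. real (card {l \<in> V - {k}. good (x l) \<and> adj (x k) (x l)})) \<in> borel_measurable P" by (simp only:)
    have "{x \<in> space P. a < real (card {l \<in> V - {k}. good (x l) \<and> adj (x k) (x l)})} \<in> sets P"
      by (rule borel_measurable_less[OF borel_measurable_const cm])
    moreover have "{x \<in> space P. good (x k)} \<in> sets P" using good_P[OF k] by (simp add: pred_def)
    ultimately have "{x \<in> space P. a < real (card {l \<in> V - {k}. good (x l) \<and> adj (x k) (x l)})} \<inter> {x \<in> space P. good (x k)} \<in> sets P"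
      by (rule sets.Int)
    moreover have "B k = {x \<in> space P. a < real (card {l \<in> V - {k}. good (x l) \<and> adj (x k) (x l)})} \<inter> {x \<in> space P. good (x k)}"
      unfolding B_def by blast
    ultimately show ?thesis by (simp only:)
  qed
  have Bp: "measure P (B k) \<le> exp (- 8 * lam)" if k: "k \<in> V" for k
  proof (rule G.resample_rev_le[OF finite_V k Bm[OF k]])
    fix y assume y: "y \<in> space (gauss d)"
    show "\<P>(x in P. x(k := y) \<in> B k) \<le> exp (- 8 * lam)"
    proof (cases "good y")
      case False
      then show ?thesis by (simp add: B_def)
    next
      case True
      define Ay where "Ay = {z \<in> space (gauss d). good z \<and> adj y z}"
      have Am: "Ay \<in> G.events"
      proof -
        have "Measurable.pred (gauss d) (\<lambda>z. good z \<and> adj y z)"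
          using good_measurable adj_measurable1[of y] by simp
        then show ?thesis by (simp add: Ay_def pred_def)
      qed
      have sub: "{x \<in> space P. x(k := y) \<in> B k} \<subseteq> {x \<in> space P. a \<le> real (card {l \<in> V - {k}. x l \<in> Ay})}"
      proof
        fix x assume "x \<in> {x \<in> space P. x(k := y) \<in> B k}"
        then have x: "x \<in> space P" "a < real (card {l \<in> V - {k}. good ((x(k := y)) l) \<and> adj y ((x(k := y)) l)})"
          by (auto simp: B_def)
        have "{l \<in> V - {k}. good ((x(k := y)) l) \<and> adj y ((x(k := y)) l)} = {l \<in> V - {k}. x l \<in> Ay}"
          using x(1) by (auto simp: Ay_def intro: W0.space_iidD)
        then show "x \<in> {x \<in> space P. a \<le> real (card {l \<in> V - {k}. x l \<in> Ay})}" using x by simp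
      qed
      have "{x \<in> space P. a \<le> real (card {l \<in> V - {k}. x l \<in> Ay})} \<in> sets P"
      proof -
        have "(\<lambda>x. \<Sum>l\<in>V - {k}. indicator Ay (x l) :: real) \<in> borel_measurable P"
        proof (rule borel_measurable_sum)
          fix l assume "l \<in> V - {k}"
          then have "(\<lambda>x. x l) \<in> P \<rightarrow>\<^sub>M gauss d" by (intro component_P) simp
          from measurable_compose[OF this borel_measurable_indicator[OF Am]]
          show "(\<lambda>x. indicator Ay (x l) :: real) \<in> borel_measurable P" .
        qed
        moreover have "(\<Sum>l\<in>V - {k}. indicator Ay (x l) :: real) = real (card {l \<in> V - {k}. x l \<in> Ay})" for x
          by (simp add: indicator_def sum.If_cases Int_def)
        ultimately have cm: "(\<lambda>x. real (card {l \<in> V - {k}. x l \<in> Ay})) \<in> borel_measurable P" by (simp only:)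
        show ?thesis by (rule borel_measurable_le[OF borel_measurable_const cm])
      qed
      then have "\<P>(x in P. x(k := y) \<in> B k) \<le> \<P>(x in P. a \<le> real (card {l \<in> V - {k}. x l \<in> Ay}))"
        by (rule PP.finite_measure_mono[OF sub])
      also have "\<dots> \<le> exp (2 * (real (card (V - {k})) * G.prob Ay) - a)"
        by (rule G.chernoff_upper[OF finite_V _ Am]) auto
      also have "\<dots> \<le> exp (- 8 * lam)"
      proof -
        have "card (V - {k}) \<le> card V" by (rule card_mono) auto
        then have "real (card (V - {k})) \<le> exp lam" using exp_big(3) by linarith
        moreover have "G.prob Ay \<le> exp ((\<rho> + 7 * \<xi>) * lam) / exp lam"
          unfolding Ay_def p_bounds[symmetric] by (rule prob_adj_le[OF good_bounds(1)[OF True]])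
        ultimately have "real (card (V - {k})) * G.prob Ay \<le> exp lam * (exp ((\<rho> + 7 * \<xi>) * lam) / exp lam)"
          by (intro mult_mono) auto
        then have 1: "real (card (V - {k})) * G.prob Ay \<le> exp ((\<rho> + 7 * \<xi>) * lam)" by simp
        have "(\<rho> + 8 * \<xi>) * lam = \<xi> * lam + (\<rho> + 7 * \<xi>) * lam" by (simp add: algebra_simps)
        then have 2: "a = exp (\<xi> * lam) * exp ((\<rho> + 7 * \<xi>) * lam)" by (simp only: a_def exp_add)
        have ge1: "1 \<le> exp ((\<rho> + 7 * \<xi>) * lam)" using rho eps basic(4) by simp
        have "10 * lam \<le> exp (\<xi> * lam) - 2" using exp_big(1) basic(5) by linarith
        also have "\<dots> = (exp (\<xi> * lam) - 2) * 1" by simp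
        also have "\<dots> \<le> (exp (\<xi> * lam) - 2) * exp ((\<rho> + 7 * \<xi>) * lam)"
          using exp_big(1) basic(5) ge1 by (intro mult_left_mono) auto
        also have "\<dots> = a - 2 * exp ((\<rho> + 7 * \<xi>) * lam)" unfolding 2 by (rule left_diff_distrib)
        finally have "2 * (real (card (V - {k})) * G.prob Ay) - a \<le> - 8 * lam" using 1 basic(4) by linarith
        then show ?thesis by (simp only: exp_le_cancel_iff)
      qed
      finally show ?thesis .
    qed
  qed
  have eq: "space P - EDeg = (\<Union>k\<in>V. B k)" by (auto simp: EDeg_def B_def a_def not_le)
  have "(\<Union>k\<in>V. B k) \<in> sets P" using Bm by auto
  then have "space P - (\<Union>k\<in>V. B k) \<in> sets P" by (rule sets.compl_sets)
  moreover have "EDeg = space P - (\<Union>k\<in>V. B k)" unfolding eq[symmetric] by (auto simp: EDeg_def)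
  ultimately show "EDeg \<in> sets P" by simp
  have "measure P (space P - EDeg) \<le> real (card V) * exp (- 8 * lam)"
    unfolding eq by (rule G.iid_union_le) (use Bm Bp in auto)
  also have "\<dots> \<le> exp lam * exp (- 8 * lam)" using exp_big(3) by (intro mult_right_mono) auto
  also have "\<dots> = exp (- 7 * lam)" by (simp add: mult_exp_exp)
  finally show "measure P (space P - EDeg) \<le> exp (- 7 * lam)" .
qed

text \<open>The cutoff has to stay below the number of points for enough candidates to exist. This
  uses the loss in \<open>\<kappa>\<close>: below \<open>g0\<close> one has
  \<open>Lv u \<le> \<rho> * lam\<close>, and \<open>\<kappa> + \<rho> + 3 * \<xi>\<close> is below
  1, where the third \<open>\<xi>\<close> pays for the factor 4.\<close>

lemma J_bounds:
  assumes "good u" "lev u < g0"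
  shows "J u = exp (\<kappa> * lam + Lv u + 2 * \<xi> * lam)" "J u \<le> exp lam / 4" "80000 \<le> J u"
proof -
  note lo = below_g0[OF assms]
  show J: "J u = exp (\<kappa> * lam + Lv u + 2 * \<xi> * lam)" using assms by (simp add: J_def)
  have e4: "4 \<le> exp (\<xi> * lam)" using exp_big(1) basic(5) by linarith
  have "J u * 4 \<le> J u * exp (\<xi> * lam)" using e4 J by (intro mult_left_mono) auto
  also have "\<dots> = exp (\<kappa> * lam + Lv u + 3 * \<xi> * lam)" unfolding J by (simp add: mult_exp_exp algebra_simps)
  also have "\<dots> \<le> exp lam"
  proof -
    have "\<kappa> * lam + \<rho> * lam + 6 * (\<xi> * lam) = lam" by (simp add: kappa algebra_simps)
    then show ?thesis using lo(3) eps_lam(2) by simp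
  qed
  finally show "J u \<le> exp lam / 4" by simp
  have "\<xi> * lam \<le> \<kappa> * lam + Lv u + 2 * \<xi> * lam"
    using basic(4,13) eps_lam(2) by (simp add: Lv_def)
  then have "exp (\<xi> * lam) \<le> J u" unfolding J by simp
  then show "80000 \<le> J u" using exp_big(1) basic(5) by linarith
qed

text \<open>\<open>J\<close> exceeds the reciprocal of the lower bound in \<open>prob_imp_ge\<close>
  by a factor \<open>exp (\<xi> * lam)\<close>. At least half of the indices up to \<open>J\<close>
  remain after rounding down and removing \<open>k\<close>, so the expected number of improving
  neighbours is at least \<open>exp (\<xi> * lam) / 2\<close>, and having none is excluded by the
  lower Chernoff tail.\<close>

lemma EProg_prob: "EProg \<in> sets P" "measure P (space P - EProg) \<le> exp (- 7 * lam)"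
proof -
  define B where "B k = {x \<in> space P. good (x k) \<and> lev (x k) < g0 \<and> (\<forall>l\<in>V - {k}. \<not> (real l \<le> J (x k) \<and> imp (x k) (x l)))}" for k
  have Bm: "B k \<in> sets P" if k: "k \<in> V" for k
  proof -
    have 1: "Measurable.pred P (\<lambda>x. lev (x k) < g0)"
      unfolding pred_def by (rule borel_measurable_less[OF lev_P[OF k] borel_measurable_const])
    have 2: "Measurable.pred P (\<lambda>x. real l \<le> J (x k))" for l
      unfolding pred_def by (rule borel_measurable_le[OF borel_measurable_const J_P[OF k]])
    have "Measurable.pred P (\<lambda>x. good (x k) \<and> lev (x k) < g0 \<and> (\<forall>l\<in>V - {k}. \<not> (real l \<le> J (x k) \<and> imp (x k) (x l))))"
    proof -
      have "Measurable.pred P (\<lambda>x. \<forall>l\<in>V - {k}. \<not> (real l \<le> J (x k) \<and> imp (x k) (x l)))"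
      proof (rule pred_intros_finite)
        fix l assume "l \<in> V - {k}"
        then have l: "l \<in> V" by simp
        show "Measurable.pred P (\<lambda>x. \<not> (real l \<le> J (x k) \<and> imp (x k) (x l)))"
          using 2[of l] pair_P[OF k l pair_measurable(2)] by simp
      qed simp
      then show ?thesis using good_P[OF k] 1 by simp
    qed
    then show ?thesis by (simp add: B_def pred_def)
  qed
  have Bp: "measure P (B k) \<le> exp (- 8 * lam)" if k: "k \<in> V" for k
  proof (rule G.resample_rev_le[OF finite_V k Bm[OF k]])
    fix y assume y: "y \<in> space (gauss d)"
    show "\<P>(x in P. x(k := y) \<in> B k) \<le> exp (- 8 * lam)"
    proof (cases "good y \<and> lev y < g0")
      case False
      then have "{x \<in> space P. x(k := y) \<in> B k} = {}" by (auto simp: B_def)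
      then show ?thesis by (simp only: measure_empty) simp
    next
      case True
      then have gy: "good y" "lev y < g0" by auto
      note J = J_bounds[OF gy]
      define Ay where "Ay = {z \<in> space (gauss d). imp y z}"
      have Am: "Ay \<in> G.events" using imp_measurable1[of y] by (simp add: Ay_def pred_def)
      define L where "L = {l \<in> V - {k}. real l \<le> J y}"
      have "{x \<in> space P. x(k := y) \<in> B k} \<subseteq> {x \<in> space P. real (card {l \<in> L. x l \<in> Ay}) \<le> 0}"
      proof safe
        fix x assume x: "x \<in> space P" "x(k := y) \<in> B k"
        then have e: "{l \<in> L. x l \<in> Ay} = {}" by (auto simp: B_def L_def Ay_def)
        show "real (card {l \<in> L. x l \<in> Ay}) \<le> 0" by (subst e) simp
      qed
      moreover have "{x \<in> space P. real (card {l \<in> L. x l \<in> Ay}) \<le> 0} \<in> sets P"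
      proof -
        have "Measurable.pred P (\<lambda>x. \<forall>l\<in>L. \<not> x l \<in> Ay)"
        proof (intro pred_intros_finite pred_intros_logic)
          fix l assume "l \<in> L"
          then have "(\<lambda>x. x l) \<in> P \<rightarrow>\<^sub>M gauss d" by (intro component_P) (simp add: L_def)
          from measurable_sets[OF this Am] show "Measurable.pred P (\<lambda>x. x l \<in> Ay)"
            by (simp add: pred_def vimage_def Int_def conj_commute)
        qed (simp add: L_def)
        moreover have "real (card {l \<in> L. x l \<in> Ay}) \<le> 0 \<longleftrightarrow> (\<forall>l\<in>L. \<not> x l \<in> Ay)" for x
        proof -
          have "finite {l \<in> L. x l \<in> Ay}" by (simp add: L_def)
          then show ?thesis by auto
        qed
        ultimately show ?thesis by (simp add: pred_def)
      qed
      ultimately have "\<P>(x in P. x(k := y) \<in> B k) \<le> \<P>(x in P. real (card {l \<in> L. x l \<in> Ay}) \<le> 0)"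
        by (rule PP.finite_measure_mono)
      also have "\<dots> \<le> exp (0 - real (card L) * G.prob Ay / 2)"
        by (rule G.chernoff_lower[OF finite_V _ Am]) (auto simp: L_def)
      also have "\<dots> \<le> exp (- 8 * lam)"
      proof -
        have sub: "{1..nat \<lfloor>J y\<rfloor>} - {k} \<subseteq> L"
        proof
          fix l assume l: "l \<in> {1..nat \<lfloor>J y\<rfloor>} - {k}"
          then have "int l \<le> \<lfloor>J y\<rfloor>" by auto
          then have lJ: "real l \<le> J y" by (simp add: le_floor_iff)
          also have "J y < exp lam" using J(2) exp_gt_zero[of lam] by linarith
          finally have "real l < real n" using exp_big(2) by simp
          then have "l \<in> V" using l by (simp add: V_def)
          then show "l \<in> L" using l lJ by (simp add: L_def)
        qed
        have "nat \<lfloor>J y\<rfloor> - 1 \<le> card ({1..nat \<lfloor>J y\<rfloor>} - {k})"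
          using diff_card_le_card_Diff[of "{k}" "{1..nat \<lfloor>J y\<rfloor>}"] by simp
        also have "\<dots> \<le> card L" by (rule card_mono[OF _ sub]) (simp add: L_def)
        finally have "nat \<lfloor>J y\<rfloor> \<le> card L + 1" by simp
        then have "real (nat \<lfloor>J y\<rfloor>) \<le> real (card L + 1)" by (rule of_nat_mono)
        moreover have "J y - 1 \<le> real (nat \<lfloor>J y\<rfloor>)" by linarith
        ultimately have c: "J y / 2 \<le> real (card L)" using J(3) by linarith
        have m: "exp (\<xi> * lam) / J y \<le> G.prob Ay"
        proof -
          have "exp (\<xi> * lam) / J y = exp (- \<kappa> * lam - Lv y - \<xi> * lam)"
            unfolding J(1) by (simp add: exp_diff[symmetric] algebra_simps)
          also have "\<dots> \<le> G.prob Ay" unfolding Ay_def by (rule prob_imp_ge[OF gy])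
          finally show ?thesis .
        qed
        have "J y / 2 * (exp (\<xi> * lam) / J y) \<le> real (card L) * G.prob Ay"
          using c m J(3) by (intro mult_mono) auto
        then have "exp (\<xi> * lam) / 2 \<le> real (card L) * G.prob Ay" using J(3) by simp
        then show ?thesis using exp_big(1) basic(4) by simp
      qed
      finally show ?thesis .
    qed
  qed
  have eq: "space P - EProg = (\<Union>k\<in>V. B k)" by (auto simp: EProg_def B_def)
  have "(\<Union>k\<in>V. B k) \<in> sets P" using Bm by auto
  then have "space P - (\<Union>k\<in>V. B k) \<in> sets P" by (rule sets.compl_sets)
  moreover have "EProg = space P - (\<Union>k\<in>V. B k)" unfolding eq[symmetric] by (auto simp: EProg_def)
  ultimately show "EProg \<in> sets P" by simp
  have "measure P (space P - EProg) \<le> real (card V) * exp (- 8 * lam)"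
    unfolding eq by (rule G.iid_union_le) (use Bm Bp in auto)
  also have "\<dots> \<le> exp lam * exp (- 8 * lam)" using exp_big(3) by (intro mult_right_mono) auto
  also have "\<dots> = exp (- 7 * lam)" by (simp add: mult_exp_exp)
  finally show "measure P (space P - EProg) \<le> exp (- 7 * lam)" .
qed

end

lemma walk_mono: "E \<subseteq> E' \<Longrightarrow> walk E js \<Longrightarrow> walk E' js"
  by (induction E js rule: walk.induct) auto

lemma nat_ceiling_bounds: "0 \<le> x \<Longrightarrow> x \<le> real (nat \<lceil>x\<rceil>) \<and> real (nat \<lceil>x\<rceil>) \<le> x + 1" for x :: real
proof -
  assume "0 \<le> x"
  then have "real (nat \<lceil>x\<rceil>) = real_of_int \<lceil>x\<rceil>" by (intro of_nat_nat) simp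
  then show ?thesis using ceiling_correct[of x] by linarith
qed

section \<open>Termination of the walks\<close>

context query_regime
begin

interpretation PP: prob_space P by (rule G.prob_space_iid)

text \<open>The exponent 22 leaves room for the longest walks in \<open>exists_scale\<close>, those
  of length up to \<open>Mb * Mb\<close> with \<open>Mb = exp (10 * (\<xi> * lam))\<close>.\<close>

definition T :: nat where "T = nat \<lfloor>exp (22 * (\<xi> * lam))\<rfloor>"

lemma T_bounds: "real T \<le> exp (22 * (\<xi> * lam))" "real m \<le> exp (22 * (\<xi> * lam)) \<Longrightarrow> m \<le> T"
proof -
  show "real T \<le> exp (22 * (\<xi> * lam))" unfolding T_def by (simp add: of_nat_nat)
  assume "real m \<le> exp (22 * (\<xi> * lam))"
  then show "m \<le> T" unfolding T_def by (simp add: le_nat_floor)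
qed

lemma card_le_J: "0 \<le> a \<Longrightarrow> real (card {j \<in> V. real j \<le> a}) \<le> a"
proof -
  assume a: "0 \<le> a"
  have "{j \<in> V. real j \<le> a} \<subseteq> {1..nat \<lfloor>a\<rfloor>}" by (auto simp: V_def le_nat_floor)
  then have "card {j \<in> V. real j \<le> a} \<le> card {1..nat \<lfloor>a\<rfloor>}" by (intro card_mono) auto
  then have "card {j \<in> V. real j \<le> a} \<le> nat \<lfloor>a\<rfloor>" by simp
  then have "real (card {j \<in> V. real j \<le> a}) \<le> real (nat \<lfloor>a\<rfloor>)" by (rule of_nat_mono)
  also have "\<dots> \<le> a" using a by (simp add: of_nat_nat)
  finally show ?thesis .
qed

lemma above_g0: "good u \<Longrightarrow> g0 \<le> lev u \<Longrightarrow> \<rho> * lam \<le> Lv u"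
proof -
  assume u: "good u" "g0 \<le> lev u"
  have "g0 * rd \<le> lp u * rd" using u(2) basic(1) by (intro mult_right_mono) (auto simp: lp_def)
  then have "(g0 * rd)\<^sup>2 \<le> (lp u * rd)\<^sup>2" using basic(1,21) by (intro power_mono) auto
  moreover have "(g0 * rd)\<^sup>2 = 2 * \<rho> * lam" using basic(1,4) rho by (simp add: g0_def rd_def)
  ultimately show ?thesis using good_bounds(8)[OF u(1)] by simp
qed

text \<open>At most \<open>J u\<close> indices are examined. Multiplied by the probability of an
  improvement near the level of \<open>u\<close>, they give at most
  \<open>exp (7 * (\<xi> * lam))\<close>: below \<open>g0\<close> by the choice of \<open>J\<close>,
  above it because \<open>J u\<close> is \<open>n\<close> and
  \<open>\<rho> * lam \<le> Lv u\<close>. The width of the window contributes about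
  \<open>1 / Mb\<close>, and \<open>Mb\<close> is chosen to win.\<close>

lemma sum_small_step_le:
  assumes Mb: "Mb = exp (10 * (\<xi> * lam))" "Mb \<le> rd" and W: "W = sqrt lam / (Mb * rd)"
  shows "(\<Sum>j\<in>V. \<P>(y in gauss d. Rel0 j u y \<and> lev y < lev u + W)) \<le> exp (- 2 * (\<xi> * lam))"
proof (cases "good u")
  case False
  then have "{y \<in> space (gauss d). Rel0 j u y \<and> lev y < lev u + W} = {}" for j by (auto simp: Rel0_def imp_def)
  then show ?thesis by (simp only: measure_empty sum.neutral_const exp_ge_zero)
next
  case True
  note bs = basic and gu = good_bounds[OF True]
  have el: "0 < \<xi> * lam" by (rule eps_lam)
  have M1: "1 \<le> Mb" using Mb el bs(4) eps by simp
  have M2: "6200 * sqrt lam \<le> \<xi> * Mb"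
  proof -
    have "sqrt lam \<le> lam" using bs by simp
    have "\<xi> * (80000 * lam * (80000 * lam)) \<le> \<xi> * (exp (\<xi> * lam) * exp (\<xi> * lam))"
      using exp_big(1) bs(4) eps by (intro mult_left_mono mult_mono) auto
    also have "\<dots> \<le> \<xi> * Mb" unfolding Mb using eps el bs(4) by (intro mult_left_mono) (auto simp: mult_exp_exp)
    finally have 1: "6400000000 * (\<xi> * lam * lam) \<le> \<xi> * Mb" by (simp add: mult_ac)
    have "1600 * lam \<le> \<xi> * lam * lam" using eps_lam(5) bs(4) by (intro mult_right_mono) auto
    then show ?thesis using 1 \<open>sqrt lam \<le> lam\<close> bs(4) by linarith
  qed
  define c where "c = exp (- \<kappa> * lam - Lv u + \<xi> * lam) * (124 * lam / Mb)"
  have c0: "0 \<le> c" using bs M1 by (simp add: c_def)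
  have one: "\<P>(y in gauss d. Rel0 j u y \<and> lev y < lev u + W) \<le> (if real j \<le> J u then c else 0)" for j
  proof (cases "real j \<le> J u")
    case True
    then have "{y \<in> space (gauss d). Rel0 j u y \<and> lev y < lev u + W} = {y \<in> space (gauss d). imp u y \<and> lev y < lev u + W}"
      by (auto simp: Rel0_def)
    then show ?thesis using True prob_small_step_le[OF \<open>good u\<close> M1 Mb(2) M2 W] by (simp add: c_def)
  next
    case False
    then have "{y \<in> space (gauss d). Rel0 j u y \<and> lev y < lev u + W} = {}" by (auto simp: Rel0_def)
    then show ?thesis using False by (simp only: measure_empty if_False order_refl)
  qed
  have J0: "0 \<le> J u" by (simp add: J_def)
  have "(\<Sum>j\<in>V. \<P>(y in gauss d. Rel0 j u y \<and> lev y < lev u + W)) \<le> (\<Sum>j\<in>V. if real j \<le> J u then c else 0)"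
    by (rule sum_mono) (rule one)
  also have "\<dots> = real (card {j \<in> V. real j \<le> J u}) * c" by (simp add: sum.If_cases Int_def)
  also have "\<dots> \<le> J u * c" by (rule mult_right_mono[OF card_le_J[OF J0] c0])
  also have "\<dots> \<le> exp (7 * (\<xi> * lam)) * (124 * lam / Mb)"
  proof -
    have "J u * exp (- \<kappa> * lam - Lv u + \<xi> * lam) \<le> exp (7 * (\<xi> * lam))"
    proof (cases "lev u < g0")
      case True
      then have "J u * exp (- \<kappa> * lam - Lv u + \<xi> * lam) = exp (3 * (\<xi> * lam))" by (simp add: J_def mult_exp_exp)
      then show ?thesis using el bs(4) eps by simp
    next
      case False
      then have "J u * exp (- \<kappa> * lam - Lv u + \<xi> * lam) = exp (lam - \<kappa> * lam - Lv u + \<xi> * lam)"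
        using exp_big(2) by (simp add: J_def mult_exp_exp)
      moreover have "\<kappa> * lam = lam - \<rho> * lam - 6 * (\<xi> * lam)" by (simp add: kappa algebra_simps)
      ultimately show ?thesis using above_g0[OF \<open>good u\<close>] False by simp
    qed
    then have "J u * exp (- \<kappa> * lam - Lv u + \<xi> * lam) * (124 * lam / Mb) \<le> exp (7 * (\<xi> * lam)) * (124 * lam / Mb)"
      by (rule mult_right_mono) (use bs M1 in auto)
    then show ?thesis by (simp only: c_def mult.assoc)
  qed
  also have "\<dots> \<le> exp (7 * (\<xi> * lam)) * (exp (\<xi> * lam) / Mb)"
    using exp_big(1) bs(4) M1 by (intro mult_left_mono divide_right_mono) auto
  also have "\<dots> = exp (7 * (\<xi> * lam) + \<xi> * lam - 10 * (\<xi> * lam))" unfolding Mb exp_diff exp_add by simp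
  also have "\<dots> = exp (- 2 * (\<xi> * lam))" by simp
  finally show ?thesis .
qed

definition stops :: "(nat \<times> nat) set \<Rightarrow> bool" where
  "stops E \<longleftrightarrow> (\<forall>s\<in>V. \<exists>t\<le>T. \<not> (\<exists>l\<in>V. (traj V E s t, l) \<in> E))"

text \<open>Quantifying over all subsets of the edges makes the same event serve the full walk and
  the walk frozen at \<open>g0\<close>.\<close>

definition EStop where "EStop = {x \<in> space P. \<forall>E \<subseteq> W0.edges x. stops E}"

lemma EStop_sets: "EStop \<in> sets P"
  unfolding EStop_def using W0.edges_pred[of "\<lambda>E'. \<forall>E \<subseteq> E'. stops E"] by (simp add: pred_def)

text \<open>Two ranges of the dimension. If \<open>rd\<close> is at least \<open>Mb\<close>, gains
  below \<open>\<sigma> / Mb\<close> are rare and about \<open>1 / \<xi>\<close> of them in a row do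
  not occur. Otherwise \<open>real d\<close> is less than \<open>Mb * Mb\<close>, and the gain of at
  least \<open>1 / real d\<close> that the greedy rule demands already bounds the length of a
  walk.\<close>

lemma exists_scale:
  "\<exists>r m W. r * m \<le> T \<and> 2 * (5 * \<sigma>) < real m * W \<and>
    \<P>(x in P. \<exists>js. set js \<subseteq> V \<and> length js = Suc r \<and>
      walk {(k, l) \<in> W0.edges x. lev (x l) < lev (x k) + W} js) \<le> exp (- lam)"
proof -
  note bs = basic
  define Mb where "Mb = exp (10 * (\<xi> * lam))"
  have el: "0 < \<xi> * lam" by (rule eps_lam)
  have M1: "1 \<le> Mb" using el bs(4) eps by (simp add: Mb_def)
  show ?thesis
  proof (cases "Mb \<le> rd")
    case True
    define W where "W = sqrt lam / (Mb * rd)"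
    \<comment> \<open>Enough small steps in a row for \<open>exp (- 2 * (\<xi> * lam)) ^ r\<close>
      to beat the \<open>n\<close> choices of a first vertex.\<close>
    define r where "r = nat \<lceil>1 / \<xi>\<rceil>"
    \<comment> \<open>Levels lie in an interval of length \<open>10 * \<sigma>\<close>, and
      \<open>Mb * W = \<sigma>\<close>, so eleven times \<open>Mb\<close> gains of size
      \<open>W\<close> are impossible.\<close>
    define m where "m = nat \<lceil>11 * Mb\<rceil>"
    interpret Ws: walk_model "gauss d" V "\<lambda>j u y. Rel0 j u y \<and> lev y < lev u + W" lev
      by (unfold_locales, rule finite_V, rule pair_measurable(5), rule Rel_lev, erule conjunct1)
    have r1: "1 / \<xi> \<le> real r" "real r \<le> 1 / \<xi> + 1"
      using nat_ceiling_bounds[of "1 / \<xi>"] eps unfolding r_def by simp_all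
    have m1: "11 * Mb \<le> real m" "real m \<le> 11 * Mb + 1"
      using nat_ceiling_bounds[of "11 * Mb"] M1 unfolding m_def by simp_all
    have eq: "Ws.edges x = {(k, l) \<in> W0.edges x. lev (x l) < lev (x k) + W}" for x
      by (auto simp: Ws.edges_def W0.edges_def)
    have "\<P>(x in P. \<exists>js. set js \<subseteq> V \<and> length js = Suc r \<and> walk (Ws.edges x) js) \<le> real (card V) * exp (- 2 * (\<xi> * lam)) ^ r"
      by (rule Ws.prob_walk_le) (rule sum_small_step_le[OF Mb_def True W_def])
    also have "\<dots> \<le> exp lam * exp (- 2 * lam)"
    proof (rule mult_mono)
      have "exp (- 2 * (\<xi> * lam)) ^ r = exp (real r * (- 2 * (\<xi> * lam)))" by (rule exp_of_nat_mult[symmetric])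
      also have "\<dots> \<le> exp (- 2 * lam)"
      proof -
        have "1 / \<xi> * (2 * (\<xi> * lam)) \<le> real r * (2 * (\<xi> * lam))" using r1 el by (intro mult_right_mono) auto
        then show ?thesis using eps by simp
      qed
      finally show "exp (- 2 * (\<xi> * lam)) ^ r \<le> exp (- 2 * lam)" .
    qed (use exp_big(3) in auto)
    also have "\<dots> = exp (- lam)" by (simp add: mult_exp_exp)
    finally have walk: "\<P>(x in P. \<exists>js. set js \<subseteq> V \<and> length js = Suc r \<and>
      walk {(k, l) \<in> W0.edges x. lev (x l) < lev (x k) + W} js) \<le> exp (- lam)" unfolding eq .
    have "2 * (5 * \<sigma>) < 11 * Mb * W"
    proof -
      have "Mb * W = sqrt lam / rd" using M1 by (simp add: W_def)
      also have "\<dots> = \<sigma>" using bs(1,9) by (simp add: field_simps)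
      finally have "11 * (Mb * W) = 11 * \<sigma>" by simp
      then have "11 * Mb * W = 11 * \<sigma>" by (simp only: mult.assoc)
      then show ?thesis using bs(8) by linarith
    qed
    also have "\<dots> \<le> real m * W" using m1 bs M1 by (intro mult_right_mono) (auto simp: W_def)
    finally have mW: "2 * (5 * \<sigma>) < real m * W" .
    have "r * m \<le> T"
    proof (rule T_bounds(2))
      have e1: "1 \<le> 1 / \<xi>" using eps by simp
      have "real (r * m) = real r * real m" by simp
      also have "\<dots> \<le> (2 / \<xi>) * (12 * Mb)"
      proof (rule mult_mono)
        have "2 / \<xi> = 1 / \<xi> + 1 / \<xi>" by simp
        then show "real r \<le> 2 / \<xi>" using r1 e1 by linarith
        show "real m \<le> 12 * Mb" using m1 M1 by linarith
      qed (use eps in auto)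
      also have "\<dots> = 24 / \<xi> * Mb" by simp
      also have "\<dots> \<le> exp (\<xi> * lam) * Mb"
      proof (rule mult_right_mono)
        have "400 / \<xi> \<le> sqrt lam" by (rule lam(2))
        then have "24 / \<xi> \<le> sqrt lam" using eps by (simp add: field_simps)
        also have "\<dots> \<le> exp (\<xi> * lam)" using bs(7,4) exp_big(1) by linarith
        finally show "24 / \<xi> \<le> exp (\<xi> * lam)" .
      qed (use M1 in simp)
      also have "\<dots> \<le> exp (22 * (\<xi> * lam))" using el bs(4) eps by (simp add: Mb_def mult_exp_exp)
      finally show "real (r * m) \<le> exp (22 * (\<xi> * lam))" .
    qed
    then show ?thesis using mW walk by blast
  next
    case False
    \<comment> \<open>No edge gains less than this, so there is no walk with even one small step,
      and \<open>r = 1\<close>, \<open>m = d\<close> will do.\<close>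
    define W where "W = 1 / real d"
    have "{x \<in> space P. \<exists>js. set js \<subseteq> V \<and> length js = Suc 1 \<and> walk {(k, l) \<in> W0.edges x. lev (x l) < lev (x k) + W} js} = {}"
    proof -
      have False if wk: "walk {(k, l) \<in> W0.edges x. lev (x l) < lev (x k) + W} js" and len: "length js = Suc 1" for x js
      proof -
        obtain a b where "js = [a, b]" using len by (auto simp: length_Suc_conv)
        then have "Rel0 a (x b) (x a)" "lev (x a) < lev (x b) + W" using wk by (auto simp: W0.edges_def)
        then show False by (simp add: Rel0_def imp_def W_def)
      qed
      then show ?thesis by blast
    qed
    then have "\<P>(x in P. \<exists>js. set js \<subseteq> V \<and> length js = Suc 1 \<and> walk {(k, l) \<in> W0.edges x. lev (x l) < lev (x k) + W} js) \<le> exp (- lam)"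
      by (simp only: measure_empty) simp
    moreover have "2 * (5 * \<sigma>) < real d * W" using bs(10) d3 by (simp add: W_def)
    moreover have "1 * d \<le> T"
    proof (rule T_bounds(2))
      have "real (1 * d) = rd * rd" using bs(2) by (simp add: power2_eq_square)
      also have "\<dots> \<le> Mb * Mb" using False bs(1) by (intro mult_mono) auto
      also have "\<dots> \<le> exp (22 * (\<xi> * lam))" using el bs(4) eps by (simp add: Mb_def mult_exp_exp)
      finally show "real (1 * d) \<le> exp (22 * (\<xi> * lam))" .
    qed
    ultimately show ?thesis by blast
  qed
qed

lemma EStop_prob: "measure P (EGood - EStop) \<le> exp (- lam)"
proof -
  obtain r m W where rm: "r * m \<le> T" "2 * (5 * \<sigma>) < real m * W"
    "\<P>(x in P. \<exists>js. set js \<subseteq> V \<and> length js = Suc r \<and>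
      walk {(k, l) \<in> W0.edges x. lev (x l) < lev (x k) + W} js) \<le> exp (- lam)"
    using exists_scale by blast
  define Bw where "Bw = {x \<in> space P. \<exists>js. set js \<subseteq> V \<and> length js = Suc r \<and>
      walk {(k, l) \<in> W0.edges x. lev (x l) < lev (x k) + W} js}"
  have sub: "EGood - EStop \<subseteq> Bw"
  proof (rule subsetI, rule ccontr)
    fix x assume x: "x \<in> EGood - EStop" "x \<notin> Bw"
    then have xs: "x \<in> space P" by (simp add: EGood_def)
    have "stops E" if E: "E \<subseteq> W0.edges x" for E
      unfolding stops_def
    proof
      fix s assume s: "s \<in> V"
      interpret increasing E "\<lambda>k. lev (x k)"
        using increasing.inc[OF W0.edges_increasing[of x]] E by unfold_locales auto
      have "\<exists>t\<le>r * m. \<not> (\<exists>l\<in>V. (traj V E s t, l) \<in> E)"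
      proof (rule traj_stops[OF s _ rm(2)])
        show "\<bar>lev (x k)\<bar> \<le> 5 * \<sigma>" if "k \<in> V" for k
          using x(1) that by (intro good_bounds(4)) (auto simp: EGood_def)
        show "\<not> walk {(k, l) \<in> E. lev (x l) < lev (x k) + W} js" if "set js \<subseteq> V" "length js = Suc r" for js
        proof
          assume "walk {(k, l) \<in> E. lev (x l) < lev (x k) + W} js"
          then have "walk {(k, l) \<in> W0.edges x. lev (x l) < lev (x k) + W} js"
            by (rule walk_mono[rotated]) (use E in auto)
          then show False using x(2) xs that by (auto simp: Bw_def)
        qed
      qed
      then show "\<exists>t\<le>T. \<not> (\<exists>l\<in>V. (traj V E s t, l) \<in> E)" using rm(1) order_trans by blast
    qed
    then show False using x(1) xs by (auto simp: EStop_def)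
  qed
  have "Bw \<in> sets P"
  proof -
    interpret Ws: walk_model "gauss d" V "\<lambda>j u y. Rel0 j u y \<and> lev y < lev u + W" lev
      by (unfold_locales, rule finite_V, rule pair_measurable(5), rule Rel_lev, erule conjunct1)
    have eq: "Ws.edges x = {(k, l) \<in> W0.edges x. lev (x l) < lev (x k) + W}" for x
      by (auto simp: Ws.edges_def W0.edges_def)
    show ?thesis
      using Ws.edges_pred[of "\<lambda>E. \<exists>js. set js \<subseteq> V \<and> length js = Suc r \<and> walk E js", unfolded eq pred_def]
      unfolding Bw_def by assumption
  qed
  then have "measure P (EGood - EStop) \<le> measure P Bw" by (rule PP.finite_measure_mono[OF sub])
  then show ?thesis using rm(3) by (simp add: Bw_def)
qed

lemma traj_end:
  assumes x: "x \<in> EGood" "x \<in> EProg" "x \<in> EStop" and s: "s \<in> V"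
  shows "traj V (W1.edges x) s T \<in> V" "good (x (traj V (W1.edges x) s T))" "g0 \<le> lev (x (traj V (W1.edges x) s T))"
proof -
  let ?E = "W1.edges x"
  let ?f = "traj V ?E s T"
  show f: "?f \<in> V" by (rule traj_mem[OF s])
  then show g: "good (x ?f)" using x(1) by (simp add: EGood_def)
  have "?E \<subseteq> W0.edges x" by (auto simp: W1.edges_def W0.edges_def Rel1_def)
  then have "stops ?E" using x(3) by (simp add: EStop_def)
  then obtain t where t: "t \<le> T" "\<not> (\<exists>l\<in>V. (traj V ?E s t, l) \<in> ?E)" using s by (auto simp: stops_def)
  then have ft: "?f = traj V ?E s t" using traj_stopped by blast
  show "g0 \<le> lev (x ?f)"
  proof (rule ccontr)
    assume "\<not> ?thesis"
    then have l: "lev (x ?f) < g0" by simp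
    then obtain l' where l': "l' \<in> V" "real l' \<le> J (x ?f)" "imp (x ?f) (x l')"
      using x(2) f g by (auto simp: EProg_def)
    then have "(?f, l') \<in> ?E" using f l by (simp add: W1.edges_def Rel1_def Rel0_def)
    then show False using t(2) ft l'(1) by auto
  qed
qed

end

section \<open>Rotation invariance of the conditional mean\<close>

lemma AE_ip_nonzero:
  assumes "3 \<le> d" "ip d v v = 1"
  shows "AE b in gauss d. ip d b v \<noteq> 0"
proof -
  interpret G: prob_space "gauss d" by (rule prob_space_gauss)
  define N where "N = {b \<in> space (gauss d). ip d b v \<in> {0}}"
  have "N = (\<lambda>b. ip d b v) -` {0} \<inter> space (gauss d)" by (auto simp: N_def)
  then have Nm: "N \<in> G.events" using measurable_sets[OF ip_measurable[of d v], of "{0}"] by simp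
  have "G.prob N = measure std_normal {0}" unfolding N_def by (rule distr_ip_gauss[OF assms]) simp
  also have "\<dots> \<le> 0" using std_normal_interval[of 0 0 0] by simp
  finally have "G.prob N = 0" using measure_nonneg[of "gauss d" N] by linarith
  then have "emeasure (gauss d) N = 0" by (simp add: G.emeasure_eq_measure)
  then show ?thesis by (intro AE_I[OF _ _ Nm]) (auto simp: N_def)
qed

lemma ip_unit_unit: "0 < d \<Longrightarrow> ip d (unit 0) (unit 0) = 1"
  by (simp add: ip_unit_right) (simp add: unit_def)

context query_regime
begin

interpretation PP: prob_space P by (rule G.prob_space_iid)

text \<open>\<open>mark\<close> with the direction itself as parameter, so that the actual direction
  can be compared with the reference direction \<open>unit 1\<close>.\<close>

definition mark_z :: "real \<Rightarrow> (nat \<Rightarrow> real) \<Rightarrow> (nat \<Rightarrow> real) \<Rightarrow> bool" where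
  "mark_z \<tau> z u \<longleftrightarrow> good u \<and> g0 \<le> lev u \<and> \<tau> * nrm d u \<le> ip d u z"

lemma mark_eq: "mark \<tau> b = mark_z \<tau> (zdir b)"
  by (simp add: mark_def mark_z_def fun_eq_iff)

lemma mark_z_measurable: "Measurable.pred (gauss d) (mark_z \<tau> z)"
proof -
  have "Measurable.pred (gauss d) (\<lambda>u. g0 \<le> lev u)"
    unfolding pred_def by (rule borel_measurable_le[OF borel_measurable_const lev_measurable])
  then have "Measurable.pred (gauss d) (\<lambda>u. good u \<and> g0 \<le> lev u \<and> \<tau> * nrm d u \<le> ip d u z)"
    using good_measurable planted_adj_measurable[of \<tau> z] by simp
  then show ?thesis by (simp add: mark_z_def[abs_def])
qed

lemma count_measurable: "(\<lambda>x. W1.count (mark_z \<tau> z) T x) \<in> borel_measurable P"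
proof -
  have "Measurable.pred (gauss2 d) (\<lambda>(b, u). mark_z \<tau> z u)"
    using measurable_compose[OF measurable_snd mark_z_measurable[of \<tau> z]] by (simp add: case_prod_unfold)
  then have h: "(\<lambda>(b, x). W1.hits (mark_z \<tau> z) T V s x) \<in> borel_measurable Pb" for s
    by (rule W1.hits_measurable) simp
  obtain b0 where b0: "b0 \<in> space (gauss d)" using G.not_empty by auto
  have "(\<lambda>x. W1.hits (mark_z \<tau> z) T V s x) \<in> borel_measurable P" for s
    using measurable_compose[OF measurable_Pair1'[OF b0] h] by simp
  then show ?thesis unfolding W1.count_def by (intro borel_measurable_sum)
qed

end

text \<open>An isometry that carries the query and \<open>z\<close> to the first two unit vectors is
  applied to every data point. It preserves the law of the points, and walks and marks depend on
  inner products only. Since the right-hand side does not mention \<open>z\<close>, the mean is the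
  same for every direction orthogonal to the query.\<close>

lemma (in query_regime) count_rotate:
  assumes z: "ip d z z = 1" "ip d q z = 0"
  shows "(\<integral>x. W1.count (mark_z \<tau> z) T x \<partial>P)
    = (\<integral>x. walk_model.count V (query_regime.Rel1 d n \<kappa> \<rho> \<xi> lam \<eta> (unit 0))
        (query_regime.mark_z d \<rho> lam \<eta> (unit 0) \<tau> (unit 1)) T x \<partial>P)"
proof -
  have d0: "0 < d" "1 < d" using d3 by auto
  interpret U: query_regime d n \<kappa> \<rho> \<xi> lam \<sigma> \<eta> "unit 0"
    by unfold_locales (rule ip_unit_unit[OF d0(1)])
  obtain \<Phi> where \<Phi>: "gauss_isometry d \<Phi>" "\<forall>x. ip d x q = \<Phi> x 0" "\<forall>x. ip d x z = \<Phi> x 1"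
    using isometry_to_units[OF d3 q z] by (elim exE conjE) rule
  have ipx: "ip d (\<Phi> x) (\<Phi> y) = ip d x y" for x y using \<Phi>(1) by (simp add: gauss_isometry_def)
  have nx: "nrm d (\<Phi> x) = nrm d x" for x by (simp add: nrm_def ipx)
  have q0: "ip d (\<Phi> x) (unit 0) = ip d x q" for x by (simp add: ip_unit_right[OF d0(1)] \<Phi>(2)[rule_format])
  have z0: "ip d (\<Phi> x) (unit 1) = ip d x z" for x by (simp only: ip_unit_right[OF d0(2)] \<Phi>(3)[rule_format])
  have lev: "U.lev (\<Phi> x) = lev x" for x by (simp add: U.lev_def lev_def q0 nx)
  have good: "U.good (\<Phi> x) = good x" for x by (simp add: U.good_def good_def q0 ipx)
  have J: "U.J (\<Phi> x) = J x" for x by (simp add: U.J_def J_def U.Lv_def Lv_def U.lp_def lp_def lev)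
  have rel: "U.Rel1 l (\<Phi> x) (\<Phi> y) = Rel1 l x y" for l x y
    by (simp add: U.Rel1_def Rel1_def U.Rel0_def Rel0_def U.imp_def imp_def adj_def lev good J nx ipx)
  have mark: "U.mark_z \<tau> (unit 1) (\<Phi> x) = mark_z \<tau> z x" for x
    by (simp only: U.mark_z_def mark_z_def lev good nx z0)
  let ?\<Psi> = "\<lambda>x. \<lambda>i\<in>V. \<Phi> (x i)"
  have \<Phi>m: "\<Phi> \<in> gauss d \<rightarrow>\<^sub>M gauss d" using \<Phi>(1) by (simp add: gauss_isometry_def)
  have \<Psi>m: "?\<Psi> \<in> P \<rightarrow>\<^sub>M P"
  proof (rule measurable_restrict)
    fix i assume "i \<in> V"
    from measurable_compose[OF component_P[OF this] \<Phi>m] show "(\<lambda>x. \<Phi> (x i)) \<in> P \<rightarrow>\<^sub>M gauss d" .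
  qed
  have edges: "U.W1.edges (?\<Psi> x) = W1.edges x" for x
    by (auto simp: U.W1.edges_def W1.edges_def rel)
  have count: "U.W1.count (U.mark_z \<tau> (unit 1)) T (?\<Psi> x) = W1.count (mark_z \<tau> z) T x" for x
  proof -
    have "U.W1.hits (U.mark_z \<tau> (unit 1)) T V s (?\<Psi> x) = W1.hits (mark_z \<tau> z) T V s x" for s
      unfolding U.W1.hits_def W1.hits_def edges by (rule sum.cong[OF refl]) (simp only: restrict_apply' mark)
    then show ?thesis by (simp only: U.W1.count_def W1.count_def)
  qed
  have "(\<integral>x. W1.count (mark_z \<tau> z) T x \<partial>P) = (\<integral>x. U.W1.count (U.mark_z \<tau> (unit 1)) T (?\<Psi> x) \<partial>P)"
    by (simp only: count)
  also have "\<dots> = (\<integral>x. U.W1.count (U.mark_z \<tau> (unit 1)) T x \<partial>distr P P ?\<Psi>)"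
    by (rule integral_distr[symmetric, OF \<Psi>m]) (rule U.count_measurable)
  also have "distr P P ?\<Psi> = P" by (rule distr_PiM_isometry[OF finite_V \<Phi>(1)])
  finally show ?thesis .
qed

section \<open>Meeting probabilities and the second moment in the Gaussian graph\<close>

context query_regime
begin

interpretation PP: prob_space P by (rule G.prob_space_iid)

lemma AE_perp: "AE b in gauss d. 0 < nrm d (perp b)"
proof -
  obtain v where v: "ip d v v = 1" "ip d q v = 0" using exists_orthogonal_unit[OF d3 q] by blast
  show ?thesis
    using AE_ip_nonzero[OF d3 v(1)]
  proof eventually_elim
    case (elim b)
    have "0 \<le> nrm d (perp b)" by (simp add: nrm_def ip_self_nonneg)
    moreover have "nrm d (perp b) \<noteq> 0"
    proof
      assume "nrm d (perp b) = 0"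
      then have "\<bar>ip d (perp b) v\<bar> \<le> 0" using ip_cauchy_schwarz[of d "perp b" v] by (simp add: nrm_def)
      then show False using elim v by (simp add: ip_perp)
    qed
    ultimately show ?case by linarith
  qed
qed

lemma Rel1_prob_le:
  assumes "u \<in> space (gauss d)"
  shows "\<P>(y in gauss d. Rel1 l u y) \<le> exp (- \<kappa> * lam + \<xi> * lam)"
    "\<P>(y in gauss d. Rel1 l y u) \<le> exp (- \<kappa> * lam + \<xi> * lam)"
proof -
  have m: "{y \<in> space (gauss d). good y \<and> adj u y} \<in> G.events"
    using good_measurable adj_measurable1[of u] by (simp add: pred_def)
  have sym: "adj y u = adj u y" for y by (simp add: adj_def ip_commute[of d y u] mult.commute)
  have "\<P>(y in gauss d. Rel1 l u y) \<le> exp (- \<kappa> * lam + \<xi> * lam) \<and>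
    \<P>(y in gauss d. Rel1 l y u) \<le> exp (- \<kappa> * lam + \<xi> * lam)"
  proof (cases "good u")
    case True
    have "\<P>(y in gauss d. Rel1 l u y) \<le> \<P>(y in gauss d. good y \<and> adj u y)"
      by (rule G.finite_measure_mono[OF _ m]) (auto simp: Rel1_def Rel0_def imp_def)
    moreover have "\<P>(y in gauss d. Rel1 l y u) \<le> \<P>(y in gauss d. good y \<and> adj u y)"
      by (rule G.finite_measure_mono[OF _ m]) (auto simp: Rel1_def Rel0_def imp_def sym)
    ultimately show ?thesis using prob_adj_le[OF good_bounds(1)[OF True]] by linarith
  next
    case False
    then have "{y \<in> space (gauss d). Rel1 l u y} = {}" "{y \<in> space (gauss d). Rel1 l y u} = {}"
      by (auto simp: Rel1_def Rel0_def imp_def)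
    then show ?thesis by (simp only: measure_empty exp_ge_zero)
  qed
  then show "\<P>(y in gauss d. Rel1 l u y) \<le> exp (- \<kappa> * lam + \<xi> * lam)"
    "\<P>(y in gauss d. Rel1 l y u) \<le> exp (- \<kappa> * lam + \<xi> * lam)" by auto
qed

text \<open>The cost of improving on \<open>u\<close> and being adjacent to one more vertex, divided
  by the cost \<open>p\<close> of one adjacency, is about
  \<open>exp (- \<kappa> * lam - Lv u)\<close>. By the choice of \<open>J\<close> this is
  \<open>1 / J u\<close> up to the tolerance, so summation over the indices up to \<open>J u\<close>
  leaves only \<open>exp (5 * (\<xi> * lam))\<close>.\<close>

definition Wt :: "nat \<Rightarrow> (nat \<Rightarrow> real) \<Rightarrow> real" where
  "Wt j u = (if good u \<and> lev u < g0 \<and> real j \<le> J u then exp (5 * (\<xi> * lam)) / J u else 0)"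

lemma Wt_measurable: "Wt j \<in> borel_measurable (gauss d)"
proof -
  have "{u \<in> space (gauss d). lev u < g0} \<in> G.events"
    by (rule borel_measurable_less[OF lev_measurable borel_measurable_const])
  moreover have "{u \<in> space (gauss d). real j \<le> J u} \<in> G.events"
    by (rule borel_measurable_le[OF borel_measurable_const J_measurable])
  moreover have "{u \<in> space (gauss d). good u} \<in> G.events" using good_measurable by (simp add: pred_def)
  ultimately have "{u \<in> space (gauss d). good u} \<inter> ({u \<in> space (gauss d). lev u < g0} \<inter> {u \<in> space (gauss d). real j \<le> J u}) \<in> G.events"
    by (intro sets.Int)
  also have "{u \<in> space (gauss d). good u} \<inter> ({u \<in> space (gauss d). lev u < g0} \<inter> {u \<in> space (gauss d). real j \<le> J u})
      = {u \<in> space (gauss d). good u \<and> lev u < g0 \<and> real j \<le> J u}" by blast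
  finally show ?thesis
    unfolding Wt_def
    by (intro measurable_If borel_measurable_divide borel_measurable_const J_measurable)
qed

lemma Wt_bounds: "0 \<le> Wt j u \<and> Wt j u \<le> exp (5 * (\<xi> * lam))" "(\<Sum>j\<in>V. Wt j u) \<le> exp (5 * (\<xi> * lam))"
proof -
  have J0: "80000 \<le> J u" if "good u" "lev u < g0" using J_bounds(3)[OF that] .
  show "0 \<le> Wt j u \<and> Wt j u \<le> exp (5 * (\<xi> * lam))"
  proof (cases "good u \<and> lev u < g0 \<and> real j \<le> J u")
    case True
    then have "80000 \<le> J u" using J0 by blast
    then have "exp (5 * (\<xi> * lam)) / J u \<le> exp (5 * (\<xi> * lam)) / 1" by (intro divide_left_mono) auto
    then show ?thesis using True \<open>80000 \<le> J u\<close> unfolding Wt_def by simp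
  next
    case False
    then have "Wt j u = 0" unfolding Wt_def by (rule if_not_P)
    then show ?thesis by simp
  qed
  show "(\<Sum>j\<in>V. Wt j u) \<le> exp (5 * (\<xi> * lam))"
  proof (cases "good u \<and> lev u < g0")
    case True
    then have J: "80000 \<le> J u" using J0 by blast
    have "(\<Sum>j\<in>V. Wt j u) = (\<Sum>j\<in>V. if real j \<le> J u then exp (5 * (\<xi> * lam)) / J u else 0)"
      using True by (intro sum.cong) (auto simp: Wt_def)
    also have "\<dots> = real (card {j \<in> V. real j \<le> J u}) * (exp (5 * (\<xi> * lam)) / J u)"
      by (simp add: sum.If_cases Int_def)
    also have "\<dots> \<le> J u * (exp (5 * (\<xi> * lam)) / J u)"
      using card_le_J[of "J u"] J by (intro mult_right_mono) auto
    finally show ?thesis using J by simp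
  next
    case False
    then have "Wt j u = 0" for j by (auto simp: Wt_def)
    then show ?thesis by simp
  qed
qed

lemma Wt_pair:
  assumes "Orth u v"
  shows "\<P>(y in gauss d. Rel1 j u y \<and> Rel1 l y v) \<le> exp (- \<kappa> * lam + \<xi> * lam) * Wt j u"
proof (cases "good u \<and> good v \<and> lev u < g0 \<and> real j \<le> J u")
  case True
  then have t: "good u" "good v" "lev u < g0" "real j \<le> J u" by auto
  have m: "{y \<in> space (gauss d). imp u y \<and> adj v y} \<in> G.events"
    using imp_measurable1[of u] adj_measurable1[of v] by (simp add: pred_def)
  have sym: "adj y v = adj v y" for y by (simp add: adj_def ip_commute[of d y v] mult.commute)
  have "\<P>(y in gauss d. Rel1 j u y \<and> Rel1 l y v) \<le> \<P>(y in gauss d. imp u y \<and> adj v y)"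
    by (rule G.finite_measure_mono[OF _ m]) (auto simp: Rel1_def Rel0_def imp_def sym)
  also have "\<dots> \<le> exp (- (2 * \<kappa> * lam + Lv u) + \<xi> * lam)" by (rule prob_two_adj_le[OF t(1,2) assms])
  also have "\<dots> \<le> exp (- \<kappa> * lam + \<xi> * lam + (5 * (\<xi> * lam) - (\<kappa> * lam + Lv u + 2 * \<xi> * lam)))"
    using eps_lam(2) by simp
  also have "\<dots> = exp (- \<kappa> * lam + \<xi> * lam) * Wt j u"
    using t by (simp only: exp_add exp_diff Wt_def J_bounds(1)[OF t(1,3)] simp_thms if_True)
  finally show ?thesis .
next
  case False
  then have "{y \<in> space (gauss d). Rel1 j u y \<and> Rel1 l y v} = {}" by (auto simp: Rel1_def Rel0_def imp_def)
  then show ?thesis using Wt_bounds(1)[of j u] by (simp only: measure_empty) simp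
qed

lemma small_Tp: "(real T + 1) * exp (- \<kappa> * lam + \<xi> * lam) \<le> 1 / 2" "real T + 1 \<le> 2 * exp (22 * (\<xi> * lam))"
proof -
  note bs = basic
  have "1 \<le> exp (22 * (\<xi> * lam))" using eps_lam(2) by simp
  then show t: "real T + 1 \<le> 2 * exp (22 * (\<xi> * lam))" using T_bounds(1) by linarith
  have "(real T + 1) * exp (- \<kappa> * lam + \<xi> * lam) \<le> 2 * exp (22 * (\<xi> * lam)) * exp (- \<kappa> * lam + \<xi> * lam)"
    using t by (rule mult_right_mono) simp
  also have "\<dots> = 2 * exp (23 * (\<xi> * lam) - \<kappa> * lam)" by (simp add: mult_exp_exp)
  also have "\<dots> \<le> 2 * exp (- lam / 100)"
  proof -
    have "\<xi> * lam \<le> lam / 100" using eps bs(4) mult_right_mono[of \<xi> "1/100" lam] by simp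
    moreover have "lam / 4 \<le> \<kappa> * lam" using bs(4,13) mult_right_mono[of "1/4" \<kappa> lam] by simp
    ultimately have "23 * (\<xi> * lam) - \<kappa> * lam \<le> - lam / 100" using bs(4) by linarith
    then show ?thesis by simp
  qed
  also have "\<dots> \<le> 1 / 2"
  proof -
    have "4 \<le> lam / 100" using bs(3,7) by linarith
    then have "4 \<le> exp (lam / 100)" using exp_ge_add_one_self[of "lam / 100"] by linarith
    then show ?thesis by (simp add: exp_minus field_simps)
  qed
  finally show "(real T + 1) * exp (- \<kappa> * lam + \<xi> * lam) \<le> 1 / 2" .
qed

text \<open>For a fixed start the probabilities of visiting \<open>s'\<close> sum to the expected
  number of visited vertices, at most \<open>T + 1\<close>; hence visits to a start, including the
  pairs with \<open>s = s'\<close>, contribute only order \<open>n\<close>. Every other term is of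
  order \<open>T\<^sup>2 * p * K\<close> per pair, and the exponent 50 is 2 * 22 + 1 + 5 from these
  three factors.\<close>

lemma sum_meet_le:
  "(\<Sum>s\<in>V. \<Sum>s'\<in>V. \<P>(x in P. W1.orb T s x \<inter> W1.orb T s' x \<noteq> {}))
    \<le> 55 * (exp lam)\<^sup>2 * exp (50 * (\<xi> * lam) - \<kappa> * lam)"
proof -
  note bs = basic
  define p where "p = exp (- \<kappa> * lam + \<xi> * lam)"
  define K where "K = exp (5 * (\<xi> * lam))"
  define X where "X = exp (22 * (\<xi> * lam))"
  define c where "c = (real T + 1) * p + 2 * (real T + 1)\<^sup>2 * p * K + exp (- 6 * lam)"
  have el: "0 < \<xi> * lam" by (rule eps_lam)
  have X1: "1 \<le> X" "real T + 1 \<le> 2 * X" using el small_Tp(2) by (auto simp: X_def)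
  have p0: "0 < p" "0 < K" by (auto simp: p_def K_def)
  have K1: "1 \<le> K" using el by (simp add: K_def)
  have meet: "\<P>(x in P. W1.orb T s x \<inter> W1.orb T s' x \<noteq> {})
      \<le> \<P>(x in P. s' \<in> W1.orb T s x) + c" if s: "s \<in> V" "s' \<in> V" for s s'
  proof (cases "s = s'")
    case True
    have "\<P>(x in P. W1.orb T s x \<inter> W1.orb T s' x \<noteq> {}) \<le> 1" by simp
    also have "1 = \<P>(x in P. s' \<in> W1.orb T s x)" using True by (simp add: PP.prob_space)
    finally have "\<P>(x in P. W1.orb T s x \<inter> W1.orb T s' x \<noteq> {})
      \<le> \<P>(x in P. s' \<in> W1.orb T s x)" .
    moreover have "0 \<le> c" using p0 by (simp add: c_def)
    ultimately show ?thesis by linarith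
  next
    case False
    have "\<P>(x in P. W1.orb T s x \<inter> W1.orb T s' x \<noteq> {})
      \<le> \<P>(x in P. s' \<in> W1.orb T s x) + (real T + 1) * p + 2 * (real T + 1)\<^sup>2 * p * K + exp (- 6 * lam)"
    proof (rule W1.prob_meet_le[where Orth=Orth and W=Wt and B="exp (5 * (\<xi> * lam))"])
      show "\<P>(y in gauss d. Rel1 l u y) \<le> p" if "u \<in> space (gauss d)" for l u
        unfolding p_def by (rule Rel1_prob_le(1)[OF that])
      show "\<P>(y in gauss d. Rel1 l y u) \<le> p" if "u \<in> space (gauss d)" for l u
        unfolding p_def by (rule Rel1_prob_le(2)[OF that])
      show "(real T + 1) * p \<le> 1 / 2" unfolding p_def by (rule small_Tp(1))
      show "Measurable.pred (gauss2 d) (\<lambda>(u, y). Orth u y)" by (rule pair_measurable(6))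
      show "\<P>(x in P. \<exists>k\<in>V. \<exists>l\<in>V. k \<noteq> l \<and> \<not> Orth (x k) (x l)) \<le> exp (- 6 * lam)"
        using EOrth_prob by (simp add: EOrth_def)
      show "Wt j \<in> borel_measurable (gauss d)" for j by (rule Wt_measurable)
      show "0 \<le> Wt j u \<and> Wt j u \<le> exp (5 * (\<xi> * lam))" for j u by (rule Wt_bounds(1))
      show "(\<Sum>j\<in>V. Wt j u) \<le> K" for u unfolding K_def by (rule Wt_bounds(2))
      show "\<P>(y in gauss d. Rel1 j u y \<and> Rel1 l y v) \<le> p * Wt j u" if "Orth u v" for u v j l
        unfolding p_def by (rule Wt_pair[OF that])
    qed (use s False in auto)
    then show ?thesis by (simp add: c_def)
  qed
  have hit: "(\<Sum>s'\<in>V. \<P>(x in P. s' \<in> W1.orb T s x)) \<le> real T + 1" if s: "s \<in> V" for s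
  proof -
    have m: "{x \<in> space P. s' \<in> W1.orb T s x} \<in> sets P" for s'
      using W1.orbit_pred_measurable by (simp add: pred_def)
    have "(\<Sum>s'\<in>V. \<P>(x in P. s' \<in> W1.orb T s x))
        = (\<Sum>s'\<in>V. \<integral>x. indicator {x \<in> space P. s' \<in> W1.orb T s x} x \<partial>P)" using m by simp
    also have "\<dots> = (\<integral>x. (\<Sum>s'\<in>V. indicator {x \<in> space P. s' \<in> W1.orb T s x} x) \<partial>P)"
      by (rule Bochner_Integration.integral_sum[symmetric])
        (intro integrable_real_indicator m, simp add: PP.emeasure_eq_measure)
    also have "\<dots> \<le> (\<integral>x. real T + 1 \<partial>P)"
    proof (rule integral_mono)
      show "integrable P (\<lambda>x. \<Sum>s'\<in>V. indicator {x \<in> space P. s' \<in> W1.orb T s x} x :: real)"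
        by (intro Bochner_Integration.integrable_sum integrable_real_indicator m) (simp add: PP.emeasure_eq_measure)
      fix x assume x: "x \<in> space P"
      have "(\<Sum>s'\<in>V. indicator {x \<in> space P. s' \<in> W1.orb T s x} x :: real) = (\<Sum>s'\<in>V. if s' \<in> W1.orb T s x then 1 else 0)"
        using x by (intro sum.cong) (auto simp: indicator_def)
      also have "\<dots> = real (card (V \<inter> W1.orb T s x))" by (subst sum.inter_restrict[symmetric]) auto
      also have "\<dots> \<le> real (card (W1.orb T s x))" by (intro of_nat_mono card_mono) auto
      also have "\<dots> \<le> real T + 1" using card_orbit[of V "W1.edges x" T s] by linarith
      finally show "(\<Sum>s'\<in>V. indicator {x \<in> space P. s' \<in> W1.orb T s x} x :: real) \<le> real T + 1" .
    qed simp
    finally show ?thesis by (simp add: PP.prob_space)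
  qed
  have "(\<Sum>s\<in>V. \<Sum>s'\<in>V. \<P>(x in P. W1.orb T s x \<inter> W1.orb T s' x \<noteq> {}))
      \<le> (\<Sum>s\<in>V. \<Sum>s'\<in>V. \<P>(x in P. s' \<in> W1.orb T s x) + c)"
    by (intro sum_mono meet)
  also have "\<dots> = (\<Sum>s\<in>V. (\<Sum>s'\<in>V. \<P>(x in P. s' \<in> W1.orb T s x)) + real (card V) * c)"
    by (simp add: sum.distrib)
  also have "\<dots> \<le> (\<Sum>s\<in>V. 2 * X + exp lam * c)"
    using hit X1 exp_big(3) p0 by (intro sum_mono add_mono mult_right_mono) (auto simp: c_def intro: order_trans)
  also have "\<dots> = real (card V) * (2 * X + exp lam * c)" by simp
  also have "\<dots> \<le> exp lam * (2 * X + exp lam * c)"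
    using exp_big(3) X1 p0 by (intro mult_right_mono) (auto simp: c_def)
  also have "\<dots> = (exp lam)\<^sup>2 * (2 * X * exp (- lam) + c)"
    by (simp add: power2_eq_square exp_minus field_simps)
  also have "\<dots> \<le> (exp lam)\<^sup>2 * (55 * (X\<^sup>2 * p * K))"
  proof (rule mult_left_mono)
    have one: "p \<le> X\<^sup>2 * p * K"
    proof -
      have "1 * 1 \<le> X\<^sup>2 * K" using X1 K1 by (intro mult_mono) (auto simp: power2_eq_square mult_ge1_I)
      then show ?thesis using p0(1) mult_right_mono[of 1 "X\<^sup>2 * K" p] by (simp add: mult_ac)
    qed
    have lp: "exp (- lam) \<le> p"
    proof -
      have "\<kappa> * lam \<le> lam" using bs(4,14) by simp
      then show ?thesis using el by (simp add: p_def)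
    qed
    have "X * 1 * 1 \<le> X * X * K" using X1 K1 by (intro mult_mono) auto
    then have Xp: "X * p \<le> X\<^sup>2 * p * K" using p0(1) mult_right_mono[of X "X * X * K" p] by (simp add: power2_eq_square mult_ac)
    have t1: "2 * X * exp (- lam) \<le> 2 * (X\<^sup>2 * p * K)"
      using mult_left_mono[OF lp, of "2 * X"] X1 Xp by linarith
    have t2: "(real T + 1) * p \<le> 2 * (X\<^sup>2 * p * K)"
      using mult_right_mono[OF X1(2), of p] p0 Xp by linarith
    have "(real T + 1)\<^sup>2 \<le> (2 * X)\<^sup>2" using X1 by (intro power_mono) auto
    then have "(real T + 1)\<^sup>2 * (p * K) \<le> (2 * X)\<^sup>2 * (p * K)" using p0 by (intro mult_right_mono) auto
    then have t3: "2 * (real T + 1)\<^sup>2 * p * K \<le> 8 * (X\<^sup>2 * p * K)" by (simp add: power_mult_distrib mult_ac)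
    have "exp (- 6 * lam) \<le> exp (- lam)" using bs(4) by simp
    then have t4: "exp (- 6 * lam) \<le> X\<^sup>2 * p * K" using lp one by linarith
    have "0 \<le> X\<^sup>2 * p * K" using p0 by simp
    then show "2 * X * exp (- lam) + c \<le> 55 * (X\<^sup>2 * p * K)" unfolding c_def using t1 t2 t3 t4 by linarith
  qed simp
  also have "X\<^sup>2 * p * K = exp (50 * (\<xi> * lam) - \<kappa> * lam)"
    by (simp add: X_def p_def K_def power2_eq_square mult_exp_exp)
  finally show ?thesis by (simp add: mult.assoc mult.left_commute)
qed

text \<open>In \<open>prob_count_less\<close> the ratio of variance to squared mean has exponent
  \<open>e - \<kappa> + 75 * \<xi> = e + \<rho> - 1 + 81 * \<xi>\<close>, in units of
  \<open>lam\<close>. The assumption \<open>gap\<close> makes this at most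
  \<open>- 19 * \<xi>\<close>, more than enough to absorb the constants.\<close>

theorem prob_few_successes:
  assumes e: "0 \<le> e" "e \<le> 1" and \<tau>: "\<tau> * rd = sqrt (2 * e * lam)" and gap: "e + \<rho> \<le> 1 - 100 * \<xi>"
  shows "measure Pb {p \<in> space Pb.
      W1.count (mark \<tau> (fst p)) T (snd p) < real (card V) * exp (- e * lam - \<xi> * lam) / 4} \<le> exp (- (\<xi> * lam))"
proof -
  note bs = basic
  have el: "0 < \<xi> * lam" by (rule eps_lam)
  define \<pi>u where "\<pi>u = exp (- e * lam + \<xi> * lam)"
  define \<pi>l where "\<pi>l = exp (- e * lam - \<xi> * lam)"
  define C where "C = 55 * (exp lam)\<^sup>2 * exp (50 * (\<xi> * lam) - \<kappa> * lam)"
  define F where "F = (\<integral>x. walk_model.count V (query_regime.Rel1 d n \<kappa> \<rho> \<xi> lam \<eta> (unit 0))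
        (query_regime.mark_z d \<rho> lam \<eta> (unit 0) \<tau> (unit 1)) T x \<partial>P)"
  have "measure Pb {p \<in> space Pb.
      W1.count (mark \<tau> (fst p)) T (snd p) < real (card V) * \<pi>l / 4} \<le> 32 * \<pi>u * (real T + 1) * C / (real (card V) * \<pi>l)\<^sup>2"
  proof (rule W1.prob_count_less[OF prob_space_gauss mark_measurable])
    show "\<P>(b in gauss d. mark \<tau> b u) \<le> \<pi>u" if "u \<in> space (gauss d)" for u
      unfolding \<pi>u_def by (rule prob_mark_le[OF e \<tau> that])
    show "AE b in gauss d. (\<integral>x. W1.count (mark \<tau> b) T x \<partial>P) = F"
      using AE_perp
    proof eventually_elim
      case (elim b)
      show ?case unfolding mark_eq F_def by (rule count_rotate) (use zdir_unit elim in auto)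
    qed
    show "0 < \<pi>l" by (simp add: \<pi>l_def)
    show "(\<Sum>s\<in>V. \<Sum>s'\<in>V. \<P>(x in P. W1.orb T s x \<inter> W1.orb T s' x \<noteq> {})) \<le> C"
      unfolding C_def by (rule sum_meet_le)
    show "V \<noteq> {}" by (rule exp_big)
    fix s assume s: "s \<in> V"
    let ?S = "{x \<in> space P. \<pi>l \<le> \<P>(b in gauss d. mark \<tau> b (x (traj V (W1.edges x) s T)))}"
    have sub: "EGood \<inter> EProg \<inter> EStop \<subseteq> ?S"
    proof
      fix x assume x: "x \<in> EGood \<inter> EProg \<inter> EStop"
      then have xs: "x \<in> space P" by (simp add: EGood_def)
      have f: "traj V (W1.edges x) s T \<in> V" "good (x (traj V (W1.edges x) s T))" "g0 \<le> lev (x (traj V (W1.edges x) s T))"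
        using traj_end[OF _ _ _ s] x by auto
      have "x (traj V (W1.edges x) s T) \<in> space (gauss d)" by (rule W1.space_iidD[OF xs f(1)])
      from prob_mark_ge[OF e \<tau> f(2,3) this] show "x \<in> ?S" using xs by (simp add: \<pi>l_def)
    qed
    have m: "EGood \<in> sets P" "EProg \<in> sets P" "EStop \<in> sets P" by (rule EGood_prob EProg_prob EStop_sets)+
    have cover: "space P \<subseteq> (EGood \<inter> EProg \<inter> EStop) \<union> (space P - EGood) \<union> (space P - EProg) \<union> (EGood - EStop)" by blast
    have m': "EGood \<inter> EProg \<inter> EStop \<in> sets P" "space P - EGood \<in> sets P" "space P - EProg \<in> sets P" "EGood - EStop \<in> sets P"
      using m by auto
    have "1 = measure P (space P)" by (simp add: PP.prob_space)
    also have "\<dots> \<le> measure P ((EGood \<inter> EProg \<inter> EStop) \<union> (space P - EGood) \<union> (space P - EProg) \<union> (EGood - EStop))"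
      by (rule PP.finite_measure_mono[OF cover]) (use m' in auto)
    also have "\<dots> \<le> measure P ((EGood \<inter> EProg \<inter> EStop) \<union> (space P - EGood) \<union> (space P - EProg)) + measure P (EGood - EStop)"
      by (rule measure_Un_le) (use m' in auto)
    also have "measure P ((EGood \<inter> EProg \<inter> EStop) \<union> (space P - EGood) \<union> (space P - EProg))
        \<le> measure P ((EGood \<inter> EProg \<inter> EStop) \<union> (space P - EGood)) + measure P (space P - EProg)"
      by (rule measure_Un_le) (use m' in auto)
    also have "measure P ((EGood \<inter> EProg \<inter> EStop) \<union> (space P - EGood)) \<le> measure P (EGood \<inter> EProg \<inter> EStop) + measure P (space P - EGood)"
      by (rule measure_Un_le) (use m' in auto)
    finally have "1 \<le> measure P (EGood \<inter> EProg \<inter> EStop) + 4 * exp (- 7 * lam) + exp (- 7 * lam) + exp (- lam)"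
      using EGood_prob(2) EProg_prob(2) EStop_prob by linarith
    moreover have "12 * exp (- lam) \<le> 1"
    proof -
      have "12 \<le> exp lam" using exp_ge_add_one_self[of lam] bs(3,7) by linarith
      then show ?thesis by (simp add: exp_minus field_simps)
    qed
    moreover have "exp (- 7 * lam) \<le> exp (- lam)" using bs(4) by simp
    ultimately have "1 / 2 \<le> measure P (EGood \<inter> EProg \<inter> EStop)" by linarith
    also have "\<dots> \<le> measure P ?S"
    proof (rule PP.finite_measure_mono[OF sub])
      have mb: "(\<lambda>u. \<P>(b in gauss d. mark \<tau> b u)) \<in> borel_measurable (gauss d)"
      proof -
        have A: "{p \<in> space (gauss2 d). mark \<tau> (snd p) (fst p)} \<in> sets (gauss2 d)"
          using measurable_compose[OF measurable_pair_swap' mark_measurable[of \<tau>]] by (simp add: case_prod_unfold pred_def)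
        from G.measurable_emeasure_Pair[OF this]
        have "(\<lambda>u. G.prob (Pair u -` {p \<in> space (gauss2 d). mark \<tau> (snd p) (fst p)})) \<in> borel_measurable (gauss d)"
          unfolding measure_def by measurable
        then show ?thesis
          by (rule measurable_cong[THEN iffD1, rotated])
            (auto simp: space_pair_measure intro!: arg_cong[where f="G.prob"])
      qed
      have "(\<lambda>x. \<Sum>v\<in>V. of_bool (traj V (W1.edges x) s T = v) * \<P>(b in gauss d. mark \<tau> b (x v))) \<in> borel_measurable P"
      proof (intro borel_measurable_sum borel_measurable_times)
        fix v assume v: "v \<in> V"
        show "(\<lambda>x. \<P>(b in gauss d. mark \<tau> b (x v))) \<in> borel_measurable P"
          using measurable_compose[OF component_P[OF v] mb] by simp
        show "(\<lambda>x. of_bool (traj V (W1.edges x) s T = v)) \<in> borel_measurable P"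
          unfolding of_bool_def using W1.edges_pred[of "\<lambda>E. traj V E s T = v"]
          by (intro measurable_If borel_measurable_const) (auto simp: pred_def)
      qed
      moreover have "(\<Sum>v\<in>V. of_bool (traj V (W1.edges x) s T = v) * \<P>(b in gauss d. mark \<tau> b (x v)))
          = \<P>(b in gauss d. mark \<tau> b (x (traj V (W1.edges x) s T)))" for x
      proof -
        have "(\<Sum>v\<in>V. of_bool (traj V (W1.edges x) s T = v) * \<P>(b in gauss d. mark \<tau> b (x v)))
            = (\<Sum>v\<in>V. if v = traj V (W1.edges x) s T then \<P>(b in gauss d. mark \<tau> b (x v)) else 0)"
          by (intro sum.cong) auto
        then show ?thesis using traj_mem[OF s] by simp
      qed
      ultimately have "(\<lambda>x. \<P>(b in gauss d. mark \<tau> b (x (traj V (W1.edges x) s T)))) \<in> borel_measurable P"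
        by (simp only:)
      then show "?S \<in> sets P" by (rule borel_measurable_le[OF borel_measurable_const])
    qed
    finally show "1 / 2 \<le> measure P ?S" .
  qed
  also have "\<dots> \<le> exp (- (\<xi> * lam))"
  proof -
    have "exp lam * \<pi>l / 2 \<le> real (card V) * \<pi>l" using mult_right_mono[OF exp_big(4), of \<pi>l] by (simp add: \<pi>l_def)
    then have "(exp lam * \<pi>l / 2)\<^sup>2 \<le> (real (card V) * \<pi>l)\<^sup>2" by (rule power_mono) (simp add: \<pi>l_def)
    moreover have "0 < (exp lam * \<pi>l / 2)\<^sup>2" by (simp add: \<pi>l_def)
    moreover have num0: "0 \<le> 32 * \<pi>u * (real T + 1) * C" by (simp add: \<pi>u_def C_def)
    ultimately have "32 * \<pi>u * (real T + 1) * C / (real (card V) * \<pi>l)\<^sup>2 \<le> 32 * \<pi>u * (real T + 1) * C / (exp lam * \<pi>l / 2)\<^sup>2"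
      by - (rule frac_le, assumption, rule order_refl, assumption+)
    also have "\<dots> \<le> 32 * \<pi>u * (2 * exp (22 * (\<xi> * lam))) * C / (exp lam * \<pi>l / 2)\<^sup>2"
      using small_Tp(2) by (intro divide_right_mono mult_right_mono mult_left_mono) (auto simp: \<pi>u_def C_def)
    \<comment> \<open>14080 = 32 * 2 * 55 * 4: the factor of \<open>prob_count_less\<close>, the
      bound on \<open>T + 1\<close>, the factor in \<open>C\<close>, and the squared 2 from
      \<open>card V\<close> being at least half of \<open>n\<close>.\<close>
    also have "\<dots> = 14080 * (\<pi>u * exp (22 * (\<xi> * lam)) * exp (50 * (\<xi> * lam) - \<kappa> * lam) / \<pi>l\<^sup>2)"
      by (simp add: C_def power_mult_distrib power_divide)
    also have "\<pi>u * exp (22 * (\<xi> * lam)) * exp (50 * (\<xi> * lam) - \<kappa> * lam) / \<pi>l\<^sup>2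
        = exp ((- e * lam + \<xi> * lam) + 22 * (\<xi> * lam) + (50 * (\<xi> * lam) - \<kappa> * lam) - 2 * (- e * lam - \<xi> * lam))"
      unfolding \<pi>u_def \<pi>l_def exp_double[symmetric] by (simp only: exp_add exp_diff)
    also have "\<dots> \<le> exp (- 2 * (\<xi> * lam))"
    proof -
      have "(e + \<rho>) * lam \<le> (1 - 100 * \<xi>) * lam" using gap bs(4) by (intro mult_right_mono) auto
      then have "e * lam + \<rho> * lam \<le> lam - 100 * (\<xi> * lam)" by (simp add: algebra_simps)
      moreover have "\<kappa> * lam = lam - \<rho> * lam - 6 * (\<xi> * lam)" by (simp add: kappa algebra_simps)
      ultimately show ?thesis using el by simp
    qed
    finally have "32 * \<pi>u * (real T + 1) * C / (real (card V) * \<pi>l)\<^sup>2 \<le> 14080 * exp (- 2 * (\<xi> * lam))" by simp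
    also have "\<dots> \<le> exp (\<xi> * lam) * exp (- 2 * (\<xi> * lam))"
      using exp_big(1) bs(5) by (intro mult_right_mono) auto
    also have "\<dots> = exp (- (\<xi> * lam))" by (simp add: mult_exp_exp)
    finally show ?thesis .
  qed
  finally show ?thesis by (simp add: \<pi>l_def)
qed

end

subsection \<open>The descent on a fixed instance\<close>

definition planted_data :: "nat \<Rightarrow> real \<Rightarrow> (nat \<Rightarrow> real) \<Rightarrow> (nat \<Rightarrow> real) \<Rightarrow> (nat \<Rightarrow> nat \<Rightarrow> real) \<Rightarrow> nat \<Rightarrow> nat \<Rightarrow> real" where
  "planted_data d \<beta> q z x k = (if k = 0 then (\<lambda>i. \<beta> * q i + sqrt (1 - \<beta>\<^sup>2) * z i) else normalize d (x k))"

locale descent = query_regime +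
  fixes \<beta> :: real and b :: "nat \<Rightarrow> real" and x :: "nat \<Rightarrow> nat \<Rightarrow> real"
  assumes beta: "\<xi> \<le> \<beta>" "\<beta> < 1"
    and b: "0 < nrm d (perp b)"
    and good: "x \<in> EGood" and prog: "x \<in> EProg" and stop: "x \<in> EStop" and deg: "x \<in> EDeg"
begin

definition "D = planted_data d \<beta> q (zdir b) x"

lemma V_iff: "k \<in> V \<longleftrightarrow> 0 < k \<and> k < n"
  by (auto simp: V_def)

lemma goodV: "k \<in> V \<Longrightarrow> good (x k)"
  using good by (simp add: EGood_def)

lemma nrmV: "k \<in> V \<Longrightarrow> 0 < nrm d (x k)"
  using good_bounds(1)[OF goodV] .

lemma D_pos: "k \<in> V \<Longrightarrow> D k = normalize d (x k)"
  by (simp add: D_def planted_data_def V_iff)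

lemma ip_normalize': "ip d (normalize d y) z = ip d y z / nrm d y"
  by (subst (1 2) ip_commute) (rule ip_normalize)

lemma D_lev: "k \<in> V \<Longrightarrow> ip d (D k) q = lev (x k)"
  by (simp add: D_pos ip_normalize' lev_def)

lemma D_edge: "k \<in> V \<Longrightarrow> l \<in> V \<Longrightarrow> nn_edge d n \<alpha> D k l \<longleftrightarrow> k \<noteq> l \<and> adj (x k) (x l)"
  using nrmV[of k] nrmV[of l]
  by (auto simp: nn_edge_def D_pos ip_normalize ip_normalize' adj_def V_iff field_simps)

lemma D_0: "D 0 = (\<lambda>i. \<beta> * q i + sqrt (1 - \<beta>\<^sup>2) * zdir b i)"
  by (simp add: D_def planted_data_def)

lemma D_0_lev: "ip d (D 0) q = \<beta>"
  using zdir_unit(2)[of b] q by (simp add: D_0 ip_linear ip_commute[of d "zdir b" q])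

lemma beta_sq: "0 \<le> 1 - \<beta>\<^sup>2" "(sqrt (1 - \<beta>\<^sup>2))\<^sup>2 = 1 - \<beta>\<^sup>2"
proof -
  have "\<beta>\<^sup>2 \<le> 1\<^sup>2" using beta eps by (intro power_mono) auto
  then show "0 \<le> 1 - \<beta>\<^sup>2" by simp
  then show "(sqrt (1 - \<beta>\<^sup>2))\<^sup>2 = 1 - \<beta>\<^sup>2" by simp
qed

lemma D_edge_0: "k \<in> V \<Longrightarrow> nn_edge d n \<alpha> D k 0 \<longleftrightarrow> \<alpha> * nrm d (x k) \<le> ip d (x k) (D 0)"
  using nrmV[of k] basic(15) by (auto simp: nn_edge_def D_pos ip_normalize' V_iff field_simps)

lemma edge_lt: "nn_edge d n \<alpha> D k l \<Longrightarrow> l \<in> insert 0 V"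
  by (auto simp: nn_edge_def V_iff)

lemma improving_V: "k \<in> V \<Longrightarrow> l \<in> V \<Longrightarrow> l \<in> improving d n \<alpha> D q k \<longleftrightarrow> imp (x k) (x l)"
proof -
  assume kl: "k \<in> V" "l \<in> V"
  have "0 < 1 / real d" using d3 by simp
  then have "imp (x k) (x l) \<Longrightarrow> k \<noteq> l" by (auto simp: imp_def)
  then show ?thesis using kl goodV by (auto simp: improving_def D_edge D_lev imp_def)
qed

text \<open>The planted point has level \<open>\<beta>\<close>, while good points have level at most
  \<open>5 * \<sigma>\<close>. Even with the required gain \<open>1 / real d\<close> the latter
  stays below \<open>\<beta>\<close>, so adjacency alone makes the planted point an
  improvement.\<close>

lemma improving_0: "k \<in> V \<Longrightarrow> nn_edge d n \<alpha> D k 0 \<Longrightarrow> 0 \<in> improving d n \<alpha> D q k"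
proof -
  assume k: "k \<in> V" "nn_edge d n \<alpha> D k 0"
  have "lev (x k) \<le> 5 * \<sigma>" using good_bounds(4)[OF goodV[OF k(1)]] by simp
  moreover have "1 / real d \<le> \<sigma>"
  proof -
    have "1 / real d \<le> \<sigma> * \<sigma>"
      using basic(5) d3 by (simp add: sigma(1) divide_right_mono)
    also have "\<dots> \<le> 1 * \<sigma>" using basic(8,10) by (intro mult_right_mono) auto
    finally show ?thesis by simp
  qed
  moreover have "6 * \<sigma> \<le> \<beta>" using sigma(2) beta(1) eps by linarith
  ultimately show ?thesis using k by (simp add: improving_def D_0_lev D_lev)
qed

lemma finite_improving: "finite (improving d n \<alpha> D q k)"
  by (rule finite_subset[of _ "{..<n}"]) (auto simp: improving_def nn_edge_def)

text \<open>The planted point carries the least index, so the least-index rule picks it as soon as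
  it is adjacent.\<close>

lemma greedy_0: "k \<in> V \<Longrightarrow> nn_edge d n \<alpha> D k 0 \<Longrightarrow> greedy_step d n \<alpha> D q k = 0"
  using improving_0[of k] Min_le[OF finite_improving, of 0 k] by (auto simp: greedy_step_def)

text \<open>The actual walk considers all improving neighbours, the model only those of index at
  most \<open>J\<close>. Below \<open>g0\<close> the event \<open>EProg\<close> supplies an
  improving neighbour within the cutoff, so the least one lies within it too; from \<open>g0\<close>
  on the cutoff is \<open>n\<close>.\<close>

lemma greedy_V:
  assumes k: "k \<in> V" and no: "\<not> nn_edge d n \<alpha> D k 0"
  shows "greedy_step d n \<alpha> D q k = step V (W0.edges x) k"
proof -
  have im: "improving d n \<alpha> D q k = {l \<in> V. imp (x k) (x l)}"
  proof (intro set_eqI iffI)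
    fix l assume l: "l \<in> improving d n \<alpha> D q k"
    then have "nn_edge d n \<alpha> D k l" by (simp add: improving_def)
    then have "l \<in> V" using edge_lt[of k l] no by auto
    then show "l \<in> {l \<in> V. imp (x k) (x l)}" using l improving_V[OF k] by blast
  qed (use improving_V[OF k] in blast)
  have k0: "k \<noteq> 0" using k by (simp add: V_iff)
  show ?thesis
  proof (cases "improving d n \<alpha> D q k = {}")
    case True
    then have "\<not> (\<exists>l\<in>V. (k, l) \<in> W0.edges x)" using im by (auto simp: W0.edges_def Rel0_def)
    then show ?thesis using True by (simp add: greedy_step_def step_def)
  next
    case False
    let ?m = "Min (improving d n \<alpha> D q k)"
    have m: "?m \<in> V" "imp (x k) (x ?m)" using Min_in[OF finite_improving False] im by auto
    have le: "?m \<le> l" if "l \<in> V" "imp (x k) (x l)" for l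
      using that im by (intro Min_le[OF finite_improving]) auto
    have "real ?m \<le> J (x k)"
    proof (cases "lev (x k) < g0")
      case True
      then obtain l where "l \<in> V" "real l \<le> J (x k)" "imp (x k) (x l)"
        using prog k goodV[OF k] by (auto simp: EProg_def)
      then show ?thesis using le[of l] by linarith
    next
      case False
      then show ?thesis using m(1) by (simp add: J_def V_iff)
    qed
    then have "step V (W0.edges x) k = ?m"
      by (intro step_eqI) (use k m le in \<open>auto simp: W0.edges_def Rel0_def\<close>)
    then show ?thesis using False k0 by (simp add: greedy_step_def)
  qed
qed

lemma greedy_pow_0: "(greedy_step d n \<alpha> D q ^^ t) 0 = 0"
  by (induction t) (auto simp: greedy_step_def)

lemma greedy_pow: "s \<in> V \<Longrightarrow> (greedy_step d n \<alpha> D q ^^ t) s = 0 \<or> (greedy_step d n \<alpha> D q ^^ t) s = traj V (W0.edges x) s t"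
proof (induction t)
  case (Suc t)
  show ?case
  proof (cases "(greedy_step d n \<alpha> D q ^^ t) s = 0")
    case True
    then show ?thesis using greedy_pow_0[of 1] by simp
  next
    case False
    then have e: "(greedy_step d n \<alpha> D q ^^ t) s = traj V (W0.edges x) s t" using Suc.IH[OF Suc.prems] by argo
    have k: "traj V (W0.edges x) s t \<in> V" by (rule traj_mem[OF Suc.prems])
    show ?thesis
    proof (cases "nn_edge d n \<alpha> D (traj V (W0.edges x) s t) 0")
      case True
      then show ?thesis using greedy_0[OF k] by (simp add: e)
    next
      case False
      then show ?thesis using greedy_V[OF k] by (simp add: e traj_Suc)
    qed
  qed
qed simp

lemma visited_subset: "s \<in> V \<Longrightarrow> visited d n \<alpha> D q s \<subseteq> insert 0 (orbit V (W0.edges x) T s)"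
proof
  fix v assume s: "s \<in> V" and "v \<in> visited d n \<alpha> D q s"
  then obtain t where t: "v = (greedy_step d n \<alpha> D q ^^ t) s" by (auto simp: visited_def)
  show "v \<in> insert 0 (orbit V (W0.edges x) T s)"
  proof (cases "v = 0")
    case False
    then have v: "v = traj V (W0.edges x) s t" using greedy_pow[OF s, of t] t by auto
    have "stops (W0.edges x)" using stop by (simp add: EStop_def)
    then obtain t0 where t0: "t0 \<le> T" "\<not> (\<exists>l\<in>V. (traj V (W0.edges x) s t0, l) \<in> W0.edges x)"
      using s by (auto simp: stops_def)
    \<comment> \<open>\<open>visited\<close> ranges over all times; a time beyond the stopping time
      can be replaced by the stopping time, which is at most \<open>T\<close>.\<close>
    have "v = traj V (W0.edges x) s (min t t0)"
      using traj_stopped[OF t0(2), of t] v by (simp add: min_def)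
    then show ?thesis using t0(1) by (auto simp: orbit_def)
  qed simp
qed

lemma visited_0: "visited d n \<alpha> D q 0 = {0}"
  by (auto simp: visited_def greedy_pow_0)

lemma descent_succeeds_if:
  assumes s: "s \<in> V" and e: "nn_edge d n \<alpha> D (traj V (W0.edges x) s t) 0"
  shows "descent_succeeds d n \<alpha> D q s"
proof -
  have k: "traj V (W0.edges x) s t \<in> V" by (rule traj_mem[OF s])
  consider "(greedy_step d n \<alpha> D q ^^ t) s = 0" | "(greedy_step d n \<alpha> D q ^^ Suc t) s = 0"
    using greedy_pow[OF s, of t] greedy_0[OF k e] by auto
  then have "\<exists>t. (greedy_step d n \<alpha> D q ^^ t) s = 0" by cases blast+
  then show ?thesis unfolding descent_succeeds_def visited_def by (metis rangeI)
qed

definition "Dg = exp ((\<rho> + 8 * \<xi>) * lam)"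

lemma degree_V: "k \<in> V \<Longrightarrow> real (degree d n \<alpha> D k) \<le> Dg + 1"
proof -
  assume k: "k \<in> V"
  have sub: "{l. nn_edge d n \<alpha> D k l} \<subseteq> insert 0 {l \<in> V - {k}. good (x l) \<and> adj (x k) (x l)}"
  proof
    fix l assume "l \<in> {l. nn_edge d n \<alpha> D k l}"
    then have l: "nn_edge d n \<alpha> D k l" by simp
    from edge_lt[OF this] show "l \<in> insert 0 {l \<in> V - {k}. good (x l) \<and> adj (x k) (x l)}"
      using l D_edge[OF k] goodV by auto
  qed
  have f: "finite {l \<in> V - {k}. good (x l) \<and> adj (x k) (x l)}" by simp
  have "degree d n \<alpha> D k \<le> card (insert 0 {l \<in> V - {k}. good (x l) \<and> adj (x k) (x l)})"
    unfolding degree_def by (rule card_mono[OF _ sub]) (use f in simp)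
  also have "\<dots> \<le> card {l \<in> V - {k}. good (x l) \<and> adj (x k) (x l)} + 1"
    using card_insert_le_m1[of 0] by (simp add: card_insert_if)
  finally have "real (degree d n \<alpha> D k) \<le> real (card {l \<in> V - {k}. good (x l) \<and> adj (x k) (x l)}) + 1"
    by (simp add: of_nat_mono[of "degree d n \<alpha> D k", simplified])
  moreover have "real (card {l \<in> V - {k}. good (x l) \<and> adj (x k) (x l)}) \<le> Dg"
    using deg k goodV[OF k] by (simp add: EDeg_def Dg_def)
  ultimately show ?thesis by linarith
qed

lemma lessThan_V: "{..<n} = insert 0 V"
  using basic(15) by (auto simp: V_iff)

lemma card_V: "real (card V) \<le> real n"
  by (simp add: V_def)

lemma space_le: "real (graph_space d n \<alpha> D) \<le> real n * (Dg + 3)"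
proof -
  \<comment> \<open>\<open>EDeg\<close> does not speak about the planted vertex. The trivial bound
    for it adds only one more \<open>n\<close> to the total.\<close>
  have "degree d n \<alpha> D 0 \<le> card {..<n}"
    unfolding degree_def by (rule card_mono) (auto simp: nn_edge_def)
  then have d0: "real (degree d n \<alpha> D 0) \<le> real n" by simp
  have "(\<Sum>k<n. real (degree d n \<alpha> D k)) = real (degree d n \<alpha> D 0) + (\<Sum>k\<in>V. real (degree d n \<alpha> D k))"
    unfolding lessThan_V by (subst sum.insert) (auto simp: V_iff)
  also have "\<dots> \<le> real n + real (card V) * (Dg + 1)"
    using d0 sum_mono[of V "\<lambda>k. real (degree d n \<alpha> D k)" "\<lambda>_. Dg + 1"] degree_V by (intro add_mono) auto
  also have "\<dots> \<le> real n + real n * (Dg + 1)"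
    using card_V by (intro add_left_mono mult_right_mono) (auto simp: Dg_def)
  finally show ?thesis by (simp add: graph_space_def algebra_simps)
qed

lemma cost_V: "s \<in> V \<Longrightarrow> real (descent_cost d n \<alpha> D q s) \<le> 1 + (real T + 1) * (Dg + 2)"
proof -
  assume s: "s \<in> V"
  let ?O = "orbit V (W0.edges x) T s"
  let ?c = "\<lambda>v. if v = 0 then 1 else degree d n \<alpha> D v + 1"
  have OV: "?O \<subseteq> V" by (rule orbit_subset[OF s])
  have "descent_cost d n \<alpha> D q s \<le> (\<Sum>v\<in>insert 0 ?O. ?c v)"
    unfolding descent_cost_def by (rule sum_mono2[OF _ visited_subset[OF s]]) auto
  also have "\<dots> = 1 + (\<Sum>v\<in>?O. ?c v)"
    using OV by (subst sum.insert) (auto simp: V_iff)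
  finally have "real (descent_cost d n \<alpha> D q s) \<le> real (1 + (\<Sum>v\<in>?O. ?c v))" by (rule of_nat_mono)
  also have "\<dots> = 1 + (\<Sum>v\<in>?O. real (?c v))" by simp
  also have "\<dots> \<le> 1 + (\<Sum>v\<in>?O. Dg + 2)"
  proof (intro add_left_mono sum_mono)
    fix v assume "v \<in> ?O"
    then have "v \<in> V" using OV by auto
    then show "real (?c v) \<le> Dg + 2" using degree_V[of v] by (simp add: V_iff)
  qed
  also have "\<dots> \<le> 1 + (real T + 1) * (Dg + 2)"
  proof -
    have "real (card ?O) \<le> real (T + 1)" by (rule of_nat_mono[OF card_orbit])
    then have "real (card ?O) * (Dg + 2) \<le> (real T + 1) * (Dg + 2)"
      by (intro mult_right_mono) (auto simp: Dg_def add.commute)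
    then show ?thesis by simp
  qed
  finally show ?thesis .
qed

lemma time_le:
  assumes S: "0 < S" "F \<subseteq> V" "S \<le> real (card F)" "\<And>s. s \<in> F \<Longrightarrow> \<exists>t. nn_edge d n \<alpha> D (traj V (W0.edges x) s t) 0"
  shows "expected_query_time d n \<alpha> D q \<le> ereal (real n * (1 + (real T + 1) * (Dg + 2)) / S)"
proof -
  let ?S = "{s. s < n \<and> descent_succeeds d n \<alpha> D q s}"
  have "F \<subseteq> ?S"
  proof
    fix s assume s: "s \<in> F"
    then have sV: "s \<in> V" using S(2) by blast
    obtain t where "nn_edge d n \<alpha> D (traj V (W0.edges x) s t) 0" using S(4)[OF s] by (elim exE)
    from descent_succeeds_if[OF sV this] show "s \<in> ?S" using sV by (simp add: V_iff)
  qed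
  then have "card F \<le> card ?S" by (intro card_mono) auto
  then have c: "S \<le> real (card ?S)" using S(3) by linarith
  then have "0 < real (card ?S)" using S(1) by linarith
  then have c0: "card ?S \<noteq> 0" by (simp only: of_nat_0_less_iff neq0_conv)
  have C0: "0 \<le> 1 + (real T + 1) * (Dg + 2)" by (simp add: Dg_def)
  have one: "real (descent_cost d n \<alpha> D q s) \<le> 1 + (real T + 1) * (Dg + 2)" if "s < n" for s
  proof (cases "s = 0")
    case True
    have "0 \<le> (real T + 1) * (Dg + 2)" by (simp add: Dg_def)
    then show ?thesis using True by (simp add: descent_cost_def visited_0)
  next
    case False
    then show ?thesis using cost_V[of s] that by (simp add: V_iff)
  qed
  have "(\<Sum>s<n. real (descent_cost d n \<alpha> D q s)) \<le> real n * (1 + (real T + 1) * (Dg + 2))"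
    using sum_mono[of "{..<n}" "\<lambda>s. real (descent_cost d n \<alpha> D q s)" "\<lambda>_. 1 + (real T + 1) * (Dg + 2)"] one by simp
  then have "(\<Sum>s<n. real (descent_cost d n \<alpha> D q s)) / real (card ?S) \<le> real n * (1 + (real T + 1) * (Dg + 2)) / S"
    using c S(1) C0 by (intro frac_le) auto
  then show ?thesis using c0 by (simp add: expected_query_time_def Let_def)
qed

lemma Dg_bound: "Dg + 3 \<le> exp (\<xi> * lam) * Dg" "1 + (real T + 1) * (Dg + 2) \<le> exp (\<xi> * lam) * exp (22 * (\<xi> * lam)) * Dg"
  "8 \<le> exp (\<xi> * lam)"
proof -
  have D1: "1 \<le> Dg" using basic(4) rho eps by (simp add: Dg_def)
  have X1: "1 \<le> exp (22 * (\<xi> * lam))" using eps_lam(2) by simp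
  have e: "1600 \<le> exp (\<xi> * lam)" using exp_ge_add_one_self[of "\<xi> * lam"] eps_lam(5) by linarith
  then show "8 \<le> exp (\<xi> * lam)" by simp
  have "4 * Dg \<le> exp (\<xi> * lam) * Dg" using e D1 by (intro mult_right_mono) auto
  then show "Dg + 3 \<le> exp (\<xi> * lam) * Dg" using D1 by linarith
  have "(real T + 1) * (Dg + 2) \<le> (2 * exp (22 * (\<xi> * lam))) * (3 * Dg)"
    using small_Tp(2) D1 by (intro mult_mono) auto
  moreover have "1 * 1 \<le> exp (22 * (\<xi> * lam)) * Dg" using X1 D1 by (intro mult_mono) auto
  ultimately have "1 + (real T + 1) * (Dg + 2) \<le> 7 * (exp (22 * (\<xi> * lam)) * Dg)" by linarith
  also have "\<dots> \<le> exp (\<xi> * lam) * (exp (22 * (\<xi> * lam)) * Dg)" using e D1 by (intro mult_right_mono) auto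
  finally show "1 + (real T + 1) * (Dg + 2) \<le> exp (\<xi> * lam) * exp (22 * (\<xi> * lam)) * Dg" by (simp add: mult.assoc)
qed

lemma space_exp: "real (graph_space d n \<alpha> D) \<le> exp ((1 + \<rho> + 9 * \<xi>) * lam)"
proof -
  have "real (graph_space d n \<alpha> D) \<le> real n * (exp (\<xi> * lam) * Dg)"
    using space_le Dg_bound(1) mult_left_mono[of "Dg + 3" "exp (\<xi> * lam) * Dg" "real n"] by linarith
  also have "\<dots> = exp ((1 + \<rho> + 9 * \<xi>) * lam)"
    unfolding exp_big(2) Dg_def mult_exp_exp by (simp add: algebra_simps)
  finally show ?thesis .
qed

lemma time_exp:
  assumes "F \<subseteq> V" "exp (g * lam) \<le> real (card F)" "\<And>s. s \<in> F \<Longrightarrow> \<exists>t. nn_edge d n \<alpha> D (traj V (W0.edges x) s t) 0"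
  shows "expected_query_time d n \<alpha> D q \<le> ereal (exp ((1 + \<rho> + 31 * \<xi> - g) * lam))"
proof -
  have "real n * (1 + (real T + 1) * (Dg + 2)) / exp (g * lam)
      \<le> real n * (exp (\<xi> * lam) * exp (22 * (\<xi> * lam)) * Dg) / exp (g * lam)"
    using Dg_bound(2) by (intro divide_right_mono mult_left_mono) auto
  also have "\<dots> = exp ((1 + \<rho> + 31 * \<xi> - g) * lam)"
    unfolding exp_big(2) Dg_def mult_exp_exp exp_diff[symmetric] by (simp add: algebra_simps)
  finally show ?thesis
    using time_le[OF _ assms(1,2,3)] order_trans by (metis ereal_less_eq(3) exp_gt_zero)
qed

lemma time_neighbours:
  assumes "exp (g * lam) \<le> real (card {l \<in> V. good (x l) \<and> \<alpha> * nrm d (x l) \<le> ip d (x l) (D 0)})"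
  shows "expected_query_time d n \<alpha> D q \<le> ereal (exp ((1 + \<rho> + 31 * \<xi> - g) * lam))"
proof (rule time_exp[OF _ assms])
  fix s assume "s \<in> {l \<in> V. good (x l) \<and> \<alpha> * nrm d (x l) \<le> ip d (x l) (D 0)}"
  then have "nn_edge d n \<alpha> D (traj V (W0.edges x) s 0) 0" using D_edge_0[of s] by simp
  then show "\<exists>t. nn_edge d n \<alpha> D (traj V (W0.edges x) s t) 0" ..
qed auto

lemma time_count:
  assumes al: "\<alpha> \<le> \<beta> * g0 + sqrt (1 - \<beta>\<^sup>2) * \<tau>" and g: "exp (g * lam) \<le> W1.count (mark \<tau> b) T x"
  shows "expected_query_time d n \<alpha> D q \<le> ereal (exp ((1 + \<rho> + 31 * \<xi> - g) * lam))"
proof -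
  define F where "F = {s \<in> V. mark \<tau> b (x (traj V (W1.edges x) s T))}"
  have "W1.count (mark \<tau> b) T x = (\<Sum>s\<in>V. of_bool (mark \<tau> b (x (traj V (W1.edges x) s T))))"
    unfolding W1.count_def by (intro sum.cong refl W1.hits_eq) auto
  also have "\<dots> = real (card F)" by (simp add: F_def of_bool_def sum.If_cases Int_def)
  finally have g': "exp (g * lam) \<le> real (card F)" using g by simp
  have adjm: "nn_edge d n \<alpha> D k 0" if k: "k \<in> V" and m: "mark \<tau> b (x k)" for k
  proof -
    have p: "0 < nrm d (x k)" by (rule nrmV[OF k])
    have "\<beta> * g0 \<le> \<beta> * lev (x k)" using m beta eps by (intro mult_left_mono) (auto simp: mark_def)
    moreover have "\<tau> \<le> ip d (x k) (zdir b) / nrm d (x k)" using m p by (simp add: mark_def field_simps)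
    then have "sqrt (1 - \<beta>\<^sup>2) * \<tau> \<le> sqrt (1 - \<beta>\<^sup>2) * (ip d (x k) (zdir b) / nrm d (x k))"
      using beta_sq(1) by (intro mult_left_mono) auto
    ultimately have "\<alpha> \<le> \<beta> * lev (x k) + sqrt (1 - \<beta>\<^sup>2) * (ip d (x k) (zdir b) / nrm d (x k))" using al by linarith
    also have "\<dots> = ip d (x k) (D 0) / nrm d (x k)"
      unfolding D_0 ip_linear lev_def by (simp add: add_divide_distrib)
    finally show ?thesis using p D_edge_0[OF k] by (simp add: field_simps)
  qed
  show ?thesis
  proof (rule time_exp[OF _ g'])
    show "F \<subseteq> V" by (auto simp: F_def)
    fix s assume s: "s \<in> F"
    have "\<exists>t'\<le>T. traj V (W1.edges x) s T = traj V (W0.edges x) s t'"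
      by (rule traj_prefix[where A = "{k. lev (x k) < g0}"]) (auto simp: W1.edges_def W0.edges_def Rel1_def)
    then obtain t' where t': "traj V (W1.edges x) s T = traj V (W0.edges x) s t'" by blast
    have "traj V (W1.edges x) s T \<in> V" using s by (intro traj_mem) (simp add: F_def)
    then have "nn_edge d n \<alpha> D (traj V (W0.edges x) s t') 0" using adjm[of "traj V (W1.edges x) s T"] s t' by (simp add: F_def)
    then show "\<exists>t. nn_edge d n \<alpha> D (traj V (W0.edges x) s t) 0" ..
  qed
qed

end

section \<open>High probability of a fast instance for a fixed query\<close>

lemma prob_pair_ge:
  assumes "prob_space M" "prob_space N" and W: "W \<in> sets (M \<Otimes>\<^sub>M N)"
    and c: "AE a in M. c \<le> measure N (Pair a -` W)"
  shows "c \<le> measure (M \<Otimes>\<^sub>M N) W"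
proof (cases "0 \<le> c")
  case True
  interpret M: prob_space M by fact
  interpret N: prob_space N by fact
  interpret MN: pair_prob_space M N ..
  have "ennreal c = (\<integral>\<^sup>+a. ennreal c \<partial>M)" by (simp add: M.emeasure_space_1)
  also have "\<dots> \<le> (\<integral>\<^sup>+a. emeasure N (Pair a -` W) \<partial>M)"
    using c by (intro nn_integral_mono_AE) (auto simp: N.emeasure_eq_measure elim!: AE_mp)
  also have "\<dots> = emeasure (M \<Otimes>\<^sub>M N) W" by (rule N.emeasure_pair_measure_alt[OF W, symmetric])
  also have "\<dots> = ennreal (measure (M \<Otimes>\<^sub>M N) W)" by (rule MN.emeasure_eq_measure)
  finally show ?thesis by simp
next
  case False
  then show ?thesis using measure_nonneg[of "M \<Otimes>\<^sub>M N" W] by linarith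
qed

definition fast_instance :: "nat \<Rightarrow> nat \<Rightarrow> real \<Rightarrow> real \<Rightarrow> real \<Rightarrow> real \<Rightarrow> (nat \<Rightarrow> real) \<Rightarrow> (nat \<Rightarrow> real) \<Rightarrow> (nat \<Rightarrow> nat \<Rightarrow> real) \<Rightarrow> bool" where
  "fast_instance d n \<alpha> \<beta> s t q b x \<longleftrightarrow>
     (let D = planted_data d \<beta> q (normalize d (\<lambda>i. b i - ip d b q * q i)) x
      in real (graph_space d n \<alpha> D) \<le> s \<and> expected_query_time d n \<alpha> D q \<le> ereal t)"

context query_regime
begin

interpretation PP: prob_space P by (rule G.prob_space_iid)

definition ENice where "ENice = EGood \<inter> EProg \<inter> EStop \<inter> EDeg"

lemma exp_eps_lam: "8 \<le> exp (\<xi> * lam)" "6 * exp (- 7 * lam) + exp (- lam) + exp (- (\<xi> * lam)) \<le> \<xi>"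
proof -
  note bs = basic
  show "8 \<le> exp (\<xi> * lam)" using exp_ge_add_one_self[of "\<xi> * lam"] eps_lam(5) by linarith
  have el: "\<xi> * lam \<le> lam" using eps bs(4) by simp
  have "8 * exp (- (\<xi> * lam)) \<le> \<xi>"
  proof -
    have "400 * 1 \<le> \<xi> * lam" using eps_lam(5) by simp
    have "8 \<le> \<xi> * (80000 * lam)" using eps_lam(5) by simp
    also have "\<dots> \<le> \<xi> * exp (\<xi> * lam)" using exp_big(1) eps by (intro mult_left_mono) auto
    finally show ?thesis by (simp add: exp_minus field_simps)
  qed
  moreover have "exp (- 7 * lam) \<le> exp (- (\<xi> * lam))" "exp (- lam) \<le> exp (- (\<xi> * lam))"
    using el bs(4) by auto
  ultimately show "6 * exp (- 7 * lam) + exp (- lam) + exp (- (\<xi> * lam)) \<le> \<xi>" by linarith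
qed

lemma ENice_prob: "ENice \<in> sets P" "measure P (space P - ENice) \<le> 6 * exp (- 7 * lam) + exp (- lam)"
proof -
  have m: "EGood \<in> sets P" "EProg \<in> sets P" "EStop \<in> sets P" "EDeg \<in> sets P"
    by (rule EGood_prob EProg_prob EStop_sets EDeg_prob)+
  then show "ENice \<in> sets P" unfolding ENice_def by (intro sets.Int)
  let ?A = "space P - EGood" and ?B = "space P - EProg" and ?C = "EGood - EStop" and ?D = "space P - EDeg"
  have m': "?A \<in> sets P" "?B \<in> sets P" "?C \<in> sets P" "?D \<in> sets P" using m by auto
  have "measure P (space P - ENice) \<le> measure P (?A \<union> ?B \<union> ?C \<union> ?D)"
    by (rule PP.finite_measure_mono) (use m' in \<open>auto simp: ENice_def\<close>)
  also have "\<dots> \<le> measure P (?A \<union> ?B \<union> ?C) + measure P ?D" by (rule measure_Un_le) (use m' in auto)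
  also have "measure P (?A \<union> ?B \<union> ?C) \<le> measure P (?A \<union> ?B) + measure P ?C" by (rule measure_Un_le) (use m' in auto)
  also have "measure P (?A \<union> ?B) \<le> measure P ?A + measure P ?B" by (rule measure_Un_le) (use m' in auto)
  finally show "measure P (space P - ENice) \<le> 6 * exp (- 7 * lam) + exp (- lam)"
    using EGood_prob(2) EProg_prob(2) EStop_prob EDeg_prob(2) by linarith
qed

lemma descentI: "\<xi> \<le> \<beta> \<Longrightarrow> \<beta> < 1 \<Longrightarrow> 0 < nrm d (perp b) \<Longrightarrow> x \<in> ENice \<Longrightarrow> descent d n \<kappa> \<rho> \<xi> lam \<sigma> \<eta> q \<beta> b x"
  by unfold_locales (auto simp: ENice_def)

abbreviation fast :: "real \<Rightarrow> real \<Rightarrow> (nat \<Rightarrow> real) \<Rightarrow> (nat \<Rightarrow> nat \<Rightarrow> real) \<Rightarrow> bool" where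
  "fast \<beta> h \<equiv> fast_instance d n \<alpha> \<beta> (exp ((1 + \<rho> + 9 * \<xi>) * lam)) (exp (h * lam)) q"

text \<open>Every neighbour of the planted point is a successful start, and for almost every
  \<open>b\<close> there are about \<open>n powr \<rho>\<close> of them. The event \<open>W\<close>
  is an arbitrary measurable superset of the fast instances because it will be a section of the
  preimage of \<open>succ_event\<close>, whose measurability is shown on the matrix space.\<close>

lemma prob_fast_neighbours:
  assumes beta: "\<xi> \<le> \<beta>" "\<beta> < 1"
    and W: "W \<in> sets Pb" "\<And>b x. b \<in> space (gauss d) \<Longrightarrow> x \<in> space P \<Longrightarrow> fast \<beta> (1 + 27 * \<xi>) b x \<Longrightarrow> (b, x) \<in> W"
  shows "1 - \<xi> \<le> measure Pb W"
proof (rule prob_pair_ge[OF prob_space_gauss G.prob_space_iid W(1)])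
  note bs = basic
  show "AE b in gauss d. 1 - \<xi> \<le> measure P (Pair b -` W)"
    using AE_perp AE_space
  proof eventually_elim
    case (elim b)
    define p where "p = (\<lambda>i. \<beta> * q i + sqrt (1 - \<beta>\<^sup>2) * zdir b i)"
    \<comment> \<open>The expected number of neighbours is at least about
      \<open>exp ((\<rho> + 5 * \<xi>) * lam)\<close>: the loss \<open>6 * \<xi>\<close> in
      \<open>\<kappa>\<close> minus the error of \<open>prob_planted_adj_ge\<close>. One further
      \<open>\<xi>\<close> is given up to absorb constants in the Chernoff bound.\<close>
    define a where "a = exp ((\<rho> + 4 * \<xi>) * lam)"
    define A where "A = {y \<in> space (gauss d). good y \<and> \<alpha> * nrm d y \<le> ip d y p}"
    define F where "F = {x \<in> space P. real (card {l \<in> V. x l \<in> A}) \<le> a}"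
    have z: "ip d (zdir b) (zdir b) = 1" "ip d q (zdir b) = 0" "ip d (zdir b) q = 0"
      using zdir_unit(1)[OF elim(1)] zdir_unit(2)[of b] by (simp_all add: ip_commute[of d "zdir b" q])
    have "\<beta>\<^sup>2 \<le> 1\<^sup>2" using beta eps by (intro power_mono) auto
    then have p1: "ip d p p = 1" unfolding p_def ip_linear z q by (simp add: power2_eq_square flip: real_sqrt_mult)
    have Am: "A \<in> sets (gauss d)"
      unfolding A_def using good_measurable planted_adj_measurable[of \<alpha> p] by (simp add: pred_def)
    have pA: "exp (- \<kappa> * lam - \<xi> * lam) \<le> measure (gauss d) A" unfolding A_def by (rule prob_planted_adj_ge[OF p1])
    have "2 * a \<le> real (card V) * measure (gauss d) A / 2"
    proof -
      have "8 * a \<le> exp (\<xi> * lam) * a" using exp_eps_lam(1) by (intro mult_right_mono) (auto simp: a_def)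
      also have "\<dots> = exp lam * exp (- \<kappa> * lam - \<xi> * lam)"
        unfolding a_def mult_exp_exp kappa by (simp add: algebra_simps)
      also have "\<dots> \<le> (2 * real (card V)) * measure (gauss d) A"
        using exp_big(4) pA by (intro mult_mono) auto
      finally show ?thesis by simp
    qed
    moreover have "measure P F \<le> exp (a - real (card V) * measure (gauss d) A / 2)"
      unfolding F_def by (rule G.chernoff_lower[OF finite_V order_refl Am])
    moreover have "\<xi> * lam \<le> a"
    proof -
      have "\<xi> * lam \<le> (\<rho> + 4 * \<xi>) * lam" using rho eps bs(4) by (intro mult_right_mono) auto
      then show ?thesis unfolding a_def using exp_ge_add_one_self[of "(\<rho> + 4 * \<xi>) * lam"] by linarith
    qed
    ultimately have F: "measure P F \<le> exp (- (\<xi> * lam))"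
      by (elim order_trans) simp
    have Fm: "F \<in> sets P"
    proof -
      have "Measurable.pred P (\<lambda>x. x l \<in> A)" if "l \<in> V" for l
        using measurable_sets[OF component_P[OF that] Am] by (simp add: pred_def vimage_def Int_def conj_commute)
      then have "(\<lambda>x. \<Sum>l\<in>V. if x l \<in> A then 1 else 0 :: real) \<in> borel_measurable P"
        by (intro borel_measurable_sum measurable_If borel_measurable_const) (simp add: pred_def)
      moreover have "(\<Sum>l\<in>V. if x l \<in> A then 1 else 0 :: real) = real (card {l \<in> V. x l \<in> A})" for x
        by (simp add: sum.If_cases Int_def)
      ultimately have "(\<lambda>x. real (card {l \<in> V. x l \<in> A})) \<in> borel_measurable P" by (simp only:)
      then show ?thesis unfolding F_def by (rule borel_measurable_le[OF _ borel_measurable_const])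
    qed
    have sub: "ENice - F \<subseteq> Pair b -` W"
    proof
      fix x assume x: "x \<in> ENice - F"
      then have xs: "x \<in> space P" by (simp add: ENice_def EGood_def)
      interpret D: descent d n \<kappa> \<rho> \<xi> lam \<sigma> \<eta> q \<beta> b x
        using descentI[OF beta elim(1)] x by simp
      have "a \<le> real (card {l \<in> V. x l \<in> A})" using x xs by (simp add: F_def)
      moreover have "{l \<in> V. x l \<in> A} = {l \<in> V. good (x l) \<and> \<alpha> * nrm d (x l) \<le> ip d (x l) (D.D 0)}"
        using W0.space_iidD[OF xs] by (auto simp: A_def p_def D.D_0)
      ultimately have c: "exp ((\<rho> + 4 * \<xi>) * lam) \<le> real (card {l \<in> V. good (x l) \<and> \<alpha> * nrm d (x l) \<le> ip d (x l) (D.D 0)})"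
        by (simp only: a_def)
      have "fast \<beta> (1 + 27 * \<xi>) b x"
        using D.time_neighbours[OF c] D.space_exp by (simp add: fast_instance_def D.D_def zdir_def perp_def)
      then show "x \<in> Pair b -` W" using W(2)[OF elim(2) xs] by simp
    qed
    have "1 - (measure P (space P - ENice) + measure P F) \<le> measure P (ENice - F)"
    proof -
      have "measure P ENice \<le> measure P ((ENice - F) \<union> F)"
        by (rule PP.finite_measure_mono) (use ENice_prob(1) Fm in auto)
      also have "\<dots> \<le> measure P (ENice - F) + measure P F"
        by (rule measure_Un_le) (use ENice_prob(1) Fm in auto)
      finally show ?thesis using PP.prob_compl[OF ENice_prob(1)] by linarith
    qed
    also have "measure P (ENice - F) \<le> measure P (Pair b -` W)"
      by (rule PP.finite_measure_mono[OF sub sets_Pair1[OF W(1)]])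
    finally show ?case using F ENice_prob(2) exp_eps_lam(2) by linarith
  qed
qed

text \<open>Outside the failure event there are at least
  \<open>exp ((1 - e - 2 * \<xi>) * lam)\<close> successful starts: one \<open>\<xi>\<close> is the
  error in the marking probability and the other absorbs a factor 8. Together with the 31 of
  \<open>time_count\<close> this makes 33.\<close>

lemma prob_fast_count:
  assumes beta: "\<xi> \<le> \<beta>" "\<beta> < 1"
    and e: "0 \<le> e" "e \<le> 1" and \<tau>: "\<tau> * rd = sqrt (2 * e * lam)" and gap: "e + \<rho> \<le> 1 - 100 * \<xi>"
    and al: "\<alpha> \<le> \<beta> * g0 + sqrt (1 - \<beta>\<^sup>2) * \<tau>"
    and W: "W \<in> sets Pb" "\<And>b x. b \<in> space (gauss d) \<Longrightarrow> x \<in> space P \<Longrightarrow> fast \<beta> (\<rho> + e + 33 * \<xi>) b x \<Longrightarrow> (b, x) \<in> W"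
  shows "1 - \<xi> \<le> measure Pb W"
proof -
  interpret GP: pair_prob_space "gauss d" P ..
  define F where "F = {p \<in> space Pb. W1.count (mark \<tau> (fst p)) T (snd p) < real (card V) * exp (- e * lam - \<xi> * lam) / 4}"
  have F: "measure Pb F \<le> exp (- (\<xi> * lam))" unfolding F_def by (rule prob_few_successes[OF e \<tau> gap])
  have Fm: "F \<in> sets Pb"
  proof -
    have "(\<lambda>(b, x). W1.hits (mark \<tau> b) T V s x) \<in> borel_measurable Pb" for s
      by (rule W1.hits_measurable[OF mark_measurable]) simp
    then have "(\<lambda>p. W1.count (mark \<tau> (fst p)) T (snd p)) \<in> borel_measurable Pb"
      unfolding W1.count_def by (intro borel_measurable_sum) (simp add: case_prod_unfold)
    then show ?thesis unfolding F_def by (rule borel_measurable_less[OF _ borel_measurable_const])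
  qed
  obtain N where N: "{b \<in> space (gauss d). \<not> 0 < nrm d (perp b)} \<subseteq> N" "emeasure (gauss d) N = 0" "N \<in> sets (gauss d)"
    using AE_E[OF AE_perp] by blast
  let ?X = "space (gauss d) \<times> ENice" and ?Y = "N \<times> space P"
  have m: "?X \<in> sets Pb" "?Y \<in> sets Pb" using ENice_prob(1) N(3) by auto
  have Y: "measure Pb ?Y = 0"
    unfolding measure_def using N by (simp add: PP.emeasure_pair_measure_Times)
  have X: "measure Pb ?X = measure P ENice"
    unfolding measure_def using ENice_prob(1) by (simp add: PP.emeasure_pair_measure_Times G.emeasure_space_1)
  have sub: "?X \<subseteq> W \<union> ?Y \<union> F"
  proof
    fix p assume p: "p \<in> ?X"
    show "p \<in> W \<union> ?Y \<union> F"
    proof (rule ccontr)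
      assume np: "p \<notin> W \<union> ?Y \<union> F"
      obtain b x where bx: "p = (b, x)" "b \<in> space (gauss d)" "x \<in> ENice" using p by auto
      then have xs: "x \<in> space P" by (simp add: ENice_def EGood_def)
      have "b \<notin> N" using np bx xs by auto
      then have b: "0 < nrm d (perp b)" using N(1) bx(2) by auto
      interpret D: descent d n \<kappa> \<rho> \<xi> lam \<sigma> \<eta> q \<beta> b x
        using descentI[OF beta b bx(3)] .
      have "exp ((1 - e - 2 * \<xi>) * lam) \<le> W1.count (mark \<tau> b) T x"
      proof -
        have "8 * exp ((1 - e - 2 * \<xi>) * lam) \<le> exp (\<xi> * lam) * exp ((1 - e - 2 * \<xi>) * lam)"
          using exp_eps_lam(1) by (intro mult_right_mono) auto
        also have "\<dots> = exp lam * exp (- e * lam - \<xi> * lam)" unfolding mult_exp_exp by (simp add: algebra_simps)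
        also have "\<dots> \<le> (2 * real (card V)) * exp (- e * lam - \<xi> * lam)" using exp_big(4) by (intro mult_right_mono) auto
        finally have "exp ((1 - e - 2 * \<xi>) * lam) \<le> real (card V) * exp (- e * lam - \<xi> * lam) / 4" by simp
        also have "\<dots> \<le> W1.count (mark \<tau> b) T x"
        proof -
          have "p \<in> space Pb" using bx xs by (simp add: space_pair_measure)
          then show ?thesis using np bx(1) by (simp add: F_def not_less)
        qed
        finally show ?thesis .
      qed
      from D.time_count[OF al this] have "expected_query_time d n \<alpha> D.D q \<le> ereal (exp ((1 + \<rho> + 31 * \<xi> - (1 - e - 2 * \<xi>)) * lam))" .
      moreover have "1 + \<rho> + 31 * \<xi> - (1 - e - 2 * \<xi>) = \<rho> + e + 33 * \<xi>" by simp
      ultimately have "fast \<beta> (\<rho> + e + 33 * \<xi>) b x"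
        using D.space_exp by (simp only: fast_instance_def D.D_def zdir_def perp_def Let_def simp_thms)
      then show False using W(2)[OF bx(2) xs] np bx(1) by simp
    qed
  qed
  have "measure Pb ?X \<le> measure Pb (W \<union> ?Y \<union> F)"
    by (rule GP.finite_measure_mono[OF sub]) (use W(1) m Fm in auto)
  also have "\<dots> \<le> measure Pb (W \<union> ?Y) + measure Pb F"
    by (rule measure_Un_le) (use W(1) m Fm in auto)
  also have "measure Pb (W \<union> ?Y) \<le> measure Pb W + measure Pb ?Y"
    by (rule measure_Un_le) (use W(1) m in auto)
  finally show ?thesis
    using X Y F ENice_prob(2) exp_eps_lam(2) PP.prob_compl[OF ENice_prob(1)] by linarith
qed

end

section \<open>From the Gaussian matrix to independent rows\<close>

definition assemble :: "nat \<Rightarrow> nat \<Rightarrow> (nat \<Rightarrow> real) \<times> (nat \<Rightarrow> real) \<times> (nat \<Rightarrow> nat \<Rightarrow> real) \<Rightarrow> nat \<times> nat \<Rightarrow> real" where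
  "assemble d n p = (\<lambda>ji\<in>{..n} \<times> {..<d}.
     if fst ji = 0 then fst p (snd ji) else if fst ji = 1 then fst (snd p) (snd ji) else snd (snd p) (fst ji - 1) (snd ji))"

definition gauss_rows :: "nat \<Rightarrow> nat \<Rightarrow> ((nat \<Rightarrow> real) \<times> (nat \<Rightarrow> real) \<times> (nat \<Rightarrow> nat \<Rightarrow> real)) measure" where
  "gauss_rows d n = gauss d \<Otimes>\<^sub>M (gauss d \<Otimes>\<^sub>M PiM {1..<n} (\<lambda>_. gauss d))"

lemma space_gauss: "space (gauss d) = PiE {..<d} (\<lambda>_. UNIV)"
  by (simp add: gauss_def space_PiM)

lemma assemble_measurable:
  assumes n: "1 \<le> n"
  shows "assemble d n \<in> gauss_rows d n \<rightarrow>\<^sub>M gauss_matrix d n"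
  unfolding assemble_def gauss_matrix_def
proof (rule measurable_restrict)
  fix ji assume "ji \<in> {..n} \<times> {..<d}"
  then obtain j i where ji: "ji = (j, i)" "j \<le> n" "i < d" by auto
  have std: "f \<in> M \<rightarrow>\<^sub>M std_normal \<longleftrightarrow> f \<in> borel_measurable M" for M :: "((nat \<Rightarrow> real) \<times> (nat \<Rightarrow> real) \<times> (nat \<Rightarrow> nat \<Rightarrow> real)) measure" and f
    using measurable_cong_sets[of M M std_normal borel] by simp
  have 1: "(\<lambda>p. fst p i) \<in> borel_measurable (gauss_rows d n)"
    unfolding gauss_rows_def by (rule measurable_compose[OF measurable_fst component_gauss[OF ji(3)]])
  have 2: "(\<lambda>p. fst (snd p) i) \<in> borel_measurable (gauss_rows d n)"
    unfolding gauss_rows_def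
    by (rule measurable_compose[OF measurable_snd measurable_compose[OF measurable_fst component_gauss[OF ji(3)]]])
  have 3: "(\<lambda>p. snd (snd p) (j - 1) i) \<in> borel_measurable (gauss_rows d n)" if j: "j \<noteq> 0" "j \<noteq> 1"
  proof -
    have "j - 1 \<in> {1..<n}" using j ji(2) by auto
    from measurable_compose[OF measurable_component_singleton[OF this] component_gauss[OF ji(3)]]
    have "(\<lambda>x. x (j - 1) i) \<in> borel_measurable (PiM {1..<n} (\<lambda>_. gauss d))" .
    then show ?thesis unfolding gauss_rows_def
      by (rule measurable_compose[OF measurable_snd measurable_compose[OF measurable_snd]])
  qed
  show "(\<lambda>p. if fst ji = 0 then fst p (snd ji) else if fst ji = 1 then fst (snd p) (snd ji) else snd (snd p) (fst ji - 1) (snd ji))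
      \<in> gauss_rows d n \<rightarrow>\<^sub>M std_normal"
    unfolding std ji fst_conv snd_conv using 1 2 3 by (cases "j = 0"; cases "j = 1") simp_all
qed

lemma prod_rows:
  fixes f :: "nat \<Rightarrow> 'a :: comm_monoid_mult"
  assumes "1 \<le> n"
  shows "(\<Prod>j\<le>n. f j) = f 0 * (f 1 * (\<Prod>k\<in>{1..<n}. f (k + 1)))"
proof -
  have e: "{..n} = insert 0 (insert 1 (Suc ` {1..<n}))"
  proof -
    have "Suc ` {1..<n} = {2..n}" by (auto simp: image_Suc_atLeastLessThan)
    then show ?thesis using assms by auto
  qed
  have "(\<Prod>j\<le>n. f j) = f 0 * (f 1 * (\<Prod>j\<in>Suc ` {1..<n}. f j))"
    unfolding e by (subst prod.insert; auto)+
  also have "(\<Prod>j\<in>Suc ` {1..<n}. f j) = (\<Prod>k\<in>{1..<n}. f (k + 1))" by (subst prod.reindex) auto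
  finally show ?thesis .
qed

text \<open>Product measures agree once they agree on boxes, and the preimage of a box of entries is
  a product of boxes of rows. Rows 0 and 1 are the query and the planted direction, and data point
  \<open>k\<close> sits in row \<open>k + 1\<close>, as in \<open>dataset\<close>; hence the shift
  of the index.\<close>

lemma distr_assemble:
  assumes n: "1 \<le> n"
  shows "distr (gauss_rows d n) (gauss_matrix d n) (assemble d n) = gauss_matrix d n"
proof -
  interpret S: product_sigma_finite "\<lambda>_::nat. std_normal"
    by (intro product_sigma_finite.intro prob_space_imp_sigma_finite prob_space_std_normal)
  interpret S2: product_sigma_finite "\<lambda>_::nat \<times> nat. std_normal"
    by (intro product_sigma_finite.intro prob_space_imp_sigma_finite prob_space_std_normal)
  interpret G: prob_space "gauss d" by (rule prob_space_gauss)
  interpret GP: product_sigma_finite "\<lambda>_::nat. gauss d"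
    by (intro product_sigma_finite.intro prob_space_imp_sigma_finite prob_space_gauss)
  interpret P: prob_space "PiM {1..<n} (\<lambda>_. gauss d)" by (rule prob_space_PiM) (rule prob_space_gauss)
  interpret BP: prob_space "gauss d \<Otimes>\<^sub>M PiM {1..<n} (\<lambda>_. gauss d)"
    by (intro prob_space_pair prob_space_PiM prob_space_gauss)
  have "distr (gauss_rows d n) (gauss_matrix d n) (assemble d n) = PiM ({..n} \<times> {..<d}) (\<lambda>_. std_normal)"
  proof (rule S2.PiM_eqI)
    show "finite ({..n} \<times> {..<d})" by simp
    show "sets (distr (gauss_rows d n) (gauss_matrix d n) (assemble d n)) = sets (PiM ({..n} \<times> {..<d}) (\<lambda>_. std_normal))"
      by (simp add: gauss_matrix_def)
    fix A :: "nat \<times> nat \<Rightarrow> real set" assume A: "\<And>i. i \<in> {..n} \<times> {..<d} \<Longrightarrow> A i \<in> sets std_normal"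
    define B where "B j = PiE {..<d} (\<lambda>i. A (j, i))" for j
    have Bm: "B j \<in> sets (gauss d)" if "j \<le> n" for j
      unfolding B_def gauss_def using A that by (intro sets_PiM_I_finite) auto
    have Be: "emeasure (gauss d) (B j) = (\<Prod>i<d. emeasure std_normal (A (j, i)))" if "j \<le> n" for j
      unfolding B_def gauss_def using A that by (intro S.emeasure_PiM) auto
    let ?X = "PiE {1..<n} (\<lambda>k. B (k + 1))"
    have Xm: "?X \<in> sets (PiM {1..<n} (\<lambda>_. gauss d))" using Bm by (intro sets_PiM_I_finite) auto
    have Xe: "emeasure (PiM {1..<n} (\<lambda>_. gauss d)) ?X = (\<Prod>k\<in>{1..<n}. emeasure (gauss d) (B (k + 1)))"
      using Bm by (intro GP.emeasure_PiM) auto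
    have Am: "PiE ({..n} \<times> {..<d}) A \<in> sets (gauss_matrix d n)"
      unfolding gauss_matrix_def using A by (intro sets_PiM_I_finite) auto
    have pre: "assemble d n -` PiE ({..n} \<times> {..<d}) A \<inter> space (gauss_rows d n) = B 0 \<times> (B 1 \<times> ?X)"
    proof (intro set_eqI iffI)
      fix p assume p: "p \<in> assemble d n -` PiE ({..n} \<times> {..<d}) A \<inter> space (gauss_rows d n)"
      obtain a b x where abx: "p = (a, b, x)" by (metis prod.exhaust)
      have sp: "a \<in> PiE {..<d} (\<lambda>_. UNIV)" "b \<in> PiE {..<d} (\<lambda>_. UNIV)" "x \<in> PiE {1..<n} (\<lambda>_. PiE {..<d} (\<lambda>_. UNIV))"
        using p by (auto simp: abx gauss_rows_def space_pair_measure space_gauss space_PiM)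
      have in_A: "assemble d n (a, b, x) (j, i) \<in> A (j, i)" if "j \<le> n" "i < d" for j i
        using p that by (auto simp: abx PiE_iff)
      have "a \<in> B 0"
        unfolding B_def using sp(1) in_A[of 0] n by (auto simp: PiE_iff assemble_def)
      moreover have "b \<in> B 1"
        unfolding B_def using sp(2) in_A[of 1] n by (auto simp: PiE_iff assemble_def)
      moreover have "x \<in> ?X"
      proof (rule PiE_I)
        fix k assume k: "k \<in> {1..<n}"
        then have "x k \<in> PiE {..<d} (\<lambda>_. UNIV)" using sp(3) by (auto simp: PiE_iff)
        then show "x k \<in> B (k + 1)"
          unfolding B_def using in_A[of "k + 1"] k by (auto simp: PiE_iff assemble_def)
      next
        fix k assume "k \<notin> {1..<n}"
        then show "x k = undefined" using sp(3) by (auto simp: PiE_iff extensional_def)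
      qed
      ultimately show "p \<in> B 0 \<times> (B 1 \<times> ?X)" by (simp add: abx)
    next
      fix p assume "p \<in> B 0 \<times> (B 1 \<times> ?X)"
      then obtain a b x where abx: "p = (a, b, x)" "a \<in> B 0" "b \<in> B 1" "x \<in> ?X" by auto
      have "B j \<subseteq> space (gauss d)" for j unfolding B_def space_gauss by (rule PiE_mono) auto
      moreover from this have "?X \<subseteq> space (PiM {1..<n} (\<lambda>_. gauss d))" unfolding space_PiM by (intro PiE_mono)
      ultimately have sp: "p \<in> space (gauss_rows d n)" using abx by (auto simp: gauss_rows_def space_pair_measure)
      have "assemble d n p \<in> PiE ({..n} \<times> {..<d}) A"
      proof (rule PiE_I)
        fix ji assume "ji \<in> {..n} \<times> {..<d}"
        then obtain j i where ji: "ji = (j, i)" "j \<le> n" "i < d" by auto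
        have "x (j - 1) \<in> B (j - 1 + 1)" if "j \<noteq> 0" "j \<noteq> 1"
          by (rule PiE_mem[OF abx(4)]) (use that ji in auto)
        then have "x (j - 1) \<in> B j" if "j \<noteq> 0" "j \<noteq> 1" using that by simp
        then have "x (j - 1) i \<in> A (j, i)" if "j \<noteq> 0" "j \<noteq> 1" using that ji(3) by (auto simp: B_def PiE_iff)
        moreover have "a i \<in> A (0, i)" "b i \<in> A (1, i)" using abx(2,3) ji(3) by (auto simp: B_def PiE_iff)
        ultimately show "assemble d n p ji \<in> A ji" using ji by (simp add: assemble_def abx(1))
      next
        fix ji assume "ji \<notin> {..n} \<times> {..<d}"
        then show "assemble d n p ji = undefined" unfolding assemble_def restrict_def by (rule if_not_P)
      qed
      then show "p \<in> assemble d n -` PiE ({..n} \<times> {..<d}) A \<inter> space (gauss_rows d n)" using sp by simp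
    qed
    have "emeasure (distr (gauss_rows d n) (gauss_matrix d n) (assemble d n)) (PiE ({..n} \<times> {..<d}) A)
        = emeasure (gauss_rows d n) (B 0 \<times> (B 1 \<times> ?X))"
      by (subst emeasure_distr[OF assemble_measurable[OF n] Am]) (simp only: pre)
    also have "\<dots> = emeasure (gauss d) (B 0) * (emeasure (gauss d) (B 1) * emeasure (PiM {1..<n} (\<lambda>_. gauss d)) ?X)"
      unfolding gauss_rows_def
      by (subst BP.emeasure_pair_measure_Times; (subst P.emeasure_pair_measure_Times)?)
        (use Bm n Xm in \<open>auto intro!: pair_measureI\<close>)
    also have "\<dots> = (\<Prod>j\<le>n. emeasure (gauss d) (B j))" unfolding Xe by (rule prod_rows[OF n, symmetric])
    also have "\<dots> = (\<Prod>j\<le>n. \<Prod>i<d. emeasure std_normal (A (j, i)))" by (rule prod.cong[OF refl], rule Be) simp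
    also have "\<dots> = (\<Prod>ji\<in>{..n} \<times> {..<d}. emeasure std_normal (A ji))"
      by (subst prod.cartesian_product) (simp add: case_prod_unfold)
    finally show "emeasure (distr (gauss_rows d n) (gauss_matrix d n) (assemble d n)) (PiE ({..n} \<times> {..<d}) A)
        = (\<Prod>ji\<in>{..n} \<times> {..<d}. emeasure std_normal (A ji))" .
  qed
  then show ?thesis by (simp only: gauss_matrix_def)
qed

definition succ_event :: "real \<Rightarrow> nat \<Rightarrow> nat \<Rightarrow> real \<Rightarrow> real \<Rightarrow> real \<Rightarrow> (nat \<times> nat \<Rightarrow> real) set" where
  "succ_event c d n \<alpha> s t = {G \<in> space (gauss_matrix d n).
     real (graph_space d n \<alpha> (dataset c d G)) \<le> s \<and> expected_query_time d n \<alpha> (dataset c d G) (query d G) \<le> ereal t}"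

lemma graph_cong:
  assumes e: "\<And>k l. nn_edge d n \<alpha> D k l = nn_edge d n \<alpha> D' k l" and i: "\<And>k. improving d n \<alpha> D q k = improving d n \<alpha> D' q' k"
  shows "graph_space d n \<alpha> D = graph_space d n \<alpha> D'" "expected_query_time d n \<alpha> D q = expected_query_time d n \<alpha> D' q'"
proof -
  have dg: "degree d n \<alpha> D = degree d n \<alpha> D'" by (simp add: degree_def e fun_eq_iff)
  then show "graph_space d n \<alpha> D = graph_space d n \<alpha> D'" by (simp add: graph_space_def)
  have "greedy_step d n \<alpha> D q = greedy_step d n \<alpha> D' q'" by (simp add: greedy_step_def i fun_eq_iff)
  then have v: "visited d n \<alpha> D q = visited d n \<alpha> D' q'" by (intro ext) (simp only: visited_def)
  have "descent_succeeds d n \<alpha> D q = descent_succeeds d n \<alpha> D' q'" "descent_cost d n \<alpha> D q = descent_cost d n \<alpha> D' q'"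
    by (intro ext, simp only: descent_succeeds_def descent_cost_def v dg)+
  then show "expected_query_time d n \<alpha> D q = expected_query_time d n \<alpha> D' q'" by (simp add: expected_query_time_def)
qed

lemma ip_vec_measurable:
  assumes "\<And>i. i < d \<Longrightarrow> (\<lambda>G. f G i) \<in> borel_measurable M" "\<And>i. i < d \<Longrightarrow> (\<lambda>G. g G i) \<in> borel_measurable M"
  shows "(\<lambda>G. ip d (f G) (g G)) \<in> borel_measurable M"
  unfolding ip_def using assms by (intro borel_measurable_sum borel_measurable_times) auto

lemma normalize_vec_measurable:
  assumes "\<And>i. i < d \<Longrightarrow> (\<lambda>G. f G i) \<in> borel_measurable M"
  shows "(\<lambda>G. normalize d (f G) i) \<in> borel_measurable M"
proof -
  have n: "(\<lambda>G. nrm d (f G)) \<in> borel_measurable M"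
    unfolding nrm_def by (intro measurable_compose[OF ip_vec_measurable[OF assms assms] borel_measurable_sqrt])
  show ?thesis
  proof (cases "i < d")
    case True
    then show ?thesis using borel_measurable_divide[OF assms[OF True] n] by (simp add: normalize_def)
  qed (simp add: normalize_def)
qed

lemma dataset_measurable:
  assumes "1 \<le> n" "k < n"
  shows "(\<lambda>G. dataset c d G k i) \<in> borel_measurable (gauss_matrix d n)" "(\<lambda>G. query d G i) \<in> borel_measurable (gauss_matrix d n)"
proof -
  have g: "(\<lambda>G. grow G j i) \<in> borel_measurable (gauss_matrix d n)" if "j \<le> n" "i < d" for j i
  proof -
    have "(\<lambda>G. G (j, i)) \<in> gauss_matrix d n \<rightarrow>\<^sub>M std_normal"
      unfolding gauss_matrix_def using that by (intro measurable_component_singleton) auto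
    then show ?thesis by (simp add: grow_def)
  qed
  have q: "(\<lambda>G. query d G i) \<in> borel_measurable (gauss_matrix d n)" for i
    unfolding query_def by (rule normalize_vec_measurable) (rule g, auto)
  then show "(\<lambda>G. query d G i) \<in> borel_measurable (gauss_matrix d n)" .
  have "(\<lambda>G. normalize d (\<lambda>i. grow G 1 i - ip d (grow G 1) (query d G) * query d G i) i) \<in> borel_measurable (gauss_matrix d n)"
  proof (rule normalize_vec_measurable)
    fix i assume "i < d"
    then show "(\<lambda>G. grow G 1 i - ip d (grow G 1) (query d G) * query d G i) \<in> borel_measurable (gauss_matrix d n)"
      using assms(1) by (intro borel_measurable_diff borel_measurable_times ip_vec_measurable g q)
  qed
  then have p: "(\<lambda>G. planted c d G i) \<in> borel_measurable (gauss_matrix d n)"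
    unfolding planted_def Let_def by (intro borel_measurable_add borel_measurable_times borel_measurable_const q)
  show "(\<lambda>G. dataset c d G k i) \<in> borel_measurable (gauss_matrix d n)"
  proof (cases "k = 0")
    case False
    have "(\<lambda>G. normalize d (grow G (k + 1)) i) \<in> borel_measurable (gauss_matrix d n)"
      by (rule normalize_vec_measurable) (rule g, use assms(2) in auto)
    then show ?thesis using False by (simp add: dataset_def)
  qed (simp add: dataset_def p)
qed

text \<open>Space and query time depend on the matrix only through two relations on
  \<open>{..<n}\<close>, adjacency and improvement. These take finitely many values, so the event is
  a finite union of events given by finitely many inequalities between measurable inner
  products.\<close>

lemma succ_event_sets: "1 \<le> n \<Longrightarrow> succ_event c d n \<alpha> s t \<in> sets (gauss_matrix d n)"
proof -
  assume n: "1 \<le> n"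
  let ?M = "gauss_matrix d n"
  define E where "E G = {(k, l). nn_edge d n \<alpha> (dataset c d G) k l}" for G
  define R where "R G = {(k, l). l \<in> improving d n \<alpha> (dataset c d G) (query d G) k}" for G
  have sub: "E G \<subseteq> {..<n} \<times> {..<n}" "R G \<subseteq> {..<n} \<times> {..<n}" for G
    by (auto simp: E_def R_def improving_def nn_edge_def)
  define S where "S = (\<lambda>G. (E G, R G)) ` succ_event c d n \<alpha> s t"
  have "S \<subseteq> Pow ({..<n} \<times> {..<n}) \<times> Pow ({..<n} \<times> {..<n})" using sub by (auto simp: S_def)
  then have fS: "finite S" by (rule finite_subset) simp
  have Em: "{G \<in> space ?M. (k, l) \<in> E G} \<in> sets ?M" for k l
  proof (cases "k < n \<and> l < n \<and> k \<noteq> l")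
    case True
    then have "{G \<in> space ?M. (k, l) \<in> E G} = {G \<in> space ?M. \<alpha> \<le> ip d (dataset c d G k) (dataset c d G l)}"
      by (auto simp: E_def nn_edge_def)
    also have "\<dots> \<in> sets ?M"
      using True by (intro borel_measurable_le borel_measurable_const ip_vec_measurable dataset_measurable n) auto
    finally show ?thesis .
  next
    case False
    then have "{G \<in> space ?M. (k, l) \<in> E G} = {}" by (auto simp: E_def nn_edge_def)
    then show ?thesis by (simp only: sets.empty_sets)
  qed
  have Rm: "{G \<in> space ?M. (k, l) \<in> R G} \<in> sets ?M" for k l
  proof (cases "k < n \<and> l < n")
    case True
    have "{G \<in> space ?M. (k, l) \<in> R G} = {G \<in> space ?M. (k, l) \<in> E G} \<inter>
        {G \<in> space ?M. ip d (dataset c d G k) (query d G) + 1 / real d \<le> ip d (dataset c d G l) (query d G)}"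
      by (auto simp: E_def R_def improving_def)
    also have "\<dots> \<in> sets ?M"
      using True by (intro sets.Int Em borel_measurable_le borel_measurable_add borel_measurable_const ip_vec_measurable dataset_measurable n) auto
    finally show ?thesis .
  next
    case False
    then have "{G \<in> space ?M. (k, l) \<in> R G} = {}" by (auto simp: R_def improving_def nn_edge_def)
    then show ?thesis by (simp only: sets.empty_sets)
  qed
  have "succ_event c d n \<alpha> s t = (\<Union>ER\<in>S. {G \<in> space ?M. E G = fst ER \<and> R G = snd ER})"
  proof (intro set_eqI iffI)
    fix G assume G: "G \<in> succ_event c d n \<alpha> s t"
    then have "(E G, R G) \<in> S" "G \<in> space ?M" by (auto simp: S_def succ_event_def)
    then show "G \<in> (\<Union>ER\<in>S. {G \<in> space ?M. E G = fst ER \<and> R G = snd ER})" by force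
  next
    fix G assume "G \<in> (\<Union>ER\<in>S. {G \<in> space ?M. E G = fst ER \<and> R G = snd ER})"
    then obtain G' where G: "G \<in> space ?M" "G' \<in> succ_event c d n \<alpha> s t" "E G = E G'" "R G = R G'"
      by (auto simp: S_def)
    have e: "nn_edge d n \<alpha> (dataset c d G) k l = nn_edge d n \<alpha> (dataset c d G') k l" for k l
      using G(3) by (simp add: E_def set_eq_iff)
    have i: "improving d n \<alpha> (dataset c d G) (query d G) k = improving d n \<alpha> (dataset c d G') (query d G') k" for k
      using G(4) by (simp add: R_def set_eq_iff)
    show "G \<in> succ_event c d n \<alpha> s t"
      using G(1,2) graph_cong[OF e i] by (simp add: succ_event_def)
  qed
  also have "\<dots> \<in> sets ?M"
  proof (intro sets.finite_UN[OF fS])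
    fix ER assume "ER \<in> S"
    then obtain G' where G': "ER = (E G', R G')" by (auto simp: S_def)
    have ER: "fst ER \<subseteq> {..<n} \<times> {..<n}" "snd ER \<subseteq> {..<n} \<times> {..<n}" unfolding G' fst_conv snd_conv by (rule sub)+
    have key: "A = B \<longleftrightarrow> (\<forall>kl\<in>X. kl \<in> A \<longleftrightarrow> kl \<in> B)" if "A \<subseteq> X" "B \<subseteq> X" for A B X :: "(nat \<times> nat) set"
      using that by blast
    have "{G \<in> space ?M. E G = fst ER \<and> R G = snd ER} = {G \<in> space ?M. \<forall>kl\<in>{..<n} \<times> {..<n}.
        (kl \<in> E G \<longleftrightarrow> kl \<in> fst ER) \<and> (kl \<in> R G \<longleftrightarrow> kl \<in> snd ER)}"
      unfolding key[OF sub(1) ER(1)] key[OF sub(2) ER(2)] by blast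
    also have "\<dots> \<in> sets ?M"
    proof (rule sets.sets_Collect_finite_All')
      fix kl assume "kl \<in> {..<n} \<times> {..<n}"
      have "{G \<in> space ?M. kl \<in> E G} \<in> sets ?M" "{G \<in> space ?M. kl \<in> R G} \<in> sets ?M"
        using Em[of "fst kl" "snd kl"] Rm[of "fst kl" "snd kl"] by (simp_all only: prod.collapse)
      then have "Measurable.pred ?M (\<lambda>G. (kl \<in> E G \<longleftrightarrow> kl \<in> fst ER) \<and> (kl \<in> R G \<longleftrightarrow> kl \<in> snd ER))"
        by (cases "kl \<in> fst ER"; cases "kl \<in> snd ER") (auto simp only: pred_def[symmetric] simp_thms intro!: pred_intros_logic)
      then show "{G \<in> space ?M. (kl \<in> E G \<longleftrightarrow> kl \<in> fst ER) \<and> (kl \<in> R G \<longleftrightarrow> kl \<in> snd ER)} \<in> sets ?M"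
        by (simp only: pred_def)
    qed (use n in \<open>auto simp: lessThan_empty_iff\<close>)
    finally show "{G \<in> space ?M. E G = fst ER \<and> R G = snd ER} \<in> sets ?M" .
  qed
  finally show ?thesis .
qed

lemma normalize_cong: "(\<And>i. i < d \<Longrightarrow> f i = g i) \<Longrightarrow> normalize d f = normalize d g"
  unfolding normalize_def nrm_def using ip_cong[of d f g f g] by auto

text \<open>Condition on row 0, which almost surely has nonzero norm and hence determines a unit
  query. It then suffices to have the bound for every fixed query, with the remaining rows
  independent of it.\<close>

lemma prob_succ_event_ge:
  assumes n: "1 \<le> n" and d: "3 \<le> d"
    and inner: "\<And>q W. ip d q q = 1 \<Longrightarrow> W \<in> sets (gauss d \<Otimes>\<^sub>M PiM {1..<n} (\<lambda>_. gauss d)) \<Longrightarrow>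
      (\<And>b x. b \<in> space (gauss d) \<Longrightarrow> x \<in> space (PiM {1..<n} (\<lambda>_. gauss d)) \<Longrightarrow>
        fast_instance d n \<alpha> (1 - 1 / c\<^sup>2) s t q b x \<Longrightarrow>
        (b, x) \<in> W) \<Longrightarrow> r \<le> measure (gauss d \<Otimes>\<^sub>M PiM {1..<n} (\<lambda>_. gauss d)) W"
  shows "r \<le> measure (gauss_matrix d n) (succ_event c d n \<alpha> s t)"
proof -
  let ?S = "succ_event c d n \<alpha> s t" and ?P = "PiM {1..<n} (\<lambda>_. gauss d)"
  let ?W = "assemble d n -` ?S \<inter> space (gauss_rows d n)"
  note Am = assemble_measurable[OF n, of d] and Sm = succ_event_sets[OF n, of c d \<alpha> s t]
  have Wm: "?W \<in> sets (gauss d \<Otimes>\<^sub>M (gauss d \<Otimes>\<^sub>M ?P))" using measurable_sets[OF Am Sm] by (simp only: gauss_rows_def)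
  have "r \<le> measure (gauss d \<Otimes>\<^sub>M (gauss d \<Otimes>\<^sub>M ?P)) ?W"
  proof (rule prob_pair_ge[OF prob_space_gauss prob_space_pair[OF prob_space_gauss prob_space_PiM[OF prob_space_gauss]] Wm])
    have d0: "0 < d" using d by simp
    show "AE a in gauss d. r \<le> measure (gauss d \<Otimes>\<^sub>M ?P) (Pair a -` ?W)"
      using AE_ip_nonzero[OF d ip_unit_unit[OF d0]] AE_space
    proof eventually_elim
      case (elim a)
      let ?q = "normalize d a"
      have "nrm d a \<noteq> 0"
      proof
        assume "nrm d a = 0"
        then have "\<bar>ip d a (unit 0)\<bar> \<le> 0" using ip_cauchy_schwarz[of d a "unit 0"] by (simp add: nrm_def)
        then show False using elim(1) by simp
      qed
      then have "nrm d a * nrm d a \<noteq> 0" by simp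
      moreover have "ip d ?q ?q = ip d a a / (nrm d a * nrm d a)"
        by (simp add: ip_def normalize_def sum_divide_distrib[symmetric])
      ultimately have q: "ip d ?q ?q = 1" by (simp add: nrm_square)
      show ?case
      proof (rule inner[OF q sets_Pair1[OF Wm]])
        fix b x assume bx: "b \<in> space (gauss d)" "x \<in> space ?P"
        let ?D = "planted_data d (1 - 1 / c\<^sup>2) ?q (normalize d (\<lambda>i. b i - ip d b ?q * ?q i)) x"
        assume "fast_instance d n \<alpha> (1 - 1 / c\<^sup>2) s t ?q b x"
        then have g: "real (graph_space d n \<alpha> ?D) \<le> s" "expected_query_time d n \<alpha> ?D ?q \<le> ereal t"
          by (simp_all only: fast_instance_def Let_def)
        let ?G = "assemble d n (a, b, x)"
        have rows: "grow ?G 0 i = a i" "grow ?G 1 i = b i" "0 < k \<Longrightarrow> k < n \<Longrightarrow> grow ?G (k + 1) i = x k i" if "i < d" for i k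
          using that n by (auto simp: grow_def assemble_def)
        have qG: "query d ?G = ?q" unfolding query_def by (rule normalize_cong) (rule rows(1))
        have "ip d (grow ?G 1) ?q = ip d b ?q" by (rule ip_cong) (simp_all add: rows(2)[simplified])
        then have "normalize d (\<lambda>i. grow ?G 1 i - ip d (grow ?G 1) ?q * ?q i) = normalize d (\<lambda>i. b i - ip d b ?q * ?q i)"
          by (intro normalize_cong) (simp only: rows(2))
        then have D0: "dataset c d ?G 0 = ?D 0"
          by (simp only: dataset_def planted_def planted_data_def Let_def qG simp_thms if_True)
        have Dk: "dataset c d ?G k = ?D k" if "k < n" for k
        proof (cases "k = 0")
          case False
          have "normalize d (grow ?G (k + 1)) = normalize d (x k)"
            by (rule normalize_cong) (use rows(3) False that in auto)
          then show ?thesis using False by (simp add: dataset_def planted_data_def)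
        qed (simp only: D0)
        have e: "nn_edge d n \<alpha> (dataset c d ?G) k l = nn_edge d n \<alpha> ?D k l" for k l
          using Dk[of k] Dk[of l] by (auto simp: nn_edge_def)
        have i: "improving d n \<alpha> (dataset c d ?G) (query d ?G) k = improving d n \<alpha> ?D ?q k" for k
          unfolding improving_def e qG using Dk by (auto simp: nn_edge_def)
        have sp: "(a, b, x) \<in> space (gauss_rows d n)"
          using elim(2) bx by (simp add: gauss_rows_def space_pair_measure)
        then have "?G \<in> ?S"
          using g measurable_space[OF Am sp] graph_cong[OF e i] by (simp add: succ_event_def)
        then show "(b, x) \<in> Pair a -` ?W" using sp by simp
      qed
    qed
  qed
  also have "\<dots> = measure (distr (gauss_rows d n) (gauss_matrix d n) (assemble d n)) ?S"
    unfolding measure_distr[OF Am Sm] by (simp only: gauss_rows_def)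
  finally show ?thesis by (simp only: distr_assemble[OF n])
qed

context regime
begin

lemma prob_succ_neighbours:
  assumes c: "1 < c" and beta: "\<xi> \<le> 1 - 1 / c\<^sup>2"
  shows "1 - \<xi> \<le> measure (gauss_matrix d n)
    (succ_event c d n \<alpha> (exp ((1 + \<rho> + 9 * \<xi>) * lam)) (exp ((1 + 27 * \<xi>) * lam)))"
proof (rule prob_succ_event_ge[OF _ d3])
  show "1 \<le> n" using basic(15) by simp
  fix q W assume q: "ip d q q = 1" and Wm: "W \<in> sets (gauss d \<Otimes>\<^sub>M PiM {1..<n} (\<lambda>_. gauss d))"
    and W: "\<And>b x. b \<in> space (gauss d) \<Longrightarrow> x \<in> space (PiM {1..<n} (\<lambda>_. gauss d)) \<Longrightarrow>
      fast_instance d n \<alpha> (1 - 1 / c\<^sup>2) (exp ((1 + \<rho> + 9 * \<xi>) * lam)) (exp ((1 + 27 * \<xi>) * lam)) q b x \<Longrightarrow> (b, x) \<in> W"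
  interpret Q: query_regime d n \<kappa> \<rho> \<xi> lam \<sigma> \<eta> q by unfold_locales (rule q)
  have beta1: "1 - 1 / c\<^sup>2 < 1" using c by simp
  show "1 - \<xi> \<le> measure (gauss d \<Otimes>\<^sub>M PiM {1..<n} (\<lambda>_. gauss d)) W"
    by (rule Q.prob_fast_neighbours[OF beta beta1, unfolded Q.V_def, OF Wm W])
qed

lemma prob_succ_count:
  assumes c: "1 < c" and beta: "\<xi> \<le> 1 - 1 / c\<^sup>2"
    and e: "0 \<le> e" "e \<le> 1" and \<tau>: "\<tau> * rd = sqrt (2 * e * lam)" and gap: "e + \<rho> \<le> 1 - 100 * \<xi>"
    and al: "\<alpha> \<le> (1 - 1 / c\<^sup>2) * g0 + sqrt (1 - (1 - 1 / c\<^sup>2)\<^sup>2) * \<tau>"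
  shows "1 - \<xi> \<le> measure (gauss_matrix d n)
    (succ_event c d n \<alpha> (exp ((1 + \<rho> + 9 * \<xi>) * lam)) (exp ((\<rho> + e + 33 * \<xi>) * lam)))"
proof (rule prob_succ_event_ge[OF _ d3])
  show "1 \<le> n" using basic(15) by simp
  fix q W assume q: "ip d q q = 1" and Wm: "W \<in> sets (gauss d \<Otimes>\<^sub>M PiM {1..<n} (\<lambda>_. gauss d))"
    and W: "\<And>b x. b \<in> space (gauss d) \<Longrightarrow> x \<in> space (PiM {1..<n} (\<lambda>_. gauss d)) \<Longrightarrow>
      fast_instance d n \<alpha> (1 - 1 / c\<^sup>2) (exp ((1 + \<rho> + 9 * \<xi>) * lam)) (exp ((\<rho> + e + 33 * \<xi>) * lam)) q b x \<Longrightarrow> (b, x) \<in> W"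
  interpret Q: query_regime d n \<kappa> \<rho> \<xi> lam \<sigma> \<eta> q by unfold_locales (rule q)
  have beta1: "1 - 1 / c\<^sup>2 < 1" using c by simp
  show "1 - \<xi> \<le> measure (gauss d \<Otimes>\<^sub>M PiM {1..<n} (\<lambda>_. gauss d)) W"
    by (rule Q.prob_fast_count[OF beta beta1 e \<tau> gap al, unfolded Q.V_def, OF Wm W])
qed

end

lemma prob_space_gauss_matrix: "prob_space (gauss_matrix d n)"
  unfolding gauss_matrix_def by (intro prob_space_PiM prob_space_std_normal)

lemma prob_succ_event_mono:
  assumes "1 \<le> n" "s \<le> s'" "t \<le> t'"
  shows "measure (gauss_matrix d n) (succ_event c d n \<alpha> s t) \<le> measure (gauss_matrix d n) (succ_event c d n \<alpha> s' t')"
proof -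
  interpret prob_space "gauss_matrix d n" by (rule prob_space_gauss_matrix)
  have "succ_event c d n \<alpha> s t \<subseteq> succ_event c d n \<alpha> s' t'"
    using assms order_trans[of _ "ereal t" "ereal t'"] by (auto simp: succ_event_def)
  then show ?thesis by (intro finite_measure_mono succ_event_sets assms(1))
qed

subsection \<open>Asymptotics\<close>

text \<open>Division by \<open>c ^ 4\<close> turns the hypothesis into
  \<open>1 - 2 * \<beta> * R \<le> (1 - \<beta>\<^sup>2) * \<rho>q\<close>, because
  \<open>c ^ 4 * (1 - \<beta>\<^sup>2) = 2 * c\<^sup>2 - 1\<close> and
  \<open>c\<^sup>2 * \<beta> = c\<^sup>2 - 1\<close>. The square in the claim expands to
  \<open>1 - (1 - \<beta>\<^sup>2) * \<rho> - 2 * \<beta> * R\<close>, and the two match. Replacing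
  \<open>\<rho>s\<close> by the minimum with 1/2 can only increase the root, since
  \<open>\<rho>s * (1 - \<rho>s)\<close> is at most 1/4.\<close>

lemma exponent_tradeoff:
  fixes c \<rho>q \<rho>s :: real
  assumes c: "c > 1" and hyp: "(2 * c\<^sup>2 - 1) * \<rho>q + 2 * c\<^sup>2 * (c\<^sup>2 - 1) * sqrt (\<rho>s * (1 - \<rho>s)) \<ge> c ^ 4" and s: "0 \<le> \<rho>s"
  defines "\<beta> \<equiv> 1 - 1 / c\<^sup>2" and "\<rho> \<equiv> min \<rho>s (1 / 2)"
  shows "\<rho> + (sqrt (1 - \<rho>) - \<beta> * sqrt \<rho>)\<^sup>2 / (1 - \<beta>\<^sup>2) \<le> \<rho>q" "0 < \<beta>" "\<beta> < 1"
proof -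
  have c2: "1 < c\<^sup>2" using c by (simp add: one_less_power)
  have "1 / c\<^sup>2 < 1" "0 < 1 / c\<^sup>2" using c2 c by (simp_all add: divide_less_eq_1)
  then show b: "0 < \<beta>" "\<beta> < 1" by (auto simp: \<beta>_def)
  have r: "0 \<le> \<rho>" "\<rho> \<le> 1 / 2" using s by (auto simp: \<rho>_def)
  define R where "R = sqrt (\<rho> * (1 - \<rho>))"
  have R: "sqrt (\<rho>s * (1 - \<rho>s)) \<le> R"
  proof (cases "\<rho>s \<le> 1 / 2")
    case True
    then show ?thesis by (simp add: R_def \<rho>_def)
  next
    case False
    have "\<rho>s * (1 - \<rho>s) \<le> 1 / 2 * (1 - 1 / 2)"
      using zero_le_power2[of "\<rho>s - 1 / 2"] by (simp add: power2_eq_square algebra_simps)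
    then show ?thesis using False by (simp add: R_def \<rho>_def)
  qed
  have "0 \<le> 2 * c\<^sup>2 * (c\<^sup>2 - 1)" using c2 by simp
  then have h: "c ^ 4 \<le> (2 * c\<^sup>2 - 1) * \<rho>q + 2 * c\<^sup>2 * (c\<^sup>2 - 1) * R"
    using hyp mult_left_mono[OF R] by fastforce
  have c4: "c ^ 4 = c\<^sup>2 * c\<^sup>2" by (simp add: power2_eq_square numeral_eq_Suc)
  have cb: "c\<^sup>2 * \<beta> = c\<^sup>2 - 1" using c by (simp add: \<beta>_def field_simps)
  have "c ^ 4 * (1 - \<beta>\<^sup>2) = c\<^sup>2 * c\<^sup>2 - (c\<^sup>2 * \<beta>) * (c\<^sup>2 * \<beta>)" by (simp add: c4 power2_eq_square algebra_simps)
  also have "\<dots> = 2 * c\<^sup>2 - 1" by (simp only: cb) (simp add: algebra_simps)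
  finally have c1: "c ^ 4 * (1 - \<beta>\<^sup>2) = 2 * c\<^sup>2 - 1" .
  have c3: "2 * c\<^sup>2 * (c\<^sup>2 - 1) = c ^ 4 * (2 * \<beta>)" unfolding cb[symmetric] c4 by simp
  have "c ^ 4 * 1 \<le> c ^ 4 * ((1 - \<beta>\<^sup>2) * \<rho>q + 2 * \<beta> * R)"
    using h unfolding c3 c1[symmetric] by (simp add: algebra_simps)
  then have main: "1 - 2 * \<beta> * R \<le> (1 - \<beta>\<^sup>2) * \<rho>q"
    using c by (subst (asm) mult_le_cancel_left_pos) auto
  have "\<beta>\<^sup>2 < 1\<^sup>2" using b by (intro power_strict_mono) auto
  then have b2: "0 < 1 - \<beta>\<^sup>2" by simp
  have "(sqrt (1 - \<rho>) - \<beta> * sqrt \<rho>)\<^sup>2 = (1 - \<rho>) + \<beta>\<^sup>2 * \<rho> - 2 * \<beta> * (sqrt \<rho> * sqrt (1 - \<rho>))"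
    using r by (simp add: power2_diff power_mult_distrib)
  also have "sqrt \<rho> * sqrt (1 - \<rho>) = R" by (simp add: R_def real_sqrt_mult)
  finally have "(sqrt (1 - \<rho>) - \<beta> * sqrt \<rho>)\<^sup>2 \<le> (1 - \<beta>\<^sup>2) * (\<rho>q - \<rho>)" using main by (simp add: algebra_simps)
  then have "(sqrt (1 - \<rho>) - \<beta> * sqrt \<rho>)\<^sup>2 / (1 - \<beta>\<^sup>2) \<le> \<rho>q - \<rho>"
    using b2 by (simp add: pos_divide_le_eq mult.commute)
  then show "\<rho> + (sqrt (1 - \<rho>) - \<beta> * sqrt \<rho>)\<^sup>2 / (1 - \<beta>\<^sup>2) \<le> \<rho>q" by simp
qed

lemma eventually_succeeds:
  fixes c \<rho>q \<rho>s \<delta> :: real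
  assumes c: "c > 1" and s: "0 \<le> \<rho>s" and \<delta>: "0 < \<delta>"
    and hyp: "(2 * c\<^sup>2 - 1) * \<rho>q + 2 * c\<^sup>2 * (c\<^sup>2 - 1) * sqrt (\<rho>s * (1 - \<rho>s)) \<ge> c ^ 4"
  shows "\<exists>\<theta>>0. \<exists>N>0. \<forall>d n. N \<le> real n \<longrightarrow> ln (real n) \<le> \<theta> * real d \<longrightarrow>
    (\<exists>\<alpha>. 0 < \<alpha> \<and> \<alpha> < 1 \<and> 1 - \<delta> \<le> measure (gauss_matrix d n)
      (succ_event c d n \<alpha> (real n powr (1 + \<rho>s + \<delta>)) (real n powr (\<rho>q + \<delta>))))"
proof -
  define \<beta> where "\<beta> = 1 - 1 / c\<^sup>2"
  define \<rho> where "\<rho> = min \<rho>s (1 / 2)"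
  note trade = exponent_tradeoff[OF c hyp s, folded \<beta>_def \<rho>_def]
  have \<rho>: "0 \<le> \<rho>" "\<rho> \<le> 1 / 2" "\<rho> \<le> \<rho>s" using s by (auto simp: \<rho>_def)
  have "\<beta>\<^sup>2 < 1\<^sup>2" using trade(2,3) by (intro power_strict_mono) auto
  then have b2: "0 < 1 - \<beta>\<^sup>2" by simp
  define g where "g = (if \<rho>q < 1 then (1 - \<rho>q) / 100 else 1)"
  \<comment> \<open>\<open>\<delta> / 33\<close> keeps the errors in space and time within
    \<open>\<delta>\<close>. \<open>\<beta>\<close> puts the planted level above all others,
    \<open>(1 - \<beta>\<^sup>2) / 12\<close> makes \<open>h\<close> nonnegative below, and
    \<open>g\<close> provides the gap of \<open>100 * \<xi>\<close> when
    \<open>\<rho>q < 1\<close>.\<close>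
  define \<xi> where "\<xi> = min (min (1 / 100) (\<delta> / 33)) (min \<beta> (min ((1 - \<beta>\<^sup>2) / 12) g))"
  have g0: "0 < g" by (simp add: g_def)
  have \<xi>: "0 < \<xi>" "\<xi> \<le> 1 / 100" "33 * \<xi> \<le> \<delta>" "\<xi> \<le> \<beta>" "12 * \<xi> \<le> 1 - \<beta>\<^sup>2" "\<xi> \<le> g"
    using \<delta> trade(2) b2 g0 by (auto simp: \<xi>_def min_def)
  define N where "N = exp ((400 / \<xi>)\<^sup>2)"
  define \<theta> where "\<theta> = (\<xi> / 1000)\<^sup>2"
  have "\<exists>\<alpha>. 0 < \<alpha> \<and> \<alpha> < 1 \<and> 1 - \<delta> \<le> measure (gauss_matrix d n)
      (succ_event c d n \<alpha> (real n powr (1 + \<rho>s + \<delta>)) (real n powr (\<rho>q + \<delta>)))"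
    if n: "N \<le> real n" and d: "ln (real n) \<le> \<theta> * real d" for d n
  proof -
    define lam where "lam = ln (real n)"
    have n0: "0 < real n" by (rule less_le_trans[OF _ n]) (simp add: N_def)
    have l1: "(400 / \<xi>)\<^sup>2 \<le> lam"
      unfolding lam_def using n n0 by (simp add: N_def ln_ge_iff)
    then have l2: "400 / \<xi> \<le> sqrt lam" by (rule real_le_rsqrt)
    have "400 \<le> 400 / \<xi>" using \<xi>(1,2) by (simp add: field_simps)
    then have "400\<^sup>2 \<le> (400 / \<xi>)\<^sup>2" by (intro power_mono) auto
    then have l0: "1 \<le> lam" using l1 by simp
    have th: "\<theta> \<le> 1 / 3"
    proof -
      have "\<theta> \<le> (1 / 2)\<^sup>2" unfolding \<theta>_def using \<xi>(1,2) by (intro power_mono) auto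
      then show ?thesis by (simp add: power2_eq_square)
    qed
    have "lam \<le> 1 / 3 * real d" using d th mult_right_mono[OF th, of "real d"] by (simp add: lam_def)
    then have d3: "3 \<le> d" using l0 by linarith
    then have d0: "0 < real d" by simp
    have "lam / real d \<le> \<theta>" using d d0 by (simp add: lam_def pos_divide_le_eq)
    then have "sqrt (lam / real d) \<le> sqrt \<theta>" by (rule real_sqrt_le_mono)
    then have sg: "sqrt (lam / real d) \<le> \<xi> / 1000" using \<xi>(1) by (simp add: \<theta>_def)
    define \<kappa> where "\<kappa> = 1 - \<rho> - 6 * \<xi>"
    interpret Q: regime d n \<kappa> \<rho> \<xi> lam "sqrt (lam / real d)" "12 * sqrt (lam / real d)"
      by unfold_locales (use d3 \<xi> \<rho> l2 sg in \<open>auto simp: \<kappa>_def lam_def\<close>)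
    have n1: "1 \<le> n" using n0 by simp
    have pw: "exp (a * lam) \<le> real n powr b" if "a \<le> b" for a b
      using that l0 n0 by (simp add: powr_def lam_def[symmetric] mult_right_mono)
    have space: "exp ((1 + \<rho> + 9 * \<xi>) * lam) \<le> real n powr (1 + \<rho>s + \<delta>)"
      using \<rho>(3) \<xi>(1,3) by (intro pw) auto
    have "Q.\<alpha> < 1"
    proof -
      have "Q.\<alpha> * Q.rd \<le> (3 / 2 * sqrt (lam / real d)) * Q.rd" using Q.basic(9,18,19) by simp
      then have "Q.\<alpha> \<le> 3 / 2 * sqrt (lam / real d)" using Q.basic(1) by (subst (asm) mult_le_cancel_right_pos) auto
      then show ?thesis using Q.basic(10) by linarith
    qed
    moreover have "1 - \<delta> \<le> measure (gauss_matrix d n) (succ_event c d n Q.\<alpha> (real n powr (1 + \<rho>s + \<delta>)) (real n powr (\<rho>q + \<delta>)))"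
    proof (cases "\<rho>q < 1")
      case False
      have t: "exp ((1 + 27 * \<xi>) * lam) \<le> real n powr (\<rho>q + \<delta>)" using False \<xi>(1,3) by (intro pw) auto
      have "1 - \<delta> \<le> 1 - \<xi>" using \<xi>(1,3) by linarith
      also have "\<dots> \<le> measure (gauss_matrix d n) (succ_event c d n Q.\<alpha> (exp ((1 + \<rho> + 9 * \<xi>) * lam)) (exp ((1 + 27 * \<xi>) * lam)))"
        by (rule Q.prob_succ_neighbours[OF c]) (use \<xi>(4) in \<open>simp add: \<beta>_def\<close>)
      also have "\<dots> \<le> measure (gauss_matrix d n) (succ_event c d n Q.\<alpha> (real n powr (1 + \<rho>s + \<delta>)) (real n powr (\<rho>q + \<delta>)))"
        by (rule prob_succ_event_mono[OF n1 space t])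
      finally show ?thesis .
    next
      case True
      define h where "h = sqrt \<kappa> - \<beta> * sqrt \<rho>"
      \<comment> \<open>The optimal exponent with \<open>1 - \<rho>\<close> lowered to
        \<open>\<kappa>\<close>, which can only decrease it, so
        \<open>\<rho> + e \<le> \<rho>q\<close> follows. The factor
        \<open>1 - \<beta>\<^sup>2\<close> in the denominator is what makes
        \<open>\<beta> * g0 + sqrt (1 - \<beta>\<^sup>2) * \<tau>\<close> equal to the threshold
        exactly.\<close>
      define e where "e = h\<^sup>2 / (1 - \<beta>\<^sup>2)"
      define \<tau> where "\<tau> = sqrt (2 * e * lam) / Q.rd"
      have "(\<beta> * sqrt \<rho>)\<^sup>2 \<le> \<kappa>"
      proof -
        have "\<beta>\<^sup>2 * \<rho> \<le> \<beta>\<^sup>2 * (1 / 2)" using \<rho> by (intro mult_left_mono) auto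
        then show ?thesis using \<xi>(5) \<rho> by (simp add: power_mult_distrib \<kappa>_def)
      qed
      then have h0: "0 \<le> h" using real_le_rsqrt by (simp add: h_def)
      have "sqrt \<kappa> \<le> sqrt (1 - \<rho>)" using \<xi>(1) by (simp add: \<kappa>_def)
      then have "h\<^sup>2 \<le> (sqrt (1 - \<rho>) - \<beta> * sqrt \<rho>)\<^sup>2" using h0 by (intro power_mono) (auto simp: h_def)
      then have "e \<le> (sqrt (1 - \<rho>) - \<beta> * sqrt \<rho>)\<^sup>2 / (1 - \<beta>\<^sup>2)" unfolding e_def using b2 by (intro divide_right_mono) auto
      then have e\<rho>: "\<rho> + e \<le> \<rho>q" using trade(1) by linarith
      have e0: "0 \<le> e" using b2 by (simp add: e_def)
      have e1: "e \<le> 1" using e\<rho> \<rho>(1) True by linarith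
      have gap: "e + \<rho> \<le> 1 - 100 * \<xi>" using e\<rho> \<xi>(6) True by (simp add: g_def)
      have \<tau>: "\<tau> * Q.rd = sqrt (2 * e * lam)" using Q.basic(1) by (simp add: \<tau>_def)
      have "sqrt (1 - \<beta>\<^sup>2) * sqrt (2 * e * lam) = h * sqrt (2 * lam)"
      proof -
        have "(1 - \<beta>\<^sup>2) * (2 * e * lam) = h\<^sup>2 * (2 * lam)" using b2 by (simp add: e_def)
        then have "sqrt ((1 - \<beta>\<^sup>2) * (2 * e * lam)) = sqrt (h\<^sup>2 * (2 * lam))" by (rule arg_cong)
        then show ?thesis using h0 by (simp add: real_sqrt_mult)
      qed
      then have "\<beta> * Q.g0 + sqrt (1 - \<beta>\<^sup>2) * \<tau> = (\<beta> * (sqrt \<rho> * sqrt (2 * lam)) + h * sqrt (2 * lam)) / Q.rd"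
        by (simp add: Q.g0_def Q.rd_def \<tau>_def add_divide_distrib real_sqrt_mult mult_ac)
      also have "\<dots> = Q.\<alpha>"
        by (simp add: h_def Q.\<alpha>_def Q.A_def Q.rd_def real_sqrt_mult algebra_simps)
      finally have al: "Q.\<alpha> \<le> \<beta> * Q.g0 + sqrt (1 - \<beta>\<^sup>2) * \<tau>" by simp
      have t: "exp ((\<rho> + e + 33 * \<xi>) * lam) \<le> real n powr (\<rho>q + \<delta>)" using e\<rho> \<xi>(3) by (intro pw) auto
      have "1 - \<delta> \<le> 1 - \<xi>" using \<xi>(1,3) by linarith
      also have "\<dots> \<le> measure (gauss_matrix d n) (succ_event c d n Q.\<alpha> (exp ((1 + \<rho> + 9 * \<xi>) * lam)) (exp ((\<rho> + e + 33 * \<xi>) * lam)))"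
        by (rule Q.prob_succ_count[OF c _ e0 e1 \<tau> gap]) (use \<xi>(4) al in \<open>simp_all add: \<beta>_def\<close>)
      also have "\<dots> \<le> measure (gauss_matrix d n) (succ_event c d n Q.\<alpha> (real n powr (1 + \<rho>s + \<delta>)) (real n powr (\<rho>q + \<delta>)))"
        by (rule prob_succ_event_mono[OF n1 space t])
      finally show ?thesis .
    qed
    ultimately show "\<exists>\<alpha>. 0 < \<alpha> \<and> \<alpha> < 1 \<and> 1 - \<delta> \<le> measure (gauss_matrix d n)
      (succ_event c d n \<alpha> (real n powr (1 + \<rho>s + \<delta>)) (real n powr (\<rho>q + \<delta>)))"
      using Q.basic(20) by blast
  qed
  moreover have "0 < \<theta>" "0 < N" using \<xi>(1) by (auto simp: \<theta>_def N_def)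
  ultimately show ?thesis by blast
qed

text \<open>For each pair \<open>(d, n)\<close> take a parameter that works for the largest feasible
  precision \<open>m\<close>; the restriction \<open>m \<le> n\<close> makes the set of candidates
  finite. Any fixed precision that is feasible and at most \<open>n\<close> is then met or
  surpassed, by a choice that knows neither the precision nor the sequence.\<close>

lemma diagonal_choice:
  fixes Q :: "'a \<Rightarrow> nat \<Rightarrow> nat \<Rightarrow> real \<Rightarrow> bool"
  assumes "\<And>d n m a. Q d n m a \<Longrightarrow> 0 < a \<and> a < 1"
  shows "\<exists>\<alpha>. (\<forall>d n. 0 < \<alpha> d n \<and> \<alpha> d n < 1) \<and> (\<forall>d n m a. m \<le> n \<longrightarrow> Q d n m a \<longrightarrow> (\<exists>M\<ge>m. Q d n M (\<alpha> d n)))"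
proof -
  have "\<exists>b. 0 < b \<and> b < 1 \<and> (\<forall>m a. m \<le> n \<longrightarrow> Q d n m a \<longrightarrow> (\<exists>M\<ge>m. Q d n M b))" for d n
  proof (cases "\<exists>m\<le>n. \<exists>a. Q d n m a")
    case True
    let ?S = "{m. m \<le> n \<and> (\<exists>a. Q d n m a)}"
    have f: "finite ?S" by simp
    have "Max ?S \<in> ?S" using True by (intro Max_in[OF f]) auto
    then obtain b where b: "Q d n (Max ?S) b" by blast
    moreover have "\<exists>M\<ge>m. Q d n M b" if "m \<le> n" "Q d n m a" for m a
      using b Max_ge[OF f, of m] that by blast
    ultimately show ?thesis using assms by blast
  next
    case False
    then show ?thesis by (intro exI[of _ "1 / 2"]) auto
  qed
  then have "\<forall>p. \<exists>b. 0 < b \<and> b < 1 \<and> (\<forall>m a. m \<le> snd p \<longrightarrow> Q (fst p) (snd p) m a \<longrightarrow> (\<exists>M\<ge>m. Q (fst p) (snd p) M b))"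
    by blast
  then obtain f where f: "\<forall>p. 0 < f p \<and> f p < 1 \<and> (\<forall>m a. m \<le> snd p \<longrightarrow> Q (fst p) (snd p) m a \<longrightarrow> (\<exists>M\<ge>m. Q (fst p) (snd p) M (f p)))"
    by (rule choice[THEN exE])
  show ?thesis
  proof (intro exI[of _ "\<lambda>d n. f (d, n)"] conjI allI impI)
    fix d n m a assume "m \<le> n" "Q d n m a"
    then show "\<exists>M\<ge>m. Q d n M (f (d, n))" using f[THEN spec, of "(d, n)"] unfolding fst_conv snd_conv by blast
  qed (use f in auto)
qed

theorem theorem1:
  fixes c \<rho>q \<rho>s :: real
  assumes "c > 1" and "\<rho>q \<ge> 0" and "\<rho>s \<ge> 0"
    and "(2 * c\<^sup>2 - 1) * \<rho>q + 2 * c\<^sup>2 * (c\<^sup>2 - 1) * sqrt (\<rho>s * (1 - \<rho>s)) \<ge> c ^ 4"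
  shows "\<exists>\<alpha> :: nat \<Rightarrow> nat \<Rightarrow> real. (\<forall>d n. 0 < \<alpha> d n \<and> \<alpha> d n < 1) \<and>
    (\<forall>dd nn :: nat \<Rightarrow> nat.
       filterlim dd at_top sequentially \<longrightarrow> filterlim nn at_top sequentially \<longrightarrow>
       ((\<lambda>k. ln (real (nn k)) / real (dd k)) \<longlonglongrightarrow> 0) \<longrightarrow>
       (\<forall>\<epsilon>>0. (\<lambda>k. measure (gauss_matrix (dd k) (nn k))
           {G \<in> space (gauss_matrix (dd k) (nn k)).
              real (graph_space (dd k) (nn k) (\<alpha> (dd k) (nn k)) (dataset c (dd k) G))
                \<le> real (nn k) powr (1 + \<rho>s + \<epsilon>) \<and>
              expected_query_time (dd k) (nn k) (\<alpha> (dd k) (nn k)) (dataset c (dd k) G) (query (dd k) G)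
                \<le> ereal (real (nn k) powr (\<rho>q + \<epsilon>))}) \<longlonglongrightarrow> 1))"
proof -
  define pr where "pr d n \<alpha> \<delta> = measure (gauss_matrix d n)
    (succ_event c d n \<alpha> (real n powr (1 + \<rho>s + \<delta>)) (real n powr (\<rho>q + \<delta>)))" for d n \<alpha> \<delta>
  \<comment> \<open>One number \<open>1 / real (Suc m)\<close> serves as tolerance in the exponents
    and as failure probability, so that a single index \<open>m\<close> measures precision in both
    respects.\<close>
  define Q where "Q d n m \<alpha> \<longleftrightarrow> 0 < \<alpha> \<and> \<alpha> < 1 \<and> 1 - 1 / real (Suc m) \<le> pr d n \<alpha> (1 / real (Suc m))" for d n m \<alpha>
  have "\<exists>\<alpha>. (\<forall>d n. 0 < \<alpha> d n \<and> \<alpha> d n < 1) \<and> (\<forall>d n m a. m \<le> n \<longrightarrow> Q d n m a \<longrightarrow> (\<exists>M\<ge>m. Q d n M (\<alpha> d n)))"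
    by (rule diagonal_choice) (simp add: Q_def)
  then obtain \<alpha> where \<alpha>: "\<forall>d n. 0 < \<alpha> d n \<and> \<alpha> d n < 1" "\<And>d n m a. m \<le> n \<Longrightarrow> Q d n m a \<Longrightarrow> \<exists>M\<ge>m. Q d n M (\<alpha> d n)"
    by blast
  have lim: "(\<lambda>k. pr (dd k) (nn k) (\<alpha> (dd k) (nn k)) \<epsilon>) \<longlonglongrightarrow> 1"
    if dd: "filterlim dd at_top sequentially" and nn: "filterlim nn at_top sequentially"
      and r: "(\<lambda>k. ln (real (nn k)) / real (dd k)) \<longlonglongrightarrow> 0" and \<epsilon>: "0 < \<epsilon>" for dd nn :: "nat \<Rightarrow> nat" and \<epsilon>
  proof (rule order_tendstoI)
    fix a :: real assume "1 < a"
    moreover have "pr d n b \<epsilon> \<le> 1" for d n b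
      unfolding pr_def by (rule prob_space.prob_le_1[OF prob_space_gauss_matrix])
    ultimately show "\<forall>\<^sub>F k in sequentially. pr (dd k) (nn k) (\<alpha> (dd k) (nn k)) \<epsilon> < a"
      by (intro always_eventually allI) (meson le_less_trans)
  next
    fix a :: real assume a: "a < 1"
    then obtain m where m: "1 / real (Suc m) < min \<epsilon> (1 - a)"
      using reals_Archimedean[of "min \<epsilon> (1 - a)"] \<epsilon> by (auto simp: inverse_eq_divide)
    obtain \<theta> N where \<theta>: "0 < \<theta>" "0 < N" and Qm: "\<And>d n. N \<le> real n \<Longrightarrow> ln (real n) \<le> \<theta> * real d \<Longrightarrow> \<exists>b. Q d n m b"
      using eventually_succeeds[OF assms(1,3) _ assms(4), of "1 / real (Suc m)"] by (auto simp: Q_def pr_def)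
    have "\<forall>\<^sub>F k in sequentially. max m (max 1 (nat \<lceil>N\<rceil>)) \<le> nn k" by (rule nn[unfolded filterlim_at_top, rule_format])
    moreover have "\<forall>\<^sub>F k in sequentially. 1 \<le> dd k" by (rule dd[unfolded filterlim_at_top, rule_format])
    moreover have "\<forall>\<^sub>F k in sequentially. ln (real (nn k)) / real (dd k) < \<theta>" using r \<theta>(1) by (rule order_tendstoD)
    ultimately show "\<forall>\<^sub>F k in sequentially. a < pr (dd k) (nn k) (\<alpha> (dd k) (nn k)) \<epsilon>"
    proof eventually_elim
      case (elim k)
      let ?n = "nn k" and ?d = "dd k"
      have n: "m \<le> ?n" "1 \<le> ?n" "N \<le> real ?n" using elim(1) by (auto simp: nat_le_iff ceiling_le_iff)
      have "ln (real ?n) \<le> \<theta> * real ?d" using elim(2,3) by (simp add: pos_divide_less_eq)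
      then obtain b where "Q ?d ?n m b" using Qm n(3) by blast
      then obtain M where M: "m \<le> M" "Q ?d ?n M (\<alpha> ?d ?n)" using \<alpha>(2)[OF n(1)] by blast
      have le: "1 / real (Suc M) \<le> 1 / real (Suc m)" using M(1) by (intro divide_left_mono) auto
      have "a < 1 - 1 / real (Suc M)" using le m by simp
      also have "\<dots> \<le> pr ?d ?n (\<alpha> ?d ?n) (1 / real (Suc M))" using M(2) by (simp add: Q_def)
      also have "\<dots> \<le> pr ?d ?n (\<alpha> ?d ?n) \<epsilon>"
        unfolding pr_def using n(2) le m by (intro prob_succ_event_mono powr_mono) auto
      finally show ?case .
    qed
  qed
  show ?thesis
    using \<alpha>(1) lim unfolding pr_def succ_event_def by (intro exI[of _ \<alpha>]) blast
qed

end
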